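(* Let $\Xi$ be a $2n$-dimensional real symplectic vector space with symplectic form $[\![\cdot,\cdot]\!]$, let $\mathcal A$ be a $C^*$-algebra and let $\Theta$ be a strongly continuous action of $\Xi$ on $\mathcal A$ by automorphisms. For $F,G\in\mathscr S(\Xi;\mathcal A^\infty)=\mathscr S(\Xi;\mathfrak A^\infty)$ and $X\in\Xi$ set $$[M(F)](X)=\int_\Xi dY\,e^{-i[\![X,Y]\!]}\,\Theta_Y[F(Y)],\qquad [M^{-1}(G)](X)=\int_\Xi dY\,e^{-i[\![X,Y]\!]}\,\Theta_{-X}[G(Y)].$$ Then $$M:\big(\mathscr S(\Xi;\mathfrak A^\infty),\square,{}^\square\big)\rightarrow\big(\mathscr S(\Xi;\mathcal A^\infty),\diamond,{}^\diamond\big)$$ is an isomorphism of Fréchet $^*$-algebras, and $M^{-1}$ is its inverse.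
   Context: Measure: $dX$ is the Lebesgue measure on $\Xi$ normalized so that the symplectic Fourier transform $(\mathcal F a)(X)=\int_\Xi dY\,e^{-i[\![X,Y]\!]}a(Y)$ is unitary on $L^2(\Xi)$ (then $\mathcal F^2=\mathrm{id}$). Action: $\Theta_X(f)$ denotes the $X$-transform of $f\in\mathcal A$; strong continuity means that $X\mapsto\Theta_X(f)$ is norm continuous for each $f\in\mathcal A$. $\mathcal A^\infty$ is the dense $^*$-algebra of those $f\in\mathcal A$ for which $X\mapsto\Theta_X(f)$ is $C^\infty$. It is a Fréchet space for the seminorms $|f|^k=\sum_{|\alpha|=k}\frac1{\alpha!}\|\partial_X^\alpha[\Theta_X(f)]_{X=0}\|_{\mathcal A}$, $k\in\mathbb N$. On $\mathcal A^\infty$ one also has the Rieffel product $$f\# g=2^{2n}\int_\Xi\int_\Xi dY\,dZ\,e^{2i[\![Y,Z]\!]}\,\Theta_Y(f)\,\Theta_Z(g),$$ an oscillatory integral (the limit as $\epsilon\to0$ of the integrals with the factor $\chi(\epsilon Y,\epsilon Z)$ inserted, $\chi\in C_c^\infty(\Xi\times\Xi)$, $\chi=1$ near $0$). The notation $\mathfrak A^\infty$ stands for the same Fréchet space $\mathcal A^\infty$ with the same involution, regarded with the product $\#$. (It is the space of smooth vectors of the Rieffel deformation $\mathfrak A$ of $\mathcal A$, and coincides with $\mathcal A^\infty$ also topologically.) $\mathscr S(\Xi;\mathcal A^\infty)=\mathscr S(\Xi;\mathfrak A^\infty)$ is the Fréchet space of smooth functions $F:\Xi\to\mathcal A^\infty$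 such that all the seminorms $\sup_X(1+|X|)^N|(\partial^\beta F)(X)|^k$ ($k,N\in\mathbb N$, $\beta\in\mathbb N^{2n}$) are finite. It carries two $^*$-algebra structures. (1) The first has involution $F^\square(X)=F(X)^*$ and product, as an oscillatory integral, $$(F_1\square F_2)(X)=2^{2n}\int_\Xi\int_\Xi dA\,dB\,e^{-2i[\![A,B]\!]}F_1(X-A)\# F_2(X-B)$$ $$=2^{4n}\int_\Xi\int_\Xi\int_\Xi\int_\Xi dA\,dB\,dY\,dZ\,e^{-2i[\![A,B]\!]}e^{2i[\![Y,Z]\!]}\,\Theta_Y[F_1(X-A)]\,\Theta_Z[F_2(X-B)].$$ (2) The second has involution $G^\diamond(X)=G(-X)^*$ and product $$(G_1\diamond G_2)(X)=\int_\Xi dY\,\kappa(X,Y)\,\Theta_{(Y-X)/2}[G_1(Y)]\,\Theta_{Y/2}[G_2(X-Y)],\qquad\kappa(X,Y)=\exp\big(-\tfrac i2[\![X,Y]\!]\big),$$ where the multiplication inside the integral is that of $\mathcal A$. *)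

theory Defs
  imports "HOL-Analysis.Analysis"
begin

section \<open>C*-algebras (not necessarily unital)\<close>

class scaleC =
  fixes scaleC :: "complex \<Rightarrow> 'a \<Rightarrow> 'a"  (infixr \<open>*\<^sub>C\<close> 75)

class star =
  fixes star :: "'a \<Rightarrow> 'a"

class cstar_algebra = real_normed_algebra + banach + scaleC + star +
  assumes scaleR_scaleC: "r *\<^sub>R x = complex_of_real r *\<^sub>C x"
    and scaleC_add_right: "a *\<^sub>C (x + y) = a *\<^sub>C x + a *\<^sub>C y"
    and scaleC_add_left: "(a + b) *\<^sub>C x = a *\<^sub>C x + b *\<^sub>C x"
    and scaleC_scaleC: "a *\<^sub>C b *\<^sub>C x = (a * b) *\<^sub>C x"
    and scaleC_one: "1 *\<^sub>C x = x"
    and mult_scaleC_left: "(a *\<^sub>C x) * y = a *\<^sub>C (x * y)"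
    and mult_scaleC_right: "x * (a *\<^sub>C y) = a *\<^sub>C (x * y)"
    and norm_scaleC: "norm (a *\<^sub>C x) = cmod a * norm x"
    and star_star: "star (star x) = x"
    and star_add: "star (x + y) = star x + star y"
    and star_scaleC: "star (a *\<^sub>C x) = cnj a *\<^sub>C star x"
    and star_mult: "star (x * y) = star y * star x"
    and cstar_identity: "norm (star x * x) = (norm x)\<^sup>2"

definition star_automorphism :: "('a::cstar_algebra \<Rightarrow> 'a) \<Rightarrow> bool" where
  "star_automorphism \<phi> \<longleftrightarrow> bij \<phi>
     \<and> (\<forall>f g. \<phi> (f + g) = \<phi> f + \<phi> g) \<and> (\<forall>a f. \<phi> (a *\<^sub>C f) = a *\<^sub>C \<phi> f)
     \<and> (\<forall>f g. \<phi> (f * g) = \<phi> f * \<phi> g) \<and> (\<forall>f. \<phi> (star f) = star (\<phi> f))"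

definition strongly_continuous_action ::
  "('x::real_normed_vector \<Rightarrow> 'a::cstar_algebra \<Rightarrow> 'a) \<Rightarrow> bool" where
  "strongly_continuous_action \<Theta> \<longleftrightarrow>
     (\<forall>X. star_automorphism (\<Theta> X)) \<and> (\<forall>f. \<Theta> 0 f = f)
     \<and> (\<forall>X Y f. \<Theta> (X + Y) f = \<Theta> X (\<Theta> Y f))
     \<and> (\<forall>f. continuous_on UNIV (\<lambda>X. \<Theta> X f))"


section \<open>Symplectic spaces and the normalized Lebesgue measure\<close>

text \<open>The Euclidean structure of \<open>'x\<close> is auxiliary and unrelated to the symplectic form: it
  supplies the norm and the basis in the seminorms below and a reference Lebesgue measure.\<close>

definition symplectic_form :: "('x::real_vector \<Rightarrow> 'x \<Rightarrow> real) \<Rightarrow> bool" where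
  "symplectic_form \<omega> \<longleftrightarrow> (\<forall>X. linear (\<omega> X)) \<and> (\<forall>Y. linear (\<lambda>X. \<omega> X Y))
     \<and> (\<forall>X. \<omega> X X = 0) \<and> (\<forall>X. (\<forall>Y. \<omega> X Y = 0) \<longrightarrow> X = 0)"

definition scaled_lborel :: "real \<Rightarrow> 'x::euclidean_space measure" where
  "scaled_lborel c = scale_measure (ennreal c) lborel"

definition L2_functions :: "real \<Rightarrow> ('x::euclidean_space \<Rightarrow> complex) set" where
  "L2_functions c = {a \<in> borel_measurable borel. integrable (scaled_lborel c) (\<lambda>X. (cmod (a X))\<^sup>2)}"

text \<open>The measure \<open>dX = c \<cdot> lborel\<close> makes the symplectic Fourier transform unitary: the integral
  formula on \<open>L\<^sup>1 \<inter> L\<^sup>2\<close> extends to a linear isometry \<open>U\<close> of \<open>L\<^sup>2\<close> onto itself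
  (on representatives, so that equalities hold almost everywhere).\<close>

definition fourier_normalized :: "('x::euclidean_space \<Rightarrow> 'x \<Rightarrow> real) \<Rightarrow> real \<Rightarrow> bool" where
  "fourier_normalized \<omega> c \<longleftrightarrow> c > 0 \<and> (\<exists>U :: ('x \<Rightarrow> complex) \<Rightarrow> ('x \<Rightarrow> complex).
     (\<forall>a \<in> L2_functions c. U a \<in> L2_functions c
        \<and> (\<integral>X. (cmod (U a X))\<^sup>2 \<partial>scaled_lborel c) = (\<integral>X. (cmod (a X))\<^sup>2 \<partial>scaled_lborel c))
     \<and> (\<forall>a \<in> L2_functions c. \<forall>b \<in> L2_functions c. \<forall>s t.
          AE X in scaled_lborel c. U (\<lambda>Z. s * a Z + t * b Z) X = s * U a X + t * U b X)
     \<and> (\<forall>b \<in> L2_functions c. \<exists>a \<in> L2_functions c. AE X in scaled_lborel c. U a X = b X)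
     \<and> (\<forall>a \<in> L2_functions c. integrable (scaled_lborel c) a \<longrightarrow>
          (AE X in scaled_lborel c. U a X = (\<integral>Y. cis (- \<omega> X Y) * a Y \<partial>scaled_lborel c))))"

text \<open>Algebra-valued integrals against \<open>dX\<close>. The library's Bochner integral requires a separable
  target, the Henstock--Kurzweil integral does not; the two agree on the continuous integrands
  with integrable norm that occur below.\<close>

definition dint :: "real \<Rightarrow> ('x::euclidean_space \<Rightarrow> 'a::banach) \<Rightarrow> 'a" where
  "dint c f = c *\<^sub>R integral UNIV f"

definition dint2 :: "real \<Rightarrow> ('x::euclidean_space \<times> 'x \<Rightarrow> 'a::banach) \<Rightarrow> 'a" where
  "dint2 c f = c\<^sup>2 *\<^sub>R integral UNIV f"


section \<open>Partial derivatives and smooth functions\<close>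

definition partial :: "'x::euclidean_space \<Rightarrow> ('x \<Rightarrow> 'b::real_normed_vector) \<Rightarrow> 'x \<Rightarrow> 'b" where
  "partial b f X = vector_derivative (\<lambda>t. f (X + t *\<^sub>R b)) (at 0)"

definition partials :: "'x::euclidean_space list \<Rightarrow> ('x \<Rightarrow> 'b::real_normed_vector) \<Rightarrow> 'x \<Rightarrow> 'b" where
  "partials w f = foldr partial w f"

definition smooth :: "('x::euclidean_space \<Rightarrow> 'b::real_normed_vector) \<Rightarrow> bool" where
  "smooth f \<longleftrightarrow> (\<forall>w \<in> lists Basis. continuous_on UNIV (partials w f)
     \<and> (\<forall>b \<in> Basis. \<forall>X. (\<lambda>t. partials w f (X + t *\<^sub>R b)) differentiable (at 0)))"

text \<open>A multi-index is a function on \<open>Basis\<close>; its values elsewhere are irrelevant to \<open>mpartial\<close>.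
  The basis is enumerated in an arbitrary fixed order.\<close>

definition basis_list :: "'x::euclidean_space list" where
  "basis_list = (SOME bs. distinct bs \<and> set bs = Basis)"

definition mpartial ::
  "('x::euclidean_space \<Rightarrow> nat) \<Rightarrow> ('x \<Rightarrow> 'b::real_normed_vector) \<Rightarrow> 'x \<Rightarrow> 'b" where
  "mpartial \<alpha> = partials (concat (map (\<lambda>b. replicate (\<alpha> b) b) basis_list))"

definition multi_indices :: "nat \<Rightarrow> ('x::euclidean_space \<Rightarrow> nat) set" where
  "multi_indices k = {\<alpha>. (\<forall>b. b \<notin> Basis \<longrightarrow> \<alpha> b = 0) \<and> (\<Sum>b\<in>Basis. \<alpha> b) = k}"


section \<open>Smooth vectors and the Rieffel product\<close>

definition smooth_vectors ::
  "('x::euclidean_space \<Rightarrow> 'a::cstar_algebra \<Rightarrow> 'a) \<Rightarrow> 'a set" where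
  "smooth_vectors \<Theta> = {f. smooth (\<lambda>X. \<Theta> X f)}"

definition smooth_seminorm ::
  "('x::euclidean_space \<Rightarrow> 'a::cstar_algebra \<Rightarrow> 'a) \<Rightarrow> nat \<Rightarrow> 'a \<Rightarrow> real" where
  "smooth_seminorm \<Theta> k f =
     (\<Sum>\<alpha>\<in>multi_indices k. (1 / (\<Prod>b\<in>Basis. fact (\<alpha> b))) * norm (mpartial \<alpha> (\<lambda>X. \<Theta> X f) 0))"

definition cutoff :: "('x::euclidean_space \<times> 'x \<Rightarrow> complex) \<Rightarrow> bool" where
  "cutoff \<psi> \<longleftrightarrow> smooth \<psi> \<and> compact (closure {P. \<psi> P \<noteq> 0}) \<and> (\<forall>\<^sub>F P in nhds 0. \<psi> P = 1)"

definition has_osc_integral ::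
  "real \<Rightarrow> ('x::euclidean_space \<times> 'x \<Rightarrow> 'a::cstar_algebra) \<Rightarrow> 'a \<Rightarrow> bool" where
  "has_osc_integral c f l \<longleftrightarrow> (\<forall>\<psi>. cutoff \<psi> \<longrightarrow>
     ((\<lambda>\<epsilon>. dint2 c (\<lambda>(Y, Z). \<psi> (\<epsilon> *\<^sub>R Y, \<epsilon> *\<^sub>R Z) *\<^sub>C f (Y, Z))) \<longlongrightarrow> l) (at_right 0))"

definition osc_integral ::
  "real \<Rightarrow> ('x::euclidean_space \<times> 'x \<Rightarrow> 'a::cstar_algebra) \<Rightarrow> 'a" where
  "osc_integral c f = (THE l. has_osc_integral c f l)"

text \<open>Below, \<open>2 ^ DIM('x)\<close> is the factor \<open>2\<^sup>2\<^sup>n\<close>.\<close>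

definition rieffel_prod :: "('x::euclidean_space \<Rightarrow> 'x \<Rightarrow> real) \<Rightarrow> real
    \<Rightarrow> ('x \<Rightarrow> 'a::cstar_algebra \<Rightarrow> 'a) \<Rightarrow> 'a \<Rightarrow> 'a \<Rightarrow> 'a" where
  "rieffel_prod \<omega> c \<Theta> f g =
     2 ^ DIM('x) *\<^sub>R osc_integral c (\<lambda>(Y, Z). cis (2 * \<omega> Y Z) *\<^sub>C (\<Theta> Y f * \<Theta> Z g))"


section \<open>The Schwartz space with values in the smooth vectors\<close>

text \<open>Smoothness refers to the Frechet topology of the smooth vectors: all iterated partial
  derivatives exist as limits of difference quotients, and are continuous, for every
  \<open>smooth_seminorm \<Theta> k\<close>. As \<open>smooth_seminorm \<Theta> 0\<close> is the norm, such a derivative is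
  necessarily the norm derivative \<open>partials\<close>.\<close>

definition smooth_into_smooth_vectors ::
  "('x::euclidean_space \<Rightarrow> 'a::cstar_algebra \<Rightarrow> 'a) \<Rightarrow> ('x \<Rightarrow> 'a) \<Rightarrow> bool" where
  "smooth_into_smooth_vectors \<Theta> F \<longleftrightarrow> (\<forall>w \<in> lists Basis.
     (\<forall>X. partials w F X \<in> smooth_vectors \<Theta>)
     \<and> (\<forall>k X. ((\<lambda>Y. smooth_seminorm \<Theta> k (partials w F Y - partials w F X)) \<longlongrightarrow> 0) (at X))
     \<and> (\<forall>b \<in> Basis. \<forall>k X. ((\<lambda>t. smooth_seminorm \<Theta> k
            ((1 / t) *\<^sub>R (partials w F (X + t *\<^sub>R b) - partials w F X) - partials (b # w) F X))
          \<longlongrightarrow> 0) (at 0)))"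

type_synonym 'x schwartz_index = "nat \<times> nat \<times> ('x \<Rightarrow> nat)"

definition schwartz_weight :: "('x::euclidean_space \<Rightarrow> 'a::cstar_algebra \<Rightarrow> 'a)
    \<Rightarrow> 'x schwartz_index \<Rightarrow> ('x \<Rightarrow> 'a) \<Rightarrow> 'x \<Rightarrow> real" where
  "schwartz_weight \<Theta> = (\<lambda>(k, N, \<beta>) F X. (1 + norm X) ^ N * smooth_seminorm \<Theta> k (mpartial \<beta> F X))"

definition schwartz_space ::
  "('x::euclidean_space \<Rightarrow> 'a::cstar_algebra \<Rightarrow> 'a) \<Rightarrow> ('x \<Rightarrow> 'a) set" where
  "schwartz_space \<Theta> = {F. smooth_into_smooth_vectors \<Theta> F
     \<and> (\<forall>i. bdd_above (range (schwartz_weight \<Theta> i F)))}"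

definition schwartz_seminorm :: "('x::euclidean_space \<Rightarrow> 'a::cstar_algebra \<Rightarrow> 'a)
    \<Rightarrow> 'x schwartz_index \<Rightarrow> ('x \<Rightarrow> 'a) \<Rightarrow> real" where
  "schwartz_seminorm \<Theta> i F = (SUP X. schwartz_weight \<Theta> i F X)"


section \<open>Frechet *-algebras and their isomorphisms\<close>

record ('i, 'v) frechet_star_algebra =
  fa_carrier :: "'v set"
  fa_add :: "'v \<Rightarrow> 'v \<Rightarrow> 'v"
  fa_scale :: "complex \<Rightarrow> 'v \<Rightarrow> 'v"
  fa_mult :: "'v \<Rightarrow> 'v \<Rightarrow> 'v"
  fa_star :: "'v \<Rightarrow> 'v"
  fa_seminorm :: "'i \<Rightarrow> 'v \<Rightarrow> real"

definition fa_topology :: "('i, 'v) frechet_star_algebra \<Rightarrow> 'v topology" where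
  "fa_topology A = topology_generated_by
     {{y \<in> fa_carrier A. fa_seminorm A i (fa_add A y (fa_scale A (- 1) x)) < e} | i x e.
        x \<in> fa_carrier A \<and> 0 < e}"

definition fa_closed :: "('i, 'v) frechet_star_algebra \<Rightarrow> bool" where
  "fa_closed A \<longleftrightarrow> (\<forall>x \<in> fa_carrier A. \<forall>y \<in> fa_carrier A. \<forall>a.
     fa_add A x y \<in> fa_carrier A \<and> fa_scale A a x \<in> fa_carrier A
     \<and> fa_mult A x y \<in> fa_carrier A \<and> fa_star A x \<in> fa_carrier A)"

text \<open>\<open>f\<close> is an isomorphism of Frechet *-algebras with inverse \<open>g\<close>. That \<open>f\<close> and \<open>g\<close> are mutually
  inverse bijections of the carriers is part of \<open>homeomorphic_maps\<close>.\<close>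

definition frechet_star_isomorphism :: "('i, 'v) frechet_star_algebra
    \<Rightarrow> ('j, 'w) frechet_star_algebra \<Rightarrow> ('v \<Rightarrow> 'w) \<Rightarrow> ('w \<Rightarrow> 'v) \<Rightarrow> bool" where
  "frechet_star_isomorphism A B f g \<longleftrightarrow> fa_closed A \<and> fa_closed B
     \<and> homeomorphic_maps (fa_topology A) (fa_topology B) f g
     \<and> (\<forall>x \<in> fa_carrier A. \<forall>y \<in> fa_carrier A. f (fa_add A x y) = fa_add B (f x) (f y))
     \<and> (\<forall>a. \<forall>x \<in> fa_carrier A. f (fa_scale A a x) = fa_scale B a (f x))
     \<and> (\<forall>x \<in> fa_carrier A. \<forall>y \<in> fa_carrier A. f (fa_mult A x y) = fa_mult B (f x) (f y))
     \<and> (\<forall>x \<in> fa_carrier A. f (fa_star A x) = fa_star B (f x))"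


section \<open>The two algebra structures and the map between them\<close>

definition square_prod :: "('x::euclidean_space \<Rightarrow> 'x \<Rightarrow> real) \<Rightarrow> real
    \<Rightarrow> ('x \<Rightarrow> 'a::cstar_algebra \<Rightarrow> 'a) \<Rightarrow> ('x \<Rightarrow> 'a) \<Rightarrow> ('x \<Rightarrow> 'a) \<Rightarrow> 'x \<Rightarrow> 'a" where
  "square_prod \<omega> c \<Theta> F\<^sub>1 F\<^sub>2 X = 2 ^ DIM('x) *\<^sub>R
     osc_integral c (\<lambda>(A, B). cis (- 2 * \<omega> A B) *\<^sub>C rieffel_prod \<omega> c \<Theta> (F\<^sub>1 (X - A)) (F\<^sub>2 (X - B)))"

definition square_star :: "('x \<Rightarrow> 'a::cstar_algebra) \<Rightarrow> 'x \<Rightarrow> 'a" where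
  "square_star F X = star (F X)"

definition diamond_prod :: "('x::euclidean_space \<Rightarrow> 'x \<Rightarrow> real) \<Rightarrow> real
    \<Rightarrow> ('x \<Rightarrow> 'a::cstar_algebra \<Rightarrow> 'a) \<Rightarrow> ('x \<Rightarrow> 'a) \<Rightarrow> ('x \<Rightarrow> 'a) \<Rightarrow> 'x \<Rightarrow> 'a" where
  "diamond_prod \<omega> c \<Theta> G\<^sub>1 G\<^sub>2 X = dint c (\<lambda>Y. cis (- (1 / 2) * \<omega> X Y) *\<^sub>C
     (\<Theta> ((1 / 2) *\<^sub>R (Y - X)) (G\<^sub>1 Y) * \<Theta> ((1 / 2) *\<^sub>R Y) (G\<^sub>2 (X - Y))))"

definition diamond_star :: "('x::real_vector \<Rightarrow> 'a::cstar_algebra) \<Rightarrow> 'x \<Rightarrow> 'a" where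
  "diamond_star G X = star (G (- X))"

definition square_algebra :: "('x::euclidean_space \<Rightarrow> 'x \<Rightarrow> real) \<Rightarrow> real
    \<Rightarrow> ('x \<Rightarrow> 'a::cstar_algebra \<Rightarrow> 'a) \<Rightarrow> ('x schwartz_index, 'x \<Rightarrow> 'a) frechet_star_algebra" where
  "square_algebra \<omega> c \<Theta> = \<lparr> fa_carrier = schwartz_space \<Theta>,
     fa_add = (\<lambda>F G X. F X + G X), fa_scale = (\<lambda>a F X. a *\<^sub>C F X),
     fa_mult = square_prod \<omega> c \<Theta>, fa_star = square_star, fa_seminorm = schwartz_seminorm \<Theta> \<rparr>"

definition diamond_algebra :: "('x::euclidean_space \<Rightarrow> 'x \<Rightarrow> real) \<Rightarrow> real
    \<Rightarrow> ('x \<Rightarrow> 'a::cstar_algebra \<Rightarrow> 'a) \<Rightarrow> ('x schwartz_index, 'x \<Rightarrow> 'a) frechet_star_algebra" where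
  "diamond_algebra \<omega> c \<Theta> = \<lparr> fa_carrier = schwartz_space \<Theta>,
     fa_add = (\<lambda>F G X. F X + G X), fa_scale = (\<lambda>a F X. a *\<^sub>C F X),
     fa_mult = diamond_prod \<omega> c \<Theta>, fa_star = diamond_star, fa_seminorm = schwartz_seminorm \<Theta> \<rparr>"

definition M_map :: "('x::euclidean_space \<Rightarrow> 'x \<Rightarrow> real) \<Rightarrow> real
    \<Rightarrow> ('x \<Rightarrow> 'a::cstar_algebra \<Rightarrow> 'a) \<Rightarrow> ('x \<Rightarrow> 'a) \<Rightarrow> 'x \<Rightarrow> 'a" where
  "M_map \<omega> c \<Theta> F X = dint c (\<lambda>Y. cis (- \<omega> X Y) *\<^sub>C \<Theta> Y (F Y))"

definition M_inv :: "('x::euclidean_space \<Rightarrow> 'x \<Rightarrow> real) \<Rightarrow> real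
    \<Rightarrow> ('x \<Rightarrow> 'a::cstar_algebra \<Rightarrow> 'a) \<Rightarrow> ('x \<Rightarrow> 'a) \<Rightarrow> 'x \<Rightarrow> 'a" where
  "M_inv \<omega> c \<Theta> G X = dint c (\<lambda>Y. cis (- \<omega> X Y) *\<^sub>C \<Theta> (- X) (G Y))"

end

theory Submission
  imports Defs "HOL-Library.Function_Algebras"
begin

text \<open>\<open>M\<close> is the twist \<open>F \<mapsto> (Y \<mapsto> \<Theta>\<^sub>Y F(Y))\<close> followed by the symplectic Fourier transform, and \<open>M\<^sup>-\<^sup>1\<close> is
  the Fourier transform followed by the inverse twist, so they are mutually inverse by Fourier inversion;
  unitarity, tested on a single bump function, fixes the constant in the inversion formula.

  A family of functions that is rapidly decreasing together with all its iterated derivatives, both in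
  \<open>X\<close> and along the action, is a family in the Schwartz space, whatever the order of the derivatives.
  Such families are treated coinductively. When the parameter ranges over the Schwartz space and the
  bounds are seminorms of the parameter, the same argument gives the continuity of \<open>M\<close> and \<open>M\<^sup>-\<^sup>1\<close>.

  For the products, one shows \<open>F\<^sub>1 \<box> F\<^sub>2 = M\<^sup>-\<^sup>1(M F\<^sub>1 \<diamond> M F\<^sub>2)\<close>. Integration by parts bounds the regularized
  Rieffel products of \<open>F\<^sub>1(X - A)\<close> and \<open>F\<^sub>2(X - B)\<close> by an integrable function of \<open>(A, B)\<close>, uniformly in \<open>\<epsilon>\<close>, and
  shows that the cutoff may be replaced by \<open>\<chi>(\<epsilon>(Y + A), \<epsilon>(Z + B))\<close>. After the substitution
  \<open>(Y, Z) \<mapsto> (Y - A, Z - B)\<close> the phases combine to \<open>2[Y, Z] - 2[A, Z] - 2[Y, B]\<close>, the cutoff no longer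
  involves \<open>A, B\<close>, and by Fubini the integral over \<open>(A, B)\<close> factors into values of \<open>M F\<^sub>1\<close> at \<open>2Z\<close> and of
  \<open>M F\<^sub>2\<close> at \<open>-2Y\<close>, up to phases and automorphisms. What remains is the double integral that defines the
  right-hand side, in the variables \<open>2Z - 2Y\<close> and \<open>2Z\<close>.\<close>

section \<open>C*-algebras\<close>

text \<open>Two obstacles shape the proof. The automorphisms are only assumed to be algebraic, while
  every estimate needs them to be isometric; this is derived from the C*-identity. And the amplitude
  \<open>\<Theta> Y f * \<Theta> Z g\<close> of the Rieffel product is bounded but does not decay,
  so the fourfold integral for the square product need not converge absolutely. Fubini is therefore
  used at fixed \<epsilon>, where the cutoff supplies the decay in \<open>(Y, Z)\<close>, and the
  limit is taken afterwards, under the outer integral; hence the bounds must be uniform in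
  \<epsilon>.

  Derivatives in X and along the action are treated together because differentiating
  \<open>\<Theta> X (F X)\<close> in X produces both. Once they are, only the norm of the algebra
  enters the estimates; the seminorms of the smooth vectors are recovered from the fact that the two
  kinds of derivatives commute.

  All integrands are continuous and dominated by a multiple of one weight, \<open>wt\<close>; for
  such functions dominated convergence, Fubini and differentiation under the integral hold with
  values in any Banach space.\<close>

lemma bounded_bilinear_scaleC:
  "bounded_bilinear (scaleC :: complex \<Rightarrow> 'a::cstar_algebra \<Rightarrow> 'a)"
proof (unfold_locales, goal_cases)
  case (3 r a b)
  then show ?case by (simp add: scaleR_scaleC scaleC_scaleC scaleR_conv_of_real)
next
  case (4 a r b)
  then show ?case by (simp add: scaleR_scaleC scaleC_scaleC mult.commute)
next
  case 5
  show ?case by (intro exI[of _ 1]) (simp add: norm_scaleC)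
qed (simp_all add: scaleC_add_left scaleC_add_right)

interpretation scaleC: bounded_bilinear "scaleC :: complex \<Rightarrow> 'a::cstar_algebra \<Rightarrow> 'a"
  by (rule bounded_bilinear_scaleC)

lemmas continuous_on_scaleC [continuous_intros] = scaleC.continuous_on
lemmas scaleC_zero [simp] = scaleC.zero_left scaleC.zero_right

lemma scaleC_scaleR: "a *\<^sub>C (r *\<^sub>R x) = r *\<^sub>R (a *\<^sub>C (x::'a::cstar_algebra))"
  by (simp add: scaleC.scaleR_right)

text \<open>The C*-identity and submultiplicativity give
  \<open>norm y * norm y \<le> norm (star y) * norm y\<close>; using this for \<open>x\<close> and
  for \<open>star x\<close> gives both inequalities.\<close>

lemma norm_star [simp]: "norm (star x) = norm (x::'a::cstar_algebra)"
proof -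
  have le: "norm y \<le> norm (star y)" for y :: 'a
  proof (cases "y = 0")
    case False
    have "norm y * norm y \<le> norm (star y) * norm y"
      using norm_mult_ineq[of "star y" y] by (simp add: cstar_identity power2_eq_square)
    then show ?thesis using False by simp
  qed simp
  show ?thesis using le[of x] le[of "star x"] by (simp add: star_star)
qed

lemma bounded_linear_star: "bounded_linear (star :: 'a::cstar_algebra \<Rightarrow> 'a)"
  by (intro bounded_linear_intro[of _ 1]) (simp_all add: star_add scaleR_scaleC star_scaleC)

subsection \<open>Automorphisms are isometric\<close>

text \<open>\<open>1 + q\<close> is the inverse of \<open>1 - x\<close> in the unitization.\<close>

definition quasi :: "'a::cstar_algebra \<Rightarrow> 'a \<Rightarrow> bool" where
  "quasi x q \<longleftrightarrow> q = x + x * q \<and> q = x + q * x"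

text \<open>The quasi-inverse is the Neumann series x + x^2 + x^3 + ..., which converges absolutely.
  Two recursions for its terms, with the new factor on the left and on the right, give the two
  equations.\<close>

lemma quasi_exists:
  assumes "norm (x::'a::cstar_algebra) < 1"
  shows "\<exists>q. quasi x q"
proof -
  \<comment> \<open>The term \<open>p n\<close> is the power of x with exponent n + 1, written as an
    iteration because there is no unit to start from.\<close>
  define p where "p = (\<lambda>n. ((\<lambda>y. x * y) ^^ n) x)"
  have p0: "p 0 = x" and pS: "p (Suc n) = x * p n" for n by (simp_all add: p_def)
  have pS': "p (Suc n) = p n * x" for n
  proof (induction n)
    case (Suc n)
    then show ?case by (metis pS mult.assoc)
  qed (simp add: p0 pS)
  have np: "norm (p n) \<le> norm x ^ Suc n" for n
  proof (induction n)
    case (Suc n)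
    have "norm (p (Suc n)) \<le> norm x * norm (p n)" by (simp add: pS norm_mult_ineq)
    also have "\<dots> \<le> norm x * norm x ^ Suc n" using Suc by (intro mult_left_mono) auto
    finally show ?case by simp
  qed (simp add: p0)
  have sm: "summable p"
    by (rule summable_comparison_test'[of "\<lambda>n. norm x ^ Suc n" 0])
       (use np assms in \<open>auto intro: summable_geometric summable_mult\<close>)
  have tail: "suminf p = x + (\<Sum>n. p (Suc n))"
    using suminf_split_head[OF sm] p0 by simp
  have "(\<Sum>n. p (Suc n)) = x * suminf p"
    unfolding pS by (rule bounded_linear.suminf[OF bounded_linear_mult_right sm, symmetric])
  moreover have "(\<Sum>n. p (Suc n)) = suminf p * x"
    unfolding pS' by (rule bounded_linear.suminf[OF bounded_linear_mult_left sm, symmetric])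
  ultimately show ?thesis using tail unfolding quasi_def by metis
qed

lemma quasi_image:
  assumes "quasi x q" "\<And>f g. \<phi> (f + g) = \<phi> f + \<phi> g" "\<And>f g. \<phi> (f * g) = \<phi> f * \<phi> g"
  shows "quasi (\<phi> x) (\<phi> q)"
  using arg_cong[OF conjunct1[OF assms(1)[unfolded quasi_def]], of \<phi>]
    arg_cong[OF conjunct2[OF assms(1)[unfolded quasi_def]], of \<phi>]
  unfolding quasi_def assms(2,3) by blast

text \<open>The second resolvent identity: in the unitization it reads (1 + q) - (1 + r) = (1 + q)(x
  - y)(1 + r), since 1 + q and 1 + r invert 1 - x and 1 - y.\<close>

lemma quasi_diff:
  assumes "quasi x q" "quasi y r"
  shows "q - r = (x - y) + (x - y) * r + q * (x - y) + q * ((x - y) * r)"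
proof -
  have 1: "q * x = q - x" and 2: "y * r = r - y"
    using assms unfolding quasi_def by (metis add_diff_cancel_left')+
  have "q * ((x - y) * r) = (q * x) * r - q * (y * r)"
    by (simp add: algebra_simps)
  also have "\<dots> = (q - x) * r - q * (r - y)" by (simp only: 1 2)
  finally have 3: "q * ((x - y) * r) = (q - x) * r - q * (r - y)" .
  have 4: "q * (x - y) = q - x - q * y" by (simp add: right_diff_distrib 1)
  have 5: "(x - y) * r = x * r - (r - y)" by (simp add: left_diff_distrib 2)
  show ?thesis unfolding 3 4 unfolding 5 by (simp add: algebra_simps)
qed

lemma norm_quasi_diff:
  assumes "quasi x q" "quasi y r"
  shows "norm (q - r) \<le> norm (x - y) * (1 + norm q) * (1 + norm r)"
proof -
  have "norm (q - r) \<le> norm (x - y) + norm (x - y) * norm r + norm q * norm (x - y)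
      + norm q * (norm (x - y) * norm r)"
    unfolding quasi_diff[OF assms]
    by (intro norm_triangle_mono norm_mult_ineq order_refl order_trans[OF norm_mult_ineq]
        mult_left_mono norm_ge_zero)
  then show ?thesis by (simp add: algebra_simps)
qed

lemma norm_quasi_le:
  assumes "quasi x q" "norm x < 1"
  shows "norm q \<le> norm x / (1 - norm x)"
proof -
  have "norm q \<le> norm x + norm x * norm q"
    using assms(1) unfolding quasi_def
    by (metis norm_triangle_le norm_mult_ineq add_left_mono)
  then show ?thesis using assms(2) by (simp add: field_simps)
qed

lemma quasi_square:
  assumes "quasi x q" "quasi (- x) r"
  shows "quasi (x * x) ((1/2) *\<^sub>R (q + r))"
proof -
  have a: "x * q = q - x" "q * x = q - x" "x * r = - r - x" "r * x = - r - x"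
    using assms unfolding quasi_def
    by (metis add_diff_cancel_left' mult_minus_left mult_minus_right minus_add_distrib
          minus_minus uminus_add_conv_diff diff_conv_add_uminus add.commute)+
  have b: "x * x * q = q - x - x * x" "x * x * r = r + x - x * x"
    by (simp_all add: mult.assoc a right_diff_distrib)
  have c: "q * (x * x) = q - x - x * x" "r * (x * x) = r + x - x * x"
    by (simp_all add: mult.assoc[symmetric] a left_diff_distrib)
  have h: "(1/2::real) *\<^sub>R (y + y) = y" for y :: 'a
    by (simp add: scaleR_2[symmetric] del: scaleR_2)
  have "(1/2) *\<^sub>R (x * x + x * x) + (1/2) *\<^sub>R ((q - x - x * x) + (r + x - x * x)) = (1/2) *\<^sub>R (q + r)"
    unfolding scaleR_add_right[symmetric] by (simp add: algebra_simps)
  then show ?thesis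
    unfolding quasi_def by (simp add: b c h distrib_left distrib_right)
qed

text \<open>The exponent is 2^m, reached by repeated squaring, so that for self-adjoint x the
  C*-identity determines the norm exactly.\<close>

fun pow2 :: "'a::times \<Rightarrow> nat \<Rightarrow> 'a" where
  "pow2 x 0 = x" | "pow2 x (Suc m) = pow2 x m * pow2 x m"

lemma star_pow2: "star h = h \<Longrightarrow> star (pow2 h m) = pow2 (h::'a::cstar_algebra) m"
  by (induction m) (simp_all add: star_mult)

lemma norm_pow2: "star h = h \<Longrightarrow> norm (pow2 (h::'a::cstar_algebra) m) = norm h ^ (2 ^ m)"
proof (induction m)
  case (Suc m)
  have "norm (pow2 h (Suc m)) = (norm (pow2 h m))\<^sup>2"
    using cstar_identity[of "pow2 h m"] star_pow2[OF Suc.prems] by simp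
  then show ?case using Suc by (simp add: power_mult[symmetric] mult.commute)
qed simp

text \<open>Since \<open>1 / (1 - x\<^sup>2)\<close> is the mean of \<open>1 / (1 - x)\<close> and \<open>1 / (1 + x)\<close>, the resolvents of
  \<open>h\<^sup>2, h\<^sup>4, \<dots>\<close> are means of values of the resolvent of \<open>h\<close> on a circle and inherit its modulus of
  continuity. This replaces the spectral radius formula.\<close>

lemma norm_le_of_quasi:
  fixes h :: "'a::cstar_algebra"
  assumes sa: "star h = h"
    and q: "\<And>\<tau>. cmod \<tau> \<le> 1 \<Longrightarrow> quasi (\<tau> *\<^sub>C h) (q \<tau>)"
  shows "norm h \<noteq> 1"
proof
  assume n1: "norm h = 1"
  have qd: "norm (q \<tau> - q \<mu>) \<le> cmod (\<tau> - \<mu>) * (1 + norm (q \<tau>)) * (1 + norm (q \<mu>))"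
    if "cmod \<tau> \<le> 1" "cmod \<mu> \<le> 1" for \<tau> \<mu>
    using norm_quasi_diff[OF q[OF that(1)] q[OF that(2)]]
    by (simp add: scaleC.diff_left[symmetric] norm_scaleC n1)
  have "continuous_on (cball 0 1) q"
    unfolding continuous_on_iff
  proof (intro ballI allI impI)
    fix \<mu> :: complex and e :: real assume \<mu>: "\<mu> \<in> cball 0 1" and e: "e > 0"
    \<comment> \<open>The norm of \<open>q \<tau>\<close> occurs on both sides of \<open>qd\<close>.
      The first bound in \<open>d\<close> makes it absorbable, \<open>t * K < 1/2\<close>, so that
      \<open>1 + norm (q \<tau>) \<le> 2 * K\<close>; the second then leaves an error below
      e/2.\<close>
    define K where "K = 1 + norm (q \<mu>)"
    have K: "K \<ge> 1" by (simp add: K_def)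
    define d where "d = min (1 / (2 * K)) (e / (4 * K * K))"
    have d: "d > 0" using K e by (auto simp: d_def)
    have "dist (q \<tau>) (q \<mu>) < e" if l: "\<tau> \<in> cball 0 1" "dist \<tau> \<mu> < d" for \<tau>
    proof -
      define t where "t = cmod (\<tau> - \<mu>)"
      have "t < 1 / (2 * K)" "t < e / (4 * K * K)"
        using l(2) by (simp_all add: d_def t_def dist_norm)
      then have "t * (2 * K) < 1" "t * (4 * K * K) < e"
        using K by (simp_all add: pos_less_divide_eq)
      then have t: "t \<ge> 0" "t * K < 1/2" "t * K * K < e/4"
        by (simp_all add: t_def)
      have b: "norm (q \<tau> - q \<mu>) \<le> t * (1 + norm (q \<tau>)) * K"
        using qd[of \<tau> \<mu>] l \<mu> by (simp add: t_def K_def)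
      have "1 + norm (q \<tau>) \<le> K + norm (q \<tau> - q \<mu>)"
        using norm_triangle_sub[of "q \<tau>" "q \<mu>"] by (simp add: K_def)
      also have "\<dots> \<le> K + (1/2) * (1 + norm (q \<tau>))"
      proof -
        have "t * K * (1 + norm (q \<tau>)) \<le> (1/2) * (1 + norm (q \<tau>))"
          using t by (intro mult_right_mono) auto
        moreover have "t * (1 + norm (q \<tau>)) * K = t * K * (1 + norm (q \<tau>))" by simp
        ultimately show ?thesis using b by linarith
      qed
      finally have "1 + norm (q \<tau>) \<le> 2 * K" by (simp add: field_simps)
      then have "t * (1 + norm (q \<tau>)) * K \<le> t * (2 * K) * K"
        using t K by (intro mult_right_mono mult_left_mono) auto
      moreover have "t * (2 * K) * K = 2 * (t * K * K)" by simp
      ultimately show ?thesis using b t e unfolding dist_norm by linarith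
    qed
    then show "\<exists>d>0. \<forall>x\<in>cball 0 1. dist x \<mu> < d \<longrightarrow> dist (q x) (q \<mu>) < e" using d by blast
  qed
  then have "uniformly_continuous_on (cball 0 1) q"
    by (intro compact_uniformly_continuous) auto
  then obtain d where d: "d > 0"
    and uc: "\<And>\<tau> \<mu>. cmod \<tau> \<le> 1 \<Longrightarrow> cmod \<mu> \<le> 1 \<Longrightarrow> cmod (\<tau> - \<mu>) < d \<Longrightarrow> norm (q \<tau> - q \<mu>) < 1/4"
    unfolding uniformly_continuous_on_def dist_norm mem_cball_0
    by (elim allE[of _ "1/4"]) (auto simp: norm_minus_commute)
  \<comment> \<open>Uniform continuity is used only for the radial displacement from \<tau> to s
    \<tau>, whose length is at most 1 - s < d and which commutes with the rotations introduced
    next.\<close>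
  define s where "s = max (1 - d/2) (1/2)"
  have s: "0 < s" "s < 1" "1 - s < d" using d by (auto simp: s_def)
  \<comment> \<open>Multiplying \<tau> by \<open>z m\<close> changes the sign of \<tau>^(2^m), as
    averaging two resolvents requires. Thus \<open>g m \<tau>\<close> is the mean of
    \<open>q\<close> over the rotations of \<tau> by all roots of unity of order 2^m, and a
    quasi-inverse of (\<tau> h)^(2^m).\<close>
  define z where "z = (\<lambda>m. cis (pi / 2 ^ m))"
  define g where "g = rec_nat q (\<lambda>m G \<tau>. (1/2) *\<^sub>R (G \<tau> + G (z m * \<tau>)))"
  have g0: "g 0 = q" and gS: "g (Suc m) \<tau> = (1/2) *\<^sub>R (g m \<tau> + g m (z m * \<tau>))" for m \<tau>
    by (simp_all add: g_def)
  have zm: "z m ^ (2 ^ m) = - 1" for m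
    unfolding z_def Complex.DeMoivre by simp
  have nz: "cmod (z m) = 1" for m by (simp add: z_def)
  have gq: "cmod \<tau> \<le> 1 \<Longrightarrow> quasi (\<tau> ^ (2 ^ m) *\<^sub>C pow2 h m) (g m \<tau>)" for m \<tau>
  proof (induction m arbitrary: \<tau>)
    case 0
    then show ?case using q by (simp add: g0)
  next
    case (Suc m)
    let ?x = "\<tau> ^ (2 ^ m) *\<^sub>C pow2 h m"
    have "quasi ((z m * \<tau>) ^ (2 ^ m) *\<^sub>C pow2 h m) (g m (z m * \<tau>))"
      using Suc.prems by (intro Suc.IH) (simp add: norm_mult nz)
    then have "quasi (- ?x) (g m (z m * \<tau>))"
      by (simp add: power_mult_distrib zm scaleC.minus_left)
    from quasi_square[OF Suc.IH[OF Suc.prems] this]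
    have "quasi (?x * ?x) (g (Suc m) \<tau>)" by (simp add: gS)
    moreover have "?x * ?x = \<tau> ^ (2 ^ Suc m) *\<^sub>C pow2 h (Suc m)"
      by (simp add: mult_scaleC_left mult_scaleC_right scaleC_scaleC mult_2 power_add)
    ultimately show ?case by simp
  qed
  \<comment> \<open>A mean of functions that change by at most 1/4 between \<tau> and s \<tau> has
    the same property, so the bound does not deteriorate with m.\<close>
  have gs: "cmod \<tau> \<le> 1 \<Longrightarrow> norm (g m \<tau> - g m (of_real s * \<tau>)) \<le> 1/4" for m \<tau>
  proof (induction m arbitrary: \<tau>)
    case 0
    have "\<tau> - of_real s * \<tau> = of_real (1 - s) * \<tau>" by (simp add: algebra_simps)
    then have "cmod (\<tau> - of_real s * \<tau>) \<le> (1 - s) * 1"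
      unfolding \<open>\<tau> - of_real s * \<tau> = of_real (1 - s) * \<tau>\<close> norm_mult norm_of_real
      using s 0 by (intro mult_mono) auto
    moreover have "cmod (of_real s * \<tau>) \<le> 1" using s 0 by (simp add: norm_mult mult_le_one)
    ultimately show ?case using uc[of \<tau> "of_real s * \<tau>"] 0 s by (simp add: g0)
  next
    case (Suc m)
    have 1: "norm (g m \<tau> - g m (of_real s * \<tau>)) \<le> 1/4" by (rule Suc.IH[OF Suc.prems])
    have 2: "norm (g m (z m * \<tau>) - g m (z m * (of_real s * \<tau>))) \<le> 1/4"
      using Suc.IH[of "z m * \<tau>"] Suc.prems by (simp add: norm_mult nz mult.left_commute)
    have "g (Suc m) \<tau> - g (Suc m) (of_real s * \<tau>) = (1/2) *\<^sub>R ((g m \<tau> - g m (of_real s * \<tau>))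
       + (g m (z m * \<tau>) - g m (z m * (of_real s * \<tau>))))"
      by (simp add: gS algebra_simps)
    then show ?case using norm_triangle_mono[OF 1 2] by simp
  qed
  have "(\<lambda>n. s ^ n) \<longlonglongrightarrow> 0" using s by (intro LIMSEQ_power_zero) auto
  then have "\<forall>\<^sub>F n in sequentially. s ^ n < 1/6"
    by (rule order_tendstoD) simp
  \<comment> \<open>At radius s the element (s h)^(2^m) has norm below 1/6, hence a quasi-inverse of
    norm at most 1/5; at radius 1 the bound becomes 1/5 + 1/4 = 9/20. But x = g - g x with x of norm
    1 requires g to have norm at least 1/2.\<close>
  then obtain m where m: "s ^ m < 1/6" by (auto simp: eventually_sequentially)
  have "s ^ (2 ^ m) \<le> s ^ m" using s by (intro power_decreasing) (auto simp: less_imp_le)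
  with m have m2: "s ^ (2 ^ m) < 1/6" by simp
  have nh: "norm (pow2 h m) = 1" by (simp add: norm_pow2 sa n1)
  have nx: "norm (of_real s ^ (2 ^ m) *\<^sub>C pow2 h m) = s ^ (2 ^ m)"
    using s by (simp add: norm_scaleC nh norm_power)
  have "norm (g m (of_real s)) \<le> s ^ (2 ^ m) / (1 - s ^ (2 ^ m))"
    using norm_quasi_le[OF gq[of "of_real s" m]] m2 s by (simp add: nx)
  also have "\<dots> \<le> 1/5" using m2 by (simp add: field_simps)
  finally have "norm (g m (of_real s)) \<le> 1/5" .
  then have g1: "norm (g m 1) \<le> 1/5 + 1/4"
    using gs[of 1 m] norm_triangle_sub[of "g m 1" "g m (of_real s)"] by simp
  have "quasi (pow2 h m) (g m 1)" using gq[of 1 m] by (simp add: scaleC_one)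
  then have "pow2 h m = g m 1 - g m 1 * pow2 h m"
    unfolding quasi_def by (metis add_diff_cancel_right')
  then have "norm (pow2 h m) \<le> norm (g m 1) + norm (g m 1) * norm (pow2 h m)"
    using norm_triangle_ineq4[of "g m 1" "g m 1 * pow2 h m"] norm_mult_ineq[of "g m 1" "pow2 h m"]
    by simp
  then show False using g1 by (simp add: nh)
qed

text \<open>If a self-adjoint b had norm below that of its image, it could be scaled so that the
  image has norm 1 and b has norm below 1. Then all \<tau> b with |\<tau>| at most 1 have
  quasi-inverses, and their images are quasi-inverses for the image, contrary to
  \<open>norm_le_of_quasi\<close>. The C*-identity extends the bound to all elements.\<close>

lemma star_automorphism_contractive:
  fixes \<phi> :: "'a::cstar_algebra \<Rightarrow> 'a"
  assumes "star_automorphism \<phi>"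
  shows "norm (\<phi> a) \<le> norm a"
proof -
  have add: "\<phi> (f + g) = \<phi> f + \<phi> g" and sc: "\<phi> (c *\<^sub>C f) = c *\<^sub>C \<phi> f"
    and mul: "\<phi> (f * g) = \<phi> f * \<phi> g" and st: "\<phi> (star f) = star (\<phi> f)" for f g c
    using assms by (simp_all add: star_automorphism_def)
  have sa: "norm (\<phi> b) \<le> norm b" if b: "star b = b" for b
  proof (rule ccontr)
    assume "\<not> ?thesis"
    then have lt: "norm b < norm (\<phi> b)" by simp
    define r where "r = complex_of_real (1 / norm (\<phi> b))"
    have pos: "norm (\<phi> b) > 0" using lt norm_ge_zero[of b] by linarith
    define q where "q = (\<lambda>\<tau>. SOME q. quasi (\<tau> *\<^sub>C r *\<^sub>C b) q)"
    have ex: "\<exists>q. quasi (\<tau> *\<^sub>C r *\<^sub>C b) q" if "cmod \<tau> \<le> 1" for \<tau>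
    proof (rule quasi_exists)
      have "norm (\<tau> *\<^sub>C r *\<^sub>C b) = cmod \<tau> * (norm b / norm (\<phi> b))"
        by (simp add: norm_scaleC r_def norm_divide)
      also have "\<dots> \<le> 1 * (norm b / norm (\<phi> b))" using that by (intro mult_right_mono) auto
      also have "\<dots> < 1" using lt pos by simp
      finally show "norm (\<tau> *\<^sub>C r *\<^sub>C b) < 1" .
    qed
    have q: "quasi (\<tau> *\<^sub>C r *\<^sub>C b) (q \<tau>)" if "cmod \<tau> \<le> 1" for \<tau>
      unfolding q_def by (rule someI_ex[OF ex[OF that]])
    have "quasi (\<tau> *\<^sub>C \<phi> (r *\<^sub>C b)) (\<phi> (q \<tau>))" if "cmod \<tau> \<le> 1" for \<tau>
      using quasi_image[OF q[OF that], of \<phi>, OF add mul] by (simp only: sc)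
    moreover have "star (\<phi> (r *\<^sub>C b)) = \<phi> (r *\<^sub>C b)"
      by (simp add: sc star_scaleC r_def st[symmetric] b)
    ultimately have "norm (\<phi> (r *\<^sub>C b)) \<noteq> 1" by (rule norm_le_of_quasi[rotated])
    then show False using pos by (simp add: sc norm_scaleC r_def norm_divide)
  qed
  have "(norm (\<phi> a))\<^sup>2 = norm (\<phi> (star a * a))"
    by (simp add: mul st cstar_identity)
  also have "\<dots> \<le> norm (star a * a)" by (rule sa) (simp add: star_mult star_star)
  also have "\<dots> = (norm a)\<^sup>2" by (rule cstar_identity)
  finally show ?thesis by (rule power2_le_imp_le) simp
qed

section \<open>Strongly continuous actions are isometric and jointly continuous\<close>

locale caction =
  fixes \<Theta> :: "'x::euclidean_space \<Rightarrow> 'a::cstar_algebra \<Rightarrow> 'a"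
  assumes sca: "strongly_continuous_action \<Theta>"
begin

lemma aut: "star_automorphism (\<Theta> X)" using sca by (simp add: strongly_continuous_action_def)

lemma act_0 [simp]: "\<Theta> 0 f = f"
  using sca unfolding strongly_continuous_action_def by blast

lemma act_act: "\<Theta> X (\<Theta> Y f) = \<Theta> (X + Y) f"
  using sca unfolding strongly_continuous_action_def by metis

lemma continuous_on_act1: "continuous_on UNIV (\<lambda>X. \<Theta> X f)"
  using sca unfolding strongly_continuous_action_def by blast

lemma act_add: "\<Theta> X (f + g) = \<Theta> X f + \<Theta> X g"
  and act_scaleC: "\<Theta> X (c *\<^sub>C f) = c *\<^sub>C \<Theta> X f"
  and act_mult: "\<Theta> X (f * g) = \<Theta> X f * \<Theta> X g"
  and act_star: "\<Theta> X (star f) = star (\<Theta> X f)"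
  using aut[of X] by (simp_all add: star_automorphism_def)

lemma norm_act [simp]: "norm (\<Theta> X f) = norm f"
  using star_automorphism_contractive[OF aut, of X f]
    star_automorphism_contractive[OF aut, of "- X" "\<Theta> X f"] by (simp add: act_act)

lemma bounded_linear_act: "bounded_linear (\<Theta> X)"
  by (intro bounded_linear_intro[of _ 1]) (simp_all add: act_add scaleR_scaleC act_scaleC)

lemmas act_diff = linear_diff[OF bounded_linear.linear[OF bounded_linear_act]]
lemmas act_scaleR = linear_scale[OF bounded_linear.linear[OF bounded_linear_act]]
lemmas act_zero [simp] = linear_0[OF bounded_linear.linear[OF bounded_linear_act]]

text \<open>Isometry upgrades strong continuity to joint continuity:
  \<open>\<Theta> (u y) (f y - a)\<close> has the norm of \<open>f y - a\<close>, and only the fixed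
  vector \<open>a\<close> is moved by the varying automorphism.\<close>

lemma tendsto_act [tendsto_intros]:
  assumes "(u \<longlongrightarrow> X) F" "(f \<longlongrightarrow> a) F"
  shows "((\<lambda>y. \<Theta> (u y) (f y)) \<longlongrightarrow> \<Theta> X a) F"
proof -
  have 1: "((\<lambda>y. \<Theta> (u y) a) \<longlongrightarrow> \<Theta> X a) F"
    by (rule continuous_on_tendsto_compose[OF continuous_on_act1 assms(1)]) auto
  have 2: "((\<lambda>y. \<Theta> (u y) (f y - a)) \<longlongrightarrow> 0) F"
    by (rule tendsto_norm_zero_cancel) (use tendsto_norm_zero[OF LIM_zero[OF assms(2)]] in simp)
  show ?thesis using tendsto_add[OF 2 1] by (simp add: act_diff)
qed

lemma continuous_on_act [continuous_intros]:
  "continuous_on S u \<Longrightarrow> continuous_on S f \<Longrightarrow> continuous_on S (\<lambda>y. \<Theta> (u y) (f y))"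
  unfolding continuous_on_def by (auto intro!: tendsto_act)

end

section \<open>Integrals of continuous dominated functions\<close>

text \<open>The exponent is twice the dimension so that the weight lies below the product of the
  functions 1 / (1 + y^2) of the coordinates, which is integrable. Majorants are always constant
  multiples of this function.\<close>

definition wt :: "'y::euclidean_space \<Rightarrow> real" where
  "wt Y = 1 / (1 + norm Y) ^ (2 * DIM('y))"

lemma wt_pos [simp]: "wt Y > 0" "wt Y \<ge> 0" "wt Y \<noteq> 0"
proof -
  have "1 + norm Y > 0" by (simp add: add_pos_nonneg)
  then show "wt Y > 0" unfolding wt_def by (rule divide_pos_pos[OF zero_less_one zero_less_power])
  then show "wt Y \<ge> 0" "wt Y \<noteq> 0" by auto
qed

lemma continuous_on_wt [continuous_intros]:
  assumes "continuous_on S f"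
  shows "continuous_on S (\<lambda>x. wt (f x))"
proof -
  have "1 + norm (f x) \<noteq> 0" for x using norm_ge_zero[of "f x"] by linarith
  then show ?thesis
    unfolding wt_def by (intro continuous_intros assms) auto
qed

lemma wt_le_1: "wt Y \<le> 1"
proof -
  have "1 \<le> (1 + norm Y) ^ (2 * DIM('a))" by (rule one_le_power) simp
  then show ?thesis unfolding wt_def by (subst divide_le_eq_1_pos) linarith+
qed

text \<open>From \<open>1 + norm Y \<le> (1 + norm Z) * (1 + norm (Y + Z))\<close>, an inequality of
  Peetre type. A bounded shift costs only a constant factor, which keeps nearby translates of an
  integrand under one majorant.\<close>

lemma wt_shift: "wt (Y + Z) \<le> (1 + norm Z) ^ (2 * DIM('y)) * wt (Y::'y::euclidean_space)"
proof -
  have 0: "1 + norm (Y + Z) > 0" "1 + norm Y > 0" "1 + norm Z > 0"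
    by (auto intro: add_pos_nonneg)
  have "1 + norm Y \<le> (1 + norm Z) * (1 + norm (Y + Z))"
    using norm_triangle_ineq4[of "Y + Z" Z, unfolded add_diff_cancel_right'] mult_nonneg_nonneg[OF norm_ge_zero[of Z] norm_ge_zero[of "Y + Z"]]
    unfolding distrib_left distrib_right mult_1_left mult_1_right by linarith
  then have "(1 + norm Y) ^ (2 * DIM('y)) \<le> ((1 + norm Z) * (1 + norm (Y + Z))) ^ (2 * DIM('y))"
    using 0 by (intro power_mono) auto
  then show ?thesis using 0 unfolding wt_def power_mult_distrib
    by (simp add: divide_simps mult.commute)
qed

lemma wt_rapid:
  assumes "(1 + norm Y) ^ (2 * DIM('y)) * a \<le> C"
  shows "a \<le> C * wt (Y::'y::euclidean_space)"
proof -
  have "1 + norm Y > 0" by (auto intro: add_pos_nonneg)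
  then show ?thesis using assms unfolding wt_def by (simp add: pos_le_divide_eq mult.commute)
qed

lemma nn_integral_inverse_square: "(\<integral>\<^sup>+x. ennreal (1 / (1 + x\<^sup>2)) \<partial>lborel) < \<infinity>"
proof -
  let ?f = "\<lambda>x::real. 1 / (1 + x\<^sup>2)"
  have m: "(\<lambda>x. ennreal (?f x)) \<in> borel_measurable borel" by measurable
  have 1: "(\<integral>\<^sup>+x. ennreal (?f x) * indicator {0..} x \<partial>lborel) = pi / 2 - arctan 0"
    using tendsto_arctan_at_top
    by (intro nn_integral_FTC_atLeast)
       (auto intro!: derivative_eq_intros simp: field_simps power2_eq_square add_nonneg_eq_0_iff)
  have "(\<integral>\<^sup>+x. ennreal (?f x) * indicator {..0} x \<partial>lborel)
      = (\<integral>\<^sup>+x. ennreal (?f x) * indicator {0..} x \<partial>lborel)"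
    by (subst nn_integral_real_affine[of _ "-1" 0])
       (use m in \<open>auto intro!: nn_integral_cong simp: indicator_def\<close>)
  moreover have "(\<integral>\<^sup>+x. ennreal (?f x) \<partial>lborel) \<le>
      (\<integral>\<^sup>+x. ennreal (?f x) * indicator {0..} x + ennreal (?f x) * indicator {..0} x \<partial>lborel)"
    by (intro nn_integral_mono) (auto simp: indicator_def)
  moreover have "\<dots> = (\<integral>\<^sup>+x. ennreal (?f x) * indicator {0..} x \<partial>lborel)
      + (\<integral>\<^sup>+x. ennreal (?f x) * indicator {..0} x \<partial>lborel)"
    by (intro nn_integral_add) auto
  ultimately show ?thesis using 1 by (auto simp: le_less_trans)
qed

lemma integrable_wt: "integrable lborel (wt :: 'y::euclidean_space \<Rightarrow> real)"
proof (rule integrableI_bounded)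
  show "(wt :: 'y \<Rightarrow> real) \<in> borel_measurable lborel"
    using borel_measurable_continuous_onI[OF continuous_on_wt[OF continuous_on_id]] by simp
  have le: "wt Y \<le> (\<Prod>b\<in>Basis. 1 / (1 + (Y \<bullet> b)\<^sup>2))" for Y :: 'y
  proof -
    have n: "1 + norm Y > 0" by (auto intro: add_pos_nonneg)
    have "(\<Prod>b\<in>(Basis::'y set). 1 + (Y \<bullet> b)\<^sup>2) \<le> (\<Prod>b\<in>(Basis::'y set). (1 + norm Y)\<^sup>2)"
    proof (intro prod_mono conjI)
      fix b :: 'y assume b: "b \<in> Basis"
      have "(Y \<bullet> b)\<^sup>2 \<le> (norm Y)\<^sup>2"
        using Basis_le_norm[OF b, of Y] by (metis abs_ge_zero power2_abs power_mono)
      then show "1 + (Y \<bullet> b)\<^sup>2 \<le> (1 + norm Y)\<^sup>2"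
        using norm_ge_zero[of Y] by (simp add: power2_sum del: norm_ge_zero)
    qed simp
    also have "\<dots> = (1 + norm Y) ^ (2 * DIM('y))" by (simp add: power_mult)
    finally have "1 / (1 + norm Y) ^ (2 * DIM('y)) \<le> 1 / (\<Prod>b\<in>(Basis::'y set). 1 + (Y \<bullet> b)\<^sup>2)"
      by (intro divide_left_mono mult_pos_pos prod_pos zero_less_power n)
         (auto intro: add_pos_nonneg)
    then show ?thesis by (simp add: wt_def prod_dividef)
  qed
  have "(\<integral>\<^sup>+Y. ennreal (norm (wt (Y::'y))) \<partial>lborel)
      \<le> (\<integral>\<^sup>+Y. (\<Prod>b\<in>(Basis::'y set). ennreal (1 / (1 + (Y \<bullet> b)\<^sup>2))) \<partial>lborel)"
    by (intro nn_integral_mono) (simp add: prod_ennreal le ennreal_leI)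
  also have "\<dots> = (\<Prod>b\<in>(Basis::'y set). (\<integral>\<^sup>+x. ennreal (1 / (1 + x\<^sup>2)) \<partial>lborel))"
    by (rule nn_integral_lborel_prod) auto
  also have "\<dots> < \<infinity>"
    using nn_integral_inverse_square by (simp add: power_less_top_ennreal)
  finally show "(\<integral>\<^sup>+Y. ennreal (norm (wt (Y::'y))) \<partial>lborel) < \<infinity>" .
qed

lemma wt_integrable_on: "(\<lambda>Y. C * wt (Y::'y::euclidean_space)) integrable_on UNIV"
  by (intro integrable_on_lborel integrable_mult_right integrable_wt)

text \<open>Both differences are integrals over the part of T outside S. They are written as
  integrals over T of functions set to zero on S, to which the usual norm bound applies.\<close>

lemma integral_diff_le:
  fixes k :: "'y::euclidean_space \<Rightarrow> 'b::banach"
  assumes "S \<subseteq> T" "k integrable_on S" "k integrable_on T" "g integrable_on S" "g integrable_on T"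
    and le: "\<And>Y. norm (k Y) \<le> g Y"
  shows "norm (integral T k - integral S k) \<le> integral T g - integral S g"
proof -
  have ST: "S \<inter> T = S" using assms(1) by auto
  have k: "(\<lambda>x. k x - (if x \<in> S then k x else 0)) integrable_on T"
    by (intro integrable_diff assms) (simp add: integrable_restrict_Int ST assms)
  have g: "(\<lambda>x. g x - (if x \<in> S then g x else 0)) integrable_on T"
    by (intro integrable_diff assms) (simp add: integrable_restrict_Int ST assms)
  have "integral T (\<lambda>x. k x - (if x \<in> S then k x else 0)) = integral T k - integral S k"
    using assms by (subst integral_diff)
      (simp_all add: integrable_restrict_Int Henstock_Kurzweil_Integration.integral_restrict_Int ST)
  moreover have "integral T (\<lambda>x. g x - (if x \<in> S then g x else 0)) = integral T g - integral S g"
    using assms by (subst integral_diff)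
      (simp_all add: integrable_restrict_Int Henstock_Kurzweil_Integration.integral_restrict_Int ST)
  moreover have "norm (integral T (\<lambda>x. k x - (if x \<in> S then k x else 0)))
      \<le> integral T (\<lambda>x. g x - (if x \<in> S then g x else 0))"
    by (rule integral_norm_bound_integral[OF k g]) (use le in auto)
  ultimately show ?thesis by simp
qed

text \<open>Continuity gives integrability on boxes, and the Cauchy criterion over growing boxes
  passes from the majorant to \<open>k\<close>. No separability or measurability of the target space
  enters.\<close>

lemma integrable_on_dominated:
  fixes k :: "'y::euclidean_space \<Rightarrow> 'b::banach"
  assumes c: "continuous_on UNIV k" and le: "\<And>Y. norm (k Y) \<le> g Y" and g: "g integrable_on UNIV"
  shows "k integrable_on UNIV"
proof -
  have kc: "k integrable_on cbox a b" for a b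
    by (rule integrable_continuous) (use c continuous_on_subset in blast)
  have gc: "g integrable_on cbox a b" for a b
    using integrable_on_subcbox[OF g] by simp
  have "\<exists>B>0. \<forall>a b c d. ball 0 B \<subseteq> cbox a b \<and> cbox a b \<subseteq> cbox c d \<longrightarrow>
      norm (integral (cbox a b) k - integral (cbox c d) k) < e" if e: "e > 0" for e
  proof -
    obtain B where B: "B > 0" "\<And>a b c d. ball 0 B \<subseteq> cbox a b \<and> ball 0 B \<subseteq> cbox c d \<Longrightarrow>
        norm (integral (cbox a b) g - integral (cbox c d) g) < e"
      using integrable_altD(2)[OF g e] by auto
    have "norm (integral (cbox a b) k - integral (cbox c d) k) < e"
      if "ball 0 B \<subseteq> cbox a b" "cbox a b \<subseteq> cbox c d" for a b c d
    proof -
      have "norm (integral (cbox c d) k - integral (cbox a b) k)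
          \<le> integral (cbox c d) g - integral (cbox a b) g"
        by (intro integral_diff_le that kc gc le)
      moreover have "norm (integral (cbox a b) g - integral (cbox c d) g) < e"
        using B(2)[of a b c d] that by blast
      ultimately show ?thesis by (simp add: norm_minus_commute)
    qed
    then show ?thesis using B(1) by blast
  qed
  then show ?thesis using kc by (subst integrable_alt_subset) simp
qed

definition dec :: "('y::euclidean_space \<Rightarrow> 'b::real_normed_vector) \<Rightarrow> bool" where
  "dec k \<longleftrightarrow> continuous_on UNIV k \<and> (\<exists>C. \<forall>Y. norm (k Y) \<le> C * wt Y)"

lemma decI: "continuous_on UNIV k \<Longrightarrow> (\<And>Y. norm (k Y) \<le> C * wt Y) \<Longrightarrow> dec k"
  unfolding dec_def by blast

lemma dec_integrable: "dec k \<Longrightarrow> k integrable_on UNIV" for k :: "'y::euclidean_space \<Rightarrow> 'b::banach"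
  unfolding dec_def by (auto intro: integrable_on_dominated[OF _ _ wt_integrable_on])

lemma dec_continuous: "dec k \<Longrightarrow> continuous_on UNIV k"
  by (simp add: dec_def)

lemma dec_add: "dec k \<Longrightarrow> dec l \<Longrightarrow> dec (\<lambda>Y. k Y + l Y)"
proof -
  assume "dec k" "dec l"
  then obtain C D where c: "continuous_on UNIV k" "continuous_on UNIV l"
    and b: "\<And>Y. norm (k Y) \<le> C * wt Y" "\<And>Y. norm (l Y) \<le> D * wt Y" by (auto simp: dec_def)
  show ?thesis
    by (rule decI[of _ "C + D"])
       (use c in \<open>auto intro!: continuous_intros norm_triangle_le add_mono b simp: distrib_right\<close>)
qed

lemma dec_bounded:
  assumes "dec k" "continuous_on UNIV l" "\<And>Y. norm (l Y) \<le> K * norm (k Y)" "K \<ge> 0"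
  shows "dec l"
proof -
  obtain C where C: "\<And>Y. norm (k Y) \<le> C * wt Y" using assms(1) by (auto simp: dec_def)
  have "norm (l Y) \<le> (K * C) * wt Y" for Y
    using order_trans[OF assms(3) mult_left_mono[OF C assms(4)]] by (simp add: mult.assoc)
  then show ?thesis using assms(2) by (intro decI)
qed

lemma dec_compact:
  fixes k :: "'y::euclidean_space \<Rightarrow> 'b::real_normed_vector"
  assumes c: "continuous_on UNIV k" and z: "\<And>Y. norm Y > R \<Longrightarrow> k Y = 0"
  shows "dec k"
proof -
  have "compact (k ` cball 0 R)"
    by (intro compact_continuous_image) (use c continuous_on_subset in auto)
  then obtain B where B: "\<And>Y. norm Y \<le> R \<Longrightarrow> norm (k Y) \<le> B"
    by (meson bounded_iff compact_imp_bounded image_eqI mem_cball_0)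
  show ?thesis
  proof (rule decI[OF c])
    fix Y :: 'y
    show "norm (k Y) \<le> (\<bar>B\<bar> * (1 + \<bar>R\<bar>) ^ (2 * DIM('y))) * wt Y"
    proof (cases "norm Y > R")
      case True
      then show ?thesis using z by (simp add: less_imp_le)
    next
      case False
      have "norm (k Y) \<le> \<bar>B\<bar>" using B[of Y] False by simp
      moreover have "(1 + norm Y) ^ (2 * DIM('y)) \<le> (1 + \<bar>R\<bar>) ^ (2 * DIM('y))"
        using False by (intro power_mono) auto
      ultimately have "(1 + norm Y) ^ (2 * DIM('y)) * norm (k Y) \<le> (1 + \<bar>R\<bar>) ^ (2 * DIM('y)) * \<bar>B\<bar>"
        by (intro mult_mono) auto
      then show ?thesis by (intro wt_rapid) (simp add: mult.commute)
    qed
  qed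
qed

lemma norm_integral_le:
  fixes k :: "'y::euclidean_space \<Rightarrow> 'b::banach"
  assumes "dec k" "\<And>Y. norm (k Y) \<le> C * wt Y"
  shows "norm (integral UNIV k) \<le> C * integral UNIV (wt :: 'y \<Rightarrow> real)"
  using integral_norm_bound_integral[OF dec_integrable[OF assms(1)] wt_integrable_on assms(2)] by simp

lemma integral_wt_nonneg: "integral UNIV (wt :: 'y::euclidean_space \<Rightarrow> real) \<ge> 0"
  by (rule integral_nonneg) (use wt_integrable_on[of 1] in auto)

subsection \<open>Dominated convergence and parameters\<close>

text \<open>The scalar dominated convergence theorem is applied, along sequences, to the norms of
  the differences; this gives the statement for values in a Banach space.\<close>

lemma tendsto_integral:
  fixes k :: "'p::first_countable_topology \<Rightarrow> 'y::euclidean_space \<Rightarrow> 'b::banach"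
  assumes k: "\<And>s. s \<in> S - {x} \<Longrightarrow> continuous_on UNIV (k s)" and l: "continuous_on UNIV l"
    and kb: "\<And>s Y. s \<in> S - {x} \<Longrightarrow> norm (k s Y) \<le> C * wt Y" and lb: "\<And>Y. norm (l Y) \<le> C * wt Y"
    and lim: "\<And>Y. ((\<lambda>s. k s Y) \<longlongrightarrow> l Y) (at x within S)"
  shows "((\<lambda>s. integral UNIV (k s)) \<longlongrightarrow> integral UNIV l) (at x within S)"
  unfolding tendsto_at_iff_sequentially
proof (intro allI impI)
  fix X assume X: "\<forall>i. X i \<in> S - {x}" "X \<longlonglongrightarrow> x"
  have li: "l integrable_on UNIV" by (intro dec_integrable decI[OF l lb])
  have ki: "k (X i) integrable_on UNIV" for i using X by (intro dec_integrable decI[OF k kb]) auto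
  define f where "f = (\<lambda>i Y. norm (k (X i) Y - l Y))"
  have fb: "norm (f i Y) \<le> (C + C) * wt Y" for i Y
    unfolding f_def using norm_triangle_le_diff[OF add_mono[OF kb lb], of "X i" Y Y] X
    by (auto simp: distrib_right intro!: norm_triangle_le_diff add_mono kb lb)
  have fc: "continuous_on UNIV (f i)" for i
    unfolding f_def using X by (intro continuous_intros k l) auto
  have fi: "f i integrable_on UNIV" for i by (intro dec_integrable decI[OF fc fb])
  have "(\<lambda>i. integral UNIV (f i)) \<longlonglongrightarrow> integral UNIV (\<lambda>Y::'y. 0::real)"
  proof (rule dominated_convergence[OF fi wt_integrable_on fb])
    fix Y
    have "(\<lambda>i. k (X i) Y) \<longlonglongrightarrow> l Y"
      using lim[of Y] X unfolding tendsto_at_iff_sequentially o_def by blast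
    then show "(\<lambda>i. f i Y) \<longlonglongrightarrow> 0"
      unfolding f_def using LIM_zero tendsto_norm_zero by blast
  qed
  then have 0: "(\<lambda>i. integral UNIV (f i)) \<longlonglongrightarrow> 0" by simp
  have "norm (integral UNIV (k (X i)) - integral UNIV l) \<le> integral UNIV (f i)" for i
    unfolding integral_diff[OF ki li, symmetric]
    by (rule integral_norm_bound_integral[OF integrable_diff[OF ki li] fi]) (simp add: f_def)
  then have "(\<lambda>i. integral UNIV (k (X i)) - integral UNIV l) \<longlonglongrightarrow> 0"
    by (intro Lim_null_comparison[OF _ 0]) auto
  then show "((\<lambda>s. integral UNIV (k s)) \<circ> X) \<longlonglongrightarrow> integral UNIV l"
    unfolding o_def by (rule LIM_zero_cancel)
qed

lemma continuous_on_integral: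
  fixes k :: "'p::first_countable_topology \<Rightarrow> 'y::euclidean_space \<Rightarrow> 'b::banach"
  assumes k: "continuous_on (S \<times> UNIV) (\<lambda>(s, Y). k s Y)"
    and kb: "\<And>s Y. s \<in> S \<Longrightarrow> norm (k s Y) \<le> C * wt Y"
  shows "continuous_on S (\<lambda>s. integral UNIV (k s))"
proof -
  have k1: "continuous_on UNIV (k s)" if "s \<in> S" for s
    using that by (intro continuous_on_compose2[OF k, of _ "\<lambda>Y. (s, Y)", simplified]) (auto intro!: continuous_intros)
  have k2: "continuous_on S (\<lambda>s. k s Y)" for Y
    by (intro continuous_on_compose2[OF k, of _ "\<lambda>s. (s, Y)", simplified]) (auto intro!: continuous_intros)
  show ?thesis unfolding continuous_on_def
    by (intro ballI tendsto_integral[of _ _ _ _ C]) (use k1 k2 kb in \<open>auto simp: continuous_on_def\<close>)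
qed

lemma has_vector_derivative_at_iff:
  "(f has_vector_derivative D) (at x) \<longleftrightarrow> ((\<lambda>t. (1 / t) *\<^sub>R (f (x + t) - f x)) \<longlongrightarrow> D) (at 0)"
proof -
  have e: "norm (f (x + h) - f x - h *\<^sub>R D) / norm h = norm ((1 / h) *\<^sub>R (f (x + h) - f x) - D)"
    if "h \<noteq> 0" for h
  proof -
    have "(1 / h) *\<^sub>R (f (x + h) - f x) - D = (1 / h) *\<^sub>R (f (x + h) - f x - h *\<^sub>R D)"
      using that by (simp add: scaleR_diff_right)
    then show ?thesis by simp
  qed
  have "(f has_vector_derivative D) (at x) \<longleftrightarrow>
      (\<lambda>h. norm (f (x + h) - f x - h *\<^sub>R D) / norm h) \<midarrow>0\<rightarrow> 0"
    unfolding has_vector_derivative_def has_derivative_at by (simp add: bounded_linear_scaleR_left)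
  also have "\<dots> \<longleftrightarrow> (\<lambda>h. norm ((1 / h) *\<^sub>R (f (x + h) - f x) - D)) \<midarrow>0\<rightarrow> 0"
  proof (rule filterlim_cong[OF refl refl])
    show "\<forall>\<^sub>F h in at 0. norm (f (x + h) - f x - h *\<^sub>R D) / norm h = norm ((1 / h) *\<^sub>R (f (x + h) - f x) - D)"
      unfolding eventually_at_filter by (intro always_eventually allI impI e)
  qed
  also have "\<dots> \<longleftrightarrow> ((\<lambda>t. (1 / t) *\<^sub>R (f (x + t) - f x)) \<longlongrightarrow> D) (at 0)"
    by (simp add: tendsto_norm_zero_iff LIM_zero_iff)
  finally show ?thesis .
qed

text \<open>By the mean value inequality the difference quotients for |t| < 1 inherit the majorant
  of the derivative, so dominated convergence applies to them.\<close>

lemma has_vector_derivative_integral: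
  fixes k :: "real \<Rightarrow> 'y::euclidean_space \<Rightarrow> 'b::banach"
  assumes d: "\<And>t Y. \<bar>t\<bar> \<le> 1 \<Longrightarrow> ((\<lambda>s. k s Y) has_vector_derivative k' t Y) (at t)"
    and b: "\<And>t Y. \<bar>t\<bar> \<le> 1 \<Longrightarrow> norm (k' t Y) \<le> C * wt Y"
    and k: "\<And>t. \<bar>t\<bar> \<le> 1 \<Longrightarrow> dec (k t)" and c: "continuous_on UNIV (k' 0)"
  shows "((\<lambda>t. integral UNIV (k t)) has_vector_derivative integral UNIV (k' 0)) (at 0)"
proof -
  let ?S = "{-1<..<1::real}"
  let ?q = "\<lambda>t Y. (1 / t) *\<^sub>R (k t Y - k 0 Y)"
  have zS: "0 \<in> ?S" by simp
  have qt: "integral UNIV (?q t) = (1 / t) *\<^sub>R (integral UNIV (k t) - integral UNIV (k 0))"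
    if "t \<in> ?S" for t
  proof -
    have "\<bar>t\<bar> \<le> 1" "\<bar>0::real\<bar> \<le> 1" using that by auto
    then have "k t integrable_on UNIV" "k 0 integrable_on UNIV"
      using dec_integrable k by blast+
    then show ?thesis by (simp add: integral_diff)
  qed
  have "((\<lambda>t. integral UNIV (?q t)) \<longlongrightarrow> integral UNIV (k' 0)) (at 0 within ?S)"
  proof (rule tendsto_integral[where C = C])
    fix t assume "t \<in> ?S - {0}"
    then have t: "\<bar>t\<bar> \<le> 1" "t \<noteq> 0" by auto
    show "continuous_on UNIV (?q t)"
      using dec_continuous[OF k[of t]] dec_continuous[OF k[of 0]] t by (auto intro!: continuous_intros)
    fix Y
    have "norm (k t Y - k 0 Y) \<le> (C * wt Y) * norm (t - 0)"
    proof (rule differentiable_bound[of "{-1..1}" "\<lambda>s. k s Y" "\<lambda>s h. h *\<^sub>R k' s Y"])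
      show "((\<lambda>s. k s Y) has_derivative (\<lambda>h. h *\<^sub>R k' s Y)) (at s within {-1..1})" if "s \<in> {-1..1}" for s
        using d[of s Y] that unfolding has_vector_derivative_def
        by (auto intro: has_derivative_at_withinI)
      show "onorm (\<lambda>h. h *\<^sub>R k' s Y) \<le> C * wt Y" if "s \<in> {-1..1}" for s
      proof -
        have "\<bar>s\<bar> \<le> 1" using that by auto
        from b[OF this, of Y] show ?thesis
          by (simp add: onorm_scaleR_left[OF bounded_linear_ident, simplified] onorm_id)
      qed
    qed (use t in auto)
    then show "norm (?q t Y) \<le> C * wt Y" using t by (simp add: divide_simps mult.commute)
  next
    fix Y
    have "((\<lambda>t. ?q t Y) \<longlongrightarrow> k' 0 Y) (at 0)"
      using d[of 0 Y] by (simp add: has_vector_derivative_at_iff)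
    then show "((\<lambda>t. ?q t Y) \<longlongrightarrow> k' 0 Y) (at 0 within ?S)" by (rule tendsto_within_subset) auto
    show "norm (k' 0 Y) \<le> C * wt Y" by (rule b) simp
  qed (rule c)
  moreover have "\<forall>\<^sub>F t in at 0 within ?S. integral UNIV (?q t)
      = (1 / t) *\<^sub>R (integral UNIV (k t) - integral UNIV (k 0))"
    unfolding eventually_at_filter by (intro always_eventually allI impI qt)
  ultimately have "((\<lambda>t. (1 / t) *\<^sub>R (integral UNIV (k t) - integral UNIV (k 0))) \<longlongrightarrow> integral UNIV (k' 0))
      (at 0 within ?S)"
    by (rule Lim_transform_eventually)
  then show ?thesis
    unfolding has_vector_derivative_at_iff at_within_open[OF zS open_greaterThanLessThan] by (simp only: add_0_left)
qed

subsection \<open>Fubini and substitutions\<close>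

lemma tendsto_integral_boxes:
  fixes k :: "'y::euclidean_space \<Rightarrow> 'b::banach"
  assumes k: "k integrable_on UNIV" and b: "\<And>n. ball 0 (real n) \<subseteq> cbox (u n) (v n)"
  shows "(\<lambda>n. integral (cbox (u n) (v n)) k) \<longlonglongrightarrow> integral UNIV k"
  unfolding LIMSEQ_iff
proof (intro allI impI)
  fix e :: real assume "e > 0"
  moreover have "\<forall>e>0. \<exists>B>0. \<forall>a b. ball 0 B \<subseteq> cbox a b \<longrightarrow> norm (integral (cbox a b) k - integral UNIV k) < e"
    using integrable_integral[OF k] by (subst (asm) has_integral_alt') simp
  ultimately obtain B where B: "\<And>a b. ball 0 B \<subseteq> cbox a b \<Longrightarrow> norm (integral (cbox a b) k - integral UNIV k) < e"
    by blast
  obtain N where N: "B \<le> real N" using real_arch_simple by blast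
  have "norm (integral (cbox (u n) (v n)) k - integral UNIV k) < e" if "n \<ge> N" for n
    using that N b[of n] by (intro B order_trans[OF subset_ball b]) simp
  then show "\<exists>N. \<forall>n\<ge>N. norm (integral (cbox (u n) (v n)) k - integral UNIV k) < e" by blast
qed

lemma ball_subset_One_box: "ball 0 r \<subseteq> cbox (- r *\<^sub>R One) (r *\<^sub>R One :: 'y::euclidean_space)"
proof
  fix x :: 'y assume "x \<in> ball 0 r"
  then have "\<bar>x \<bullet> b\<bar> \<le> r" if "b \<in> Basis" for b
    using Basis_le_norm[OF that, of x] by simp
  then show "x \<in> cbox (- r *\<^sub>R One) (r *\<^sub>R One)"
    by (auto simp: mem_box abs_le_iff minus_le_iff)
qed

lemma integral_affine:
  fixes k :: "'y::euclidean_space \<Rightarrow> 'b::banach"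
  assumes k: "k integrable_on UNIV" and m: "m \<noteq> 0"
  shows "((\<lambda>Y. k (m *\<^sub>R Y + a)) has_integral (1 / \<bar>m\<bar> ^ DIM('y)) *\<^sub>R integral UNIV k) UNIV"
proof -
  define r where "r = 1 / \<bar>m\<bar> ^ DIM('y)"
  have r: "r > 0" using m by (simp add: r_def)
  let ?h = "\<lambda>x::'y. m *\<^sub>R x + a"
  have inv: "(\<lambda>x. (1 / m) *\<^sub>R x + - ((1 / m) *\<^sub>R a)) ` ?h ` S = S" for S
    using m by (simp add: image_image scaleR_add_right)
  have box: "\<exists>w z. ?h ` cbox u v = cbox w z" for u v
    using interval_image_affinity_interval by blast
  have hi: "((\<lambda>Y. k (?h Y)) has_integral r *\<^sub>R integral (?h ` cbox u v) k) (cbox u v)" for u v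
  proof -
    obtain w z where wz: "?h ` cbox u v = cbox w z" using box by blast
    have "(k has_integral integral (cbox w z) k) (cbox w z)"
      using integrable_on_subcbox[OF k] by (intro integrable_integral) simp
    from has_integral_affinity[OF this m, of a] show ?thesis
      unfolding wz[symmetric] inv r_def .
  qed
  have lim: "\<forall>e>0. \<exists>B>0. \<forall>a b. ball 0 B \<subseteq> cbox a b \<longrightarrow> norm (integral (cbox a b) k - integral UNIV k) < e"
    using integrable_integral[OF k] by (subst (asm) has_integral_alt') simp
  have "\<exists>B>0. \<forall>u v. ball 0 B \<subseteq> cbox u v \<longrightarrow>
      norm (integral (cbox u v) (\<lambda>Y. k (?h Y)) - r *\<^sub>R integral UNIV k) < e" if e: "e > 0" for e
  proof -
    have "e / r > 0" using e r by simp
    then obtain B where B: "B > 0" "\<And>a b. ball 0 B \<subseteq> cbox a b \<Longrightarrow> norm (integral (cbox a b) k - integral UNIV k) < e / r"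
      using lim by blast
    \<comment> \<open>This radius is chosen so that the image of \<open>ball 0 B'\<close> under the
      affine map contains \<open>ball 0 B\<close>; large boxes are then carried to boxes that are
      large enough for \<open>lim\<close>.\<close>
    define B' where "B' = (B + norm a) / \<bar>m\<bar>"
    have "norm (integral (cbox u v) (\<lambda>Y. k (?h Y)) - r *\<^sub>R integral UNIV k) < e"
      if uv: "ball 0 B' \<subseteq> cbox u v" for u v
    proof -
      obtain w z where wz: "?h ` cbox u v = cbox w z" using box by blast
      have "ball 0 B \<subseteq> cbox w z"
      proof
        fix x :: 'y assume x: "x \<in> ball 0 B"
        let ?y = "(1 / m) *\<^sub>R (x - a)"
        have "norm (x - a) < B + norm a" using x norm_triangle_ineq4[of x a] by simp
        then have "?y \<in> ball 0 B'" using m by (simp add: B'_def divide_strict_right_mono)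
        then have "?h ?y \<in> cbox w z" using uv wz by blast
        then show "x \<in> cbox w z" using m by simp
      qed
      from B(2)[OF this] have "norm (integral (cbox w z) k - integral UNIV k) < e / r" .
      then have "norm (r *\<^sub>R (integral (cbox w z) k - integral UNIV k)) < e"
        using r by (simp add: pos_less_divide_eq mult.commute)
      then show ?thesis
        using integral_unique[OF hi[of u v]] by (simp add: wz scaleR_diff_right)
    qed
    moreover have "B' > 0" using B(1) m by (simp add: B'_def add_pos_nonneg)
    ultimately show ?thesis by blast
  qed
  then have "((\<lambda>Y. k (?h Y)) has_integral r *\<^sub>R integral UNIV k) UNIV"
    using has_integral_integrable[OF hi] by (subst has_integral_alt') simp
  then show ?thesis by (simp add: r_def)
qed

lemma integral_shift:
  fixes k :: "'y::euclidean_space \<Rightarrow> 'b::banach"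
  assumes "k integrable_on UNIV"
  shows "integral UNIV (\<lambda>Y. k (Y + a)) = integral UNIV k"
  using integral_unique[OF integral_affine[OF assms, of 1 a]] by simp

lemma integral_reflect:
  fixes k :: "'y::euclidean_space \<Rightarrow> 'b::banach"
  assumes "k integrable_on UNIV"
  shows "integral UNIV (\<lambda>Y. k (a - Y)) = integral UNIV k"
  using integral_unique[OF integral_affine[OF assms, of "-1" a]] by (simp add: algebra_simps)

text \<open>Fubini holds for continuous functions on boxes. The errors made by cutting the inner and
  the outer integral to boxes are bounded by tails of the integral of the weight, so the formula
  survives the limit.\<close>

lemma
  fixes k :: "'p::euclidean_space \<times> 'q::euclidean_space \<Rightarrow> 'b::banach"
  assumes c: "continuous_on UNIV k" and b: "\<And>x y. norm (k (x, y)) \<le> C * (wt x * wt y)"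
  shows fubini_integrable: "k integrable_on UNIV"
    and fubini: "integral UNIV k = integral UNIV (\<lambda>x. integral UNIV (\<lambda>y. k (x, y)))"
    and fubini_dec: "dec (\<lambda>x. integral UNIV (\<lambda>y. k (x, y)))"
    and fubini_inner_dec: "dec (\<lambda>y. k (x, y))"
proof -
  let ?W = "\<lambda>(x::'p, y::'q). wt x * wt y"
  have "integrable (lborel \<Otimes>\<^sub>M lborel) ?W"
  proof (rule lborel_pair.Fubini_integrable)
    have "continuous_on UNIV ?W" by (auto simp: split_beta intro!: continuous_intros)
    then show "?W \<in> borel_measurable (lborel \<Otimes>\<^sub>M lborel)"
      by (simp add: lborel_prod borel_measurable_continuous_onI)
  qed (auto simp: integrable_wt)
  then have W: "?W integrable_on UNIV" by (intro integrable_on_lborel) (simp add: lborel_prod)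
  show ki: "k integrable_on UNIV"
    by (rule integrable_on_dominated[OF c, of "\<lambda>p. C * ?W p"])
       (use b integrable_cmul[OF W, of C] in \<open>auto simp: split_beta\<close>)
  have cx: "continuous_on UNIV (\<lambda>y. k (x, y))" for x
    by (intro continuous_on_compose2[OF c] continuous_intros) auto
  have C0: "C \<ge> 0"
    using order_trans[OF norm_ge_zero b[of 0 0]] mult_neg_pos[of C "wt (0::'p) * wt (0::'q)"]
    by (force simp: not_le)
  have bx: "norm (k (x, y)) \<le> (C * wt x) * wt y" for x y using b by (simp add: mult.assoc)
  show dx: "dec (\<lambda>y. k (x, y))" for x by (rule decI[OF cx bx])
  define K where "K = (\<lambda>x. integral UNIV (\<lambda>y. k (x, y)))"
  define w where "w = integral UNIV (wt :: 'q \<Rightarrow> real)"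
  have Kb: "norm (K x) \<le> (C * w) * wt x" for x
    using norm_integral_le[OF dx bx, of x] by (simp add: K_def w_def mult_ac)
  have Kc: "continuous_on UNIV K"
    unfolding K_def
  proof (rule continuous_on_integral)
    show "continuous_on (UNIV \<times> UNIV) (\<lambda>(x, y). k (x, y))" using c by simp
    show "norm (k (x, y)) \<le> C * wt y" for x y
      using b[of x y] mult_left_mono[OF mult_right_mono[OF wt_le_1[of x], of "wt y"] C0] by simp
  qed
  show dK: "dec K" by (rule decI[OF Kc Kb])
  let ?p = "\<lambda>n. cbox (- real n *\<^sub>R One) (real n *\<^sub>R One :: 'p)"
  let ?q = "\<lambda>n. cbox (- real n *\<^sub>R One) (real n *\<^sub>R One :: 'q)"
  let ?pq = "\<lambda>n. cbox (- real n *\<^sub>R One :: 'p, - real n *\<^sub>R One :: 'q) (real n *\<^sub>R One, real n *\<^sub>R One)"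
  have 1: "(\<lambda>n. integral (?pq n) k) \<longlonglongrightarrow> integral UNIV k"
  proof (rule tendsto_integral_boxes[OF ki])
    fix n
    show "ball 0 (real n) \<subseteq> ?pq n"
    proof
      fix z :: "'p \<times> 'q" assume "z \<in> ball 0 (real n)"
      then have "fst z \<in> ball 0 (real n)" "snd z \<in> ball 0 (real n)"
        using norm_fst_le[of "fst z" "snd z"] norm_snd_le[of "snd z" "fst z"] by auto
      then show "z \<in> ?pq n"
        using ball_subset_One_box[of "real n", where 'y='p] ball_subset_One_box[of "real n", where 'y='q]
        by (cases z) auto
    qed
  qed
  \<comment> \<open>\<open>\<rho> n\<close> and \<open>\<sigma> n\<close> are the integrals of the
    weight outside the n-th box in the inner and in the outer variable; they control the two
    truncation errors.\<close>
  define \<rho> where "\<rho> = (\<lambda>n. w - integral (?q n) wt)"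
  define \<sigma> where "\<sigma> = (\<lambda>n. integral UNIV (wt :: 'p \<Rightarrow> real) - integral (?p n) wt)"
  have "(\<lambda>n. w - integral (?q n) wt) \<longlonglongrightarrow> w - w" unfolding w_def
    by (intro tendsto_diff tendsto_const tendsto_integral_boxes ball_subset_One_box)
       (use wt_integrable_on[of 1] in simp)
  then have r0: "\<rho> \<longlonglongrightarrow> 0" by (simp add: \<rho>_def)
  have "(\<lambda>n. integral UNIV (wt :: 'p \<Rightarrow> real) - integral (?p n) wt)
      \<longlonglongrightarrow> integral UNIV (wt :: 'p \<Rightarrow> real) - integral UNIV (wt :: 'p \<Rightarrow> real)"
    by (intro tendsto_diff tendsto_const tendsto_integral_boxes ball_subset_One_box)
       (use wt_integrable_on[of 1] in simp)
  then have s0: "\<sigma> \<longlonglongrightarrow> 0" by (simp add: \<sigma>_def)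
  have sub: "f integrable_on cbox u v" if "f integrable_on UNIV" for u v :: "'c::euclidean_space" and f :: "'c \<Rightarrow> real"
    using integrable_on_subcbox[OF that] by simp
  have err: "norm (integral (?pq n) k - integral UNIV K) \<le> \<rho> n * (C * integral UNIV (wt :: 'p \<Rightarrow> real)) + C * w * \<sigma> n" for n
  proof -
    have pq: "integral (?pq n) k = integral (?p n) (\<lambda>x. integral (?q n) (\<lambda>y. k (x, y)))"
      by (rule integral_prod_continuous) (use c continuous_on_subset in blast)
    have c1: "continuous_on (?p n) (\<lambda>x. integral (?q n) (\<lambda>y. k (x, y)))"
      by (rule integral_continuous_on_param) (use c continuous_on_subset in \<open>auto simp: split_beta'\<close>)
    have c2: "continuous_on (?p n) K" using Kc continuous_on_subset by blast
    have i1: "(\<lambda>x. integral (?q n) (\<lambda>y. k (x, y))) integrable_on ?p n" and i2: "K integrable_on ?p n"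
      by (intro integrable_continuous c1 c2)+
    have wp: "wt integrable_on ?p n" by (rule sub) (use wt_integrable_on[of 1] in simp)
    have inner: "norm (integral (?q n) (\<lambda>y. k (x, y)) - K x) \<le> (C * \<rho> n) * wt x" for x
    proof -
      have "norm (K x - integral (?q n) (\<lambda>y. k (x, y)))
          \<le> integral UNIV (\<lambda>y::'q. (C * wt x) * wt y) - integral (?q n) (\<lambda>y. (C * wt x) * wt y)"
        unfolding K_def
      proof (rule integral_diff_le[OF subset_UNIV _ dec_integrable[OF dx] _ wt_integrable_on])
        show "(\<lambda>y. k (x, y)) integrable_on ?q n"
          by (rule integrable_continuous) (use cx continuous_on_subset in blast)
        show "(\<lambda>y. C * wt x * wt y) integrable_on ?q n" by (intro sub wt_integrable_on)
      qed (rule bx)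
      then show ?thesis by (simp add: \<rho>_def w_def norm_minus_commute algebra_simps)
    qed
    have \<rho>0: "C * \<rho> n \<ge> 0"
      using order_trans[OF norm_ge_zero inner[of 0]] mult_neg_pos[of "C * \<rho> n" "wt (0::'p)"]
      by (force simp: not_le)
    have "norm (integral (?p n) (\<lambda>x. integral (?q n) (\<lambda>y. k (x, y))) - integral (?p n) K)
        \<le> integral (?p n) (\<lambda>x. (C * \<rho> n) * wt x)"
      unfolding integral_diff[OF i1 i2, symmetric]
      by (rule integral_norm_bound_integral[OF integrable_diff[OF i1 i2] _ inner])
         (intro sub wt_integrable_on)
    also have "\<dots> = (C * \<rho> n) * integral (?p n) wt" by simp
    also have "\<dots> \<le> (C * \<rho> n) * integral UNIV (wt :: 'p \<Rightarrow> real)"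
      by (intro mult_left_mono \<rho>0 integral_subset_le) (use wp wt_integrable_on[of 1] in auto)
    finally have 2: "norm (integral (?pq n) k - integral (?p n) K) \<le> (C * \<rho> n) * integral UNIV (wt :: 'p \<Rightarrow> real)"
      unfolding pq .
    have "norm (integral UNIV K - integral (?p n) K)
        \<le> integral UNIV (\<lambda>x::'p. (C * w) * wt x) - integral (?p n) (\<lambda>x. (C * w) * wt x)"
      by (rule integral_diff_le) (use dec_integrable[OF dK] i2 Kb in \<open>auto intro!: wt_integrable_on sub\<close>)
    then have 3: "norm (integral (?p n) K - integral UNIV K) \<le> C * w * \<sigma> n"
      by (simp add: \<sigma>_def norm_minus_commute algebra_simps)
    have "norm (integral (?pq n) k - integral UNIV K) \<le> norm (integral (?pq n) k - integral (?p n) K)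
        + norm (integral (?p n) K - integral UNIV K)"
      using norm_triangle_ineq[of "integral (?pq n) k - integral (?p n) K" "integral (?p n) K - integral UNIV K"]
      by (simp only: diff_add_eq_diff_diff_swap[symmetric] add_diff_eq diff_add_cancel)
    then show ?thesis using 2 3 by (simp add: mult_ac)
  qed
  have e0: "(\<lambda>n. \<rho> n * (C * integral UNIV (wt :: 'p \<Rightarrow> real)) + C * w * \<sigma> n) \<longlonglongrightarrow> 0"
    using r0 s0 by (auto intro!: tendsto_eq_intros)
  have "(\<lambda>n. integral (?pq n) k - integral UNIV K) \<longlonglongrightarrow> 0"
    by (rule Lim_null_comparison[OF _ e0]) (intro always_eventually allI err)
  then have "(\<lambda>n. integral (?pq n) k) \<longlonglongrightarrow> integral UNIV K" by (rule LIM_zero_cancel)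
  then show "integral UNIV k = integral UNIV K" using 1 LIMSEQ_unique by blast
qed

lemma fubini_swap:
  fixes k :: "'p::euclidean_space \<Rightarrow> 'q::euclidean_space \<Rightarrow> 'b::banach"
  assumes c: "continuous_on UNIV (\<lambda>(x, y). k x y)" and b: "\<And>x y. norm (k x y) \<le> C * (wt x * wt y)"
  shows "integral UNIV (\<lambda>x. integral UNIV (k x)) = integral UNIV (\<lambda>y. integral UNIV (\<lambda>x. k x y))"
proof -
  have c': "continuous_on UNIV (\<lambda>(y, x). k x y)"
    using continuous_on_compose2[OF c continuous_on_swap, of UNIV] by (simp add: prod.swap_def split_beta)
  have b': "norm ((\<lambda>(y, x). k x y) (y, x)) \<le> C * (wt y * wt x)" for x y
    using b[of x y] by (simp add: mult.commute)
  have p: "(\<lambda>(x, y). k x y) integrable_on UNIV" by (rule fubini_integrable[OF c]) (use b in simp)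
  have "integral UNIV (\<lambda>x. integral UNIV (k x)) = integral UNIV (\<lambda>(x, y). k x y)"
    by (subst fubini[OF c, of C]) (use b in auto)
  also have "\<dots> = integral UNIV (\<lambda>(y, x). k x y)"
  \<comment> \<open>Exchanging the coordinates leaves the integral over each box unchanged, and both
    integrals over the whole space are limits of these.\<close>
  proof (rule LIMSEQ_unique)
    let ?B = "\<lambda>n. cbox (- real n *\<^sub>R One) (real n *\<^sub>R One)"
    let ?p = "\<lambda>n. cbox (- real n *\<^sub>R One :: 'p, - real n *\<^sub>R One :: 'q) (real n *\<^sub>R One, real n *\<^sub>R One)"
    let ?q = "\<lambda>n. cbox (- real n *\<^sub>R One :: 'q, - real n *\<^sub>R One :: 'p) (real n *\<^sub>R One, real n *\<^sub>R One)"
    \<comment> \<open>\<open>dummy\<close> introduces the two type parameters with their class, so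
      that one fact serves both orders of the factors.\<close>
    have sb: "ball 0 (real n) \<subseteq> cbox (- real n *\<^sub>R One :: 'c, - real n *\<^sub>R One :: 'd) (real n *\<^sub>R One, real n *\<^sub>R One)"
      for n and dummy :: "'c::euclidean_space \<times> 'd::euclidean_space"
    proof
      fix z :: "'c \<times> 'd" assume "z \<in> ball 0 (real n)"
      then have "fst z \<in> ball 0 (real n)" "snd z \<in> ball 0 (real n)"
        using norm_fst_le[of "fst z" "snd z"] norm_snd_le[of "snd z" "fst z"] by auto
      then show "z \<in> cbox (- real n *\<^sub>R One :: 'c, - real n *\<^sub>R One :: 'd) (real n *\<^sub>R One, real n *\<^sub>R One)"
        using ball_subset_One_box[of "real n", where 'y='c] ball_subset_One_box[of "real n", where 'y='d]
        by (cases z) auto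
    qed
    show "(\<lambda>n. integral (?p n) (\<lambda>(x, y). k x y)) \<longlonglongrightarrow> integral UNIV (\<lambda>(x, y). k x y)"
      by (rule tendsto_integral_boxes[OF p sb])
    have "integral (?p n) (\<lambda>(x, y). k x y) = integral (?q n) (\<lambda>(y, x). k x y)" for n
      by (rule integral_swap_2dim) (use c continuous_on_subset in blast)
    moreover have "(\<lambda>n. integral (?q n) (\<lambda>(y, x). k x y)) \<longlonglongrightarrow> integral UNIV (\<lambda>(y, x). k x y)"
      by (rule tendsto_integral_boxes[OF fubini_integrable[OF c' b'] sb])
    ultimately show "(\<lambda>n. integral (?p n) (\<lambda>(x, y). k x y)) \<longlonglongrightarrow> integral UNIV (\<lambda>(y, x). k x y)"
      by simp
  qed
  also have "\<dots> = integral UNIV (\<lambda>y. integral UNIV (\<lambda>x. k x y))"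
    by (subst fubini[OF c' b']) simp
  finally show ?thesis .
qed

subsection \<open>Directional derivatives\<close>

text \<open>A relation instead of an operator: it asserts differentiability at every point together
  with the value, so calculus rules need no side conditions.\<close>

definition has_dd :: "'y::real_normed_vector \<Rightarrow> ('y \<Rightarrow> 'b::real_normed_vector) \<Rightarrow> ('y \<Rightarrow> 'b) \<Rightarrow> bool" where
  "has_dd b f g \<longleftrightarrow> (\<forall>X. ((\<lambda>t. f (X + t *\<^sub>R b)) has_vector_derivative g X) (at 0))"

lemma has_vector_derivative_shift:
  "((\<lambda>s. f (s - t)) has_vector_derivative D) (at t) \<longleftrightarrow> (f has_vector_derivative D) (at (0::real))"
  unfolding has_vector_derivative_at_iff by simp

lemma has_dd_at:
  assumes "has_dd b f g"
  shows "((\<lambda>s. f (X + s *\<^sub>R b)) has_vector_derivative g (X + t *\<^sub>R b)) (at t)"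
proof -
  have "((\<lambda>s. f ((X + t *\<^sub>R b) + (s - t) *\<^sub>R b)) has_vector_derivative g (X + t *\<^sub>R b)) (at t)"
    using assms has_vector_derivative_shift[of "\<lambda>s. f ((X + t *\<^sub>R b) + s *\<^sub>R b)" t] by (simp add: has_dd_def)
  then show ?thesis by (simp add: algebra_simps)
qed

lemma has_dd_partial: "has_dd b f g \<Longrightarrow> partial b f = g"
  unfolding has_dd_def partial_def by (auto intro: vector_derivative_at)

lemma has_dd_unique: "has_dd b f g \<Longrightarrow> has_dd b f h \<Longrightarrow> g = h"
  for f :: "'y::euclidean_space \<Rightarrow> 'b::real_normed_vector"
  using has_dd_partial[of b f g] has_dd_partial[of b f h] by simp

lemma has_dd_add: "has_dd b f g \<Longrightarrow> has_dd b f' g' \<Longrightarrow> has_dd b (\<lambda>X. f X + f' X) (\<lambda>X. g X + g' X)"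
  unfolding has_dd_def by (auto intro: has_vector_derivative_add)

lemma has_dd_const: "has_dd b (\<lambda>X. c) (\<lambda>X. 0)"
  by (simp add: has_dd_def)

lemma has_dd_linear:
  assumes "linear l" shows "has_dd b l (\<lambda>X. l b)"
  unfolding has_dd_def has_vector_derivative_at_iff
  by (intro allI, rule tendsto_eventually)
     (simp add: eventually_at_filter linear_add[OF assms] linear_scale[OF assms])

lemma (in bounded_linear) has_dd: "has_dd b g g' \<Longrightarrow> has_dd b (\<lambda>X. f (g X)) (\<lambda>X. f (g' X))"
  unfolding has_dd_def by (intro allI has_vector_derivative) (rule spec)

lemma (in bounded_bilinear) has_dd:
  assumes "has_dd b f f'" "has_dd b g g'"
  shows "has_dd b (\<lambda>X. prod (f X) (g X)) (\<lambda>X. prod (f X) (g' X) + prod (f' X) (g X))"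
  unfolding has_dd_def
proof
  fix X
  show "((\<lambda>t. prod (f (X + t *\<^sub>R b)) (g (X + t *\<^sub>R b))) has_vector_derivative
      prod (f X) (g' X) + prod (f' X) (g X)) (at 0)"
    using has_vector_derivative[of "\<lambda>t. f (X + t *\<^sub>R b)" "f' X" 0 UNIV "\<lambda>t. g (X + t *\<^sub>R b)" "g' X"] assms
    by (simp add: has_dd_def)
qed

lemma has_dd_cis: "has_dd b f f' \<Longrightarrow> has_dd b (\<lambda>X. cis (f X)) (\<lambda>X. \<i> * of_real (f' X) * cis (f X))"
  unfolding has_dd_def
proof
  fix X assume f: "\<forall>X. ((\<lambda>t. f (X + t *\<^sub>R b)) has_vector_derivative f' X) (at 0)"
  have 1: "((\<lambda>t. f (X + t *\<^sub>R b)) has_vector_derivative f' X) (at 0)" using f by blast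
  have 2: "(cis has_vector_derivative \<i> * cis t) (at t)" for t
    using has_derivative_cis[OF has_derivative_ident, of t UNIV]
    by (simp add: has_vector_derivative_def scaleR_conv_of_real mult_ac)
  show "((\<lambda>t. cis (f (X + t *\<^sub>R b))) has_vector_derivative \<i> * of_real (f' X) * cis (f X)) (at 0)"
    using vector_diff_chain_at[OF 1, of cis "\<i> * cis (f X)"] 2
    by (simp add: o_def scaleR_conv_of_real mult_ac)
qed

text \<open>By translation invariance the integral of \<open>k (Y + t b)\<close> does not depend on
  t; its derivative at t = 0, computed under the integral, is the integral of \<open>k'\<close>. All
  integrations by parts reduce to this.\<close>

lemma integral_has_dd_0:
  fixes k :: "'y::euclidean_space \<Rightarrow> 'b::banach"
  assumes d: "has_dd b k k'" and k: "dec k" and k': "dec k'"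
  shows "integral UNIV k' = 0"
proof -
  obtain C where C: "\<And>Y. norm (k' Y) \<le> C * wt Y" using k' by (auto simp: dec_def)
  obtain D where D: "\<And>Y. norm (k Y) \<le> D * wt Y" using k by (auto simp: dec_def)
  have nn: "0 \<le> E" if "\<And>Y::'y. norm (l Y) \<le> E * wt Y" for E and l :: "'y \<Rightarrow> 'b"
    using order_trans[OF norm_ge_zero that[of 0]] mult_neg_pos[of E "wt (0::'y)"] by (force simp: not_le)
  have sh: "norm (l (Y + t *\<^sub>R b)) \<le> (E * (1 + norm (t *\<^sub>R b)) ^ (2 * DIM('y))) * wt Y"
    if "\<And>Y::'y. norm (l Y) \<le> E * wt Y" for Y t E and l :: "'y \<Rightarrow> 'b"
    using order_trans[OF that[of "Y + t *\<^sub>R b"] mult_left_mono[OF wt_shift[of Y "t *\<^sub>R b"] nn[OF that]]]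
    by (simp only: mult.assoc)
  have "((\<lambda>t. integral UNIV (\<lambda>Y. k (Y + t *\<^sub>R b))) has_vector_derivative
      integral UNIV (\<lambda>Y. k' (Y + 0 *\<^sub>R b))) (at 0)"
  proof (rule has_vector_derivative_integral)
    show "((\<lambda>s. k (Y + s *\<^sub>R b)) has_vector_derivative k' (Y + t *\<^sub>R b)) (at t)" for t Y
      by (rule has_dd_at[OF d])
    show "norm (k' (Y + t *\<^sub>R b)) \<le> (C * (1 + norm b) ^ (2 * DIM('y))) * wt Y" if "\<bar>t\<bar> \<le> 1" for t Y
    proof -
      have "\<bar>t\<bar> * norm b \<le> 1 * norm b" by (intro mult_right_mono that) auto
      then have "(1 + norm (t *\<^sub>R b)) ^ (2 * DIM('y)) \<le> (1 + norm b) ^ (2 * DIM('y))"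
        by (intro power_mono) auto
      then have "C * (1 + norm (t *\<^sub>R b)) ^ (2 * DIM('y)) * wt Y \<le> C * (1 + norm b) ^ (2 * DIM('y)) * wt Y"
        by (intro mult_right_mono mult_left_mono nn[OF C]) auto
      then show ?thesis using sh[OF C, of Y t] by linarith
    qed
    show "dec (\<lambda>Y. k (Y + t *\<^sub>R b))" for t
      by (rule decI[OF _ sh[OF D]])
         (rule continuous_on_compose2[OF dec_continuous[OF k]], auto intro!: continuous_intros)
  qed (use dec_continuous[OF k'] in simp)
  moreover have "integral UNIV (\<lambda>Y. k (Y + t *\<^sub>R b)) = integral UNIV k" for t
    by (rule integral_shift[OF dec_integrable[OF k]])
  ultimately have "((\<lambda>t::real. integral UNIV k) has_vector_derivative integral UNIV k') (at 0)" by simp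
  then show ?thesis using has_vector_derivative_const[of "integral UNIV k" "at 0"]
    by (rule vector_derivative_unique_at)
qed

section \<open>Coinductive jets\<close>

text \<open>Infinite differentiability with growth conditions: \<open>R F F'\<close> for \<open>R \<in> D\<close> says that \<open>F'\<close> is a
  derivative of \<open>F\<close>, and \<open>G\<close> is imposed on all iterated derivatives. A class of functions whose
  derivatives are sums of members of the class satisfies it as soon as its members satisfy \<open>G\<close>.\<close>

coinductive jet :: "('f \<Rightarrow> 'f \<Rightarrow> bool) set \<Rightarrow> ('f \<Rightarrow> bool) \<Rightarrow> 'f \<Rightarrow> bool" for D G where
  jetI: "G F \<Longrightarrow> \<forall>R\<in>D. \<exists>F'. R F F' \<and> jet D G F' \<Longrightarrow> jet D G F"

inductive addspan :: "'f::plus set \<Rightarrow> 'f \<Rightarrow> bool" for C where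
  addspan_base: "F \<in> C \<Longrightarrow> addspan C F"
| addspan_add: "addspan C F \<Longrightarrow> addspan C F' \<Longrightarrow> addspan C (F + F')"

text \<open>Coinduction up to sums. Since \<open>G\<close> and the derivative relations are
  additive, the sums of members of \<open>C\<close> form a class closed under derivatives in which
  \<open>G\<close> holds, and such a class consists of jets.\<close>

lemma jet_upto:
  assumes G: "\<And>F F'. G F \<Longrightarrow> G F' \<Longrightarrow> G (F + F')"
    and R: "\<And>R F F' H H'. R \<in> D \<Longrightarrow> R F H \<Longrightarrow> R F' H' \<Longrightarrow> R (F + F') (H + H')"
    and CG: "\<And>F. F \<in> C \<Longrightarrow> G F"
    and CR: "\<And>F R. F \<in> C \<Longrightarrow> R \<in> D \<Longrightarrow> \<exists>H. R F H \<and> addspan C H"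
    and F: "addspan C F"
  shows "jet D G F"
  using F
proof (coinduction arbitrary: F)
  case jet
  have "G F" using jet by (induction rule: addspan.induct) (simp_all add: G CG)
  moreover have "\<exists>H. R F H \<and> addspan C H" if r: "R \<in> D" for R
    using jet
  proof (induction rule: addspan.induct)
    case (addspan_base F)
    then show ?case using CR r by blast
  next
    case (addspan_add F F')
    then show ?case using R[OF r] addspan.addspan_add by blast
  qed
  ultimately show ?case by blast
qed

lemma jet_add:
  assumes "\<And>F F'. G F \<Longrightarrow> G F' \<Longrightarrow> G (F + F')"
    and "\<And>R F F' H H'. R \<in> D \<Longrightarrow> R F H \<Longrightarrow> R F' H' \<Longrightarrow> R (F + F') (H + H')"
    and "jet D G F" "jet D G F'"
  shows "jet D G (F + F')"
proof (rule jet_upto[where C = "Collect (jet D G)"])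
  fix F R assume "F \<in> Collect (jet D G)" "R \<in> D"
  then show "\<exists>H. R F H \<and> addspan (Collect (jet D G)) H"
    unfolding mem_Collect_eq by (elim jet.cases) (blast intro: addspan_base)
next
  fix F assume "F \<in> Collect (jet D G)"
  then show "G F" unfolding mem_Collect_eq by (elim jet.cases) simp
next
  show "addspan (Collect (jet D G)) (F + F')"
    using assms(3,4) by (intro addspan_add addspan_base) simp_all
qed (fact assms(1,2))+

section \<open>Cones of bounds and rapidly decreasing families\<close>

definition cone :: "('p \<Rightarrow> real) set \<Rightarrow> bool" where
  "cone P \<longleftrightarrow> (\<forall>p\<in>P. \<forall>q\<in>P. (\<lambda>\<theta>. p \<theta> + q \<theta>) \<in> P) \<and> (\<forall>p\<in>P. \<forall>c\<ge>0. (\<lambda>\<theta>. c * p \<theta>) \<in> P)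
    \<and> (\<lambda>\<theta>. 0) \<in> P"

lemma cone_UNIV [simp]: "cone UNIV" by (simp add: cone_def)

lemma cone_add: "cone P \<Longrightarrow> p \<in> P \<Longrightarrow> q \<in> P \<Longrightarrow> (\<lambda>\<theta>. p \<theta> + q \<theta>) \<in> P"
  and cone_scale: "cone P \<Longrightarrow> p \<in> P \<Longrightarrow> c \<ge> 0 \<Longrightarrow> (\<lambda>\<theta>. c * p \<theta>) \<in> P"
  by (auto simp: cone_def)

lemma cone_sum:
  assumes "cone P" "\<And>a. a \<in> A \<Longrightarrow> p a \<in> P"
  shows "(\<lambda>\<theta>. \<Sum>a\<in>A. p a \<theta>) \<in> P"
  using assms(2)
proof (induction A rule: infinite_finite_induct)
  case (insert a A)
  then show ?case using cone_add[OF assms(1), of "p a" "\<lambda>\<theta>. \<Sum>a\<in>A. p a \<theta>"] by simp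
qed (use assms(1) in \<open>auto simp: cone_def\<close>)

text \<open>Families \<open>F \<theta>\<close>, \<open>\<theta> \<in> Q\<close>, of rapidly decreasing functions. The bounds are taken from a cone \<open>P\<close> of
  functions of the parameter: with \<open>Q\<close> the Schwartz space itself and \<open>P\<close> the functionals bounded by
  finitely many seminorms, they express the continuity of \<open>\<theta> \<mapsto> F \<theta>\<close>.\<close>

definition rapid :: "('p \<Rightarrow> real) set \<Rightarrow> 'p set \<Rightarrow> ('p \<Rightarrow> 'x::euclidean_space \<Rightarrow> 'a::real_normed_vector) \<Rightarrow> bool" where
  "rapid P Q F \<longleftrightarrow> (\<forall>\<theta>\<in>Q. continuous_on UNIV (F \<theta>))
     \<and> (\<forall>N. \<exists>p\<in>P. \<forall>\<theta>\<in>Q. \<forall>X. (1 + norm X) ^ N * norm (F \<theta> X) \<le> p \<theta>)"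

lemma rapid_add:
  assumes "cone P" "rapid P Q F" "rapid P Q F'"
  shows "rapid P Q (F + F')"
  unfolding rapid_def
proof (intro conjI allI ballI)
  fix N
  obtain p q where p: "p \<in> P" "\<And>\<theta> X. \<theta> \<in> Q \<Longrightarrow> (1 + norm X) ^ N * norm (F \<theta> X) \<le> p \<theta>"
    and q: "q \<in> P" "\<And>\<theta> X. \<theta> \<in> Q \<Longrightarrow> (1 + norm X) ^ N * norm (F' \<theta> X) \<le> q \<theta>"
    using assms(2,3) unfolding rapid_def by meson
  have "(1 + norm X) ^ N * norm ((F + F') \<theta> X) \<le> p \<theta> + q \<theta>" if "\<theta> \<in> Q" for \<theta> X
  proof -
    have "(1 + norm X) ^ N * norm (F \<theta> X + F' \<theta> X) \<le> (1 + norm X) ^ N * (norm (F \<theta> X) + norm (F' \<theta> X))"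
      by (intro mult_left_mono norm_triangle_ineq) auto
    then show ?thesis using p(2)[OF that, of X] q(2)[OF that, of X] by (simp add: distrib_left)
  qed
  then show "\<exists>p\<in>P. \<forall>\<theta>\<in>Q. \<forall>X. (1 + norm X) ^ N * norm ((F + F') \<theta> X) \<le> p \<theta>"
    by (intro bexI[of _ "\<lambda>\<theta>. p \<theta> + q \<theta>"] ballI allI cone_add[OF assms(1) p(1) q(1)])
next
  fix \<theta> assume "\<theta> \<in> Q"
  then show "continuous_on UNIV ((F + F') \<theta>)"
    using assms(2,3) by (auto simp: rapid_def plus_fun_def intro!: continuous_intros)
qed

lemma rapid_bounded:
  assumes "cone P" "rapid P Q F" "\<And>\<theta>. \<theta> \<in> Q \<Longrightarrow> continuous_on UNIV (H \<theta>)"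
    and "\<And>\<theta> X. \<theta> \<in> Q \<Longrightarrow> norm (H \<theta> X) \<le> K * (1 + norm X) ^ M * norm (F \<theta> X)" "K \<ge> 0"
  shows "rapid P Q H"
  unfolding rapid_def
proof (intro conjI allI ballI assms(3))
  fix N
  obtain p where p: "p \<in> P" "\<And>\<theta> X. \<theta> \<in> Q \<Longrightarrow> (1 + norm X) ^ (N + M) * norm (F \<theta> X) \<le> p \<theta>"
    using assms(2) unfolding rapid_def by meson
  have "(1 + norm X) ^ N * norm (H \<theta> X) \<le> K * p \<theta>" if "\<theta> \<in> Q" for \<theta> X
  proof -
    have "(1 + norm X) ^ N * norm (H \<theta> X) \<le> (1 + norm X) ^ N * (K * (1 + norm X) ^ M * norm (F \<theta> X))"
      by (intro mult_left_mono assms that) auto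
    also have "\<dots> = K * ((1 + norm X) ^ (N + M) * norm (F \<theta> X))" by (simp add: power_add)
    also have "\<dots> \<le> K * p \<theta>" by (intro mult_left_mono p that assms)
    finally show ?thesis .
  qed
  then show "\<exists>p\<in>P. \<forall>\<theta>\<in>Q. \<forall>X. (1 + norm X) ^ N * norm (H \<theta> X) \<le> p \<theta>"
    by (intro bexI[of _ "\<lambda>\<theta>. K * p \<theta>"] ballI allI cone_scale[OF assms(1) p(1) assms(5)])
qed

lemma rapid_continuous: "rapid P Q F \<Longrightarrow> \<theta> \<in> Q \<Longrightarrow> continuous_on UNIV (F \<theta>)"
  by (simp add: rapid_def)

lemma rapid_dec:
  assumes "cone P" "rapid P Q F"
  shows "\<exists>p\<in>P. \<forall>\<theta>\<in>Q. dec (F \<theta>) \<and> (\<forall>X. norm (F \<theta> X) \<le> p \<theta> * wt X)"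
proof -
  obtain p where p: "p \<in> P" "\<And>\<theta> X. \<theta> \<in> Q \<Longrightarrow> (1 + norm X) ^ (2 * DIM('b)) * norm (F \<theta> X) \<le> p \<theta>"
    using assms(2) unfolding rapid_def by meson
  have "norm (F \<theta> X) \<le> p \<theta> * wt X" if "\<theta> \<in> Q" for \<theta> X by (rule wt_rapid[OF p(2)[OF that]])
  then show ?thesis using p(1) rapid_continuous[OF assms(2)] unfolding dec_def by blast
qed

definition ddX :: "'p set \<Rightarrow> 'x \<Rightarrow> ('p \<Rightarrow> 'x::euclidean_space \<Rightarrow> 'a::real_normed_vector) \<Rightarrow> ('p \<Rightarrow> 'x \<Rightarrow> 'a) \<Rightarrow> bool" where
  "ddX Q b F H \<longleftrightarrow> (\<forall>\<theta>\<in>Q. has_dd b (F \<theta>) (H \<theta>))"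

section \<open>Derivatives along the action and Schwartz families\<close>

context caction
begin

text \<open>The generator of the one-parameter group in direction b: f lies in its domain and is
  mapped to d.\<close>

definition hasA :: "'x \<Rightarrow> 'a \<Rightarrow> 'a \<Rightarrow> bool" where
  "hasA b f d \<longleftrightarrow> ((\<lambda>t. \<Theta> (t *\<^sub>R b) f) has_vector_derivative d) (at 0)"

lemma hasA_add: "hasA b f d \<Longrightarrow> hasA b g e \<Longrightarrow> hasA b (f + g) (d + e)"
  unfolding hasA_def act_add by (rule has_vector_derivative_add)

lemma hasA_map:
  assumes "bounded_linear L" "\<And>Y f. \<Theta> Y (L f) = L (\<Theta> Y f)" "hasA b f d"
  shows "hasA b (L f) (L d)"
  using bounded_linear.has_vector_derivative[OF assms(1) assms(3)[unfolded hasA_def]]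
  by (simp add: hasA_def assms(2))

lemma hasA_act: "hasA b f d \<Longrightarrow> hasA b (\<Theta> Y f) (\<Theta> Y d)"
  by (rule hasA_map[OF bounded_linear_act]) (simp_all add: act_act add.commute)

lemma hasA_mult: "hasA b f d \<Longrightarrow> hasA b g e \<Longrightarrow> hasA b (f * g) (f * e + d * g)"
  unfolding hasA_def act_mult by (drule (1) has_vector_derivative_mult) simp

lemma hasA_dd: "hasA b f d \<Longrightarrow> has_dd b (\<lambda>S. \<Theta> S f) (\<lambda>S. \<Theta> S d)"
  unfolding has_dd_def hasA_def act_act[symmetric]
  by (intro allI bounded_linear.has_vector_derivative[OF bounded_linear_act])

lemma hasA_scale:
  assumes "hasA b f d"
  shows "hasA (s *\<^sub>R b) f (s *\<^sub>R d)"
proof -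
  have 1: "((\<lambda>t. t * s) has_vector_derivative s) (at 0)"
    using has_vector_derivative_mult_left[OF has_vector_derivative_id, of s "at 0"] by simp
  have "((\<lambda>t. \<Theta> (t *\<^sub>R b) f) has_vector_derivative d) (at (0 * s))" using assms by (simp add: hasA_def)
  from vector_diff_chain_at[OF 1 this] show ?thesis by (simp add: hasA_def o_def)
qed

text \<open>A product rule: the increment is that of \<open>\<Theta> (t b)\<close> on the fixed
  vector \<open>g 0\<close>, plus \<open>\<Theta> (t b)\<close> applied to the increment of
  \<open>g\<close>. Joint continuity of the action gives the limit of the second part.\<close>

lemma has_vector_derivative_act:
  assumes "hasA b (g 0) d" "(g has_vector_derivative g') (at 0)"
  shows "((\<lambda>t. \<Theta> (t *\<^sub>R b) (g t)) has_vector_derivative (d + g')) (at 0)"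
  unfolding has_vector_derivative_at_iff
proof -
  have t: "((\<lambda>t. t *\<^sub>R b) \<longlongrightarrow> 0) (at 0)" by (auto intro!: tendsto_eq_intros)
  have 1: "((\<lambda>t. (1 / t) *\<^sub>R (\<Theta> (t *\<^sub>R b) (g 0) - g 0)) \<longlongrightarrow> d) (at 0)"
    using assms(1) unfolding hasA_def has_vector_derivative_at_iff by simp
  have "((\<lambda>t. (1 / t) *\<^sub>R (g t - g 0)) \<longlongrightarrow> g') (at 0)"
    using assms(2) unfolding has_vector_derivative_at_iff by simp
  from tendsto_act[OF t this] have 2: "((\<lambda>t. (1 / t) *\<^sub>R (\<Theta> (t *\<^sub>R b) (g t) - \<Theta> (t *\<^sub>R b) (g 0))) \<longlongrightarrow> g') (at 0)"
    by (simp add: act_scaleR act_diff)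
  have "((\<lambda>t. (1 / t) *\<^sub>R (\<Theta> (t *\<^sub>R b) (g t) - g 0)) \<longlongrightarrow> d + g') (at 0)"
    using tendsto_add[OF 1 2] by (simp add: scaleR_add_right[symmetric])
  then show "((\<lambda>t. (1 / t) *\<^sub>R (\<Theta> ((0 + t) *\<^sub>R b) (g (0 + t)) - \<Theta> (0 *\<^sub>R b) (g 0))) \<longlongrightarrow> d + g') (at 0)"
    by simp
qed

text \<open>The derivative in X of a twisted function contains a derivative along the action. This
  is why the twist preserves only classes closed under both kinds of derivatives.\<close>

lemma has_dd_act:
  assumes "\<And>X. hasA b (f X) (g X)" "has_dd b f f'"
  shows "has_dd b (\<lambda>X. \<Theta> (s *\<^sub>R X) (f X)) (\<lambda>X. \<Theta> (s *\<^sub>R X) (s *\<^sub>R g X + f' X))"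
  unfolding has_dd_def
proof
  fix X
  have "((\<lambda>t. \<Theta> (t *\<^sub>R (s *\<^sub>R b)) (f (X + t *\<^sub>R b))) has_vector_derivative s *\<^sub>R g X + f' X) (at 0)"
    using assms by (intro has_vector_derivative_act) (auto intro!: hasA_scale simp: has_dd_def)
  from bounded_linear.has_vector_derivative[OF bounded_linear_act this, of "s *\<^sub>R X"]
  show "((\<lambda>t. \<Theta> (s *\<^sub>R (X + t *\<^sub>R b)) (f (X + t *\<^sub>R b))) has_vector_derivative
      \<Theta> (s *\<^sub>R X) (s *\<^sub>R g X + f' X)) (at 0)"
    by (simp add: act_act scaleR_add_right mult.commute)
qed

definition ddA :: "'p set \<Rightarrow> 'x \<Rightarrow> ('p \<Rightarrow> 'x \<Rightarrow> 'a) \<Rightarrow> ('p \<Rightarrow> 'x \<Rightarrow> 'a) \<Rightarrow> bool" where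
  "ddA Q b F H \<longleftrightarrow> (\<forall>\<theta>\<in>Q. \<forall>X. hasA b (F \<theta> X) (H \<theta> X))"

text \<open>Derivatives in X and derivatives along the action stand on the same footing, so
  \<open>rapid\<close> can be stated with the norm of the algebra alone; bounds in the seminorms of
  the smooth vectors follow in \<open>sch_schwartz\<close>.\<close>

definition sch :: "('p \<Rightarrow> real) set \<Rightarrow> 'p set \<Rightarrow> ('p \<Rightarrow> 'x \<Rightarrow> 'a) \<Rightarrow> bool" where
  "sch P Q = jet (ddX Q ` Basis \<union> ddA Q ` Basis) (rapid P Q)"

lemma dirs_add:
  assumes "R \<in> ddX Q ` Basis \<union> ddA Q ` Basis" "R F H" "R F' H'"
  shows "R (F + F') (H + H')"
  using assms by (auto simp: ddX_def ddA_def plus_fun_def intro!: has_dd_add hasA_add)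

lemma sch_coinduct:
  assumes P: "cone P" and C: "\<And>F. F \<in> C \<Longrightarrow> rapid P Q F"
    and X: "\<And>F b. F \<in> C \<Longrightarrow> b \<in> Basis \<Longrightarrow> \<exists>H. ddX Q b F H \<and> addspan C H"
    and A: "\<And>F b. F \<in> C \<Longrightarrow> b \<in> Basis \<Longrightarrow> \<exists>H. ddA Q b F H \<and> addspan C H"
    and F: "F \<in> C"
  shows "sch P Q F"
  unfolding sch_def
proof (rule jet_upto[where C = C])
  show "addspan C F" using F by (rule addspan_base)
  fix F R assume FR: "F \<in> C" "R \<in> ddX Q ` Basis \<union> ddA Q ` Basis"
  from FR(2) show "\<exists>H. R F H \<and> addspan C H"
    by (elim UnE imageE) (simp_all only: X[OF FR(1)] A[OF FR(1)])
qed (rule rapid_add[OF P] dirs_add C; assumption)+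

lemma sch_add: "cone P \<Longrightarrow> sch P Q F \<Longrightarrow> sch P Q F' \<Longrightarrow> sch P Q (F + F')"
  unfolding sch_def by (rule jet_add) (rule rapid_add dirs_add; assumption)+

lemma sch_add': "cone P \<Longrightarrow> sch P Q F \<Longrightarrow> sch P Q F' \<Longrightarrow> sch P Q (\<lambda>\<theta> X. F \<theta> X + F' \<theta> X)"
  using sch_add[of P Q F F'] by (simp add: plus_fun_def)

lemma sch_rapid: "sch P Q F \<Longrightarrow> rapid P Q F"
  unfolding sch_def by (auto elim: jet.cases)

lemma sch_ddX: "sch P Q F \<Longrightarrow> b \<in> Basis \<Longrightarrow> \<exists>H. ddX Q b F H \<and> sch P Q H"
  unfolding sch_def by (erule jet.cases) blast

lemma sch_ddA: "sch P Q F \<Longrightarrow> b \<in> Basis \<Longrightarrow> \<exists>H. ddA Q b F H \<and> sch P Q H"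
  unfolding sch_def by (erule jet.cases) blast

lemma sch_continuous: "sch P Q F \<Longrightarrow> \<theta> \<in> Q \<Longrightarrow> continuous_on UNIV (F \<theta>)"
  by (rule rapid_continuous[OF sch_rapid])

lemma sch_map:
  assumes P: "cone P" and L: "bounded_linear L" "\<And>Y f. \<Theta> Y (L f) = L (\<Theta> Y f)" and F: "sch P Q F"
  shows "sch P Q (\<lambda>\<theta> X. L (F \<theta> X))"
proof (rule sch_coinduct[OF P, where C = "{(\<lambda>\<theta> X. L (F \<theta> X)) |F. sch P Q F}"])
  fix F and b :: 'x assume "F \<in> {(\<lambda>\<theta> X. L (F \<theta> X)) |F. sch P Q F}"
  then obtain G where F: "F = (\<lambda>\<theta> X. L (G \<theta> X))" and G: "sch P Q G" by blast
  obtain K where K: "K \<ge> 0" "\<And>f. norm (L f) \<le> norm f * K" using bounded_linear.nonneg_bounded[OF L(1)] by blast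
  show "rapid P Q F"
  proof (rule rapid_bounded[OF P sch_rapid[OF G], of _ K 0])
    show "continuous_on UNIV (F \<theta>)" if "\<theta> \<in> Q" for \<theta>
      unfolding F by (intro bounded_linear.continuous_on[OF L(1)] sch_continuous[OF G that])
  qed (use K in \<open>auto simp: F mult.commute\<close>)
  assume b: "b \<in> Basis"
  show "\<exists>H. ddX Q b F H \<and> addspan {(\<lambda>\<theta> X. L (F \<theta> X)) |F. sch P Q F} H"
  proof -
    obtain H where "ddX Q b G H" "sch P Q H" using sch_ddX[OF G b] by blast
    then show ?thesis
      by (intro exI[of _ "\<lambda>\<theta> X. L (H \<theta> X)"])
         (auto simp: F ddX_def intro!: addspan_base bounded_linear.has_dd[OF L(1)])
  qed
  show "\<exists>H. ddA Q b F H \<and> addspan {(\<lambda>\<theta> X. L (F \<theta> X)) |F. sch P Q F} H"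
  proof -
    obtain H where "ddA Q b G H" "sch P Q H" using sch_ddA[OF G b] by blast
    then show ?thesis
      by (intro exI[of _ "\<lambda>\<theta> X. L (H \<theta> X)"])
         (auto simp: F ddA_def intro!: addspan_base hasA_map[OF L])
  qed
qed (use F in auto)

lemma sch_scaleC: "cone P \<Longrightarrow> sch P Q F \<Longrightarrow> sch P Q (\<lambda>\<theta> X. a *\<^sub>C F \<theta> X)"
  by (rule sch_map) (auto simp: act_scaleC scaleC.bounded_linear_right)

lemma sch_scaleR: "cone P \<Longrightarrow> sch P Q F \<Longrightarrow> sch P Q (\<lambda>\<theta> X. r *\<^sub>R F \<theta> X)"
  by (rule sch_map) (auto simp: act_scaleR bounded_linear_scaleR_right)

lemma sch_star: "cone P \<Longrightarrow> sch P Q F \<Longrightarrow> sch P Q (\<lambda>\<theta> X. star (F \<theta> X))"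
  by (rule sch_map) (auto simp: act_star bounded_linear_star)

lemma sch_linear:
  assumes P: "cone P" and l: "linear l" and F: "sch P Q F"
  shows "sch P Q (\<lambda>\<theta> X. (l X :: real) *\<^sub>R F \<theta> X)"
proof -
  \<comment> \<open>Differentiating \<open>l X *\<^sub>R F \<theta> X\<close> in X also produces the
    constant multiple \<open>l b *\<^sub>R F \<theta> X\<close>, so the plain families must belong
    to the class as well.\<close>
  let ?C = "{(\<lambda>\<theta> X. l X *\<^sub>R F \<theta> X) |F. sch P Q F} \<union> Collect (sch P Q)"
  have bl: "bounded_linear l" using l by (rule linear_conv_bounded_linear[THEN iffD1])
  have sch: "sch P Q (\<lambda>\<theta> X. r *\<^sub>R F \<theta> X)" if "sch P Q F" for F r by (rule sch_scaleR[OF P that])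
  show ?thesis
  proof (rule sch_coinduct[OF P, where C = ?C])
    fix F and b :: 'x assume "F \<in> ?C"
    then consider (1) "sch P Q F" | (2) G where "F = (\<lambda>\<theta> X. l X *\<^sub>R G \<theta> X)" "sch P Q G" by blast
    note cs = this
    show "rapid P Q F" using cs
    proof cases
      case 2
      obtain K where K: "K \<ge> 0" "\<And>X. norm (l X) \<le> norm X * K" using bounded_linear.nonneg_bounded[OF bl] by blast
      show ?thesis
      proof (rule rapid_bounded[OF P sch_rapid[OF 2(2)], of _ K 1])
        show "continuous_on UNIV (F \<theta>)" if "\<theta> \<in> Q" for \<theta>
          unfolding 2(1) by (intro continuous_intros bounded_linear.continuous_on[OF bl] sch_continuous[OF 2(2) that])
        show "norm (F \<theta> X) \<le> K * (1 + norm X) ^ 1 * norm (G \<theta> X)" for \<theta> X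
        proof -
          have "norm (l X) \<le> K * (1 + norm X)" using K(2)[of X] K(1) by (simp add: algebra_simps)
          then show ?thesis by (simp add: 2(1) mult_right_mono)
        qed
      qed (rule K(1))
    qed (rule sch_rapid)
    assume b: "b \<in> Basis"
    show "\<exists>H. ddX Q b F H \<and> addspan ?C H" using cs
    proof cases
      case 1
      then show ?thesis using sch_ddX[OF 1 b] by (auto intro!: addspan_base)
    next
      case 2
      obtain H where H: "ddX Q b G H" "sch P Q H" using sch_ddX[OF 2(2) b] by blast
      have "addspan ?C ((\<lambda>\<theta> X. l X *\<^sub>R H \<theta> X) + (\<lambda>\<theta> X. l b *\<^sub>R G \<theta> X))"
        using H(2) sch[OF 2(2), of "l b"] by (intro addspan_add addspan_base) auto
      moreover have "ddX Q b F ((\<lambda>\<theta> X. l X *\<^sub>R H \<theta> X) + (\<lambda>\<theta> X. l b *\<^sub>R G \<theta> X))"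
        unfolding 2(1) ddX_def plus_fun_def
        using H(1) by (auto simp: ddX_def intro!: bounded_bilinear.has_dd[OF bounded_bilinear_scaleR] has_dd_linear l)
      ultimately show ?thesis by blast
    qed
    show "\<exists>H. ddA Q b F H \<and> addspan ?C H" using cs
    proof cases
      case 1
      then show ?thesis using sch_ddA[OF 1 b] by (auto intro!: addspan_base)
    next
      case 2
      obtain H where H: "ddA Q b G H" "sch P Q H" using sch_ddA[OF 2(2) b] by blast
      have "ddA Q b F (\<lambda>\<theta> X. l X *\<^sub>R H \<theta> X)"
        using H(1) hasA_map[OF bounded_linear_scaleR_right act_scaleR]
        unfolding 2(1) ddA_def by simp
      then show ?thesis using H(2) by (blast intro: addspan_base)
    qed
  qed (use F in auto)
qed

text \<open>Substitution in the parameter. Applied with a constant map it specializes the universal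
  family of all Schwartz functions to a single one.\<close>

lemma sch_reindex:
  assumes "cone P'" and g: "\<And>r. r \<in> Q' \<Longrightarrow> g r \<in> Q" and p: "\<And>p. p \<in> P \<Longrightarrow> (\<lambda>r. p (g r)) \<in> P'" and F: "sch P Q F"
  shows "sch P' Q' (\<lambda>r. F (g r))"
proof (rule sch_coinduct[OF assms(1), where C = "{(\<lambda>r. F (g r)) |F. sch P Q F}"])
  fix F and b :: 'x assume "F \<in> {(\<lambda>r. F (g r)) |F. sch P Q F}"
  then obtain G where F: "F = (\<lambda>r. G (g r))" and G: "sch P Q G" by blast
  show "rapid P' Q' F"
    unfolding rapid_def
  proof (intro conjI ballI allI)
    fix N
    obtain p where "p \<in> P" "\<forall>\<theta>\<in>Q. \<forall>X. (1 + norm X) ^ N * norm (G \<theta> X) \<le> p \<theta>"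
      using sch_rapid[OF G] unfolding rapid_def by meson
    then show "\<exists>p\<in>P'. \<forall>\<theta>\<in>Q'. \<forall>X. (1 + norm X) ^ N * norm (F \<theta> X) \<le> p \<theta>"
      using g by (intro bexI[of _ "\<lambda>r. p (g r)"] assms) (auto simp: F)
  qed (use sch_continuous[OF G] g in \<open>auto simp: F\<close>)
  assume b: "b \<in> Basis"
  show "\<exists>H. ddX Q' b F H \<and> addspan {(\<lambda>r. F (g r)) |F. sch P Q F} H"
    using sch_ddX[OF G b] g by (fastforce simp: F ddX_def intro!: addspan_base)
  show "\<exists>H. ddA Q' b F H \<and> addspan {(\<lambda>r. F (g r)) |F. sch P Q F} H"
    using sch_ddA[OF G b] g by (fastforce simp: F ddA_def intro!: addspan_base)
qed (use F in auto)

lemma sch_affine: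
  assumes P: "cone P" and s: "\<bar>s\<bar> = 1" and F: "sch P Q F"
  shows "sch P Q (\<lambda>\<theta> X. F \<theta> (s *\<^sub>R X + v))"
proof (rule sch_coinduct[OF P, where C = "{(\<lambda>\<theta> X. F \<theta> (s *\<^sub>R X + v)) |F. sch P Q F}"])
  fix F and b :: 'x assume "F \<in> {(\<lambda>\<theta> X. F \<theta> (s *\<^sub>R X + v)) |F. sch P Q F}"
  then obtain G where F: "F = (\<lambda>\<theta> X. G \<theta> (s *\<^sub>R X + v))" and G: "sch P Q G" by blast
  show "rapid P Q F"
    unfolding rapid_def
  proof (intro conjI ballI allI)
    fix \<theta> assume "\<theta> \<in> Q"
    then show "continuous_on UNIV (F \<theta>)"
      unfolding F by (intro continuous_on_compose2[OF sch_continuous[OF G]] continuous_intros) auto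
  next
    fix N
    obtain p where p: "p \<in> P" "\<And>\<theta> X. \<theta> \<in> Q \<Longrightarrow> (1 + norm X) ^ N * norm (G \<theta> X) \<le> p \<theta>"
      using sch_rapid[OF G] unfolding rapid_def by meson
    have "(1 + norm X) ^ N * norm (F \<theta> X) \<le> (1 + norm v) ^ N * p \<theta>" if "\<theta> \<in> Q" for \<theta> X
    proof -
      have "norm X = norm (s *\<^sub>R X)" using s by simp
      also have "\<dots> \<le> norm (s *\<^sub>R X + v) + norm v"
        using norm_triangle_ineq4[of "s *\<^sub>R X + v" v] by simp
      finally have "1 + norm X \<le> (1 + norm v) * (1 + norm (s *\<^sub>R X + v))"
        using mult_nonneg_nonneg[OF norm_ge_zero[of v] norm_ge_zero[of "s *\<^sub>R X + v"]]
        unfolding distrib_left distrib_right mult_1_left mult_1_right by linarith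
      then have "(1 + norm X) ^ N \<le> (1 + norm v) ^ N * (1 + norm (s *\<^sub>R X + v)) ^ N"
        unfolding power_mult_distrib[symmetric] by (intro power_mono) auto
      then have "(1 + norm X) ^ N * norm (F \<theta> X)
          \<le> (1 + norm v) ^ N * ((1 + norm (s *\<^sub>R X + v)) ^ N * norm (G \<theta> (s *\<^sub>R X + v)))"
        unfolding F mult.assoc[symmetric] by (rule mult_right_mono) simp
      also have "\<dots> \<le> (1 + norm v) ^ N * p \<theta>" by (intro mult_left_mono p that) auto
      finally show ?thesis .
    qed
    then show "\<exists>p\<in>P. \<forall>\<theta>\<in>Q. \<forall>X. (1 + norm X) ^ N * norm (F \<theta> X) \<le> p \<theta>"
      by (intro bexI[of _ "\<lambda>\<theta>. (1 + norm v) ^ N * p \<theta>"] cone_scale[OF P p(1)]) auto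
  qed
  assume b: "b \<in> Basis"
  show "\<exists>H. ddX Q b F H \<and> addspan {(\<lambda>\<theta> X. F \<theta> (s *\<^sub>R X + v)) |F. sch P Q F} H"
  proof -
    obtain H where H: "ddX Q b G H" "sch P Q H" using sch_ddX[OF G b] by blast
    have "has_dd b (F \<theta>) (\<lambda>X. s *\<^sub>R H \<theta> (s *\<^sub>R X + v))" if "\<theta> \<in> Q" for \<theta>
      unfolding has_dd_def
    proof
      fix X
      have 1: "((\<lambda>t. t * s) has_vector_derivative s) (at 0)"
        using has_vector_derivative_mult_left[OF has_vector_derivative_id, of s "at 0"] by simp
      have der: "((\<lambda>t. G \<theta> ((s *\<^sub>R X + v) + t *\<^sub>R b)) has_vector_derivative H \<theta> (s *\<^sub>R X + v)) (at (0 * s))"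
        using H(1) that by (simp add: ddX_def has_dd_def)
      have e: "s *\<^sub>R (X + t *\<^sub>R b) + v = (s *\<^sub>R X + v) + (t * s) *\<^sub>R b" for t
        by (simp add: scaleR_add_right mult.commute)
      from vector_diff_chain_at[OF 1 der]
      show "((\<lambda>t. F \<theta> (X + t *\<^sub>R b)) has_vector_derivative s *\<^sub>R H \<theta> (s *\<^sub>R X + v)) (at 0)"
        by (simp only: F o_def e)
    qed
    moreover have "addspan {(\<lambda>\<theta> X. F \<theta> (s *\<^sub>R X + v)) |F. sch P Q F} (\<lambda>\<theta> X. s *\<^sub>R H \<theta> (s *\<^sub>R X + v))"
      using sch_scaleR[OF P H(2), of s] by (auto intro!: addspan_base)
    ultimately show ?thesis
      by (intro exI[of _ "\<lambda>\<theta> X. s *\<^sub>R H \<theta> (s *\<^sub>R X + v)"]) (simp add: ddX_def)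
  qed
  show "\<exists>H. ddA Q b F H \<and> addspan {(\<lambda>\<theta> X. F \<theta> (s *\<^sub>R X + v)) |F. sch P Q F} H"
  proof -
    obtain H where H: "ddA Q b G H" "sch P Q H" using sch_ddA[OF G b] by blast
    then have "ddA Q b F (\<lambda>\<theta> X. H \<theta> (s *\<^sub>R X + v))" by (simp add: F ddA_def)
    then show ?thesis using H(2) by (blast intro: addspan_base)
  qed
qed (use F in auto)

text \<open>The twist keeps the norm, and by \<open>has_dd_act\<close> each of its derivatives is
  again the twist of a Schwartz family.\<close>

lemma sch_act:
  assumes P: "cone P" and F: "sch P Q F"
  shows "sch P Q (\<lambda>\<theta> X. \<Theta> (s *\<^sub>R X) (F \<theta> X))"
proof (rule sch_coinduct[OF P, where C = "{(\<lambda>\<theta> X. \<Theta> (s *\<^sub>R X) (F \<theta> X)) |F. sch P Q F}"])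
  fix F and b :: 'x assume "F \<in> {(\<lambda>\<theta> X. \<Theta> (s *\<^sub>R X) (F \<theta> X)) |F. sch P Q F}"
  then obtain G where F: "F = (\<lambda>\<theta> X. \<Theta> (s *\<^sub>R X) (G \<theta> X))" and G: "sch P Q G" by blast
  show "rapid P Q F"
  proof (rule rapid_bounded[OF P sch_rapid[OF G], of _ 1 0])
    show "continuous_on UNIV (F \<theta>)" if "\<theta> \<in> Q" for \<theta>
      unfolding F by (intro continuous_intros sch_continuous[OF G that])
  qed (auto simp: F)
  assume b: "b \<in> Basis"
  obtain H where H: "ddX Q b G H" "sch P Q H" using sch_ddX[OF G b] by blast
  obtain K where K: "ddA Q b G K" "sch P Q K" using sch_ddA[OF G b] by blast
  show "\<exists>H. ddX Q b F H \<and> addspan {(\<lambda>\<theta> X. \<Theta> (s *\<^sub>R X) (F \<theta> X)) |F. sch P Q F} H"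
  proof (intro exI conjI)
    show "ddX Q b F (\<lambda>\<theta> X. \<Theta> (s *\<^sub>R X) (s *\<^sub>R K \<theta> X + H \<theta> X))"
      using H(1) K(1) unfolding F ddX_def ddA_def by (blast intro: has_dd_act)
    show "addspan {(\<lambda>\<theta> X. \<Theta> (s *\<^sub>R X) (F \<theta> X)) |F. sch P Q F} (\<lambda>\<theta> X. \<Theta> (s *\<^sub>R X) (s *\<^sub>R K \<theta> X + H \<theta> X))"
      using sch_add'[OF P sch_scaleR[OF P K(2)] H(2), of s] by (auto intro!: addspan_base)
  qed
  show "\<exists>H. ddA Q b F H \<and> addspan {(\<lambda>\<theta> X. \<Theta> (s *\<^sub>R X) (F \<theta> X)) |F. sch P Q F} H"
    using K by (intro exI[of _ "\<lambda>\<theta> X. \<Theta> (s *\<^sub>R X) (K \<theta> X)"]) (auto simp: F ddA_def intro!: addspan_base hasA_act)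
qed (use F in auto)

end

section \<open>Equality of mixed partial derivatives\<close>

text \<open>The fundamental theorem along b' writes f(X + \<sigma> b + u b') - f(X + \<sigma> b) as
  an integral of q. Differentiating in \<sigma> under the integral shows that p(X + u b') - p(X) is
  the integral of r from 0 to u; its derivative at u = 0 is therefore r X as well as s X.\<close>

lemma clairaut:
  fixes f :: "'y::real_normed_vector \<Rightarrow> 'b::banach"
  assumes f: "has_dd b f p" "has_dd b' f q" and q: "has_dd b q r" and p: "has_dd b' p s"
    and cq: "continuous_on UNIV q" and cr: "continuous_on UNIV r"
  shows "r = s"
proof
  fix X
  have "((\<lambda>u. p (X + u *\<^sub>R b') - p X) has_vector_derivative r X) (at 0 within {0..1})"
  proof -
    have cont: "continuous_on UNIV (\<lambda>(\<sigma>::real, \<tau>::real). r (X + \<sigma> *\<^sub>R b + \<tau> *\<^sub>R b'))"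
      unfolding split_beta by (intro continuous_on_compose2[OF cr] continuous_intros) auto
    have eq: "p (X + u *\<^sub>R b') - p X = integral {0..u} (\<lambda>\<tau>. r (X + \<tau> *\<^sub>R b'))" if u: "0 \<le> u" for u
    proof -
      have ftc: "((\<lambda>\<tau>. q (X + \<sigma> *\<^sub>R b + \<tau> *\<^sub>R b')) has_integral
          f (X + \<sigma> *\<^sub>R b + u *\<^sub>R b') - f (X + \<sigma> *\<^sub>R b + 0 *\<^sub>R b')) {0..u}" for \<sigma>
        by (rule fundamental_theorem_of_calculus[OF u])
           (rule has_vector_derivative_at_within[OF has_dd_at[OF f(2)]])
      have "((\<lambda>\<sigma>. integral (cbox 0 u) (\<lambda>\<tau>. q (X + \<sigma> *\<^sub>R b + \<tau> *\<^sub>R b'))) has_vector_derivative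
          integral (cbox 0 u) (\<lambda>\<tau>. r (X + 0 *\<^sub>R b + \<tau> *\<^sub>R b'))) (at 0 within UNIV)"
      proof (rule leibniz_rule_vector_derivative)
        show "((\<lambda>\<sigma>. q (X + \<sigma> *\<^sub>R b + \<tau> *\<^sub>R b')) has_vector_derivative r (X + \<sigma> *\<^sub>R b + \<tau> *\<^sub>R b')) (at \<sigma> within UNIV)"
          for \<sigma> \<tau>
          using has_dd_at[OF q, of "X + \<tau> *\<^sub>R b'" \<sigma>] by (simp add: add_ac)
        show "(\<lambda>\<tau>. q (X + \<sigma> *\<^sub>R b + \<tau> *\<^sub>R b')) integrable_on cbox 0 u" for \<sigma>
          by (intro integrable_continuous continuous_on_compose2[OF cq] continuous_intros) auto
      qed (use cont continuous_on_subset in auto)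
      then have "((\<lambda>\<sigma>. f (X + \<sigma> *\<^sub>R b + u *\<^sub>R b') - f (X + \<sigma> *\<^sub>R b)) has_vector_derivative
          integral {0..u} (\<lambda>\<tau>. r (X + \<tau> *\<^sub>R b'))) (at 0)"
        using integral_unique[OF ftc] by simp
      moreover have "((\<lambda>\<sigma>. f (X + \<sigma> *\<^sub>R b + u *\<^sub>R b') - f (X + \<sigma> *\<^sub>R b)) has_vector_derivative
          p (X + u *\<^sub>R b') - p X) (at 0)"
      proof (rule has_vector_derivative_diff)
        show "((\<lambda>\<sigma>. f (X + \<sigma> *\<^sub>R b + u *\<^sub>R b')) has_vector_derivative p (X + u *\<^sub>R b')) (at 0)"
          using spec[OF f(1)[unfolded has_dd_def], of "X + u *\<^sub>R b'"]
          by (simp only: add.assoc add.commute[of "_ *\<^sub>R b" "u *\<^sub>R b'"])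
        show "((\<lambda>\<sigma>. f (X + \<sigma> *\<^sub>R b)) has_vector_derivative p X) (at 0)"
          using f(1) by (simp add: has_dd_def)
      qed
      ultimately show ?thesis by (rule vector_derivative_unique_at[rotated])
    qed
    have "continuous_on {0..1} (\<lambda>\<tau>. r (X + \<tau> *\<^sub>R b'))"
      by (intro continuous_on_compose2[OF cr] continuous_intros) auto
    from integral_has_vector_derivative[OF this, of 0]
    have "((\<lambda>u. integral {0..u} (\<lambda>\<tau>. r (X + \<tau> *\<^sub>R b'))) has_vector_derivative r X) (at 0 within {0..1})"
      by simp
    then show ?thesis
    proof (rule has_vector_derivative_transform[rotated 2])
      fix u :: real assume "u \<in> {0..1}"
      then show "p (X + u *\<^sub>R b') - p X = integral {0..u} (\<lambda>\<tau>. r (X + \<tau> *\<^sub>R b'))" by (intro eq) simp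
    qed simp
  qed
  moreover have "((\<lambda>u. p (X + u *\<^sub>R b') - p X) has_vector_derivative s X - 0) (at 0 within {0..1})"
    by (rule has_vector_derivative_diff[OF has_vector_derivative_at_within[OF spec[OF p[unfolded has_dd_def]]]
          has_vector_derivative_const])
  moreover have "at (0::real) within {0..1} \<noteq> bot" by (simp add: trivial_limit_within islimpt_Icc)
  ultimately show "r X = s X" using vector_derivative_unique_within[of 0 "{0..1}"] by simp
qed

section \<open>Words of derivatives and multi-indices\<close>

lemma partials_Nil [simp]: "partials [] f = f"
  and partials_Cons [simp]: "partials (b # w) f = partial b (partials w f)"
  by (simp_all add: partials_def)

lemma smooth_has_dd:
  assumes "smooth f" "w \<in> lists Basis" "b \<in> Basis"
  shows "has_dd b (partials w f) (partials (b # w) f)"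
  using assms unfolding smooth_def has_dd_def partials_Cons partial_def
  by (auto simp: vector_derivative_works)

lemma smooth_continuous: "smooth f \<Longrightarrow> w \<in> lists Basis \<Longrightarrow> continuous_on UNIV (partials w f)"
  by (simp add: smooth_def)

lemma smoothI:
  fixes f :: "'y::euclidean_space \<Rightarrow> 'b::real_normed_vector"
  assumes "\<And>w. w \<in> lists Basis \<Longrightarrow> continuous_on UNIV (G w)" "G [] = f"
    and "\<And>w b. w \<in> lists Basis \<Longrightarrow> b \<in> Basis \<Longrightarrow> has_dd b (G w) (G (b # w))"
  shows "smooth f" and "w \<in> lists Basis \<Longrightarrow> partials w f = G w"
proof -
  have eq: "w \<in> lists Basis \<Longrightarrow> partials w f = G w" for w
  proof (induction w rule: list.induct)
    case (Cons b w)
    then show ?case using has_dd_partial[OF assms(3)[of w b]] by simp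
  qed (simp add: assms)
  then show "w \<in> lists Basis \<Longrightarrow> partials w f = G w" .
  show "smooth f"
    unfolding smooth_def
  proof (intro ballI conjI allI)
    fix w :: "'y list" and b :: 'y and X assume w: "w \<in> lists Basis" and b: "b \<in> Basis"
    show "(\<lambda>t. partials w f (X + t *\<^sub>R b)) differentiable (at 0)"
      unfolding eq[OF w] using assms(3)[OF w b] unfolding has_dd_def by (blast intro: differentiableI_vector)
  qed (simp add: eq assms(1))
qed

text \<open>The first letter of \<open>w\<close> is brought to the front of \<open>w'\<close> by
  exchanging neighbours, each exchange being an instance of \<open>clairaut\<close>; induction
  treats the remaining letters.\<close>

lemma partials_perm:
  fixes f :: "'x::euclidean_space \<Rightarrow> 'b::banach"
  assumes f: "smooth f" and "w \<in> lists Basis" "mset w = mset w'"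
  shows "partials w f = partials w' f"
  using assms(2,3)
proof (induction w arbitrary: w' rule: list.induct)
  case (Cons b v)
  have "b \<in> set w'" using Cons.prems(2) by (metis list.set_intros(1) set_mset_mset)
  then obtain l r where w': "w' = l @ b # r" by (auto simp: in_set_conv_decomp)
  have m: "mset v = mset (l @ r)" using Cons.prems(2) w' by simp
  have "set w' \<subseteq> Basis" using Cons.prems by (metis in_lists_conv_set set_mset_mset subsetI)
  then have lr: "set (l @ r) \<subseteq> Basis" using w' by auto
  have b: "b \<in> Basis" using Cons.prems by simp
  have "set l \<subseteq> Basis \<Longrightarrow> partials (l @ b # r) f = partials (b # l @ r) f"
  proof (induction l)
    case (Cons a l)
    let ?v = "l @ r"
    have v: "?v \<in> lists Basis" "a \<in> Basis" using Cons.prems lr by auto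
    have 1: "partials (a # l @ b # r) f = partials (a # b # ?v) f" using Cons by simp
    have "partials (b # a # ?v) f = partials (a # b # ?v) f"
      by (rule clairaut[OF smooth_has_dd[OF f v(1) b] smooth_has_dd[OF f v] smooth_has_dd[OF f _ b]
            smooth_has_dd[OF f _ v(2)] smooth_continuous[OF f] smooth_continuous[OF f]])
         (use v b in auto)
    then show ?case using 1 by simp
  qed simp
  then have "partials w' f = partial b (partials (l @ r) f)" using lr w' by simp
  moreover have "partials v f = partials (l @ r) f"
    by (rule Cons.IH[OF _ m]) (use Cons.prems in simp)
  ultimately show ?case by simp
qed simp

definition mword :: "('x::euclidean_space \<Rightarrow> nat) \<Rightarrow> 'x list" where
  "mword \<alpha> = concat (map (\<lambda>b. replicate (\<alpha> b) b) basis_list)"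

lemma mpartial_mword: "mpartial \<alpha> f = partials (mword \<alpha>) f"
  by (simp add: mpartial_def mword_def)

lemma basis_list: "distinct (basis_list :: 'x::euclidean_space list)" "set basis_list = (Basis :: 'x set)"
proof -
  have "\<exists>bs :: 'x list. distinct bs \<and> set bs = Basis"
    using finite_distinct_list[OF finite_Basis] by metis
  then have "distinct (basis_list :: 'x list) \<and> set basis_list = (Basis :: 'x set)"
    unfolding basis_list_def by (rule someI_ex)
  then show "distinct (basis_list :: 'x list)" "set basis_list = (Basis :: 'x set)" by auto
qed

lemma mword_lists: "mword \<alpha> \<in> lists Basis"
  by (auto simp: mword_def basis_list(2))

lemma mset_concat_replicate:
  "distinct bs \<Longrightarrow> count (mset (concat (map (\<lambda>b. replicate (\<alpha> b) b) bs))) x = (if x \<in> set bs then \<alpha> x else 0)"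
  by (induction bs) auto

text \<open>The link between words, along which derivatives are iterated in inductions, and
  multi-indices, by which the seminorms are indexed: the letter counts of a word are its
  multi-index.\<close>

lemma word_multi_index:
  fixes w :: "'x::euclidean_space list"
  assumes w: "w \<in> lists Basis"
  shows "mset w = mset (mword (count (mset w)))" "count (mset w) \<in> multi_indices (length w)"
proof -
  have z: "count (mset w) b = 0" if "b \<notin> Basis" for b
    using w that by (metis count_eq_zero_iff in_lists_conv_set set_mset_mset)
  show "mset w = mset (mword (count (mset w)))"
    by (rule multiset_eqI) (simp add: mword_def mset_concat_replicate basis_list z)
  have "length w = (\<Sum>b\<in>set_mset (mset w). count (mset w) b)"
    by (metis size_mset size_multiset_overloaded_eq)
  also have "\<dots> = (\<Sum>b\<in>Basis. count (mset w) b)"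
    by (rule sum.mono_neutral_left) (use w in \<open>auto simp: count_eq_zero_iff\<close>)
  finally show "count (mset w) \<in> multi_indices (length w)" using z by (simp add: multi_indices_def)
qed

lemma finite_multi_indices: "finite (multi_indices k :: ('x::euclidean_space \<Rightarrow> nat) set)"
proof (rule finite_subset)
  show "multi_indices k \<subseteq> {\<alpha>::'x \<Rightarrow> nat. \<forall>x. (x \<in> Basis \<longrightarrow> \<alpha> x \<in> {..k}) \<and> (x \<notin> Basis \<longrightarrow> \<alpha> x = 0)}"
    by (auto simp: multi_indices_def intro: member_le_sum)
qed (rule finite_set_of_finite_funs, auto)

section \<open>Smooth vectors and the Schwartz space\<close>

context caction
begin

text \<open>The product of the generators belonging to the letters of the word, applied to f; the
  head of the word acts last.\<close>

definition delta :: "'x list \<Rightarrow> 'a \<Rightarrow> 'a" where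
  "delta w f = partials w (\<lambda>S. \<Theta> S f) 0"

text \<open>Since \<open>\<Theta> (S + t b)\<close> is \<open>\<Theta> S\<close> after
  \<open>\<Theta> (t b)\<close>, a derivative of the orbit map at the origin gives its derivatives
  everywhere, by applying \<open>\<Theta> S\<close>. Candidates at the origin therefore
  suffice.\<close>

lemma smooth_vectorsI:
  assumes "G [] = f" "\<And>w b. w \<in> lists Basis \<Longrightarrow> b \<in> Basis \<Longrightarrow> hasA b (G w) (G (b # w))"
  shows "f \<in> smooth_vectors \<Theta>" and "w \<in> lists Basis \<Longrightarrow> delta w f = G w"
proof -
  have G: "(\<lambda>S. \<Theta> S (G [])) = (\<lambda>S. \<Theta> S f)" by (simp add: assms)
  have c: "continuous_on UNIV (\<lambda>S. \<Theta> S (G w))" for w by (intro continuous_intros)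
  note * = smoothI[of "\<lambda>w S. \<Theta> S (G w)", OF c G hasA_dd[OF assms(2)]]
  show "f \<in> smooth_vectors \<Theta>" using *(1) by (simp add: smooth_vectors_def)
  show "w \<in> lists Basis \<Longrightarrow> delta w f = G w" using *(2)[of w] by (simp add: delta_def)
qed

lemma smooth_vectors_partials:
  assumes f: "f \<in> smooth_vectors \<Theta>"
  shows "w \<in> lists Basis \<Longrightarrow> partials w (\<lambda>S. \<Theta> S f) = (\<lambda>S. \<Theta> S (delta w f))"
    and "w \<in> lists Basis \<Longrightarrow> b \<in> Basis \<Longrightarrow> hasA b (delta w f) (delta (b # w) f)"
proof -
  have sm: "smooth (\<lambda>S. \<Theta> S f)" using f by (simp add: smooth_vectors_def)
  have A: "hasA b (delta w f) (delta (b # w) f)"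
    if "partials w (\<lambda>S. \<Theta> S f) = (\<lambda>S. \<Theta> S (delta w f))" "w \<in> lists Basis" "b \<in> Basis" for w b
    using spec[OF smooth_has_dd[OF sm that(2,3), unfolded that(1) has_dd_def], of 0]
    by (simp add: hasA_def delta_def)
  show P: "partials w (\<lambda>S. \<Theta> S f) = (\<lambda>S. \<Theta> S (delta w f))" if "w \<in> lists Basis" for w
    using that
  proof (induction w rule: list.induct)
    case (Cons b w)
    then have w: "partials w (\<lambda>S. \<Theta> S f) = (\<lambda>S. \<Theta> S (delta w f))" "w \<in> lists Basis" "b \<in> Basis" by auto
    show ?case using has_dd_partial[OF hasA_dd[OF A[OF w]]] w(1) by simp
  qed (simp add: delta_def)
  show "w \<in> lists Basis \<Longrightarrow> b \<in> Basis \<Longrightarrow> hasA b (delta w f) (delta (b # w) f)"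
    using A P by blast
qed

lemma delta_Nil [simp]: "delta [] f = f"
  by (simp add: delta_def)

lemma
  assumes f: "f \<in> smooth_vectors \<Theta>" and g: "g \<in> smooth_vectors \<Theta>"
  shows smooth_vectors_lincomb: "f + r *\<^sub>R g \<in> smooth_vectors \<Theta>"
    and delta_lincomb: "w \<in> lists Basis \<Longrightarrow> delta w (f + r *\<^sub>R g) = delta w f + r *\<^sub>R delta w g"
proof -
  have "hasA b (delta w f + r *\<^sub>R delta w g) (delta (b # w) f + r *\<^sub>R delta (b # w) g)"
    if "w \<in> lists Basis" "b \<in> Basis" for w b
    by (intro hasA_add hasA_map[OF bounded_linear_scaleR_right act_scaleR] smooth_vectors_partials f g that)
  note * = smooth_vectorsI[of "\<lambda>w. delta w f + r *\<^sub>R delta w g", OF _ this]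
  show "f + r *\<^sub>R g \<in> smooth_vectors \<Theta>"
    "w \<in> lists Basis \<Longrightarrow> delta w (f + r *\<^sub>R g) = delta w f + r *\<^sub>R delta w g"
    by (rule *; simp)+
qed

lemma smooth_seminorm_delta: "smooth_seminorm \<Theta> k f =
   (\<Sum>\<alpha>\<in>multi_indices k. (1 / (\<Prod>b\<in>Basis. fact (\<alpha> b))) * norm (delta (mword \<alpha>) f))"
  by (simp add: smooth_seminorm_def mpartial_mword delta_def)

lemma smooth_seminorm_nonneg: "smooth_seminorm \<Theta> k f \<ge> 0"
  unfolding smooth_seminorm_def by (intro sum_nonneg mult_nonneg_nonneg divide_nonneg_nonneg prod_nonneg) auto

text \<open>After reordering, the derivative along \<open>v\<close> is one of the nonnegative terms
  of the seminorm of order \<open>length v\<close>; the constant undoes its coefficient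
  1/\<alpha>!.\<close>

lemma norm_delta_le:
  assumes v: "v \<in> lists Basis"
  shows "\<exists>K\<ge>0. \<forall>f\<in>smooth_vectors \<Theta>. norm (delta v f) \<le> K * smooth_seminorm \<Theta> (length v) f"
proof -
  define \<alpha> where "\<alpha> = count (mset v)"
  define K where "K = (\<Prod>b\<in>Basis. fact (\<alpha> (b::'x))::real)"
  have K: "K > 0" unfolding K_def by (intro prod_pos) auto
  have "norm (delta v f) \<le> K * smooth_seminorm \<Theta> (length v) f" if "f \<in> smooth_vectors \<Theta>" for f
  proof -
    have sm: "smooth (\<lambda>S. \<Theta> S f)" using that by (simp add: smooth_vectors_def)
    have "delta v f = delta (mword \<alpha>) f"
      unfolding delta_def \<alpha>_def by (rule fun_cong[OF partials_perm[OF sm v word_multi_index(1)[OF v]]])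
    moreover have "(1 / K) * norm (delta (mword \<alpha>) f) \<le> smooth_seminorm \<Theta> (length v) f"
      unfolding smooth_seminorm_delta K_def
      by (rule member_le_sum[where f = "\<lambda>\<alpha>. (1 / (\<Prod>b\<in>Basis. fact (\<alpha> b))) * norm (delta (mword \<alpha>) f)"])
         (auto intro!: mult_nonneg_nonneg divide_nonneg_nonneg prod_nonneg finite_multi_indices
            simp: \<alpha>_def word_multi_index(2)[OF v])
    ultimately show ?thesis using K by (simp add: divide_le_eq mult.commute)
  qed
  then show ?thesis using K by (auto intro: less_imp_le)
qed

section \<open>The Schwartz space as a universal family, and the converse\<close>

abbreviation S where "S \<equiv> schwartz_space \<Theta>"

lemma schwartz_weight_le:
  assumes "F \<in> S"
  shows "schwartz_weight \<Theta> i F X \<le> schwartz_seminorm \<Theta> i F"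
proof -
  have "\<forall>i. bdd_above (range (schwartz_weight \<Theta> i F))"
    using assms unfolding schwartz_space_def by (elim CollectE conjE)
  then have "bdd_above (range (schwartz_weight \<Theta> i F))" ..
  then show ?thesis unfolding schwartz_seminorm_def by (rule cSUP_upper[OF UNIV_I])
qed

lemma schwartz_weight_nonneg: "schwartz_weight \<Theta> i F X \<ge> 0"
  unfolding schwartz_weight_def by (auto simp: split_beta intro!: mult_nonneg_nonneg smooth_seminorm_nonneg)

lemma schwartz_seminorm_nonneg: "F \<in> S \<Longrightarrow> schwartz_seminorm \<Theta> i F \<ge> 0"
  using order_trans[OF schwartz_weight_nonneg schwartz_weight_le] .

definition seminorm_cone :: "(('x \<Rightarrow> 'a) \<Rightarrow> real) set" where
  "seminorm_cone = {p. \<exists>J C. finite J \<and> C \<ge> 0 \<and> (\<forall>F\<in>S. p F \<le> C * (\<Sum>j\<in>J. schwartz_seminorm \<Theta> j F))}"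

lemma cone_seminorm: "cone seminorm_cone"
  unfolding cone_def
proof (intro conjI ballI allI impI)
  fix p q assume "p \<in> seminorm_cone" "q \<in> seminorm_cone"
  then obtain I C J D where p: "finite I" "C \<ge> 0" "\<And>F. F \<in> S \<Longrightarrow> p F \<le> C * (\<Sum>j\<in>I. schwartz_seminorm \<Theta> j F)"
    and q: "finite J" "D \<ge> 0" "\<And>F. F \<in> S \<Longrightarrow> q F \<le> D * (\<Sum>j\<in>J. schwartz_seminorm \<Theta> j F)"
    unfolding seminorm_cone_def by blast
  have "p F + q F \<le> (C + D) * (\<Sum>j\<in>I\<union>J. schwartz_seminorm \<Theta> j F)" if F: "F \<in> S" for F
  proof -
    have "(\<Sum>j\<in>I. schwartz_seminorm \<Theta> j F) \<le> (\<Sum>j\<in>I\<union>J. schwartz_seminorm \<Theta> j F)"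
      "(\<Sum>j\<in>J. schwartz_seminorm \<Theta> j F) \<le> (\<Sum>j\<in>I\<union>J. schwartz_seminorm \<Theta> j F)"
      using p(1) q(1) schwartz_seminorm_nonneg[OF F] by (auto intro!: sum_mono2)
    then show ?thesis
      using p(3)[OF F] q(3)[OF F] mult_left_mono[OF _ p(2)] mult_left_mono[OF _ q(2)]
      by (smt (verit) distrib_right)
  qed
  then show "(\<lambda>F. p F + q F) \<in> seminorm_cone" using p q unfolding seminorm_cone_def
    by (intro CollectI exI[of _ "I \<union> J"] exI[of _ "C + D"]) auto
next
  fix p c assume "p \<in> seminorm_cone" and c: "(0::real) \<le> c"
  then obtain I C where p: "finite I" "C \<ge> 0" "\<And>F. F \<in> S \<Longrightarrow> p F \<le> C * (\<Sum>j\<in>I. schwartz_seminorm \<Theta> j F)"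
    unfolding seminorm_cone_def by blast
  then show "(\<lambda>F. c * p F) \<in> seminorm_cone" unfolding seminorm_cone_def using c
    by (intro CollectI exI[of _ I] exI[of _ "c * C"]) (auto simp: mult.assoc mult_left_mono)
qed (auto simp: seminorm_cone_def intro!: exI[of _ "{}"] exI[of _ 0])

lemma schwartz_partials:
  assumes "F \<in> S" "w \<in> lists Basis"
  shows "partials w F X \<in> smooth_vectors \<Theta>"
    and "((\<lambda>Y. smooth_seminorm \<Theta> k (partials w F Y - partials w F X)) \<longlongrightarrow> 0) (at X)"
    and "b \<in> Basis \<Longrightarrow> ((\<lambda>t. smooth_seminorm \<Theta> k
            ((1 / t) *\<^sub>R (partials w F (X + t *\<^sub>R b) - partials w F X) - partials (b # w) F X))
          \<longlongrightarrow> 0) (at 0)"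
  using assms unfolding schwartz_space_def smooth_into_smooth_vectors_def by blast+

lemma tendsto_delta:
  assumes v: "v \<in> lists Basis" and g: "\<forall>\<^sub>F y in F. g y \<in> smooth_vectors \<Theta>"
    and lim: "((\<lambda>y. smooth_seminorm \<Theta> (length v) (g y)) \<longlongrightarrow> 0) F"
  shows "((\<lambda>y. delta v (g y)) \<longlongrightarrow> 0) F"
proof -
  obtain K where K: "K \<ge> 0" "\<And>f. f \<in> smooth_vectors \<Theta> \<Longrightarrow> norm (delta v f) \<le> K * smooth_seminorm \<Theta> (length v) f"
    using norm_delta_le[OF v] by blast
  have "((\<lambda>y. K * smooth_seminorm \<Theta> (length v) (g y)) \<longlongrightarrow> 0) F"
    using tendsto_mult_left[OF lim, of K] by simp
  then show ?thesis
    by (rule Lim_null_comparison[rotated]) (use g in \<open>auto elim!: eventually_mono intro: K\<close>)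
qed

lemma delta_diff:
  assumes "f \<in> smooth_vectors \<Theta>" "g \<in> smooth_vectors \<Theta>" "w \<in> lists Basis"
  shows "f - g \<in> smooth_vectors \<Theta>" "delta w (f - g) = delta w f - delta w g"
  using smooth_vectors_lincomb[OF assms(1,2), of "-1"] delta_lincomb[OF assms, of "-1"] by auto

text \<open>Limits of increments and of difference quotients exist in the seminorm of order
  \<open>length v\<close>, which controls \<open>delta v\<close>. So \<open>delta v\<close> may be
  applied inside the limit, and it commutes with the derivatives in X.\<close>

lemma schwartz_delta_partials:
  assumes F: "F \<in> S" and w: "w \<in> lists Basis" and v: "v \<in> lists Basis"
  shows "continuous_on UNIV (\<lambda>X. delta v (partials w F X))"
    and "b \<in> Basis \<Longrightarrow> has_dd b (\<lambda>X. delta v (partials w F X)) (\<lambda>X. delta v (partials (b # w) F X))"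
proof -
  have sv: "partials w F X \<in> smooth_vectors \<Theta>" for X by (rule schwartz_partials[OF F w])
  show "continuous_on UNIV (\<lambda>X. delta v (partials w F X))"
    unfolding continuous_on_eq_continuous_at[OF open_UNIV] isCont_def
  proof
    fix X
    have "((\<lambda>Y. delta v (partials w F Y - partials w F X)) \<longlongrightarrow> 0) (at X)"
      by (rule tendsto_delta[OF v _ schwartz_partials(2)[OF F w]])
         (intro always_eventually allI delta_diff(1)[OF sv sv v])
    then show "((\<lambda>X. delta v (partials w F X)) \<longlongrightarrow> delta v (partials w F X)) (at X)"
      by (simp add: delta_diff sv v LIM_zero_iff)
  qed
  assume b: "b \<in> Basis"
  have sv': "partials (b # w) F X \<in> smooth_vectors \<Theta>" for X
    by (rule schwartz_partials[OF F]) (use w b in simp)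
  show "has_dd b (\<lambda>X. delta v (partials w F X)) (\<lambda>X. delta v (partials (b # w) F X))"
    unfolding has_dd_def has_vector_derivative_at_iff
  proof
    fix X
    have sv2: "(1 / t) *\<^sub>R (partials w F (X + t *\<^sub>R b) - partials w F X) \<in> smooth_vectors \<Theta>" 
      "delta v ((1 / t) *\<^sub>R (partials w F (X + t *\<^sub>R b) - partials w F X))
        = (1 / t) *\<^sub>R (delta v (partials w F (X + t *\<^sub>R b)) - delta v (partials w F X))" for t
    proof -
      have z: "(0::'a) \<in> smooth_vectors \<Theta>" "delta v 0 = 0"
        using delta_diff[OF sv sv v, of X X] by auto
      note d = delta_diff[OF sv sv v, of "X + t *\<^sub>R b" X]
      show "(1 / t) *\<^sub>R (partials w F (X + t *\<^sub>R b) - partials w F X) \<in> smooth_vectors \<Theta>"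
        using smooth_vectors_lincomb[OF z(1) d(1), of "1 / t"] by simp
      show "delta v ((1 / t) *\<^sub>R (partials w F (X + t *\<^sub>R b) - partials w F X))
        = (1 / t) *\<^sub>R (delta v (partials w F (X + t *\<^sub>R b)) - delta v (partials w F X))"
        using delta_lincomb[OF z(1) d(1) v, of "1 / t"] d(2) z(2) by simp
    qed
    have "((\<lambda>t. delta v ((1 / t) *\<^sub>R (partials w F (X + t *\<^sub>R b) - partials w F X) - partials (b # w) F X))
        \<longlongrightarrow> 0) (at 0)"
      by (rule tendsto_delta[OF v _ schwartz_partials(3)[OF F w b]])
         (intro always_eventually allI delta_diff(1)[OF sv2(1) sv' v])
    then have "((\<lambda>t. (1 / t) *\<^sub>R (delta v (partials w F (X + t *\<^sub>R b)) - delta v (partials w F X))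
        - delta v (partials (b # w) F X)) \<longlongrightarrow> 0) (at 0)"
      unfolding delta_diff(2)[OF sv2(1) sv' v] sv2(2) .
    then show "((\<lambda>t. (1 / t) *\<^sub>R (delta v (partials w F (X + (0 + t) *\<^sub>R b)) - delta v (partials w F (X + 0 *\<^sub>R b))))
        \<longlongrightarrow> delta v (partials (b # w) F X)) (at 0)"
      by (simp only: add_0_left scaleR_zero_left add_0_right LIM_zero_iff)
  qed
qed

lemma schwartz_smooth: 
  assumes F: "F \<in> S" shows "smooth F"
  by (rule smoothI[of "\<lambda>w. partials w F"])
     (use schwartz_delta_partials[OF F, of _ "[]"] in simp_all)

text \<open>The universal family, whose parameter is the function itself. The class of all
  \<open>delta v\<close> of \<open>partials w F\<close> is closed: a derivative in X lengthens
  \<open>w\<close>, a derivative along the action lengthens \<open>v\<close>, and each bound is a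
  multiple of a single seminorm.\<close>

theorem sch_seminorm_cone: "sch seminorm_cone S (\<lambda>F. F)"
proof (rule sch_coinduct[OF cone_seminorm,
      where C = "{(\<lambda>F X. delta v (partials w F X)) |v w. v \<in> lists Basis \<and> w \<in> lists Basis}"])
  fix G :: "('x \<Rightarrow> 'a) \<Rightarrow> 'x \<Rightarrow> 'a" and b :: 'x
  assume "G \<in> {(\<lambda>F X. delta v (partials w F X)) |v w. v \<in> lists Basis \<and> w \<in> lists Basis}"
  then obtain v w where G: "G = (\<lambda>F X. delta v (partials w F X))" and v: "v \<in> lists Basis" and w: "w \<in> lists Basis"
    by blast
  show "rapid seminorm_cone S G"
    unfolding rapid_def
  proof (intro conjI ballI allI)
    fix F assume "F \<in> S"
    then show "continuous_on UNIV (G F)" unfolding G by (rule schwartz_delta_partials(1)[OF _ w v])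
  next
    fix N :: nat
    obtain K where K: "K \<ge> 0" "\<And>f. f \<in> smooth_vectors \<Theta> \<Longrightarrow> norm (delta v f) \<le> K * smooth_seminorm \<Theta> (length v) f"
      using norm_delta_le[OF v] by blast
    \<comment> \<open>The seminorm that controls this derivative: the number of derivatives along
      the action, the power of the weight, and the multi-index of the derivatives in X.\<close>
    define i where "i = (length v, N, count (mset w))"
    have le: "(1 + norm X) ^ N * norm (G F X) \<le> K * schwartz_seminorm \<Theta> i F" if F: "F \<in> S" for F X
    proof -
      have "partials w F X = mpartial (count (mset w)) F X"
        unfolding mpartial_mword
        by (rule fun_cong[OF partials_perm[OF schwartz_smooth[OF F] w word_multi_index(1)[OF w]]])
      then have "(1 + norm X) ^ N * norm (G F X)
          \<le> (1 + norm X) ^ N * (K * smooth_seminorm \<Theta> (length v) (mpartial (count (mset w)) F X))"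
        unfolding G using K(2)[OF schwartz_partials(1)[OF F w, of X]] by (intro mult_left_mono) auto
      also have "\<dots> = K * schwartz_weight \<Theta> i F X" by (simp add: i_def schwartz_weight_def)
      also have "\<dots> \<le> K * schwartz_seminorm \<Theta> i F" by (intro mult_left_mono schwartz_weight_le F K)
      finally show ?thesis .
    qed
    have "(\<lambda>F. K * schwartz_seminorm \<Theta> i F) \<in> seminorm_cone"
      unfolding seminorm_cone_def using K(1) by (intro CollectI exI[of _ "{i}"] exI[of _ K]) auto
    then show "\<exists>p\<in>seminorm_cone. \<forall>F\<in>S. \<forall>X. (1 + norm X) ^ N * norm (G F X) \<le> p F"
      by (rule bexI[rotated]) (use le in blast)
  qed
  assume b: "b \<in> Basis"
  show "\<exists>H. ddX S b G H \<and> addspan {(\<lambda>F X. delta v (partials w F X)) |v w. v \<in> lists Basis \<and> w \<in> lists Basis} H"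
  proof (intro exI conjI)
    show "ddX S b G (\<lambda>F X. delta v (partials (b # w) F X))"
      unfolding ddX_def G using schwartz_delta_partials(2)[OF _ w v b] by blast
    have "b # w \<in> lists Basis" using b w by simp
    then show "addspan {(\<lambda>F X. delta v (partials w F X)) |v w. v \<in> lists Basis \<and> w \<in> lists Basis}
        (\<lambda>F X. delta v (partials (b # w) F X))" using v by (intro addspan_base) blast
  qed
  show "\<exists>H. ddA S b G H \<and> addspan {(\<lambda>F X. delta v (partials w F X)) |v w. v \<in> lists Basis \<and> w \<in> lists Basis} H"
  proof (intro exI conjI)
    show "ddA S b G (\<lambda>F X. delta (b # v) (partials w F X))"
      unfolding ddA_def G using smooth_vectors_partials(2)[OF schwartz_partials(1)[OF _ w] v b] by blast
    have "b # v \<in> lists Basis" using b v by simp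
    then show "addspan {(\<lambda>F X. delta v (partials w F X)) |v w. v \<in> lists Basis \<and> w \<in> lists Basis}
        (\<lambda>F X. delta (b # v) (partials w F X))" using w by (intro addspan_base) blast
  qed
next
  show "(\<lambda>F. F) \<in> {(\<lambda>F X. delta v (partials w F X)) |v w. v \<in> lists Basis \<and> w \<in> lists Basis}"
    by (intro CollectI exI[of _ "[]"]) simp
qed

lemma sch_partials:
  assumes "sch P Q F" "w \<in> lists Basis"
  shows "\<exists>G. sch P Q G \<and> (\<forall>\<theta>\<in>Q. partials w (F \<theta>) = G \<theta>)"
  using assms(2)
proof (induction w rule: list.induct)
  case (Cons b w)
  then obtain G where G: "sch P Q G" "\<forall>\<theta>\<in>Q. partials w (F \<theta>) = G \<theta>" by auto
  obtain H where H: "ddX Q b G H" "sch P Q H" using sch_ddX[OF G(1)] Cons.prems by auto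
  have "partials (b # w) (F \<theta>) = H \<theta>" if "\<theta> \<in> Q" for \<theta>
    using G(2) H(1) that by (simp add: ddX_def has_dd_partial)
  then show ?case using H(2) by blast
qed (use assms(1) in auto)

lemma sch_delta:
  assumes F: "sch P Q F"
  shows "\<theta> \<in> Q \<Longrightarrow> F \<theta> X \<in> smooth_vectors \<Theta>"
    and "w \<in> lists Basis \<Longrightarrow> \<exists>G. sch P Q G \<and> (\<forall>\<theta>\<in>Q. \<forall>X. delta w (F \<theta> X) = G \<theta> X)"
proof -
  \<comment> \<open>\<open>sch_ddA\<close> provides a derivative for each letter only existentially.
    The recursion fixes one for every word, and \<open>smooth_vectorsI\<close> then identifies it
    with \<open>delta\<close>.\<close>
  define G where "G = rec_list F (\<lambda>b w H. SOME K. ddA Q b H K \<and> sch P Q K)"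
  have G0: "G [] = F" and GS: "G (b # w) = (SOME K. ddA Q b (G w) K \<and> sch P Q K)" for b w
    by (simp_all add: G_def)
  have step: "ddA Q b (G w) (G (b # w)) \<and> sch P Q (G (b # w))" if "sch P Q (G w)" "b \<in> Basis" for b w
    unfolding GS by (rule someI_ex[OF sch_ddA[OF that]])
  have sG: "w \<in> lists Basis \<Longrightarrow> sch P Q (G w)" for w
    by (induction w) (use F G0 step in auto)
  have A: "hasA b (G w \<theta> X) (G (b # w) \<theta> X)" if "\<theta> \<in> Q" "w \<in> lists Basis" "b \<in> Basis" for b w \<theta> X
    using step[OF sG[OF that(2)] that(3)] that(1) by (simp add: ddA_def)
  have 0: "(\<lambda>w. G w \<theta> X) [] = F \<theta> X" for \<theta> X by (simp add: G0)
  note * = smooth_vectorsI[OF 0 A]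
  show "\<theta> \<in> Q \<Longrightarrow> F \<theta> X \<in> smooth_vectors \<Theta>" by (rule *(1))
  assume w: "w \<in> lists Basis"
  have "delta w (F \<theta> X) = G w \<theta> X" if "\<theta> \<in> Q" for \<theta> X
    by (rule *(2)[OF that _ _ w])
  then show "\<exists>G. sch P Q G \<and> (\<forall>\<theta>\<in>Q. \<forall>X. delta w (F \<theta> X) = G \<theta> X)" using sG[OF w] by blast
qed

text \<open>On the doubled space, the function sending (X, V) to \<open>\<Theta> V (F X)\<close>
  turns the derivative along the action into an ordinary one in direction (0, b'). There
  \<open>clairaut\<close> exchanges it with the derivative in direction (b, 0), and V = 0 gives the
  claim.\<close>

lemma sch_mixed:
  assumes G: "sch P Q G" and H: "ddX Q b G H" and b: "b \<in> Basis" and b': "b' \<in> Basis"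
    and K: "ddA Q b' G K" "sch P Q K" and H': "ddA Q b' H H'"
  shows "ddX Q b K H'"
proof -
  obtain K' where K': "ddX Q b K K'" "sch P Q K'" using sch_ddX[OF K(2) b] by blast
  have "K' \<theta> = H' \<theta>" if \<theta>: "\<theta> \<in> Q" for \<theta>
  proof -
    have ddS: "has_dd (0, b') (\<lambda>(X, V). \<Theta> V (F \<theta> X)) (\<lambda>(X, V). \<Theta> V (F' \<theta> X))"
      if "ddA Q b' F F'" for F F'
      using hasA_dd[of b' "F \<theta> X" "F' \<theta> X" for X] that \<theta> unfolding has_dd_def ddA_def by auto
    have ddX: "has_dd (b, 0) (\<lambda>(X, V). \<Theta> V (F \<theta> X)) (\<lambda>(X, V). \<Theta> V (F' \<theta> X))"
      if "ddX Q b F F'" for F F'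
      unfolding has_dd_def
    proof
      fix Z :: "'x \<times> 'x"
      have "((\<lambda>t. F \<theta> (fst Z + t *\<^sub>R b)) has_vector_derivative F' \<theta> (fst Z)) (at 0)"
        using that \<theta> by (simp add: ddX_def has_dd_def)
      from bounded_linear.has_vector_derivative[OF bounded_linear_act this]
      show "((\<lambda>t. case Z + t *\<^sub>R (b, 0) of (X, V) \<Rightarrow> \<Theta> V (F \<theta> X)) has_vector_derivative
          (case Z of (X, V) \<Rightarrow> \<Theta> V (F' \<theta> X))) (at 0)"
        by (cases Z) auto
    qed
    have c: "continuous_on UNIV (\<lambda>(X, V). \<Theta> V (F \<theta> X))" if "sch P Q F" for F
      unfolding split_beta
      by (intro continuous_intros continuous_on_compose2[OF sch_continuous[OF that \<theta>]]) auto
    have "(\<lambda>(X, V). \<Theta> V (K' \<theta> X)) = (\<lambda>(X, V). \<Theta> V (H' \<theta> X))"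
      by (rule clairaut[OF ddX[OF H] ddS[OF K(1)] ddX[OF K'(1)] ddS[OF H'] c[OF K(2)] c[OF K'(2)]])
    from fun_cong[OF this, of "(_, 0)"] show ?thesis by (auto simp: fun_eq_iff)
  qed
  then show ?thesis using K'(1) by (simp add: ddX_def)
qed

text \<open>By induction on the word from \<open>sch_mixed\<close>. It upgrades differentiability in
  the norm to differentiability in every seminorm of the smooth vectors.\<close>

lemma sch_ddX_delta:
  assumes G: "sch P Q G" and H: "ddX Q b G H" "sch P Q H" and b: "b \<in> Basis" and v: "v \<in> lists Basis"
  shows "ddX Q b (\<lambda>\<theta> X. delta v (G \<theta> X)) (\<lambda>\<theta> X. delta v (H \<theta> X))"
  using v
proof (induction v rule: list.induct)
  case (Cons b' v)
  then have v: "v \<in> lists Basis" "b' \<in> Basis" by auto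
  have A: "ddA Q b' (\<lambda>\<theta> X. delta v (F \<theta> X)) (\<lambda>\<theta> X. delta (b' # v) (F \<theta> X))" if "sch P Q F" for F
    unfolding ddA_def using smooth_vectors_partials(2)[OF sch_delta(1)[OF that] v] by blast
  obtain Gv where Gv: "sch P Q Gv" "\<forall>\<theta>\<in>Q. \<forall>X. delta v (G \<theta> X) = Gv \<theta> X"
    using sch_delta(2)[OF G v(1)] by blast
  obtain K where K: "sch P Q K" "\<forall>\<theta>\<in>Q. \<forall>X. delta (b' # v) (G \<theta> X) = K \<theta> X"
    using sch_delta(2)[OF G Cons.prems] by blast
  obtain Hv where Hv: "sch P Q Hv" "\<forall>\<theta>\<in>Q. \<forall>X. delta v (H \<theta> X) = Hv \<theta> X"
    using sch_delta(2)[OF H(2) v(1)] by blast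
  have e: "ddX Q b F F' \<longleftrightarrow> ddX Q b L L'"
    if "\<forall>\<theta>\<in>Q. \<forall>X. F \<theta> X = L \<theta> X" "\<forall>\<theta>\<in>Q. \<forall>X. F' \<theta> X = L' \<theta> X" for F F' L L' :: "_ \<Rightarrow> 'x \<Rightarrow> 'a"
  proof -
    have "F \<theta> = L \<theta>" "F' \<theta> = L' \<theta>" if "\<theta> \<in> Q" for \<theta> using that \<open>\<forall>\<theta>\<in>Q. \<forall>X. F \<theta> X = L \<theta> X\<close>
      \<open>\<forall>\<theta>\<in>Q. \<forall>X. F' \<theta> X = L' \<theta> X\<close> by (auto simp: fun_eq_iff)
    then show ?thesis by (simp add: ddX_def)
  qed
  have 1: "ddX Q b Gv Hv" using Cons.IH[OF v(1)] e[OF Gv(2) Hv(2)] by blast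
  have 2: "ddA Q b' Gv K" using A[OF G] Gv(2) K(2) by (simp add: ddA_def)
  have 3: "ddA Q b' Hv (\<lambda>\<theta> X. delta (b' # v) (H \<theta> X))" using A[OF H(2)] Hv(2) by (simp add: ddA_def)
  have "ddX Q b K (\<lambda>\<theta> X. delta (b' # v) (H \<theta> X))"
    by (rule sch_mixed[OF Gv(1) 1 b v(2) 2 K(1) 3])
  then show ?case using e[OF K(2)] by blast
qed (use H in simp)

lemma sch_seminorm_tendsto:
  assumes G: "sch P Q G" and \<theta>: "\<theta> \<in> Q"
  shows "((\<lambda>Y. smooth_seminorm \<Theta> k (G \<theta> Y - G \<theta> X)) \<longlongrightarrow> 0) (at X)"
proof -
  have "((\<lambda>Y. delta (mword \<alpha>) (G \<theta> Y - G \<theta> X)) \<longlongrightarrow> 0) (at X)" for \<alpha>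
  proof -
    obtain Gv where Gv: "sch P Q Gv" "\<forall>\<theta>\<in>Q. \<forall>X. delta (mword \<alpha>) (G \<theta> X) = Gv \<theta> X"
      using sch_delta(2)[OF G mword_lists] by blast
    have "((\<lambda>Y. Gv \<theta> Y - Gv \<theta> X) \<longlongrightarrow> 0) (at X)"
      using sch_continuous[OF Gv(1) \<theta>] by (simp add: continuous_on_def LIM_zero)
    then show ?thesis using Gv(2) \<theta> delta_diff(2)[OF sch_delta(1)[OF G \<theta>] sch_delta(1)[OF G \<theta>] mword_lists] by simp
  qed
  then have "((\<lambda>Y. smooth_seminorm \<Theta> k (G \<theta> Y - G \<theta> X)) \<longlongrightarrow>
      (\<Sum>\<alpha>\<in>multi_indices k. (1 / (\<Prod>b\<in>Basis. fact (\<alpha> (b::'x)))) * norm (0::'a))) (at X)"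
    unfolding smooth_seminorm_delta by (intro tendsto_sum tendsto_mult tendsto_norm tendsto_const)
  then show ?thesis by simp
qed

lemma sch_seminorm_derivative:
  assumes G: "sch P Q G" and H: "ddX Q b G H" "sch P Q H" and b: "b \<in> Basis" and \<theta>: "\<theta> \<in> Q"
  shows "((\<lambda>t. smooth_seminorm \<Theta> k ((1 / t) *\<^sub>R (G \<theta> (X + t *\<^sub>R b) - G \<theta> X) - H \<theta> X)) \<longlongrightarrow> 0) (at 0)"
proof -
  note svG = sch_delta(1)[OF G \<theta>] and svH = sch_delta(1)[OF H(2) \<theta>]
  have "((\<lambda>t. delta (mword \<alpha>) ((1 / t) *\<^sub>R (G \<theta> (X + t *\<^sub>R b) - G \<theta> X) - H \<theta> X)) \<longlongrightarrow> 0) (at 0)" for \<alpha>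
  proof -
    have dd: "f - g \<in> smooth_vectors \<Theta>" "delta (mword \<alpha>) (f - g) = delta (mword \<alpha>) f - delta (mword \<alpha>) g"
      if "f \<in> smooth_vectors \<Theta>" "g \<in> smooth_vectors \<Theta>" for f g
      by (rule delta_diff[OF that mword_lists])+
    have ds: "r *\<^sub>R f \<in> smooth_vectors \<Theta>" "delta (mword \<alpha>) (r *\<^sub>R f) = r *\<^sub>R delta (mword \<alpha>) f"
      if "f \<in> smooth_vectors \<Theta>" for f r
    proof -
      have z: "(0::'a) \<in> smooth_vectors \<Theta>" "delta (mword \<alpha>) 0 = 0"
        using dd[OF that that] by simp_all
      show "r *\<^sub>R f \<in> smooth_vectors \<Theta>" using smooth_vectors_lincomb[OF z(1) that, where r = r] by simp
      show "delta (mword \<alpha>) (r *\<^sub>R f) = r *\<^sub>R delta (mword \<alpha>) f"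
        using delta_lincomb[OF z(1) that mword_lists, where r = r] z(2) by simp
    qed
    have d: "delta (mword \<alpha>) ((1 / t) *\<^sub>R (G \<theta> (X + t *\<^sub>R b) - G \<theta> X) - H \<theta> X) =
       (1 / t) *\<^sub>R (delta (mword \<alpha>) (G \<theta> (X + t *\<^sub>R b)) - delta (mword \<alpha>) (G \<theta> X)) - delta (mword \<alpha>) (H \<theta> X)" for t
      by (simp only: dd ds svG svH)
    have "has_dd b (\<lambda>X. delta (mword \<alpha>) (G \<theta> X)) (\<lambda>X. delta (mword \<alpha>) (H \<theta> X))"
      using sch_ddX_delta[OF G H b mword_lists] \<theta> by (simp add: ddX_def)
    then show ?thesis
      unfolding d has_dd_def has_vector_derivative_at_iff by (simp add: LIM_zero)
  qed
  then have "((\<lambda>t. smooth_seminorm \<Theta> k ((1 / t) *\<^sub>R (G \<theta> (X + t *\<^sub>R b) - G \<theta> X) - H \<theta> X)) \<longlongrightarrow>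
      (\<Sum>\<alpha>\<in>multi_indices k. (1 / (\<Prod>b\<in>Basis. fact (\<alpha> (b::'x)))) * norm (0::'a))) (at 0)"
    unfolding smooth_seminorm_delta by (intro tendsto_sum tendsto_mult tendsto_norm tendsto_const)
  then show ?thesis by simp
qed

lemma sch_weight_bound:
  assumes P: "cone P" and F: "sch P Q F"
  shows "\<exists>p\<in>P. \<forall>\<theta>\<in>Q. \<forall>X. schwartz_weight \<Theta> i (F \<theta>) X \<le> p \<theta>"
proof -
  obtain k N \<beta> where i: "i = (k, N, \<beta>)" by (cases i)
  obtain G where G: "sch P Q G" "\<And>\<theta>. \<theta> \<in> Q \<Longrightarrow> partials (mword \<beta>) (F \<theta>) = G \<theta>"
    using sch_partials[OF F mword_lists] by blast
  have "\<exists>p\<in>P. \<forall>\<theta>\<in>Q. \<forall>X. (1 + norm X) ^ N * norm (delta (mword \<alpha>) (G \<theta> X)) \<le> p \<theta>" for \<alpha>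
  proof -
    obtain H where H: "sch P Q H" "\<And>\<theta> X. \<theta> \<in> Q \<Longrightarrow> delta (mword \<alpha>) (G \<theta> X) = H \<theta> X"
      using sch_delta(2)[OF G(1) mword_lists] by blast
    then show ?thesis using sch_rapid[OF H(1)] unfolding rapid_def by simp
  qed
  then obtain p where p: "\<And>\<alpha>. p \<alpha> \<in> P" "\<And>\<alpha> \<theta> X. \<theta> \<in> Q \<Longrightarrow> (1 + norm X) ^ N * norm (delta (mword \<alpha>) (G \<theta> X)) \<le> p \<alpha> \<theta>"
    by metis
  define c where "c = (\<lambda>\<alpha>::'x \<Rightarrow> nat. 1 / (\<Prod>b\<in>Basis. fact (\<alpha> b)) :: real)"
  have c: "c \<alpha> \<ge> 0" for \<alpha> unfolding c_def by (intro divide_nonneg_nonneg prod_nonneg) auto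
  have "schwartz_weight \<Theta> i (F \<theta>) X \<le> (\<Sum>\<alpha>\<in>multi_indices k. c \<alpha> * p \<alpha> \<theta>)" if \<theta>: "\<theta> \<in> Q" for \<theta> X
  proof -
    have "schwartz_weight \<Theta> i (F \<theta>) X = (\<Sum>\<alpha>\<in>multi_indices k. c \<alpha> * ((1 + norm X) ^ N * norm (delta (mword \<alpha>) (G \<theta> X))))"
      by (simp add: i schwartz_weight_def mpartial_mword G(2)[OF \<theta>] smooth_seminorm_delta c_def sum_distrib_left mult_ac)
    also have "\<dots> \<le> (\<Sum>\<alpha>\<in>multi_indices k. c \<alpha> * p \<alpha> \<theta>)"
      by (intro sum_mono mult_left_mono p \<theta> c)
    finally show ?thesis .
  qed
  moreover have "(\<lambda>\<theta>. \<Sum>\<alpha>\<in>multi_indices k. c \<alpha> * p \<alpha> \<theta>) \<in> P"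
    by (intro cone_sum[OF P] cone_scale[OF P] p c)
  ultimately show ?thesis by (intro bexI[of _ "\<lambda>\<theta>. \<Sum>\<alpha>\<in>multi_indices k. c \<alpha> * p \<alpha> \<theta>"]) auto
qed

text \<open>The converse of \<open>sch_seminorm_cone\<close>. With \<open>P = seminorm_cone\<close>
  the second statement bounds each seminorm of \<open>F \<theta>\<close> by finitely many seminorms
  of \<theta>, which for a linear dependence on \<theta> is continuity.\<close>

theorem sch_schwartz:
  assumes P: "cone P" and F: "sch P Q F"
  shows "\<theta> \<in> Q \<Longrightarrow> F \<theta> \<in> S"
    and "\<exists>p\<in>P. \<forall>\<theta>\<in>Q. schwartz_seminorm \<Theta> i (F \<theta>) \<le> p \<theta>"
proof -
  show "\<exists>p\<in>P. \<forall>\<theta>\<in>Q. schwartz_seminorm \<Theta> i (F \<theta>) \<le> p \<theta>"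
  proof -
    obtain p where p: "p \<in> P" "\<And>\<theta> X. \<theta> \<in> Q \<Longrightarrow> schwartz_weight \<Theta> i (F \<theta>) X \<le> p \<theta>"
      using sch_weight_bound[OF P F] by blast
    have "schwartz_seminorm \<Theta> i (F \<theta>) \<le> p \<theta>" if "\<theta> \<in> Q" for \<theta>
      unfolding schwartz_seminorm_def by (rule cSUP_least) (use p that in auto)
    then show ?thesis using p(1) by blast
  qed
  assume \<theta>: "\<theta> \<in> Q"
  have "smooth_into_smooth_vectors \<Theta> (F \<theta>)"
    unfolding smooth_into_smooth_vectors_def
  proof (intro ballI)
    fix w :: "'x list" assume w: "w \<in> lists Basis"
    obtain G where G: "sch P Q G" "\<And>\<theta>. \<theta> \<in> Q \<Longrightarrow> partials w (F \<theta>) = G \<theta>"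
      using sch_partials[OF F w] by blast
    have "((\<lambda>t. smooth_seminorm \<Theta> k ((1 / t) *\<^sub>R (partials w (F \<theta>) (X + t *\<^sub>R b) - partials w (F \<theta>) X)
        - partials (b # w) (F \<theta>) X)) \<longlongrightarrow> 0) (at 0)" if b: "b \<in> Basis" for b k X
    proof -
      obtain H where H: "ddX Q b G H" "sch P Q H" using sch_ddX[OF G(1) b] by blast
      have "partials (b # w) (F \<theta>) = H \<theta>" using H(1) \<theta> by (simp add: G(2)[OF \<theta>] ddX_def has_dd_partial)
      then show ?thesis using sch_seminorm_derivative[OF G(1) H b \<theta>] by (simp add: G(2)[OF \<theta>])
    qed
    then show "(\<forall>X. partials w (F \<theta>) X \<in> smooth_vectors \<Theta>) \<and>
      (\<forall>k X. ((\<lambda>Y. smooth_seminorm \<Theta> k (partials w (F \<theta>) Y - partials w (F \<theta>) X)) \<longlongrightarrow> 0) (at X)) \<and>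
      (\<forall>b\<in>Basis. \<forall>k X. ((\<lambda>t. smooth_seminorm \<Theta> k ((1 / t) *\<^sub>R (partials w (F \<theta>) (X + t *\<^sub>R b)
         - partials w (F \<theta>) X) - partials (b # w) (F \<theta>) X)) \<longlongrightarrow> 0) (at 0))"
      using sch_delta(1)[OF G(1) \<theta>] sch_seminorm_tendsto[OF G(1) \<theta>] by (simp add: G(2)[OF \<theta>] del: partials_Cons)
  qed
  moreover have "bdd_above (range (schwartz_weight \<Theta> i (F \<theta>)))" for i
    using sch_weight_bound[OF P F, of i] \<theta> by (auto simp: bdd_above_def)
  ultimately show "F \<theta> \<in> S" by (simp add: schwartz_space_def)
qed

text \<open>A single function as a family over a one-point parameter space, where the cone
  \<open>UNIV\<close> only asks for finite bounds.\<close>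

definition schw :: "('x \<Rightarrow> 'a) \<Rightarrow> bool" where
  "schw F \<longleftrightarrow> sch UNIV UNIV (\<lambda>_::unit. F)"

lemma schw_iff: "schw F \<longleftrightarrow> F \<in> S"
proof
  assume "schw F" then show "F \<in> S" unfolding schw_def by (rule sch_schwartz(1)[OF cone_UNIV, of UNIV "\<lambda>_. F" "()"]) simp
next
  assume "F \<in> S" then show "schw F"
    unfolding schw_def by (intro sch_reindex[OF _ _ _ sch_seminorm_cone, where g = "\<lambda>_. F"]) auto
qed

end

section \<open>The symplectic Fourier transform and the two products on Schwartz functions\<close>

lemma has_dd_affine:
  assumes "has_dd b f g"
  shows "has_dd b (\<lambda>X. f (s *\<^sub>R X + v)) (\<lambda>X. s *\<^sub>R g (s *\<^sub>R X + v))"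
  unfolding has_dd_def
proof
  fix X
  have 1: "((\<lambda>t. t * s) has_vector_derivative s) (at 0)"
    using has_vector_derivative_mult_left[OF has_vector_derivative_id, of s "at 0"] by simp
  have der: "((\<lambda>t. f ((s *\<^sub>R X + v) + t *\<^sub>R b)) has_vector_derivative g (s *\<^sub>R X + v)) (at (0 * s))"
    using assms by (simp add: has_dd_def)
  have e: "s *\<^sub>R (X + t *\<^sub>R b) + v = (s *\<^sub>R X + v) + (t * s) *\<^sub>R b" for t
    by (simp add: scaleR_add_right mult.commute)
  from vector_diff_chain_at[OF 1 der]
  show "((\<lambda>t. f (s *\<^sub>R (X + t *\<^sub>R b) + v)) has_vector_derivative s *\<^sub>R g (s *\<^sub>R X + v)) (at 0)"
    by (simp only: o_def e)
qed

lemma has_dd_integral: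
  fixes k :: "'x::euclidean_space \<Rightarrow> 'y::euclidean_space \<Rightarrow> 'b::banach"
  assumes d: "\<And>Y. has_dd b (\<lambda>X. k X Y) (\<lambda>X. k' X Y)" and k: "\<And>X. dec (k X)"
    and c: "\<And>X. continuous_on UNIV (k' X)" and bd: "\<And>X Y. norm (k' X Y) \<le> C * wt Y"
  shows "has_dd b (\<lambda>X. integral UNIV (k X)) (\<lambda>X. integral UNIV (k' X))"
  unfolding has_dd_def
proof
  fix X
  have "((\<lambda>t. integral UNIV (k (X + t *\<^sub>R b))) has_vector_derivative integral UNIV (k' (X + 0 *\<^sub>R b))) (at 0)"
    by (rule has_vector_derivative_integral[OF has_dd_at[OF d] bd k c])
  then show "((\<lambda>t. integral UNIV (k (X + t *\<^sub>R b))) has_vector_derivative integral UNIV (k' X)) (at 0)"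
    by simp
qed

lemma dint_bounded_linear:
  assumes "bounded_linear L" "f integrable_on UNIV"
  shows "L (dint c f) = dint c (\<lambda>Y. L (f Y))"
  using integral_linear[OF assms(2,1)] linear_scale[OF bounded_linear.linear[OF assms(1)]]
  by (simp add: dint_def o_def)

text \<open>Nondegeneracy makes the linear map with coordinates \<open>B X b\<close> injective, and
  an injective linear map in finite dimension is bounded below. It converts decay in the values of
  the form into decay in the norm.\<close>

lemma bilinear_nondegenerate_bound:
  fixes B :: "'y::euclidean_space \<Rightarrow> 'y \<Rightarrow> real"
  assumes l: "\<And>Y. linear (\<lambda>X. B X Y)" and nd: "\<And>X. (\<And>b. b \<in> Basis \<Longrightarrow> B X b = 0) \<Longrightarrow> X = 0"
  shows "\<exists>K\<ge>0. \<forall>X. norm X \<le> K * (\<Sum>b\<in>Basis. \<bar>B X b\<bar>)"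
proof -
  let ?L = "\<lambda>X. \<Sum>b\<in>Basis. B X b *\<^sub>R b"
  have lin: "linear ?L"
    by (intro linear_compose_sum ballI) (auto intro!: linearI simp: linear_add[OF l] linear_scale[OF l] scaleR_add_left)
  have "inj ?L"
    unfolding linear_injective_0[OF lin]
  proof (intro allI impI)
    fix X assume 0: "?L X = 0"
    show "X = 0"
    proof (rule nd)
      fix b :: 'y assume b: "b \<in> Basis"
      have "B X b = ?L X \<bullet> b" using b by (simp add: inner_sum_left_Basis)
      then show "B X b = 0" using 0 by simp
    qed
  qed
  then obtain m where m: "m > 0" "\<And>X. m * norm X \<le> norm (?L X)"
    using linear_inj_bounded_below_pos[OF lin] by blast
  have "norm X \<le> (1 / m) * (\<Sum>b\<in>Basis. \<bar>B X b\<bar>)" for X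
  proof -
    have "norm (?L X) \<le> (\<Sum>b\<in>Basis. \<bar>B X b\<bar>)"
      by (rule order_trans[OF norm_sum]) (auto intro!: sum_mono)
    then have "m * norm X \<le> (\<Sum>b\<in>Basis. \<bar>B X b\<bar>)" using m(2)[of X] by linarith
    then show ?thesis using m(1) by (simp add: field_simps)
  qed
  then show ?thesis using m(1) by (intro exI[of _ "1 / m"]) auto
qed

section \<open>The symplectic form\<close>

locale symplectic =
  fixes \<omega> :: "'x::euclidean_space \<Rightarrow> 'x \<Rightarrow> real"
  assumes sf: "symplectic_form \<omega>"
begin

lemma linear_form: "linear (\<omega> X)" "linear (\<lambda>X. \<omega> X Y)"
  using sf by (auto simp: symplectic_form_def)

lemma bounded_bilinear_form: "bounded_bilinear \<omega>"
  using linear_form by (simp add: bilinear_def bilinear_conv_bounded_bilinear[symmetric])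

sublocale \<omega>: bounded_bilinear \<omega>
  by (rule bounded_bilinear_form)

lemmas continuous_on_form [continuous_intros] = \<omega>.continuous_on

lemma form_self [simp]: "\<omega> X X = 0"
  using sf by (simp add: symplectic_form_def)

lemma form_antisym: "\<omega> X Y = - \<omega> Y X"
proof -
  have "\<omega> (X + Y) (X + Y) = \<omega> X X + \<omega> X Y + (\<omega> Y X + \<omega> Y Y)"
    by (simp only: \<omega>.add_left \<omega>.add_right)
  then show ?thesis by simp
qed

lemma form_nondegenerate:
  assumes "\<And>b. b \<in> Basis \<Longrightarrow> \<omega> X b = 0"
  shows "X = 0"
proof -
  have "\<omega> X Y = 0" for Y
  proof -
    have "\<omega> X Y = (\<Sum>b\<in>Basis. (Y \<bullet> b) * \<omega> X b)"
      using \<omega>.sum_right[of X "\<lambda>b. (Y \<bullet> b) *\<^sub>R b" Basis] by (simp add: euclidean_representation \<omega>.scaleR_right)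
    then show ?thesis using assms by simp
  qed
  then show ?thesis using sf by (auto simp: symplectic_form_def)
qed

lemma form_bound: "\<exists>K\<ge>0. \<forall>X. norm X \<le> K * (\<Sum>b\<in>Basis. \<bar>\<omega> X b\<bar>)"
  by (rule bilinear_nondegenerate_bound[OF linear_form(2) form_nondegenerate])

end

definition FT :: "('x::euclidean_space \<Rightarrow> 'x \<Rightarrow> real) \<Rightarrow> real \<Rightarrow> ('x \<Rightarrow> 'a::cstar_algebra) \<Rightarrow> 'x \<Rightarrow> 'a" where
  "FT \<omega> c f X = dint c (\<lambda>Y. cis (- \<omega> X Y) *\<^sub>C f Y)"

context caction
begin

lemma hasA_integral:
  fixes k :: "'y::euclidean_space \<Rightarrow> 'a"
  assumes d: "\<And>Y. hasA b (k Y) (k' Y)" and k: "dec k" and k': "dec k'"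
  shows "hasA b (integral UNIV k) (integral UNIV k')"
proof -
  obtain C where C: "\<And>Y. norm (k' Y) \<le> C * wt Y" using k' by (auto simp: dec_def)
  have "((\<lambda>t. integral UNIV (\<lambda>Y. \<Theta> (t *\<^sub>R b) (k Y))) has_vector_derivative
      integral UNIV (\<lambda>Y. \<Theta> (0 *\<^sub>R b) (k' Y))) (at 0)"
  proof (rule has_vector_derivative_integral)
    show "((\<lambda>s. \<Theta> (s *\<^sub>R b) (k Y)) has_vector_derivative \<Theta> (t *\<^sub>R b) (k' Y)) (at t)" for t Y
      using has_dd_at[OF hasA_dd[OF d[of Y]], of 0 t] by simp
    show "dec (\<lambda>Y. \<Theta> (t *\<^sub>R b) (k Y))" for t
      by (rule dec_bounded[OF k, of _ 1]) (auto intro!: continuous_intros dec_continuous[OF k])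
  qed (use C dec_continuous[OF k'] in auto)
  moreover have "integral UNIV (\<lambda>Y. \<Theta> (t *\<^sub>R b) (k Y)) = \<Theta> (t *\<^sub>R b) (integral UNIV k)" for t
    using integral_linear[OF dec_integrable[OF k] bounded_linear_act] by (simp add: o_def)
  ultimately show ?thesis by (simp add: hasA_def)
qed

lemma hasA_dint:
  "(\<And>Y. hasA b (k Y) (k' Y)) \<Longrightarrow> dec k \<Longrightarrow> dec k' \<Longrightarrow> hasA b (dint c k) (dint c k')"
  unfolding dint_def by (rule hasA_map[OF bounded_linear_scaleR_right act_scaleR hasA_integral])

end

lemma has_dd_dint:
  fixes k :: "'x::euclidean_space \<Rightarrow> 'x \<Rightarrow> 'b::banach"
  assumes d: "\<And>Y. has_dd b (\<lambda>X. k X Y) (\<lambda>X. k' X Y)" and k: "\<And>X. dec (k X)"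
    and c: "\<And>X. continuous_on UNIV (k' X)" and bd: "\<And>X Y. norm (k' X Y) \<le> C * wt Y"
  shows "has_dd b (\<lambda>X. dint c (k X)) (\<lambda>X. dint c (k' X))"
  unfolding dint_def by (rule bounded_linear.has_dd[OF bounded_linear_scaleR_right has_dd_integral[OF d k c bd]])

lemma norm_dint_le:
  fixes k :: "'x::euclidean_space \<Rightarrow> 'b::banach"
  assumes "dec k" "\<And>Y. norm (k Y) \<le> C * wt Y"
  shows "norm (dint c k) \<le> (\<bar>c\<bar> * integral UNIV (wt::'x \<Rightarrow> real)) * C"
  using mult_left_mono[OF norm_integral_le[OF assms] abs_ge_zero[of c]] by (simp add: dint_def mult_ac)

lemma dint_add: "dec k \<Longrightarrow> dec l \<Longrightarrow> dint c (\<lambda>Y. k Y + l Y) = dint c k + dint c l"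
  for k :: "'x::euclidean_space \<Rightarrow> 'b::banach"
  by (simp add: dint_def integral_add dec_integrable scaleR_add_right)

section \<open>The Fourier transform of Schwartz families\<close>

locale fourier = caction \<Theta> + symplectic \<omega>
  for \<Theta> :: "'x::euclidean_space \<Rightarrow> 'a::cstar_algebra \<Rightarrow> 'a" and \<omega> :: "'x \<Rightarrow> 'x \<Rightarrow> real" +
  fixes c :: real
begin

lemma dec_cis: "dec f \<Longrightarrow> continuous_on UNIV g \<Longrightarrow> dec (\<lambda>Y. cis (g Y) *\<^sub>C f Y)"
  for f :: "'y::euclidean_space \<Rightarrow> 'a"
  by (rule dec_bounded[of f _ 1])
     (auto simp: norm_scaleC dec_continuous intro!: continuous_on_scaleC continuous_on_cis)

lemma dec_FT: "dec f \<Longrightarrow> dec (\<lambda>Y. cis (- \<omega> X Y) *\<^sub>C f Y)" for f :: "'x \<Rightarrow> 'a"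
  by (rule dec_cis) (auto intro!: continuous_intros)

text \<open>Integration by parts: the derivative of
  \<open>cis (- \<omega> X Y) *\<^sub>C f Y\<close> in Y along b has integral 0, and differentiating
  the phase contributes the factor -i [X, b].\<close>

lemma FT_has_dd:
  fixes f :: "'x \<Rightarrow> 'a"
  assumes f: "dec f" and f': "dec f'" and d: "has_dd b f f'"
  shows "FT \<omega> c f' X = \<i> *\<^sub>C (\<omega> X b *\<^sub>R FT \<omega> c f X)"
proof -
  let ?e = "\<lambda>Y. cis (- \<omega> X Y)"
  have e: "has_dd b ?e (\<lambda>Y. \<i> * of_real (- \<omega> X b) * ?e Y)"
    by (intro has_dd_cis has_dd_linear) (auto intro!: linear_compose_neg linear_form)
  have dd: "has_dd b (\<lambda>Y. ?e Y *\<^sub>C f Y) (\<lambda>Y. ?e Y *\<^sub>C f' Y + (\<i> * of_real (- \<omega> X b) * ?e Y) *\<^sub>C f Y)"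
    by (rule scaleC.has_dd[OF e d])
  have eq: "(\<i> * of_real (- \<omega> X b) * ?e Y) *\<^sub>C f Y = (- (\<i> * of_real (\<omega> X b))) *\<^sub>C (?e Y *\<^sub>C f Y)" for Y
    by (simp add: scaleC_scaleC)
  have i1: "dec (\<lambda>Y. ?e Y *\<^sub>C f' Y)" and i2: "dec (\<lambda>Y. ?e Y *\<^sub>C f Y)" by (rule dec_FT[OF f'] dec_FT[OF f])+
  have i3: "dec (\<lambda>Y. (- (\<i> * of_real (\<omega> X b))) *\<^sub>C (?e Y *\<^sub>C f Y))"
    by (rule dec_bounded[OF i2, of _ "\<bar>\<omega> X b\<bar>"])
       (auto simp: norm_scaleC norm_mult intro!: continuous_intros dec_continuous[OF i2, unfolded o_def])
  have "integral UNIV (\<lambda>Y. ?e Y *\<^sub>C f' Y + (- (\<i> * of_real (\<omega> X b))) *\<^sub>C (?e Y *\<^sub>C f Y)) = 0"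
    by (rule integral_has_dd_0[OF dd[unfolded eq] i2 dec_add[OF i1 i3]])
  then have "integral UNIV (\<lambda>Y. ?e Y *\<^sub>C f' Y) =
      - integral UNIV (\<lambda>Y. (- (\<i> * of_real (\<omega> X b))) *\<^sub>C (?e Y *\<^sub>C f Y))"
    using dec_integrable[OF i1] dec_integrable[OF i3] by (simp add: integral_add eq_neg_iff_add_eq_0)
  also have "\<dots> = (\<i> * of_real (\<omega> X b)) *\<^sub>C integral UNIV (\<lambda>Y. ?e Y *\<^sub>C f Y)"
    using integral_linear[OF dec_integrable[OF i2] scaleC.bounded_linear_right, of "- (\<i> * of_real (\<omega> X b))"]
    by (simp add: o_def scaleC.minus_left)
  finally show ?thesis
    by (simp add: FT_def dint_def scaleR_scaleC scaleC_scaleC mult_ac)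
qed

text \<open>Induction on the power N. One more factor \<open>norm X\<close> is bounded, by
  \<open>form_bound\<close>, through the factors [X, b]; each of these is absorbed by replacing F
  with its derivative along b, for which the induction hypothesis holds.\<close>

lemma FT_sch_bound:
  assumes P: "cone P" and F: "sch P Q F"
  shows "\<exists>p\<in>P. \<forall>\<theta>\<in>Q. \<forall>X. (1 + norm X) ^ N * norm (FT \<omega> c (F \<theta>) X) \<le> p \<theta>"
  using F
proof (induction N arbitrary: F)
  case 0
  obtain p where p: "p \<in> P" "\<And>\<theta>. \<theta> \<in> Q \<Longrightarrow> dec (F \<theta>)" "\<And>\<theta> X. \<theta> \<in> Q \<Longrightarrow> norm (F \<theta> X) \<le> p \<theta> * wt X"
    using rapid_dec[OF P sch_rapid[OF 0]] by blast
  define W where "W = \<bar>c\<bar> * integral UNIV (wt::'x \<Rightarrow> real)"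
  have "norm (FT \<omega> c (F \<theta>) X) \<le> W * p \<theta>" if "\<theta> \<in> Q" for \<theta> X
    unfolding FT_def W_def by (rule norm_dint_le[OF dec_FT[OF p(2)[OF that]]]) (simp add: norm_scaleC p(3)[OF that])
  moreover have "W \<ge> 0" by (simp add: W_def integral_wt_nonneg)
  ultimately show ?case by (intro bexI[of _ "\<lambda>\<theta>. W * p \<theta>"] cone_scale[OF P p(1)]) auto
next
  case (Suc N)
  obtain K where K: "K \<ge> 0" "\<And>X. norm X \<le> K * (\<Sum>b\<in>Basis. \<bar>\<omega> X b\<bar>)" using form_bound by blast
  define H where "H = (\<lambda>b. SOME H. ddX Q b F H \<and> sch P Q H)"
  have H: "ddX Q b F (H b)" "sch P Q (H b)" if "b \<in> Basis" for b
    using someI_ex[OF sch_ddX[OF Suc.prems that]] by (simp_all add: H_def)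
  define p where "p = (\<lambda>b. SOME p. p \<in> P \<and> (\<forall>\<theta>\<in>Q. \<forall>X. (1 + norm X) ^ N * norm (FT \<omega> c (H b \<theta>) X) \<le> p \<theta>))"
  have p: "p b \<in> P \<and> (\<forall>\<theta>\<in>Q. \<forall>X. (1 + norm X) ^ N * norm (FT \<omega> c (H b \<theta>) X) \<le> p b \<theta>)" if "b \<in> Basis" for b
    unfolding p_def by (rule someI_ex[OF Suc.IH[OF H(2)[OF that], unfolded Bex_def]])
  obtain q where q: "q \<in> P" "\<And>\<theta> X. \<theta> \<in> Q \<Longrightarrow> (1 + norm X) ^ N * norm (FT \<omega> c (F \<theta>) X) \<le> q \<theta>"
    using Suc.IH[OF Suc.prems] by blast
  have "(1 + norm X) ^ Suc N * norm (FT \<omega> c (F \<theta>) X) \<le> q \<theta> + K * (\<Sum>b\<in>Basis. p b \<theta>)" if \<theta>: "\<theta> \<in> Q" for \<theta> X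
  proof -
    let ?n = "norm (FT \<omega> c (F \<theta>) X)" and ?m = "(1 + norm X) ^ N"
    have m: "?m \<ge> 0" by simp
    have b: "\<bar>\<omega> X b\<bar> * (?m * ?n) \<le> p b \<theta>" if b: "b \<in> Basis" for b
    proof -
      have "dec (F \<theta>)" "dec (H b \<theta>)"
        using rapid_dec[OF P sch_rapid[OF Suc.prems]] rapid_dec[OF P sch_rapid[OF H(2)[OF b]]] \<theta> by blast+
      moreover have "has_dd b (F \<theta>) (H b \<theta>)" using H(1)[OF b] \<theta> by (simp add: ddX_def)
      ultimately have "norm (FT \<omega> c (H b \<theta>) X) = \<bar>\<omega> X b\<bar> * ?n"
        by (simp add: FT_has_dd norm_scaleC)
      then show ?thesis using p[OF b] \<theta> by (metis mult.left_commute)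
    qed
    have "norm X * (?m * ?n) \<le> (K * (\<Sum>b\<in>Basis. \<bar>\<omega> X b\<bar>)) * (?m * ?n)"
      by (intro mult_right_mono K) auto
    also have "\<dots> = K * (\<Sum>b\<in>Basis. \<bar>\<omega> X b\<bar> * (?m * ?n))" by (simp add: sum_distrib_right)
    also have "\<dots> \<le> K * (\<Sum>b\<in>Basis. p b \<theta>)" by (intro mult_left_mono sum_mono b K)
    finally have 1: "norm X * (?m * ?n) \<le> K * (\<Sum>b\<in>Basis. p b \<theta>)" .
    have "(1 + norm X) ^ Suc N * ?n = ?m * ?n + norm X * (?m * ?n)" by (simp add: algebra_simps)
    then show ?thesis using 1 q(2)[OF \<theta>, of X] by linarith
  qed
  moreover have "(\<lambda>\<theta>. q \<theta> + K * (\<Sum>b\<in>Basis. p b \<theta>)) \<in> P"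
    using p by (intro cone_add[OF P] cone_scale[OF P] cone_sum[OF P] q K) blast
  ultimately show ?case by (intro bexI[of _ "\<lambda>\<theta>. q \<theta> + K * (\<Sum>b\<in>Basis. p b \<theta>)"]) auto
qed

text \<open>Differentiating the transform in X along b multiplies F by -i [b, Y], which
  \<open>sch_linear\<close> permits; derivatives along the action pass through the integral. So the
  transforms of Schwartz families form a closed class.\<close>

lemma FT_sch:
  assumes P: "cone P" and F: "sch P Q F"
  shows "sch P Q (\<lambda>\<theta>. FT \<omega> c (F \<theta>))"
proof (rule sch_coinduct[OF P, where C = "{(\<lambda>\<theta>. FT \<omega> c (F \<theta>)) |F. sch P Q F}"])
  fix F and b :: 'x assume "F \<in> {(\<lambda>\<theta>. FT \<omega> c (F \<theta>)) |F. sch P Q F}"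
  then obtain G where F: "F = (\<lambda>\<theta>. FT \<omega> c (G \<theta>))" and G: "sch P Q G" by blast
  obtain p where p: "\<And>\<theta>. \<theta> \<in> Q \<Longrightarrow> dec (G \<theta>)" "\<And>\<theta> X. \<theta> \<in> Q \<Longrightarrow> norm (G \<theta> X) \<le> p \<theta> * wt X"
    using rapid_dec[OF P sch_rapid[OF G]] by blast
  show "rapid P Q F"
    unfolding rapid_def
  proof (intro conjI ballI allI)
    fix \<theta> assume \<theta>: "\<theta> \<in> Q"
    show "continuous_on UNIV (F \<theta>)"
      unfolding F FT_def dint_def
    proof (intro continuous_intros continuous_on_integral)
      show "continuous_on (UNIV \<times> UNIV) (\<lambda>(X, Y). cis (- \<omega> X Y) *\<^sub>C G \<theta> Y)"
        unfolding split_beta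
        by (intro continuous_on_scaleC continuous_on_cis continuous_intros
            continuous_on_compose2[OF dec_continuous[OF p(1)[OF \<theta>]]]) auto
      show "norm (cis (- \<omega> X Y) *\<^sub>C G \<theta> Y) \<le> p \<theta> * wt Y" for X Y
        using p(2)[OF \<theta>] by (simp add: norm_scaleC)
    qed
  next
    fix N
    show "\<exists>p\<in>P. \<forall>\<theta>\<in>Q. \<forall>X. (1 + norm X) ^ N * norm (F \<theta> X) \<le> p \<theta>"
      unfolding F by (rule FT_sch_bound[OF P G])
  qed
  assume b: "b \<in> Basis"
  show "\<exists>H. ddX Q b F H \<and> addspan {(\<lambda>\<theta>. FT \<omega> c (F \<theta>)) |F. sch P Q F} H"
  proof (intro exI conjI)
    let ?H = "\<lambda>\<theta> Y. (- \<i>) *\<^sub>C (\<omega> b Y *\<^sub>R G \<theta> Y)"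
    have H: "sch P Q ?H" by (intro sch_scaleC[OF P] sch_linear[OF P] linear_form G)
    obtain q where q: "\<And>\<theta>. \<theta> \<in> Q \<Longrightarrow> dec (?H \<theta>)" "\<And>\<theta> X. \<theta> \<in> Q \<Longrightarrow> norm (?H \<theta> X) \<le> q \<theta> * wt X"
      using rapid_dec[OF P sch_rapid[OF H]] by blast
    show "ddX Q b F (\<lambda>\<theta>. FT \<omega> c (?H \<theta>))"
      unfolding ddX_def F FT_def
    proof
      fix \<theta> assume \<theta>: "\<theta> \<in> Q"
      show "has_dd b (\<lambda>X. dint c (\<lambda>Y. cis (- \<omega> X Y) *\<^sub>C G \<theta> Y)) (\<lambda>X. dint c (\<lambda>Y. cis (- \<omega> X Y) *\<^sub>C ?H \<theta> Y))"
      proof (rule has_dd_dint)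
        fix Y
        have "has_dd b (\<lambda>X. cis (- \<omega> X Y)) (\<lambda>X. \<i> * of_real (- \<omega> b Y) * cis (- \<omega> X Y))"
          by (intro has_dd_cis has_dd_linear) (auto intro!: linear_compose_neg linear_form)
        from bounded_linear.has_dd[OF scaleC.bounded_linear_left this, of "G \<theta> Y"]
        show "has_dd b (\<lambda>X. cis (- \<omega> X Y) *\<^sub>C G \<theta> Y) (\<lambda>X. cis (- \<omega> X Y) *\<^sub>C ?H \<theta> Y)"
          by (simp add: scaleR_scaleC scaleC_scaleC mult_ac)
      next
        show "norm (cis (- \<omega> X Y) *\<^sub>C ?H \<theta> Y) \<le> q \<theta> * wt Y" for X Y
          using q(2)[OF \<theta>, of Y] by (simp add: norm_scaleC)
      qed (intro dec_FT p \<theta> dec_continuous q)+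
    qed
    show "addspan {(\<lambda>\<theta>. FT \<omega> c (F \<theta>)) |F. sch P Q F} (\<lambda>\<theta>. FT \<omega> c (?H \<theta>))"
      using H by (intro addspan_base CollectI exI[of _ ?H]) simp
  qed
  show "\<exists>H. ddA Q b F H \<and> addspan {(\<lambda>\<theta>. FT \<omega> c (F \<theta>)) |F. sch P Q F} H"
  proof -
    obtain H where H: "ddA Q b G H" "sch P Q H" using sch_ddA[OF G b] by blast
    have "hasA b (FT \<omega> c (G \<theta>) X) (FT \<omega> c (H \<theta>) X)" if \<theta>: "\<theta> \<in> Q" for \<theta> X
      unfolding FT_def
    proof (rule hasA_dint)
      show "hasA b (cis (- \<omega> X Y) *\<^sub>C G \<theta> Y) (cis (- \<omega> X Y) *\<^sub>C H \<theta> Y)" for Y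
        using H(1) \<theta> by (intro hasA_map[OF scaleC.bounded_linear_right act_scaleC]) (simp add: ddA_def)
      show "dec (\<lambda>Y. cis (- \<omega> X Y) *\<^sub>C G \<theta> Y)" by (rule dec_FT[OF p(1)[OF \<theta>]])
      show "dec (\<lambda>Y. cis (- \<omega> X Y) *\<^sub>C H \<theta> Y)"
        using rapid_dec[OF P sch_rapid[OF H(2)]] \<theta> by (intro dec_FT) blast
    qed
    then have "ddA Q b F (\<lambda>\<theta>. FT \<omega> c (H \<theta>))" by (simp add: F ddA_def)
    then show ?thesis using H(2) by (intro exI[of _ "\<lambda>\<theta>. FT \<omega> c (H \<theta>)"] conjI addspan_base) auto
  qed
qed (use F in auto)

lemma sch_dec:
  assumes "cone P" "sch P Q F" "\<theta> \<in> Q"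
  shows "dec (F \<theta>)"
  using rapid_dec[OF assms(1) sch_rapid[OF assms(2)]] assms(3) by blast

lemma M_map_FT: "M_map \<omega> c \<Theta> F = FT \<omega> c (\<lambda>Y. \<Theta> (1 *\<^sub>R Y) (F Y))"
  by (simp add: M_map_def FT_def fun_eq_iff)

lemma M_inv_FT:
  assumes "dec G"
  shows "M_inv \<omega> c \<Theta> G X = \<Theta> (- 1 *\<^sub>R X) (FT \<omega> c G X)"
  using dint_bounded_linear[OF bounded_linear_act dec_integrable[OF dec_FT[OF assms]]]
  by (simp add: M_inv_def FT_def act_scaleC)

lemma M_map_sch: "cone P \<Longrightarrow> sch P Q F \<Longrightarrow> sch P Q (\<lambda>\<theta>. M_map \<omega> c \<Theta> (F \<theta>))"
  unfolding M_map_FT by (intro FT_sch sch_act)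

text \<open>Taking the automorphism out of the integral requires an integrable function, which is
  known only for parameters in \<open>Q\<close>; hence the auxiliary family that agrees with
  \<open>M_inv\<close> there.\<close>

lemma M_inv_sch:
  assumes P: "cone P" and F: "sch P Q F"
  shows "\<exists>G. sch P Q G \<and> (\<forall>\<theta>\<in>Q. G \<theta> = M_inv \<omega> c \<Theta> (F \<theta>))"
proof (intro exI conjI ballI)
  show "sch P Q (\<lambda>\<theta> X. \<Theta> (- 1 *\<^sub>R X) (FT \<omega> c (F \<theta>) X))" by (intro sch_act FT_sch P F)
  show "(\<lambda>X. \<Theta> (- 1 *\<^sub>R X) (FT \<omega> c (F \<theta>) X)) = M_inv \<omega> c \<Theta> (F \<theta>)" if "\<theta> \<in> Q" for \<theta>
    using M_inv_FT[OF sch_dec[OF P F that]] by (simp add: fun_eq_iff)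
qed

end

subsection \<open>The twisted convolution\<close>

context caction
begin

lemma schw_coinduct:
  assumes C1: "\<And>F. F \<in> C \<Longrightarrow> continuous_on UNIV F"
    and C2: "\<And>F N. F \<in> C \<Longrightarrow> \<exists>K. \<forall>X. (1 + norm X) ^ N * norm (F X) \<le> K"
    and X: "\<And>F b. F \<in> C \<Longrightarrow> b \<in> Basis \<Longrightarrow> \<exists>H. has_dd b F H \<and> addspan C H"
    and A: "\<And>F b. F \<in> C \<Longrightarrow> b \<in> Basis \<Longrightarrow> \<exists>H. (\<forall>X. hasA b (F X) (H X)) \<and> addspan C H"
    and F: "F \<in> C"
  shows "schw F"
proof -
  let ?C = "(\<lambda>F (_::unit). F) ` C"
  have sp: "addspan ?C (\<lambda>_. H)" if "addspan C H" for H
    using that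
  proof (induction rule: addspan.induct)
    case (addspan_add F F')
    have "addspan ?C ((\<lambda>_. F) + (\<lambda>_. F'))" by (rule addspan.addspan_add[OF addspan_add.IH])
    then show ?case by (simp add: plus_fun_def)
  qed (auto intro: addspan_base)
  show ?thesis unfolding schw_def
  proof (rule sch_coinduct[where C = ?C])
    fix F' and b :: 'x assume "F' \<in> ?C"
    then obtain F where F': "F' = (\<lambda>_. F)" and F: "F \<in> C" by blast
    show "rapid UNIV UNIV F'"
      unfolding rapid_def F'
    proof (intro conjI ballI allI C1[OF F])
      fix N
      obtain K where "\<forall>X. (1 + norm X) ^ N * norm (F X) \<le> K" using C2[OF F] by blast
      then show "\<exists>p\<in>UNIV. \<forall>\<theta>\<in>UNIV. \<forall>X. (1 + norm X) ^ N * norm (F X) \<le> p \<theta>"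
        by (intro bexI[of _ "\<lambda>_. K"]) auto
    qed
    assume b: "b \<in> Basis"
    obtain H where "has_dd b F H" "addspan C H" using X[OF F b] by blast
    then show "\<exists>H. ddX UNIV b F' H \<and> addspan ?C H"
      by (intro exI[of _ "\<lambda>_. H"]) (simp add: F' ddX_def sp)
    obtain H where "\<forall>X. hasA b (F X) (H X)" "addspan C H" using A[OF F b] by blast
    then show "\<exists>H. ddA UNIV b F' H \<and> addspan ?C H"
      by (intro exI[of _ "\<lambda>_. H"]) (simp add: F' ddA_def sp)
  qed (use F in auto)
qed

lemma schw_continuous: "schw F \<Longrightarrow> continuous_on UNIV F"
  unfolding schw_def using sch_continuous[of UNIV UNIV "\<lambda>_::unit. F" "()"] by simp

lemma schw_bound:
  assumes "schw F" shows "\<exists>K\<ge>0. \<forall>X. (1 + norm X) ^ N * norm (F X) \<le> K"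
proof -
  obtain p where p: "\<And>X. (1 + norm X) ^ N * norm (F X) \<le> p ()"
    using sch_rapid[OF assms[unfolded schw_def]] unfolding rapid_def by blast
  have "0 \<le> (1 + norm (0::'x)) ^ N * norm (F 0)" by (intro mult_nonneg_nonneg) auto
  then show ?thesis using p order_trans by blast
qed

lemma schw_wt_bound:
  assumes "schw F" shows "\<exists>K\<ge>0. \<forall>X. (1 + norm X) ^ N * norm (F X) \<le> K * wt X"
proof -
  obtain K where K: "K \<ge> 0" "\<And>X. (1 + norm X) ^ (2 * DIM('x) + N) * norm (F X) \<le> K"
    using schw_bound[OF assms] by blast
  have "(1 + norm X) ^ N * norm (F X) \<le> K * wt X" for X
    by (rule wt_rapid) (use K(2)[of X] in \<open>simp add: power_add mult_ac\<close>)
  then show ?thesis using K(1) by blast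
qed

lemma schw_dec: "schw F \<Longrightarrow> dec F"
  using schw_wt_bound[of F 0] schw_continuous by (auto simp: dec_def)

lemma schw_has_dd: assumes "schw F" "b \<in> Basis" shows "\<exists>H. has_dd b F H \<and> schw H"
proof -
  obtain H :: "unit \<Rightarrow> 'x \<Rightarrow> 'a" where H: "ddX UNIV b (\<lambda>_. F) H" "sch UNIV UNIV H"
    using sch_ddX[OF assms(1)[unfolded schw_def] assms(2)] by blast
  have "(\<lambda>_. H ()) = H" by auto
  then show ?thesis using H unfolding schw_def ddX_def by (intro exI[of _ "H ()"]) simp
qed

lemma schw_hasA: assumes "schw F" "b \<in> Basis" shows "\<exists>H. (\<forall>X. hasA b (F X) (H X)) \<and> schw H"
proof -
  obtain H :: "unit \<Rightarrow> 'x \<Rightarrow> 'a" where H: "ddA UNIV b (\<lambda>_. F) H" "sch UNIV UNIV H"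
    using sch_ddA[OF assms(1)[unfolded schw_def] assms(2)] by blast
  have "(\<lambda>_. H ()) = H" by auto
  then show ?thesis using H unfolding schw_def ddA_def by (intro exI[of _ "H ()"]) simp
qed

lemma schw_add: "schw F \<Longrightarrow> schw G \<Longrightarrow> schw (\<lambda>X. F X + G X)"
  unfolding schw_def by (rule sch_add'[OF cone_UNIV])

lemma schw_scaleC: "schw F \<Longrightarrow> schw (\<lambda>X. a *\<^sub>C F X)"
  unfolding schw_def by (rule sch_scaleC[OF cone_UNIV])

lemma schw_scaleR: "schw F \<Longrightarrow> schw (\<lambda>X. a *\<^sub>R F X)"
  unfolding schw_def by (rule sch_scaleR[OF cone_UNIV])

lemma schw_star: "schw F \<Longrightarrow> schw (\<lambda>X. star (F X))"
  unfolding schw_def by (rule sch_star[OF cone_UNIV])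

lemma schw_linear: "linear l \<Longrightarrow> schw F \<Longrightarrow> schw (\<lambda>X. (l X :: real) *\<^sub>R F X)"
  unfolding schw_def by (rule sch_linear[OF cone_UNIV])

lemma schw_affine: "\<bar>s\<bar> = 1 \<Longrightarrow> schw F \<Longrightarrow> schw (\<lambda>X. F (s *\<^sub>R X + v))"
  unfolding schw_def by (rule sch_affine[OF cone_UNIV])

lemma schw_act: "schw F \<Longrightarrow> schw (\<lambda>X. \<Theta> (s *\<^sub>R X) (F X))"
  unfolding schw_def by (rule sch_act[OF cone_UNIV])

end

context fourier
begin

lemma schw_FT: "schw F \<Longrightarrow> schw (FT \<omega> c F)"
  unfolding schw_def by (rule FT_sch[OF cone_UNIV])

lemma schw_M_map: "schw F \<Longrightarrow> schw (M_map \<omega> c \<Theta> F)"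
  unfolding M_map_FT by (intro schw_FT schw_act)

lemma schw_M_inv: assumes "schw F" shows "schw (M_inv \<omega> c \<Theta> F)"
proof -
  have "M_inv \<omega> c \<Theta> F = (\<lambda>X. \<Theta> (- 1 *\<^sub>R X) (FT \<omega> c F X))"
    using M_inv_FT[OF schw_dec[OF assms]] by (simp add: fun_eq_iff)
  then show ?thesis using schw_act[OF schw_FT[OF assms], of "- 1"] by simp
qed

text \<open>Keeping the integrand as a function of both variables lets the same bounds serve for
  continuity, for derivatives and for Fubini.\<close>

definition tw :: "('x \<Rightarrow> 'a) \<Rightarrow> ('x \<Rightarrow> 'a) \<Rightarrow> 'x \<Rightarrow> 'x \<Rightarrow> 'a" where
  "tw G H X Y = cis (- (1 / 2) * \<omega> X Y) *\<^sub>C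
     (\<Theta> ((1 / 2) *\<^sub>R (Y - X)) (G Y) * \<Theta> ((1 / 2) *\<^sub>R Y) (H (X - Y)))"

lemma diamond_tw: "diamond_prod \<omega> c \<Theta> G H = (\<lambda>X. dint c (tw G H X))"
proof
  fix X
  have "tw G H X = (\<lambda>Y. cis (- (1 / 2) * \<omega> X Y) *\<^sub>C
     (\<Theta> ((1 / 2) *\<^sub>R (Y - X)) (G Y) * \<Theta> ((1 / 2) *\<^sub>R Y) (H (X - Y))))"
    by (rule ext) (simp only: tw_def)
  then show "diamond_prod \<omega> c \<Theta> G H X = dint c (tw G H X)" by (simp only: diamond_prod_def)
qed

lemma norm_tw: "norm (tw G H X Y) \<le> norm (G Y) * norm (H (X - Y))"
  unfolding tw_def norm_scaleC by (auto intro: order_trans[OF norm_mult_ineq])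

lemma continuous_on_tw:
  assumes "schw G" "schw H"
  shows "continuous_on UNIV (\<lambda>(X, Y). tw G H X Y)"
  unfolding tw_def split_beta
  by (intro continuous_intros continuous_on_scaleC
      continuous_on_compose2[OF schw_continuous[OF assms(1)]] continuous_on_compose2[OF schw_continuous[OF assms(2)]]) auto

text \<open>Since \<open>1 + norm X \<le> (1 + norm Y) * (1 + norm (X - Y))\<close>, a power of the
  weight in X is shared between the rapid decay of G at Y and that of H at X - Y.\<close>

lemma tw_bound:
  assumes "schw G" "schw H"
  shows "\<exists>K\<ge>0. \<forall>X Y. (1 + norm X) ^ N * norm (tw G H X Y) \<le> K * wt Y"
proof -
  obtain K where K: "K \<ge> 0" "\<And>X. (1 + norm X) ^ N * norm (G X) \<le> K * wt X" using schw_wt_bound[OF assms(1)] by blast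
  obtain L where L: "L \<ge> 0" "\<And>X. (1 + norm X) ^ N * norm (H X) \<le> L" using schw_bound[OF assms(2)] by blast
  have "(1 + norm X) ^ N * norm (tw G H X Y) \<le> (K * L) * wt Y" for X Y
  proof -
    have "norm X \<le> norm Y + norm (X - Y)" using norm_triangle_ineq[of Y "X - Y"] by simp
    then have "1 + norm X \<le> (1 + norm Y) * (1 + norm (X - Y))"
      using mult_nonneg_nonneg[OF norm_ge_zero[of Y] norm_ge_zero[of "X - Y"]]
      unfolding distrib_left distrib_right mult_1_left mult_1_right by linarith
    then have "(1 + norm X) ^ N \<le> (1 + norm Y) ^ N * (1 + norm (X - Y)) ^ N"
      unfolding power_mult_distrib[symmetric] by (intro power_mono) auto
    then have "(1 + norm X) ^ N * norm (tw G H X Y)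
        \<le> ((1 + norm Y) ^ N * (1 + norm (X - Y)) ^ N) * (norm (G Y) * norm (H (X - Y)))"
      by (intro mult_mono norm_tw) auto
    also have "\<dots> = ((1 + norm Y) ^ N * norm (G Y)) * ((1 + norm (X - Y)) ^ N * norm (H (X - Y)))" by simp
    also have "\<dots> \<le> (K * wt Y) * L" by (intro mult_mono K L) (auto intro!: mult_nonneg_nonneg K)
    finally show ?thesis by (simp add: mult_ac)
  qed
  then show ?thesis using K(1) L(1) by (intro exI[of _ "K * L"]) auto
qed

lemma tw_dec:
  assumes "schw G" "schw H" shows "dec (tw G H X)"
proof -
  obtain K where "\<And>X Y. (1 + norm X) ^ 0 * norm (tw G H X Y) \<le> K * wt Y" using tw_bound[OF assms] by blast
  then show ?thesis
    by (intro decI[of _ K] continuous_on_compose2[OF continuous_on_tw[OF assms], of UNIV "\<lambda>Y. (X, Y)", simplified] continuous_intros) auto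
qed

text \<open>The twisted convolutions of Schwartz functions form a class closed under both kinds of
  derivatives: the terms of the product rule are again such convolutions, with modified
  factors.\<close>

lemma schw_diamond:
  assumes "schw G" "schw H"
  shows "schw (diamond_prod \<omega> c \<Theta> G H)"
proof (rule schw_coinduct[where C = "{(\<lambda>X. dint c (tw G H X)) |G H. schw G \<and> schw H}"])
  fix F and b :: 'x assume "F \<in> {(\<lambda>X. dint c (tw G H X)) |G H. schw G \<and> schw H}"
  then obtain G H where F: "F = (\<lambda>X. dint c (tw G H X))" and G: "schw G" and H: "schw H" by blast
  have inC: "addspan {(\<lambda>X. dint c (tw G H X)) |G H. schw G \<and> schw H} (\<lambda>X. dint c (tw G' H' X))"
    if "schw G'" "schw H'" for G' H' using that by (intro addspan_base) blast
  show "continuous_on UNIV F"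
  proof -
    obtain K where "\<And>X Y. (1 + norm X) ^ 0 * norm (tw G H X Y) \<le> K * wt Y" using tw_bound[OF G H] by blast
    then show ?thesis unfolding F dint_def
      using continuous_on_tw[OF G H] by (intro continuous_intros continuous_on_integral[of _ _ K]) auto
  qed
  show "\<exists>K. \<forall>X. (1 + norm X) ^ N * norm (F X) \<le> K" for N
  proof -
    obtain K where K: "\<And>X Y. (1 + norm X) ^ N * norm (tw G H X Y) \<le> K * wt Y" using tw_bound[OF G H] by blast
    have "(1 + norm X) ^ N * norm (F X) \<le> (\<bar>c\<bar> * integral UNIV (wt::'x \<Rightarrow> real)) * K" for X
    proof -
      have pos: "(1 + norm X) ^ N > 0" by (intro zero_less_power add_pos_nonneg) auto
      have "norm (tw G H X Y) \<le> (K / (1 + norm X) ^ N) * wt Y" for Y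
        using K[of X Y] pos by (simp add: field_simps)
      from norm_dint_le[OF tw_dec[OF G H] this, of c] show ?thesis unfolding F
        using pos by (simp add: field_simps)
    qed
    then show ?thesis by blast
  qed
  assume b: "b \<in> Basis"
  obtain G' where G': "has_dd b G G'" "schw G'" using schw_has_dd[OF G b] by blast
  obtain GA where GA: "\<And>X. hasA b (G X) (GA X)" "schw GA" using schw_hasA[OF G b] by blast
  obtain H' where H': "has_dd b H H'" "schw H'" using schw_has_dd[OF H b] by blast
  obtain HA where HA: "\<And>X. hasA b (H X) (HA X)" "schw HA" using schw_hasA[OF H b] by blast
  show "\<exists>H. has_dd b F H \<and> addspan {(\<lambda>X. dint c (tw G H X)) |G H. schw G \<and> schw H} H"
  proof -
    \<comment> \<open>\<open>Ga\<close> absorbs the derivative of the phase, and \<open>Gb\<close>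
      the derivative of the automorphism, where -1/2 is the coefficient of X in (Y - X)/2.\<close>
    define Ga where "Ga = (\<lambda>Y. (- (\<i> / 2)) *\<^sub>C (\<omega> b Y *\<^sub>R G Y))"
    define Gb where "Gb = (\<lambda>Y. (- (1/2)) *\<^sub>R GA Y)"
    have Ga: "schw Ga" unfolding Ga_def by (intro schw_scaleC schw_linear linear_form G)
    have Gb: "schw Gb" unfolding Gb_def by (intro schw_scaleR GA)
    have d: "has_dd b (\<lambda>X. tw G H X Y) (\<lambda>X. (tw G H' X Y + tw Gb H X Y) + tw Ga H X Y)" for Y
    proof -
      have 1: "has_dd b (\<lambda>X. cis (- (1 / 2) * \<omega> X Y)) (\<lambda>X. \<i> * of_real (- (1/2) * \<omega> b Y) * cis (- (1 / 2) * \<omega> X Y))"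
        by (rule has_dd_cis, rule has_dd_linear) (auto intro!: linearI simp: \<omega>.add_left \<omega>.scaleR_left algebra_simps)
      have 2: "has_dd b (\<lambda>X. \<Theta> ((- (1 / 2)) *\<^sub>R X + (1/2) *\<^sub>R Y) (G Y)) (\<lambda>X. (- (1/2)) *\<^sub>R \<Theta> ((- (1 / 2)) *\<^sub>R X + (1/2) *\<^sub>R Y) (GA Y))"
        by (rule has_dd_affine[OF hasA_dd[OF GA(1)]])
      have 2: "has_dd b (\<lambda>X. \<Theta> ((1 / 2) *\<^sub>R (Y - X)) (G Y)) (\<lambda>X. \<Theta> ((1 / 2) *\<^sub>R (Y - X)) (Gb Y))"
        using 2 by (simp only: scaleR_diff_right scaleR_minus_left Gb_def act_scaleR[symmetric] add.commute[of "- _"] add_uminus_conv_diff)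
      have 3: "has_dd b (\<lambda>X. \<Theta> ((1 / 2) *\<^sub>R Y) (H (X - Y))) (\<lambda>X. \<Theta> ((1 / 2) *\<^sub>R Y) (H' (X - Y)))"
        using bounded_linear.has_dd[OF bounded_linear_act has_dd_affine[OF H'(1), of 1 "- Y"]] by simp
      note D = scaleC.has_dd[OF 1 bounded_bilinear.has_dd[OF bounded_bilinear_mult 2 3]]
      have A: "\<Theta> Z (Ga Y) = (- (\<i> / 2) * of_real (\<omega> b Y)) *\<^sub>C \<Theta> Z (G Y)" for Z
        by (simp add: Ga_def act_scaleC act_scaleR scaleR_scaleC scaleC_scaleC)
      show ?thesis
        using D unfolding tw_def A mult_scaleC_left scaleC_scaleC scaleC_add_right
        by (simp add: mult_ac)
    qed
    define k' where "k' = (\<lambda>X Y. (tw G H' X Y + tw Gb H X Y) + tw Ga H X Y)"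
    obtain K1 where K1: "\<And>X Y. (1 + norm X) ^ 0 * norm (tw G H' X Y) \<le> K1 * wt Y" using tw_bound[OF G H'(2)] by blast
    obtain K2 where K2: "\<And>X Y. (1 + norm X) ^ 0 * norm (tw Gb H X Y) \<le> K2 * wt Y" using tw_bound[OF Gb H] by blast
    obtain K3 where K3: "\<And>X Y. (1 + norm X) ^ 0 * norm (tw Ga H X Y) \<le> K3 * wt Y" using tw_bound[OF Ga H] by blast
    have "has_dd b F (\<lambda>X. dint c (k' X))"
      unfolding F
    proof (rule has_dd_dint)
      show "has_dd b (\<lambda>X. tw G H X Y) (\<lambda>X. k' X Y)" for Y unfolding k'_def by (rule d)
      show "dec (tw G H X)" for X by (rule tw_dec[OF G H])
      show "continuous_on UNIV (k' X)" for X
        unfolding k'_def by (intro dec_continuous dec_add tw_dec G H H' Gb Ga)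
      show "norm (k' X Y) \<le> (K1 + K2 + K3) * wt Y" for X Y
        using norm_triangle_mono[OF norm_triangle_mono[OF K1[of X Y, simplified] K2[of X Y, simplified]] K3[of X Y, simplified]]
        by (simp add: k'_def distrib_right)
    qed
    moreover have "(\<lambda>X. dint c (k' X)) = ((\<lambda>X. dint c (tw G H' X)) + (\<lambda>X. dint c (tw Gb H X))) + (\<lambda>X. dint c (tw Ga H X))"
      unfolding plus_fun_def k'_def by (simp add: dint_add dec_add tw_dec G H H' Gb Ga)
    moreover have "addspan {(\<lambda>X. dint c (tw G H X)) |G H. schw G \<and> schw H} \<dots>"
      by (intro addspan_add inC G H H' Gb Ga)
    ultimately show ?thesis by (intro exI[of _ "\<lambda>X. dint c (k' X)"]) simp
  qed
  show "\<exists>H. (\<forall>X. hasA b (F X) (H X)) \<and> addspan {(\<lambda>X. dint c (tw G H X)) |G H. schw G \<and> schw H} H"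
  proof -
    have d: "hasA b (tw G H X Y) (tw G HA X Y + tw GA H X Y)" for X Y
      unfolding tw_def scaleC_add_right[symmetric]
      by (intro hasA_map[OF scaleC.bounded_linear_right act_scaleC] hasA_mult hasA_act GA HA)
    have "hasA b (F X) (dint c (\<lambda>Y. tw G HA X Y + tw GA H X Y))" for X
      unfolding F by (intro hasA_dint d dec_add tw_dec G H HA GA)
    moreover have "(\<lambda>X. dint c (\<lambda>Y. tw G HA X Y + tw GA H X Y)) = (\<lambda>X. dint c (tw G HA X)) + (\<lambda>X. dint c (tw GA H X))"
      unfolding plus_fun_def by (simp add: dint_add tw_dec G H HA GA)
    moreover have "addspan {(\<lambda>X. dint c (tw G H X)) |G H. schw G \<and> schw H} \<dots>"
      by (intro addspan_add inC G H HA GA)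
    ultimately show ?thesis by (intro exI[of _ "\<lambda>X. dint c (\<lambda>Y. tw G HA X Y + tw GA H X Y)"]) simp
  qed
next
  show "diamond_prod \<omega> c \<Theta> G H \<in> {(\<lambda>X. dint c (tw G H X)) |G H. schw G \<and> schw H}"
    using assms unfolding diamond_tw by blast
qed

end

section \<open>Smooth functions with compact support\<close>

text \<open>For j = 0 this is the flat function exp(-1/t). The factors t^(-j) are included so that
  derivatives are combinations of members of the family.\<close>

definition hk :: "nat \<Rightarrow> real \<Rightarrow> real" where
  "hk j t = (if t > 0 then inverse t ^ j / exp (inverse t) else 0)"

lemma hk_tendsto_0: "(hk j \<longlongrightarrow> 0) (at 0)"
proof -
  have "((\<lambda>t. inverse t ^ j / exp (inverse t)) \<longlongrightarrow> 0) (at_right (0::real))"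
    by (rule filterlim_compose[OF tendsto_power_div_exp_0 filterlim_inverse_at_top_right])
  then have r: "(hk j \<longlongrightarrow> 0) (at_right 0)"
    by (rule Lim_transform_eventually) (auto simp: hk_def eventually_at_filter)
  have "(hk j \<longlongrightarrow> 0) (at_left 0)"
    by (rule tendsto_eventually) (auto simp: hk_def eventually_at_filter)
  with r show ?thesis by (simp add: filterlim_at_split)
qed

lemma hk_derivative: "(hk j has_real_derivative hk (j + 2) t - real j * hk (j + 1) t) (at t)"
proof -
  consider "t > 0" | "t < 0" | "t = 0" by linarith
  then show ?thesis
  proof cases
    case 1
    have "((\<lambda>t. inverse t ^ j * exp (- inverse t)) has_real_derivative
        inverse t ^ j * (exp (- inverse t) * (inverse t ^ 2)) + (real j * inverse t ^ (j - 1) * (- (inverse t ^ 2))) * exp (- inverse t)) (at t)"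
      using 1 by (auto intro!: derivative_eq_intros simp: power2_eq_square)
    also have "inverse t ^ j * (exp (- inverse t) * (inverse t ^ 2)) + (real j * inverse t ^ (j - 1) * (- (inverse t ^ 2))) * exp (- inverse t)
        = hk (j + 2) t - real j * hk (j + 1) t"
      using 1 by (cases j) (simp_all add: hk_def exp_minus divide_inverse power2_eq_square)
    finally show ?thesis
      by (rule has_field_derivative_transform_within_open[of _ _ _ "{0<..}"])
         (use 1 in \<open>auto simp: hk_def exp_minus divide_inverse\<close>)
  next
    case 2
    have "((\<lambda>t. 0) has_real_derivative hk (j + 2) t - real j * hk (j + 1) t) (at t)"
      using 2 by (simp add: hk_def)
    then show ?thesis
      by (rule has_field_derivative_transform_within_open[of _ _ _ "{..<0}"]) (use 2 in \<open>auto simp: hk_def\<close>)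
  next
    case 3
    \<comment> \<open>At the origin the difference quotient of \<open>hk j\<close> is
      \<open>hk (Suc j)\<close>, which tends to 0.\<close>
    have "hk j h / h = hk (Suc j) h" for h by (simp add: hk_def field_simps)
    then have "((\<lambda>h. (hk j (0 + h) - hk j 0) / h) \<longlongrightarrow> 0) (at 0)"
      using hk_tendsto_0[of "Suc j"] by (simp add: hk_def[of j 0])
    then show ?thesis unfolding 3 by (simp add: DERIV_def hk_def)
  qed
qed

text \<open>A syntactic class closed under directional derivatives: smoothness of a function follows
  from the way it is built, without computing its derivatives.\<close>

inductive smf :: "('y::euclidean_space \<Rightarrow> real) \<Rightarrow> bool" where
  smf_const: "smf (\<lambda>_. r)"
| smf_linear: "linear l \<Longrightarrow> smf l"
| smf_add: "smf f \<Longrightarrow> smf g \<Longrightarrow> smf (\<lambda>X. f X + g X)"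
| smf_mult: "smf f \<Longrightarrow> smf g \<Longrightarrow> smf (\<lambda>X. f X * g X)"
| smf_hk: "smf f \<Longrightarrow> smf (\<lambda>X. hk j (f X))"

lemma smf_continuous: "smf f \<Longrightarrow> continuous_on UNIV f"
proof (induction rule: smf.induct)
  case (smf_linear l)
  then show ?case by (simp add: linear_continuous_on linear_conv_bounded_linear)
next
  case (smf_hk f j)
  have "continuous_on UNIV (hk j)"
    using hk_derivative DERIV_isCont by (intro continuous_at_imp_continuous_on) blast
  from continuous_on_compose2[OF this smf_hk.IH] show ?case by simp
qed (auto intro!: continuous_intros)

lemma smf_has_dd: "smf f \<Longrightarrow> \<exists>g. smf g \<and> has_dd b f g"
proof (induction rule: smf.induct)
  case (smf_const r)
  then show ?case using has_dd_const smf.smf_const by blast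
next
  case (smf_linear l)
  then show ?case using has_dd_linear smf.smf_const by blast
next
  case (smf_add f g)
  then show ?case using has_dd_add smf.smf_add by blast
next
  case (smf_mult f g)
  then obtain f' g' where *: "smf f'" "has_dd b f f'" "smf g'" "has_dd b g g'" by blast
  have "smf (\<lambda>X. f X * g' X + f' X * g X)" using * smf_mult by (intro smf.smf_add smf.smf_mult) auto
  then show ?case using bounded_bilinear.has_dd[OF bounded_bilinear_mult *(2,4)] by blast
next
  case (smf_hk f j)
  then obtain f' where *: "smf f'" "has_dd b f f'" by blast
  let ?g = "\<lambda>X. (hk (j + 2) (f X) + (- real j) * hk (j + 1) (f X)) * f' X"
  have "smf ?g" by (intro smf.smf_add smf.smf_mult smf.smf_hk smf.smf_const smf_hk *)
  moreover have "has_dd b (\<lambda>X. hk j (f X)) ?g"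
    unfolding has_dd_def
  proof
    fix X
    have "((\<lambda>t. f (X + t *\<^sub>R b)) has_real_derivative f' X) (at 0)"
      using *(2) by (simp add: has_dd_def has_real_derivative_iff_has_vector_derivative)
    from DERIV_chain2[OF _ this, of "hk j"] hk_derivative[of j "f X"]
    show "((\<lambda>t. hk j (f (X + t *\<^sub>R b))) has_vector_derivative ?g X) (at 0)"
      by (simp add: has_real_derivative_iff_has_vector_derivative[symmetric])
  qed
  ultimately show ?case by blast
qed

lemma smf_sum: "finite A \<Longrightarrow> (\<And>a. a \<in> A \<Longrightarrow> smf (f a)) \<Longrightarrow> smf (\<lambda>X. \<Sum>a\<in>A. f a X)"
  by (induction A rule: finite_induct) (auto intro: smf_const smf_add)

lemma has_dd_of_real: "has_dd b f g \<Longrightarrow> has_dd b (\<lambda>X. complex_of_real (f X)) (\<lambda>X. complex_of_real (g X))"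
  by (rule bounded_linear.has_dd[OF bounded_linear_of_real])

lemma smf_smooth: assumes "smf f" shows "smooth (\<lambda>X. complex_of_real (f X))"
proof -
  have "\<exists>g. smf g \<and> partials w (\<lambda>X. complex_of_real (f X)) = (\<lambda>X. complex_of_real (g X))" for w :: "'a list"
  proof (induction w)
    case (Cons b w)
    then obtain g where g: "smf g" "partials w (\<lambda>X. complex_of_real (f X)) = (\<lambda>X. complex_of_real (g X))" by blast
    obtain g' where g': "smf g'" "has_dd b g g'" using smf_has_dd[OF g(1)] by blast
    then show ?case using g(2) has_dd_partial[OF has_dd_of_real[OF g'(2)]] by auto
  qed (use assms in auto)
  then obtain g where g: "\<And>w. smf (g w)" "\<And>w. partials w (\<lambda>X. complex_of_real (f X)) = (\<lambda>X. complex_of_real (g w X))"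
    by metis
  show ?thesis unfolding smooth_def
  proof (intro ballI conjI allI)
    fix w :: "'a list" and b X :: 'a
    show "continuous_on UNIV (partials w (\<lambda>X. complex_of_real (f X)))"
      unfolding g(2) by (intro continuous_intros smf_continuous g)
    obtain g' where "smf g'" "has_dd b (g w) g'" using smf_has_dd[OF g(1)] by blast
    then show "(\<lambda>t. partials w (\<lambda>X. complex_of_real (f X)) (X + t *\<^sub>R b)) differentiable at 0"
      unfolding g(2) using has_dd_of_real[of b "g w" g'] unfolding has_dd_def by (blast intro: differentiableI_vector)
  qed
qed

text \<open>Composing \<open>hk 0\<close> with itself gives a plateau without dividing by an integral.\<close>

definition bump :: "'y::euclidean_space \<Rightarrow> real" where
  "bump P = exp 2 * hk 0 (1 / 2 + (- 1) * hk 0 ((\<Sum>b\<in>Basis. (P \<bullet> b) * (P \<bullet> b)) + (- 1)))"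

lemma smf_bump: "smf (bump :: 'y::euclidean_space \<Rightarrow> real)"
  unfolding bump_def[abs_def]
  by (intro smf_mult smf_const smf_hk smf_add smf_sum finite_Basis smf_linear)
     (auto intro!: bounded_linear.linear bounded_linear_inner_left)

lemma bump_eq: "bump P = exp 2 * hk 0 (1 / 2 - hk 0 ((norm P)\<^sup>2 - 1))"
  unfolding bump_def power2_norm_eq_inner euclidean_inner[of P P] by simp

text \<open>In the unit ball the inner \<open>hk 0\<close> vanishes, and the factor
  \<open>exp 2\<close> cancels the value exp(-2) of \<open>hk 0\<close> at 1/2.\<close>

lemma bump_1: assumes "norm P \<le> 1" shows "bump P = 1"
proof -
  have "(norm P)\<^sup>2 \<le> 1" using assms by (simp add: power_le_one)
  then have "hk 0 ((norm P)\<^sup>2 - 1) = 0" by (simp add: hk_def)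
  then show ?thesis by (simp add: bump_eq hk_def)
qed

text \<open>Here the inner value is exp(-r) with r = 1 / (|P|^2 - 1) at most 1/3, and exp(-r) is at
  least 1 - r, hence at least 1/2. The argument of the outer \<open>hk 0\<close> is then not
  positive.\<close>

lemma bump_0: assumes "norm P > 2" shows "bump P = 0"
proof -
  have "2\<^sup>2 \<le> (norm P)\<^sup>2" using assms by (intro power_mono) auto
  then have t: "(norm P)\<^sup>2 - 1 \<ge> 3" by simp
  then have "inverse ((norm P)\<^sup>2 - 1) \<le> inverse 3" by (intro le_imp_inverse_le) auto
  moreover have "1 + (- inverse ((norm P)\<^sup>2 - 1)) \<le> exp (- inverse ((norm P)\<^sup>2 - 1))" by (rule exp_ge_add_one_self)
  moreover have "1 / 2 \<le> 1 + (- inverse ((norm P)\<^sup>2 - 1))"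
    if "inverse ((norm P)\<^sup>2 - 1) \<le> inverse 3" using that by simp
  ultimately have "1 / 2 \<le> exp (- inverse ((norm P)\<^sup>2 - 1))" by (meson order_trans)
  then have "1 / 2 \<le> hk 0 ((norm P)\<^sup>2 - 1)" using t by (simp add: hk_def exp_minus inverse_eq_divide)
  then show ?thesis by (simp add: bump_eq hk_def)
qed

lemma cutoff_bump: "cutoff (\<lambda>P. complex_of_real (bump P))"
  unfolding cutoff_def
proof (intro conjI)
  show "smooth (\<lambda>P. complex_of_real (bump P))" by (rule smf_smooth[OF smf_bump])
  have "{P. complex_of_real (bump P) \<noteq> 0} \<subseteq> cball 0 2"
    using bump_0 by (force simp: not_le[symmetric])
  then have "closure {P. complex_of_real (bump P) \<noteq> 0} \<subseteq> cball 0 2" by (rule closure_minimal) simp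
  then show "compact (closure {P. complex_of_real (bump P) \<noteq> 0})"
    using bounded_subset[OF bounded_cball] by (auto simp: compact_eq_bounded_closed)
  show "\<forall>\<^sub>F P in nhds 0. complex_of_real (bump P) = 1"
    unfolding eventually_nhds by (intro exI[of _ "ball 0 1"]) (auto simp: bump_1)
qed

section \<open>Fourier inversion\<close>

text \<open>Scalar functions become functions with values in a C*-algebra, with the trivial action,
  so the results on transforms apply to the bump function that fixes the normalization.\<close>

instantiation complex :: cstar_algebra
begin

definition scaleC_complex :: "complex \<Rightarrow> complex \<Rightarrow> complex" where "scaleC_complex a z = a * z"
definition star_complex :: "complex \<Rightarrow> complex" where "star_complex z = cnj z"

instance
  by standard (simp_all add: scaleC_complex_def star_complex_def algebra_simps scaleR_conv_of_real
      norm_mult power2_eq_square)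

end

interpretation triv: caction "\<lambda>(X::'x::euclidean_space) (z::complex). z"
  by standard (auto simp: strongly_continuous_action_def star_automorphism_def bij_betw_def)

text \<open>For the trivial action these rules have the form \<open>f = f\<close> and would loop.\<close>

declare triv.act_0 [simp del] triv.norm_act [simp del] triv.act_zero [simp del]
  triv.continuous_on_act [continuous_intros del] triv.tendsto_act [tendsto_intros del]

text \<open>The set where the norm exceeds R is open, so the difference quotients at P vanish for
  small t.\<close>

lemma has_dd_support:
  assumes d: "has_dd b f g" and f: "\<And>P. norm P > R \<Longrightarrow> f P = 0" and P: "norm P > R"
  shows "g P = 0"
proof -
  have "((\<lambda>t. norm (P + t *\<^sub>R b)) \<longlongrightarrow> norm P) (at 0)"
    by (auto intro!: tendsto_eq_intros)
  then have "\<forall>\<^sub>F t in at 0. norm (P + t *\<^sub>R b) > R" using P by (rule order_tendstoD)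
  then have "\<forall>\<^sub>F t in at 0. (1 / t) *\<^sub>R (f (P + (0 + t) *\<^sub>R b) - f (P + 0 *\<^sub>R b)) = 0"
    by (rule eventually_mono) (simp add: f P)
  then have "((\<lambda>t. (1 / t) *\<^sub>R (f (P + (0 + t) *\<^sub>R b) - f (P + 0 *\<^sub>R b))) \<longlongrightarrow> 0) (at 0)"
    by (rule tendsto_eventually)
  moreover have "((\<lambda>t. (1 / t) *\<^sub>R (f (P + (0 + t) *\<^sub>R b) - f (P + 0 *\<^sub>R b))) \<longlongrightarrow> g P) (at 0)"
    using d unfolding has_dd_def has_vector_derivative_at_iff by blast
  ultimately show ?thesis using tendsto_unique trivial_limit_at by blast
qed

lemma smf_triv_schw:
  fixes f :: "'x::euclidean_space \<Rightarrow> real"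
  assumes "smf f" "\<And>P. norm P > R \<Longrightarrow> f P = 0"
  shows "triv.schw (\<lambda>P. complex_of_real (f P))"
proof (rule triv.schw_coinduct[where C = "{(\<lambda>P. complex_of_real (f P)) |f. smf f \<and> (\<forall>P. norm P > R \<longrightarrow> f P = 0)}"])
  fix F :: "'x \<Rightarrow> complex" and b :: 'x assume "F \<in> {(\<lambda>P. complex_of_real (f P)) |f. smf f \<and> (\<forall>P. norm P > R \<longrightarrow> f P = 0)}"
  then obtain f :: "'x \<Rightarrow> real" where F: "F = (\<lambda>P. complex_of_real (f P))" and f: "smf f" "\<And>P. norm P > R \<Longrightarrow> f P = 0" by blast
  show "continuous_on UNIV F" unfolding F by (intro continuous_intros smf_continuous f)
  show "\<exists>K. \<forall>X. (1 + norm X) ^ N * norm (F X) \<le> K" for N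
  proof -
    have "dec (\<lambda>X. (1 + norm X) ^ N * f X)"
      by (rule dec_compact[of _ R]) (auto simp: f(2) intro!: continuous_intros smf_continuous[OF f(1)])
    then obtain C where C: "\<And>X. norm ((1 + norm X) ^ N * f X) \<le> C * wt X" by (auto simp: dec_def)
    have "(1 + norm X) ^ N * norm (F X) \<le> \<bar>C\<bar>" for X
    proof -
      have "C * wt X \<le> \<bar>C\<bar> * 1" by (intro mult_mono) (auto simp: wt_le_1)
      then show ?thesis using C[of X] by (simp add: F abs_mult)
    qed
    then show ?thesis by blast
  qed
  obtain g where g: "smf g" "has_dd b f g" using smf_has_dd[OF f(1)] by blast
  have "g P = 0" if "norm P > R" for P by (rule has_dd_support[OF g(2) f(2) that])
  then show "\<exists>H. has_dd b F H \<and> addspan {(\<lambda>P. complex_of_real (f P)) |f. smf f \<and> (\<forall>P. norm P > R \<longrightarrow> f P = 0)} H"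
    using g unfolding F by (intro exI[of _ "\<lambda>P. complex_of_real (g P)"] conjI has_dd_of_real addspan_base) auto
  show "\<exists>H. (\<forall>X. triv.hasA b (F X) (H X)) \<and> addspan {(\<lambda>P. complex_of_real (f P)) |f. smf f \<and> (\<forall>P. norm P > R \<longrightarrow> f P = 0)} H"
    by (intro exI[of _ "\<lambda>P. complex_of_real 0"] conjI addspan_base CollectI exI[of _ "\<lambda>_. 0"])
       (auto simp: triv.hasA_def smf_const)
qed (use assms in auto)

abbreviation cbump :: "'y::euclidean_space \<Rightarrow> complex" where
  "cbump P \<equiv> complex_of_real (bump P)"

lemma schw_cbump: "triv.schw (cbump :: 'x::euclidean_space \<Rightarrow> complex)"
  by (rule smf_triv_schw[OF smf_bump bump_0])

lemma continuous_on_bump [continuous_intros]: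
  "continuous_on S f \<Longrightarrow> continuous_on S (\<lambda>x. bump (f x))"
  using continuous_on_compose2[OF smf_continuous[OF smf_bump]] by blast

lemma bump_bounded: "\<exists>B\<ge>0. \<forall>P::'y::euclidean_space. \<bar>bump P\<bar> \<le> B"
proof -
  have "dec (bump :: 'y \<Rightarrow> real)"
    by (rule dec_compact[of _ 2]) (auto intro!: bump_0 continuous_intros)
  then obtain C where C: "\<And>P::'y. norm (bump P) \<le> C * wt P" by (auto simp: dec_def)
  have "\<bar>bump P\<bar> \<le> \<bar>C\<bar>" for P :: 'y
  proof -
    have "C * wt P \<le> \<bar>C\<bar> * 1" by (intro mult_mono) (auto simp: wt_le_1)
    then show ?thesis using C[of P] by simp
  qed
  then show ?thesis by (intro exI[of _ "\<bar>C\<bar>"]) auto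
qed

lemma dec_bump_scaled:
  assumes "e \<noteq> 0" shows "dec (\<lambda>Y::'y::euclidean_space. bump (e *\<^sub>R Y))"
proof (rule dec_compact[of _ "2 / \<bar>e\<bar>"])
  fix Y :: 'y assume "norm Y > 2 / \<bar>e\<bar>"
  then have "norm (e *\<^sub>R Y) > 2" using assms by (simp add: field_simps)
  then show "bump (e *\<^sub>R Y) = 0" by (rule bump_0)
qed (auto intro!: continuous_intros)

lemma tendsto_bump: "((\<lambda>e. bump (e *\<^sub>R Y)) \<longlongrightarrow> 1) (at 0 within S)"
proof -
  have "((\<lambda>e. bump (e *\<^sub>R Y)) \<longlongrightarrow> bump (0 *\<^sub>R Y)) (at 0 within S)"
    by (rule continuous_on_tendsto_compose[of UNIV bump])
       (intro continuous_intros | intro tendsto_intros | simp)+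
  then show ?thesis by (simp add: bump_1)
qed

context fourier
begin

text \<open>The transform with the opposite sign and with unnormalized Lebesgue measure; hence the
  factor \<open>c\<^sup>2\<close> that accompanies its integral below, one \<open>c\<close> from
  each of two transforms.\<close>

definition bump_ft :: "'x \<Rightarrow> complex" where
  "bump_ft V = integral UNIV (\<lambda>Y. cis (\<omega> V Y) * cbump Y)"

end

sublocale fourier \<subseteq> triv: fourier "\<lambda>(X::'x) (z::complex). z" \<omega> c
  by unfold_locales

context fourier
begin

declare triv.act_0 [simp del] triv.norm_act [simp del] triv.act_zero [simp del]
  triv.continuous_on_act [continuous_intros del] triv.tendsto_act [tendsto_intros del]

lemma dec_bump_ft: assumes "c \<noteq> 0" shows "dec bump_ft"
proof -
  have "triv.schw (\<lambda>V. FT \<omega> c cbump ((- 1) *\<^sub>R V + 0))"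
    by (intro triv.schw_affine triv.schw_FT schw_cbump) simp
  then have "dec (\<lambda>V. FT \<omega> c cbump (- V))" using triv.schw_dec by simp
  moreover have "FT \<omega> c cbump (- V) = c *\<^sub>R bump_ft V" for V
    by (simp add: FT_def dint_def bump_ft_def scaleC_complex_def \<omega>.minus_left)
  ultimately have d: "dec (\<lambda>V. c *\<^sub>R bump_ft V)" by simp
  have "continuous_on UNIV (\<lambda>V. (1 / c) *\<^sub>R (c *\<^sub>R bump_ft V))"
    by (rule continuous_on_scaleR[OF continuous_on_const dec_continuous[OF d]])
  then have "continuous_on UNIV bump_ft" using assms by simp
  then show ?thesis by (rule dec_bounded[OF d, of _ "1 / \<bar>c\<bar>"]) (use assms in auto)
qed

text \<open>The outer integral is regularized by a scaled bump. Fubini and a rescaling turn it into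
  the integral of f(e V + X) against \<open>bump_ft\<close>, an approximate identity up to a
  constant, so that e tending to 0 leaves a multiple of f X. The multiple is not yet known to be
  1.\<close>

lemma FT_FT_const:
  assumes c: "c \<noteq> 0" and f: "schw f"
  shows "FT \<omega> c (FT \<omega> c f) X = (complex_of_real (c\<^sup>2) * integral UNIV bump_ft) *\<^sub>C f X"
proof -
  define h where "h = FT \<omega> c f"
  have h: "dec h" unfolding h_def by (intro schw_dec schw_FT f)
  have fd: "dec f" by (rule schw_dec[OF f])
  obtain Ch where Ch: "\<And>Y. norm (h Y) \<le> Ch * wt Y" using h by (auto simp: dec_def)
  obtain Cf where Cf: "\<And>Y. norm (f Y) \<le> Cf * wt Y" using fd by (auto simp: dec_def)
  obtain Bf where Bf: "Bf \<ge> 0" "\<And>Y. norm (f Y) \<le> Bf" using schw_bound[OF f, of 0] by auto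
  obtain Cg where Cg: "\<And>Y. norm (bump_ft Y) \<le> Cg * wt Y" using dec_bump_ft[OF c] by (auto simp: dec_def)
  obtain B where B: "B \<ge> 0" "\<And>P::'x. \<bar>bump P\<bar> \<le> B" using bump_bounded by blast
  let ?L = "\<lambda>e. integral UNIV (\<lambda>Y. cbump (e *\<^sub>R Y) *\<^sub>C cis (- \<omega> X Y) *\<^sub>C h Y)"
  have "(?L \<longlongrightarrow> integral UNIV (\<lambda>Y. cis (- \<omega> X Y) *\<^sub>C h Y)) (at_right 0)"
  proof (rule tendsto_integral[where C = "(B + 1) * Ch"])
    have Ch0: "Ch * wt Y \<ge> 0" for Y :: 'x by (rule order_trans[OF norm_ge_zero Ch])
    show "continuous_on UNIV (\<lambda>Y. cbump (e *\<^sub>R Y) *\<^sub>C cis (- \<omega> X Y) *\<^sub>C h Y)" for e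
      by (intro continuous_on_scaleC continuous_intros continuous_on_cis dec_continuous[OF h])
    show "continuous_on UNIV (\<lambda>Y. cis (- \<omega> X Y) *\<^sub>C h Y)" by (intro dec_continuous dec_FT h)
    show "norm (cbump (e *\<^sub>R Y) *\<^sub>C cis (- \<omega> X Y) *\<^sub>C h Y) \<le> (B + 1) * Ch * wt Y" for e Y
    proof -
      have "\<bar>bump (e *\<^sub>R Y)\<bar> \<le> B + 1" using B(2)[of "e *\<^sub>R Y"] by linarith
      then have "\<bar>bump (e *\<^sub>R Y)\<bar> * norm (h Y) \<le> (B + 1) * (Ch * wt Y)"
        by (rule mult_mono[OF _ Ch]) (use B(1) in auto)
      then show ?thesis by (simp add: norm_scaleC mult.assoc)
    qed
    show "norm (cis (- \<omega> X Y) *\<^sub>C h Y) \<le> (B + 1) * Ch * wt Y" for Y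
      using Ch[of Y] mult_right_mono[of 1 "B + 1" "Ch * wt Y"] B(1) Ch0[of Y]
      by (simp add: norm_scaleC mult.assoc)
    fix Y
    have "((\<lambda>e. cbump (e *\<^sub>R Y) *\<^sub>C cis (- \<omega> X Y) *\<^sub>C h Y) \<longlongrightarrow> complex_of_real 1 *\<^sub>C cis (- \<omega> X Y) *\<^sub>C h Y) (at_right 0)"
      by (intro scaleC.tendsto tendsto_of_real tendsto_bump tendsto_const)
    then show "((\<lambda>e. cbump (e *\<^sub>R Y) *\<^sub>C cis (- \<omega> X Y) *\<^sub>C h Y) \<longlongrightarrow> cis (- \<omega> X Y) *\<^sub>C h Y) (at_right 0)"
      by (simp add: scaleC_one)
  qed
  moreover have "?L e = c *\<^sub>R integral UNIV (\<lambda>V. bump_ft V *\<^sub>C f (e *\<^sub>R V + X))" if e: "e > 0" for e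
  proof -
    \<comment> \<open>The phases combine by -[X, Y] - [Y, Z] = [Z - X, Y]. For fixed e the bump
      supplies the decay in Y and f the decay in Z, as Fubini requires.\<close>
    define u where "u = (\<lambda>Y Z. cbump (e *\<^sub>R Y) *\<^sub>C cis (\<omega> (Z - X) Y) *\<^sub>C f Z)"
    obtain Cb where Cb: "\<And>Y. \<bar>bump (e *\<^sub>R Y)\<bar> \<le> Cb * wt (Y::'x)" using dec_bump_scaled[of e] e by (auto simp: dec_def)
    have ub: "norm (u Y Z) \<le> (Cb * Cf) * (wt Y * wt Z)" for Y Z
    proof -
      have "\<bar>bump (e *\<^sub>R Y)\<bar> * norm (f Z) \<le> (Cb * wt Y) * (Cf * wt Z)"
        by (intro mult_mono Cb Cf order_trans[OF abs_ge_zero Cb]) auto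
      then show ?thesis by (simp add: u_def norm_scaleC mult_ac)
    qed
    have uc: "continuous_on UNIV (\<lambda>(Y, Z). u Y Z)"
      unfolding u_def split_beta
      by (intro continuous_on_scaleC continuous_intros continuous_on_cis continuous_on_compose2[OF dec_continuous[OF fd]]) auto
    have "cbump (e *\<^sub>R Y) *\<^sub>C cis (- \<omega> X Y) *\<^sub>C h Y = c *\<^sub>R integral UNIV (u Y)" for Y
    proof -
      let ?a = "cbump (e *\<^sub>R Y) * cis (- \<omega> X Y)"
      have "?a *\<^sub>C integral UNIV (\<lambda>Z. cis (- \<omega> Y Z) *\<^sub>C f Z) = integral UNIV (\<lambda>Z. ?a *\<^sub>C cis (- \<omega> Y Z) *\<^sub>C f Z)"
        using integral_linear[OF dec_integrable[OF dec_FT[OF fd, of Y]] scaleC.bounded_linear_right, of ?a] by (simp add: o_def)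
      also have "(\<lambda>Z. ?a *\<^sub>C cis (- \<omega> Y Z) *\<^sub>C f Z) = u Y"
      proof
        fix Z
        have "- \<omega> X Y - \<omega> Y Z = \<omega> (Z - X) Y" by (simp add: \<omega>.diff_left form_antisym[of Y Z])
        then show "?a *\<^sub>C cis (- \<omega> Y Z) *\<^sub>C f Z = u Y Z"
          by (simp add: u_def scaleC_scaleC mult.assoc cis_mult)
      qed
      finally show ?thesis by (simp add: h_def FT_def dint_def scaleC_scaleR scaleC_scaleC)
    qed
    then have "?L e = c *\<^sub>R integral UNIV (\<lambda>Y. integral UNIV (u Y))" by simp
    also have "integral UNIV (\<lambda>Y. integral UNIV (u Y)) = integral UNIV (\<lambda>Z. integral UNIV (\<lambda>Y. u Y Z))"
      by (rule fubini_swap[OF uc ub])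
    \<comment> \<open>Rescaling Y by e gives a factor e^(-dim), which the substitution Z = e V + X
      in the next step cancels.\<close>
    also have "(\<lambda>Z. integral UNIV (\<lambda>Y. u Y Z)) = (\<lambda>Z. (1 / e ^ DIM('x)) *\<^sub>R (bump_ft ((1 / e) *\<^sub>R (Z - X)) *\<^sub>C f Z))"
    proof
      fix Z
      let ?k = "\<lambda>Y. cis (\<omega> ((1 / e) *\<^sub>R (Z - X)) Y) * cbump Y"
      have dk: "dec ?k"
        by (rule dec_compact[of _ 2]) (auto simp: bump_0 intro!: continuous_intros continuous_on_cis)
      have "integral UNIV (\<lambda>Y. ?k (e *\<^sub>R Y + 0)) = (1 / e ^ DIM('x)) *\<^sub>R bump_ft ((1 / e) *\<^sub>R (Z - X))"
        using integral_unique[OF integral_affine[OF dec_integrable[OF dk], of e 0]] e by (simp add: bump_ft_def)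
      moreover have "(\<lambda>Y. ?k (e *\<^sub>R Y + 0)) = (\<lambda>Y. cbump (e *\<^sub>R Y) * cis (\<omega> (Z - X) Y))"
        using e by (simp add: \<omega>.scaleR_left \<omega>.scaleR_right mult.commute)
      ultimately have i: "integral UNIV (\<lambda>Y. cbump (e *\<^sub>R Y) * cis (\<omega> (Z - X) Y)) = (1 / e ^ DIM('x)) *\<^sub>R bump_ft ((1 / e) *\<^sub>R (Z - X))"
        by (simp only:)
      have "dec (\<lambda>Y. cbump (e *\<^sub>R Y) * cis (\<omega> (Z - X) Y))"
        by (rule dec_bounded[OF dec_bump_scaled[of e], of _ 1])
           (use e in \<open>auto simp: norm_mult intro!: continuous_intros continuous_on_cis\<close>)
      from integral_linear[OF dec_integrable[OF this] scaleC.bounded_linear_left, of "f Z"]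
      have "integral UNIV (\<lambda>Y. u Y Z) = integral UNIV (\<lambda>Y. cbump (e *\<^sub>R Y) * cis (\<omega> (Z - X) Y)) *\<^sub>C f Z"
        by (simp add: o_def u_def scaleC_scaleC)
      then show "integral UNIV (\<lambda>Y. u Y Z) = (1 / e ^ DIM('x)) *\<^sub>R (bump_ft ((1 / e) *\<^sub>R (Z - X)) *\<^sub>C f Z)"
        unfolding i by (simp add: scaleC.scaleR_left)
    qed
    also have "integral UNIV \<dots> = integral UNIV (\<lambda>V. bump_ft V *\<^sub>C f (e *\<^sub>R V + X))"
    proof -
      let ?k = "\<lambda>Z. bump_ft ((1 / e) *\<^sub>R (Z - X)) *\<^sub>C f Z"
      have dk: "dec ?k"
      proof (rule dec_bounded[OF fd, of _ "\<bar>Cg\<bar>"])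
        show "continuous_on UNIV ?k"
          by (intro continuous_on_scaleC dec_continuous[OF fd] continuous_on_compose2[OF dec_continuous[OF dec_bump_ft[OF c]]] continuous_intros) auto
        show "norm (?k Y) \<le> \<bar>Cg\<bar> * norm (f Y)" for Y
        proof -
          have "Cg * wt ((1 / e) *\<^sub>R (Y - X)) \<le> \<bar>Cg\<bar> * 1" by (intro mult_mono) (auto simp: wt_le_1)
          then have "norm (bump_ft ((1 / e) *\<^sub>R (Y - X))) \<le> \<bar>Cg\<bar>" using Cg[of "(1 / e) *\<^sub>R (Y - X)"] by simp
          then show ?thesis by (simp add: norm_scaleC mult_right_mono)
        qed
      qed simp
      have "integral UNIV (\<lambda>V. ?k (e *\<^sub>R V + X)) = (1 / e ^ DIM('x)) *\<^sub>R integral UNIV ?k"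
        using integral_unique[OF integral_affine[OF dec_integrable[OF dk], of e X]] e by simp
      moreover have "?k (e *\<^sub>R V + X) = bump_ft V *\<^sub>C f (e *\<^sub>R V + X)" for V using e by simp
      ultimately show ?thesis by simp
    qed
    finally show ?thesis .
  qed
  then have "\<forall>\<^sub>F e in at_right 0. ?L e = c *\<^sub>R integral UNIV (\<lambda>V. bump_ft V *\<^sub>C f (e *\<^sub>R V + X))"
    unfolding eventually_at_filter by (intro always_eventually) auto
  ultimately have "((\<lambda>e. c *\<^sub>R integral UNIV (\<lambda>V. bump_ft V *\<^sub>C f (e *\<^sub>R V + X))) \<longlongrightarrow>
      integral UNIV (\<lambda>Y. cis (- \<omega> X Y) *\<^sub>C h Y)) (at_right 0)"
    by (rule Lim_transform_eventually)
  moreover have "((\<lambda>e. c *\<^sub>R integral UNIV (\<lambda>V. bump_ft V *\<^sub>C f (e *\<^sub>R V + X))) \<longlongrightarrow>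
      c *\<^sub>R integral UNIV (\<lambda>V. bump_ft V *\<^sub>C f X)) (at_right 0)"
  proof (intro tendsto_intros tendsto_integral[where C = "Cg * Bf"])
    have le: "norm (bump_ft V *\<^sub>C f Z) \<le> Cg * Bf * wt V" for V Z
      using mult_mono[OF Cg[of V] Bf(2)[of Z] order_trans[OF norm_ge_zero Cg]] by (simp add: norm_scaleC mult_ac)
    show "norm (bump_ft V *\<^sub>C f (e *\<^sub>R V + X)) \<le> Cg * Bf * wt V" "norm (bump_ft V *\<^sub>C f X) \<le> Cg * Bf * wt V" for V e
      by (rule le)+
    show "continuous_on UNIV (\<lambda>V. bump_ft V *\<^sub>C f (e *\<^sub>R V + X))" for e
      by (intro continuous_on_scaleC dec_continuous[OF dec_bump_ft[OF c]] continuous_on_compose2[OF dec_continuous[OF fd]] continuous_intros) auto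
    show "continuous_on UNIV (\<lambda>V. bump_ft V *\<^sub>C f X)"
      by (intro continuous_on_scaleC dec_continuous[OF dec_bump_ft[OF c]] continuous_intros)
    fix V
    have "((\<lambda>e. f (e *\<^sub>R V + X)) \<longlongrightarrow> f (0 *\<^sub>R V + X)) (at_right 0)"
      by (rule continuous_on_tendsto_compose[OF dec_continuous[OF fd]]) ((intro tendsto_intros | simp)+)
    then show "((\<lambda>e. bump_ft V *\<^sub>C f (e *\<^sub>R V + X)) \<longlongrightarrow> bump_ft V *\<^sub>C f X) (at_right 0)"
      by (intro scaleC.tendsto tendsto_const) simp
  qed
  ultimately have "integral UNIV (\<lambda>Y. cis (- \<omega> X Y) *\<^sub>C h Y) = c *\<^sub>R integral UNIV (\<lambda>V. bump_ft V *\<^sub>C f X)"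
    by (rule tendsto_unique[rotated]) simp
  also have "integral UNIV (\<lambda>V. bump_ft V *\<^sub>C f X) = integral UNIV bump_ft *\<^sub>C f X"
    using integral_linear[OF dec_integrable[OF dec_bump_ft[OF c]] scaleC.bounded_linear_left, of "f X"] by (simp add: o_def)
  finally show ?thesis
    unfolding h_def[symmetric] FT_def[of \<omega> c h] dint_def
    by (simp add: scaleR_scaleC scaleC_scaleC power2_eq_square mult_ac)
qed

end

section \<open>The constant in the inversion formula\<close>

lemma scaled_lborel_density: "c > 0 \<Longrightarrow> scaled_lborel c = density lborel (\<lambda>_. ennreal c)"
  unfolding scaled_lborel_def by (rule measure_eqI) (simp_all add: emeasure_density_const)

text \<open>The bridge between the measure integrals in which unitarity is expressed and the
  integrals used for algebra-valued functions; it concerns Euclidean targets only.\<close>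

lemma
  fixes f :: "'x::euclidean_space \<Rightarrow> 'b::euclidean_space"
  assumes c: "c > 0" and f: "dec f"
  shows integrable_scaled_lborel: "integrable (scaled_lborel c) f"
    and integral_scaled_lborel: "(\<integral>X. f X \<partial>scaled_lborel c) = dint c f"
proof -
  have m: "f \<in> borel_measurable borel" by (intro borel_measurable_continuous_onI dec_continuous f)
  obtain C where C: "\<And>X. norm (f X) \<le> C * wt X" using f by (auto simp: dec_def)
  have i: "integrable lborel f"
  proof (rule Bochner_Integration.integrable_bound)
    show "integrable lborel (\<lambda>X::'x. C * wt X)" by (intro integrable_mult_right integrable_wt)
    show "AE X in lborel. norm (f X) \<le> norm (C * wt X)" using order_trans[OF C abs_ge_self] by (intro AE_I2) simp
  qed (use m in simp)
  show "integrable (scaled_lborel c) f"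
    unfolding scaled_lborel_density[OF c] using c m i by (subst integrable_density) auto
  show "(\<integral>X. f X \<partial>scaled_lborel c) = dint c f"
    unfolding scaled_lborel_density[OF c] dint_def integral_lborel[OF i]
    using c m i by (subst integral_density) auto
qed

locale normalized = fourier \<Theta> \<omega> c
  for \<Theta> :: "'x::euclidean_space \<Rightarrow> 'a::cstar_algebra \<Rightarrow> 'a" and \<omega> :: "'x \<Rightarrow> 'x \<Rightarrow> real" and c :: real +
  assumes fn: "fourier_normalized \<omega> c"
begin

lemma c_pos: "c > 0" using fn by (simp add: fourier_normalized_def)

text \<open>\<open>U\<close> maps the bump to its transform almost everywhere, so isometry of
  \<open>U\<close> is the Plancherel identity for this one function; the positive factor
  \<open>c\<close> occurs on both sides and cancels.\<close>

lemma norm_FT_cbump: "integral UNIV (\<lambda>X. (cmod (FT \<omega> c cbump X))\<^sup>2) = integral UNIV (\<lambda>X::'x. (bump X)\<^sup>2)"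
proof -
  let ?\<gamma> = "FT \<omega> c (cbump :: 'x \<Rightarrow> complex)"
  have sq: "dec (\<lambda>X. (cmod (g X))\<^sup>2)" if g: "triv.schw g" for g :: "'x \<Rightarrow> complex"
  proof -
    obtain B where B: "B \<ge> 0" "\<And>X. cmod (g X) \<le> B" using triv.schw_bound[OF g, of 0] by auto
    show ?thesis
      by (rule dec_bounded[OF triv.schw_dec[OF g], of _ B])
         (auto simp: power2_eq_square B intro!: mult_right_mono continuous_intros triv.schw_continuous g)
  qed
  have L2: "g \<in> L2_functions c" if "triv.schw g" for g :: "'x \<Rightarrow> complex"
    unfolding L2_functions_def
    using integrable_scaled_lborel[OF c_pos sq[OF that]] borel_measurable_continuous_onI[OF triv.schw_continuous[OF that]] by simp
  from fn[unfolded fourier_normalized_def, THEN conjunct2] obtain U where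
    U0: "\<forall>a \<in> L2_functions c. U a \<in> L2_functions c
        \<and> (\<integral>X. (cmod (U a X))\<^sup>2 \<partial>scaled_lborel c) = (\<integral>X. (cmod (a X))\<^sup>2 \<partial>scaled_lborel c)"
      "\<forall>a \<in> L2_functions c. integrable (scaled_lborel c) a \<longrightarrow>
          (AE X in scaled_lborel c. U a X = (\<integral>Y. cis (- \<omega> X Y) * a Y \<partial>scaled_lborel c))"
    by (elim exE conjE) (rule that, assumption+)
  note U = U0(1)[rule_format] U0(2)[rule_format]
  have b: "(cbump :: 'x \<Rightarrow> complex) \<in> L2_functions c" by (rule L2[OF schw_cbump])
  have sg: "triv.schw ?\<gamma>" by (rule triv.schw_FT[OF schw_cbump])
  have ft: "(\<integral>Y. cis (- \<omega> X Y) * cbump Y \<partial>scaled_lborel c) = ?\<gamma> X" for X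
    using integral_scaled_lborel[OF c_pos triv.dec_FT[OF triv.schw_dec[OF schw_cbump], of X]]
    by (simp add: FT_def scaleC_complex_def)
  have "(\<integral>X. (cmod (U cbump X))\<^sup>2 \<partial>scaled_lborel c) = (\<integral>X. (cmod (?\<gamma> X))\<^sup>2 \<partial>scaled_lborel c)"
  proof (rule integral_cong_AE)
    have sets: "sets (scaled_lborel c :: 'x measure) = sets borel" by (simp add: scaled_lborel_def)
    have [measurable]: "U cbump \<in> borel_measurable borel" using U(1)[OF b] by (simp add: L2_functions_def)
    show "(\<lambda>X. (cmod (U cbump X))\<^sup>2) \<in> borel_measurable (scaled_lborel c)"
      unfolding measurable_cong_sets[OF sets refl] by measurable
    have [measurable]: "?\<gamma> \<in> borel_measurable borel" using L2[OF sg] by (simp add: L2_functions_def)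
    show "(\<lambda>X. (cmod (?\<gamma> X))\<^sup>2) \<in> borel_measurable (scaled_lborel c)"
      unfolding measurable_cong_sets[OF sets refl] by measurable
    show "AE X in scaled_lborel c. (cmod (U cbump X))\<^sup>2 = (cmod (?\<gamma> X))\<^sup>2"
      using U(2)[OF b integrable_scaled_lborel[OF c_pos triv.schw_dec[OF schw_cbump]]] unfolding ft by auto
  qed
  also have "(\<integral>X. (cmod (U cbump X))\<^sup>2 \<partial>scaled_lborel c) = (\<integral>X. (cmod (cbump (X::'x)))\<^sup>2 \<partial>scaled_lborel c)"
    using U(1)[OF b] by (rule conjunct2)
  finally have "dint c (\<lambda>X::'x. (cmod (cbump X))\<^sup>2) = dint c (\<lambda>X. (cmod (?\<gamma> X))\<^sup>2)"
    by (simp only: integral_scaled_lborel[OF c_pos sq[OF sg]] integral_scaled_lborel[OF c_pos sq[OF schw_cbump]])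
  then show ?thesis using c_pos by (simp add: dint_def)
qed

text \<open>By Fubini the integral of the squared modulus of the transform equals that of the bump
  times its double transform, which is C I with I the integral of the squared bump. By
  \<open>norm_FT_cbump\<close> it also equals I, and I is not 0 since the bump is continuous with
  value 1 at the origin.\<close>

lemma inversion_constant: "complex_of_real (c\<^sup>2) * integral UNIV bump_ft = 1"
proof -
  let ?\<gamma> = "FT \<omega> c (cbump :: 'x \<Rightarrow> complex)"
  define C where "C = complex_of_real (c\<^sup>2) * integral UNIV bump_ft"
  define I where "I = integral UNIV (\<lambda>X::'x. (bump X)\<^sup>2)"
  have sg: "triv.schw ?\<gamma>" by (rule triv.schw_FT[OF schw_cbump])
  have dg: "dec ?\<gamma>" and db: "dec (cbump :: 'x \<Rightarrow> complex)" by (rule triv.schw_dec[OF sg] triv.schw_dec[OF schw_cbump])+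
  obtain Cg where Cg: "\<And>X. norm (?\<gamma> X) \<le> Cg * wt X" using dg by (auto simp: dec_def)
  obtain Cb where Cb: "\<And>X. norm (cbump X) \<le> Cb * wt (X::'x)" using db unfolding dec_def by blast
  have sq: "dec (\<lambda>X::'x. (bump X)\<^sup>2)"
    by (rule dec_compact[of _ 2]) (auto simp: bump_0 intro!: continuous_intros)
  have sqg: "dec (\<lambda>X. (cmod (?\<gamma> X))\<^sup>2)"
  proof -
    obtain B where B: "B \<ge> 0" "\<And>X. cmod (?\<gamma> X) \<le> B" using triv.schw_bound[OF sg, of 0] by auto
    show ?thesis
      by (rule dec_bounded[OF dg, of _ B])
         (auto simp: power2_eq_square B intro!: mult_right_mono continuous_intros dec_continuous[OF dg])
  qed
  have FF: "FT \<omega> c ?\<gamma> Y = C * cbump Y" for Y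
    using triv.FT_FT_const[OF _ schw_cbump, of Y] c_pos
    by (simp add: C_def scaleC_complex_def bump_ft_def triv.bump_ft_def cong del: if_weak_cong)
  define u where "u = (\<lambda>X Y. cis (\<omega> X Y) * cbump Y * ?\<gamma> X)"
  have uc: "continuous_on UNIV (\<lambda>(X, Y). u X Y)"
    unfolding u_def split_beta
    by (intro continuous_intros continuous_on_cis continuous_on_compose2[OF dec_continuous[OF dg]]) auto
  have ub: "norm (u X Y) \<le> (Cg * Cb) * (wt X * wt Y)" for X Y
  proof -
    have "norm (cbump Y) * norm (?\<gamma> X) \<le> (Cb * wt Y) * (Cg * wt X)"
      by (intro mult_mono Cb Cg order_trans[OF norm_ge_zero Cb]) auto
    then show ?thesis by (simp add: u_def norm_mult mult_ac)
  qed
  have 1: "complex_of_real ((cmod (?\<gamma> X))\<^sup>2) = c *\<^sub>R integral UNIV (u X)" for X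
  proof -
    have "cnj (?\<gamma> X) = c *\<^sub>R integral UNIV (\<lambda>Y. cis (\<omega> X Y) * cbump Y)"
      using integral_linear[OF dec_integrable[OF triv.dec_FT[OF db, of X]] bounded_linear_cnj]
      by (simp add: FT_def dint_def o_def scaleC_complex_def cis_cnj)
    moreover have "dec (\<lambda>Y. cis (\<omega> X Y) * cbump Y)"
      using triv.dec_FT[OF db, of "- X"] by (simp add: scaleC_complex_def \<omega>.minus_left)
    then have "integral UNIV (\<lambda>Y. cis (\<omega> X Y) * cbump Y) * ?\<gamma> X = integral UNIV (u X)"
      using integral_linear[OF dec_integrable bounded_linear_mult_left, of "\<lambda>Y. cis (\<omega> X Y) * cbump Y" "?\<gamma> X"]
      by (simp add: o_def u_def)
    moreover have "complex_of_real ((cmod (?\<gamma> X))\<^sup>2) = cnj (?\<gamma> X) * ?\<gamma> X"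
      by (subst complex_norm_square) (rule mult.commute)
    ultimately show ?thesis by simp
  qed
  have 2: "c *\<^sub>R integral UNIV (\<lambda>X. u X Y) = C * complex_of_real ((bump Y)\<^sup>2)" for Y
  proof -
    have "integral UNIV (\<lambda>X. cbump Y * (cis (- \<omega> Y X) * ?\<gamma> X)) = cbump Y * integral UNIV (\<lambda>X. cis (- \<omega> Y X) * ?\<gamma> X)"
      using integral_linear[OF dec_integrable[OF triv.dec_FT[OF dg, of Y]] bounded_linear_mult_right, of "cbump Y"]
      by (simp add: o_def scaleC_complex_def)
    moreover have "u X Y = cbump Y * (cis (- \<omega> Y X) * ?\<gamma> X)" for X
      by (simp add: u_def form_antisym[of X Y] mult_ac)
    ultimately have "c *\<^sub>R integral UNIV (\<lambda>X. u X Y) = cbump Y * FT \<omega> c ?\<gamma> Y"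
      by (simp add: FT_def dint_def scaleC_complex_def)
    then show ?thesis by (simp add: FF power2_eq_square)
  qed
  have "complex_of_real I = complex_of_real (integral UNIV (\<lambda>X. (cmod (?\<gamma> X))\<^sup>2))"
    by (simp add: I_def norm_FT_cbump)
  also have "\<dots> = integral UNIV (\<lambda>X. complex_of_real ((cmod (?\<gamma> X))\<^sup>2))"
    using integral_linear[where h = "of_real :: real \<Rightarrow> complex", OF dec_integrable[OF sqg] bounded_linear_of_real] by (simp add: o_def)
  also have "\<dots> = c *\<^sub>R integral UNIV (\<lambda>X. integral UNIV (u X))" unfolding 1 by simp
  also have "\<dots> = c *\<^sub>R integral UNIV (\<lambda>Y. integral UNIV (\<lambda>X. u X Y))" by (simp only: fubini_swap[OF uc ub])
  also have "\<dots> = integral UNIV (\<lambda>Y. c *\<^sub>R integral UNIV (\<lambda>X. u X Y))" by simp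
  also have "\<dots> = C * integral UNIV (\<lambda>Y::'x. complex_of_real ((bump Y)\<^sup>2))" unfolding 2 by simp
  also have "integral UNIV (\<lambda>Y::'x. complex_of_real ((bump Y)\<^sup>2)) = complex_of_real I"
    using integral_linear[where h = "of_real :: real \<Rightarrow> complex", OF dec_integrable[OF sq] bounded_linear_of_real] by (simp add: o_def I_def)
  finally have "complex_of_real I = C * complex_of_real I" .
  moreover have "I \<noteq> 0"
  proof
    assume "I = 0"
    then have "((\<lambda>X::'x. (bump X)\<^sup>2) has_integral 0) (cbox (- One) One)"
    proof -
      have le: "integral (cbox (- One) One) (\<lambda>X::'x. (bump X)\<^sup>2) \<le> I"
        unfolding I_def by (rule integral_subset_le) (use dec_integrable[OF sq] in \<open>auto intro: integrable_on_subcbox\<close>)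
      have i: "(\<lambda>X::'x. (bump X)\<^sup>2) integrable_on cbox (- One) One"
        using integrable_on_subcbox[OF dec_integrable[OF sq]] by simp
      have "integral (cbox (- One) One) (\<lambda>X::'x. (bump X)\<^sup>2) \<ge> 0" by (rule integral_nonneg[OF i]) simp
      then show ?thesis using le \<open>I = 0\<close> i by (simp add: has_integral_iff)
    qed
    then have "(bump (0::'x))\<^sup>2 = 0"
    proof (rule has_integral_0_cbox_imp_0[rotated 2])
      show "continuous_on (cbox (- One) One) (\<lambda>X::'x. (bump X)\<^sup>2)" by (intro continuous_intros)
      show "(0::'x) \<in> cbox (- One) One" by (simp add: mem_box)
      show "box (- One) (One::'x) \<noteq> {}" by (simp add: box_ne_empty)
    qed simp
    then show False by (simp add: bump_1)
  qed
  ultimately show ?thesis unfolding C_def[symmetric] by simp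
qed

theorem FT_FT: "schw f \<Longrightarrow> FT \<omega> c (FT \<omega> c f) = f"
  using FT_FT_const[of f] c_pos inversion_constant by (auto simp: scaleC_one)

lemma M_M_inv: assumes "schw G" shows "M_map \<omega> c \<Theta> (M_inv \<omega> c \<Theta> G) = G"
proof -
  have "(\<lambda>Y. \<Theta> (1 *\<^sub>R Y) (M_inv \<omega> c \<Theta> G Y)) = FT \<omega> c G"
    using M_inv_FT[OF schw_dec[OF assms]] by (simp add: fun_eq_iff act_act)
  then show ?thesis unfolding M_map_FT using FT_FT[OF assms] by simp
qed

lemma M_inv_M: assumes "schw F" shows "M_inv \<omega> c \<Theta> (M_map \<omega> c \<Theta> F) = F"
proof
  fix X
  have "FT \<omega> c (M_map \<omega> c \<Theta> F) = (\<lambda>Y. \<Theta> (1 *\<^sub>R Y) (F Y))"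
    unfolding M_map_FT by (rule FT_FT[OF schw_act[OF assms]])
  then show "M_inv \<omega> c \<Theta> (M_map \<omega> c \<Theta> F) X = F X"
    using M_inv_FT[OF schw_dec[OF schw_M_map[OF assms]], of X] by (simp add: act_act)
qed

end

section \<open>Oscillatory integrals\<close>

text \<open>Integration by parts with \<open>cis \<Phi> = u (1 + \<partial>\<^sub>b) cis \<Phi>\<close>, where \<open>u = 1 / (1 + \<i> \<partial>\<^sub>b \<Phi>)\<close>, gains a factor
  \<open>u\<close> of decay in each step and keeps the amplitude in the same class.\<close>

context fourier
begin

definition phase :: "'x \<times> 'x \<Rightarrow> real" where
  "phase P = 2 * \<omega> (fst P) (snd P)"

definition slope :: "'x \<times> 'x \<Rightarrow> 'x \<times> 'x \<Rightarrow> real" where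
  "slope b P = 2 * (\<omega> (fst P) (snd b) + \<omega> (fst b) (snd P))"

definition damp :: "'x \<times> 'x \<Rightarrow> 'x \<times> 'x \<Rightarrow> complex" where
  "damp b P = 1 / (1 + \<i> * of_real (slope b P))"

lemma linear_slope: "linear (slope b)" "linear (\<lambda>b. slope b P)"
  by (auto intro!: linearI simp: slope_def \<omega>.add_left \<omega>.add_right \<omega>.scaleR_left \<omega>.scaleR_right algebra_simps)

lemma continuous_on_phase [continuous_intros]: "continuous_on T f \<Longrightarrow> continuous_on T (\<lambda>x. phase (f x))"
  unfolding phase_def by (intro continuous_intros)

lemma continuous_on_slope: "continuous_on T f \<Longrightarrow> continuous_on T (\<lambda>x. slope b (f x))"
  unfolding slope_def by (intro continuous_intros)

lemma damp_denominator: "1 + \<i> * complex_of_real r \<noteq> 0"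
  by (simp add: complex_eq_iff)

lemma continuous_on_damp [continuous_intros]: "continuous_on T f \<Longrightarrow> continuous_on T (\<lambda>x. damp b (f x))"
  unfolding damp_def by (intro continuous_intros continuous_on_slope) (simp_all add: damp_denominator)

lemma damp_eq: "\<i> * of_real (slope b P) * damp b P = 1 - damp b P"
  using damp_denominator[of "slope b P"] by (simp add: damp_def field_simps)

lemma norm_damp_denominator: "1 \<le> cmod (1 + \<i> * of_real r)" "\<bar>r\<bar> \<le> cmod (1 + \<i> * of_real r)"
  using abs_Re_le_cmod[of "1 + \<i> * of_real r"] abs_Im_le_cmod[of "1 + \<i> * of_real r"] by simp_all

lemma norm_damp: "cmod (damp b P) = 1 / cmod (1 + \<i> * of_real (slope b P))"
  by (simp add: damp_def norm_divide)

lemma norm_damp_le_1: "cmod (damp b P) \<le> 1"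
  unfolding norm_damp using norm_damp_denominator(1)[of "slope b P"] by (simp add: divide_le_eq_1)

lemma has_dd_phase: "has_dd b phase (slope b)"
proof -
  have "has_dd b (\<lambda>P. \<omega> (fst P) (snd P)) (\<lambda>P. \<omega> (fst P) (snd b) + \<omega> (fst b) (snd P))"
    by (intro \<omega>.has_dd has_dd_linear) (auto intro!: linearI)
  from bounded_linear.has_dd[OF bounded_linear_mult_right this, of 2]
  show ?thesis by (simp add: phase_def[abs_def] slope_def[abs_def])
qed

text \<open>A basis vector of the product has only one nonzero component, so the phase is affine
  along it. Hence \<open>damp b\<close> is constant in direction b and is not differentiated in the
  integration by parts.\<close>

lemma slope_self: "b \<in> Basis \<Longrightarrow> slope b b = 0"
  by (auto simp: slope_def Basis_prod_def \<omega>.zero_left \<omega>.zero_right)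

lemma has_dd_damp: "has_dd b' (damp b) (\<lambda>P. (- \<i> * of_real (slope b b')) * (damp b P)\<^sup>2)"
  unfolding has_dd_def has_vector_derivative_at_iff
proof
  fix P
  let ?\<beta> = "- \<i> * complex_of_real (slope b b')"
  have e: "(1 / t) *\<^sub>R (damp b (P + (0 + t) *\<^sub>R b') - damp b (P + 0 *\<^sub>R b')) = ?\<beta> * (damp b (P + t *\<^sub>R b') * damp b P)"
    if "t \<noteq> 0" for t
  proof -
    have s: "slope b (P + t *\<^sub>R b') = slope b P + t * slope b b'"
      by (simp add: linear_add[OF linear_slope(1)] linear_scale[OF linear_slope(1)])
    have n: "1 + \<i> * complex_of_real (slope b P) \<noteq> 0" "1 + \<i> * complex_of_real (slope b P + t * slope b b') \<noteq> 0"
      by (rule damp_denominator)+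
    have "damp b (P + t *\<^sub>R b') - damp b P = of_real t * (?\<beta> * (damp b (P + t *\<^sub>R b') * damp b P))"
      unfolding damp_def s diff_frac_eq[OF n(2,1)] by (simp add: algebra_simps)
    then show ?thesis using that by (simp add: scaleR_conv_of_real)
  qed
  have "((\<lambda>t. P + t *\<^sub>R b') \<longlongrightarrow> P + 0 *\<^sub>R b') (at 0)" by (intro tendsto_intros)
  then have "((\<lambda>t. damp b (P + t *\<^sub>R b')) \<longlongrightarrow> damp b (P + 0 *\<^sub>R b')) (at 0)"
    by (rule continuous_on_tendsto_compose[OF continuous_on_damp[OF continuous_on_id[of UNIV]]]) simp_all
  then have "((\<lambda>t. damp b (P + t *\<^sub>R b')) \<longlongrightarrow> damp b P) (at 0)" by simp
  then have "((\<lambda>t. ?\<beta> * (damp b (P + t *\<^sub>R b') * damp b P)) \<longlongrightarrow> ?\<beta> * (damp b P * damp b P)) (at 0)"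
    by (intro tendsto_intros)
  then have "((\<lambda>t. ?\<beta> * (damp b (P + t *\<^sub>R b') * damp b P)) \<longlongrightarrow> ?\<beta> * (damp b P)\<^sup>2) (at 0)"
    by (simp add: power2_eq_square)
  moreover have "\<forall>\<^sub>F t in at 0. ?\<beta> * (damp b (P + t *\<^sub>R b') * damp b P)
      = (1 / t) *\<^sub>R (damp b (P + (0 + t) *\<^sub>R b') - damp b (P + 0 *\<^sub>R b'))"
    unfolding eventually_at_filter by (intro always_eventually allI impI e[symmetric])
  ultimately show "((\<lambda>t. (1 / t) *\<^sub>R (damp b (P + (0 + t) *\<^sub>R b') - damp b (P + 0 *\<^sub>R b'))) \<longlongrightarrow> ?\<beta> * (damp b P)\<^sup>2) (at 0)"
    by (rule Lim_transform_eventually)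
qed

lemma has_dd_damp_power:
  "has_dd b' (\<lambda>P. damp b P ^ j) (\<lambda>P. (of_nat j * (- \<i> * of_real (slope b b'))) * damp b P ^ Suc j)"
proof (induction j)
  case 0
  then show ?case using has_dd_const[of b' "1::complex"] by simp
next
  case (Suc j)
  show ?case
    using bounded_bilinear.has_dd[OF bounded_bilinear_mult has_dd_damp[of b' b] Suc.IH]
    by (simp add: algebra_simps power2_eq_square)
qed

text \<open>The denominators have modulus at least 1 and at least the respective slope, so their
  product dominates every slope; by nondegeneracy the slopes together dominate the norm of P. One
  round through all directions thus gains one power of decay.\<close>

lemma prod_damp_bound: "\<exists>K. \<forall>P. (\<Prod>b\<in>Basis. cmod (damp b P)) \<le> K / (1 + norm P)"
proof -
  have "\<exists>K\<ge>0. \<forall>P. norm P \<le> K * (\<Sum>b\<in>Basis. \<bar>slope b P\<bar>)"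
  proof (rule bilinear_nondegenerate_bound[of "\<lambda>P b. slope b P"])
    fix P assume 0: "\<And>b. b \<in> Basis \<Longrightarrow> slope b P = 0"
    have "\<omega> (fst P) b = 0" if "b \<in> Basis" for b using 0[of "(0, b)"] that by (simp add: slope_def Basis_prod_def \<omega>.zero_left)
    moreover have "\<omega> (snd P) b = 0" if "b \<in> Basis" for b
      using 0[of "(b, 0)"] that form_antisym[of "snd P" b] by (simp add: slope_def Basis_prod_def \<omega>.zero_right)
    ultimately show "P = 0" by (intro prod_eqI) (auto intro: form_nondegenerate)
  qed (rule linear_slope)
  then obtain K where K: "K \<ge> 0" "\<And>P. norm P \<le> K * (\<Sum>b\<in>Basis. \<bar>slope b P\<bar>)" by blast
  define D where "D = real (DIM('x \<times> 'x))"
  have "(\<Prod>b\<in>Basis. cmod (damp b P)) \<le> (1 + K * D) / (1 + norm P)" for P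
  proof -
    let ?m = "\<lambda>b. cmod (1 + \<i> * of_real (slope b P))"
    define p where "p = (\<Prod>b\<in>Basis. ?m b)"
    have m1: "1 \<le> p" unfolding p_def by (intro prod_ge_1 norm_damp_denominator)
    have "\<bar>slope b P\<bar> \<le> p" if b: "b \<in> Basis" for b
    proof -
      have "\<bar>slope b P\<bar> * 1 \<le> ?m b * (\<Prod>b\<in>Basis - {b}. ?m b)"
        by (intro mult_mono prod_ge_1 norm_damp_denominator) auto
      also have "\<dots> = p" unfolding p_def using b by (subst prod.remove[of _ b]) auto
      finally show ?thesis by simp
    qed
    then have "(\<Sum>b\<in>Basis. \<bar>slope b P\<bar>) \<le> D * p"
      unfolding D_def using sum_bounded_above[of "Basis :: ('x \<times> 'x) set" "\<lambda>b. \<bar>slope b P\<bar>" p] by simp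
    then have "norm P \<le> K * (D * p)"
      by (rule order_trans[OF K(2) mult_left_mono]) (rule K(1))
    then have le: "1 + norm P \<le> (1 + K * D) * p" using m1 by (simp add: algebra_simps)
    have n0: "1 + norm P > 0" by (simp add: add_pos_nonneg)
    have "(\<Prod>b\<in>Basis. cmod (damp b P)) = 1 / p" by (simp add: norm_damp p_def prod_dividef)
    also have "\<dots> \<le> (1 + K * D) / (1 + norm P)" using le n0 m1 by (simp add: divide_simps mult.commute)
    finally show ?thesis .
  qed
  then show ?thesis by blast
qed

text \<open>The arguments are the regularization e, the outer variables \<theta> = (A, B) and the
  inner variables P = (Y, Z). The value e = 0 stands for the amplitude without regularization, where
  compact support in P is lost but the bound remains.\<close>

definition oscG :: "('x \<times> 'x \<Rightarrow> real) \<Rightarrow> (real \<Rightarrow> 'x \<times> 'x \<Rightarrow> 'x \<times> 'x \<Rightarrow> 'a) \<Rightarrow> bool" where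
  "oscG W F \<longleftrightarrow> (\<forall>e\<in>{0..1}. continuous_on UNIV (\<lambda>(\<theta>, P). F e \<theta> P))
    \<and> (\<exists>C. \<forall>e\<in>{0..1}. \<forall>\<theta> P. norm (F e \<theta> P) \<le> C * (wt \<theta> * W P))
    \<and> (\<forall>\<theta> P. ((\<lambda>e. F e \<theta> P) \<longlongrightarrow> F 0 \<theta> P) (at_right 0))
    \<and> (\<forall>e\<in>{0<..1}. \<forall>\<theta>. \<exists>R. \<forall>P. norm P > R \<longrightarrow> F e \<theta> P = 0)"

definition oscD :: "'x \<times> 'x \<Rightarrow> (real \<Rightarrow> 'x \<times> 'x \<Rightarrow> 'x \<times> 'x \<Rightarrow> 'a) \<Rightarrow> (real \<Rightarrow> 'x \<times> 'x \<Rightarrow> 'x \<times> 'x \<Rightarrow> 'a) \<Rightarrow> bool" where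
  "oscD b F G \<longleftrightarrow> (\<forall>e\<in>{0..1}. \<forall>\<theta>. has_dd b (F e \<theta>) (G e \<theta>))"

definition osc :: "('x \<times> 'x \<Rightarrow> real) \<Rightarrow> (real \<Rightarrow> 'x \<times> 'x \<Rightarrow> 'x \<times> 'x \<Rightarrow> 'a) \<Rightarrow> bool" where
  "osc W = jet (oscD ` Basis) (oscG W)"

lemma oscG_add:
  assumes "oscG W F" "oscG W F'" shows "oscG W (F + F')"
  unfolding oscG_def
proof (intro conjI ballI allI)
  fix e :: real assume e: "e \<in> {0..1}"
  have "continuous_on UNIV (\<lambda>z. (case z of (\<theta>, P) \<Rightarrow> F e \<theta> P) + (case z of (\<theta>, P) \<Rightarrow> F' e \<theta> P))"
    using assms e unfolding oscG_def by (intro continuous_on_add) blast+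
  then show "continuous_on UNIV (\<lambda>(\<theta>, P). (F + F') e \<theta> P)" by (simp add: split_beta)
next
  obtain C D where C: "\<And>e \<theta> P. e \<in> {0..1} \<Longrightarrow> norm (F e \<theta> P) \<le> C * (wt \<theta> * W P)"
    and D: "\<And>e \<theta> P. e \<in> {0..1} \<Longrightarrow> norm (F' e \<theta> P) \<le> D * (wt \<theta> * W P)"
    using assms unfolding oscG_def by metis
  have "norm ((F + F') e \<theta> P) \<le> (C + D) * (wt \<theta> * W P)" if "e \<in> {0..1}" for e \<theta> P
    using norm_triangle_mono[OF C[OF that, of \<theta> P] D[OF that, of \<theta> P]] by (simp add: distrib_right)
  then show "\<exists>C. \<forall>e\<in>{0..1}. \<forall>\<theta> P. norm ((F + F') e \<theta> P) \<le> C * (wt \<theta> * W P)" by blast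
next
  fix \<theta> P
  have "((\<lambda>e. F e \<theta> P + F' e \<theta> P) \<longlongrightarrow> F 0 \<theta> P + F' 0 \<theta> P) (at_right 0)"
    using assms unfolding oscG_def by (intro tendsto_add) blast+
  then show "((\<lambda>e. (F + F') e \<theta> P) \<longlongrightarrow> (F + F') 0 \<theta> P) (at_right 0)" by simp
next
  fix e :: real and \<theta> assume e: "e \<in> {0<..1}"
  obtain R R' where "\<And>P. norm P > R \<Longrightarrow> F e \<theta> P = 0" "\<And>P. norm P > R' \<Longrightarrow> F' e \<theta> P = 0"
    using assms e unfolding oscG_def by metis
  then show "\<exists>R. \<forall>P. norm P > R \<longrightarrow> (F + F') e \<theta> P = 0" by (intro exI[of _ "max R R'"]) auto
qed

lemma oscD_add:
  assumes "R \<in> oscD ` Basis" "R F H" "R F' H'" shows "R (F + F') (H + H')"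
proof -
  obtain b where R: "R = oscD b" using assms(1) by blast
  have "has_dd b ((F + F') e \<theta>) ((H + H') e \<theta>)" if "e \<in> {0..1}" for e \<theta>
  proof -
    have "has_dd b (F e \<theta>) (H e \<theta>)" "has_dd b (F' e \<theta>) (H' e \<theta>)"
      using assms(2,3) that unfolding R oscD_def by blast+
    from has_dd_add[OF this] show ?thesis by (simp add: plus_fun_def)
  qed
  then show ?thesis by (simp add: R oscD_def)
qed

lemma osc_coinduct:
  assumes G: "\<And>F. F \<in> C \<Longrightarrow> oscG W F"
    and D: "\<And>F b. F \<in> C \<Longrightarrow> b \<in> Basis \<Longrightarrow> \<exists>H. oscD b F H \<and> addspan C H" and F: "F \<in> C"
  shows "osc W F"
  unfolding osc_def
proof (rule jet_upto[where C = C])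
  show "addspan C F" using F by (rule addspan_base)
  fix F R assume FR: "F \<in> C" "R \<in> oscD ` Basis"
  from FR(2) show "\<exists>H. R F H \<and> addspan C H" by (elim imageE) (simp only: D[OF FR(1)])
qed (rule oscG_add oscD_add G; assumption)+

lemma osc_add: "osc W F \<Longrightarrow> osc W F' \<Longrightarrow> osc W (F + F')"
  unfolding osc_def by (rule jet_add) (rule oscG_add oscD_add; assumption)+

lemma osc_oscG: "osc W F \<Longrightarrow> oscG W F"
  unfolding osc_def by (auto elim: jet.cases)

lemma osc_oscD: "osc W F \<Longrightarrow> b \<in> Basis \<Longrightarrow> \<exists>H. oscD b F H \<and> osc W H"
  unfolding osc_def by (erule jet.cases) blast

text \<open>A derivative of \<open>damp b P ^ j\<close> in any direction is a multiple of
  \<open>damp b P ^ Suc j\<close>, so the class with exponents j \<ge> m is closed and no decay is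
  lost. This is why the hypothesis on \<open>W'\<close> ranges over all j \<ge> m.\<close>

lemma osc_mult:
  assumes W: "\<And>P. W P \<ge> 0" and W': "\<And>j P. j \<ge> m \<Longrightarrow> cmod (damp b P) ^ j * W P \<le> W' P" and F: "osc W F"
  shows "osc W' (\<lambda>e \<theta> P. (\<kappa> * damp b P ^ m) *\<^sub>C F e \<theta> P)"
proof (rule osc_coinduct[where C = "{(\<lambda>e \<theta> P. (\<kappa> * damp b P ^ j) *\<^sub>C F e \<theta> P) |\<kappa> j F. j \<ge> m \<and> osc W F}"])
  fix H and b' :: "'x \<times> 'x"
  assume "H \<in> {(\<lambda>e \<theta> P. (\<kappa> * damp b P ^ j) *\<^sub>C F e \<theta> P) |\<kappa> j F. j \<ge> m \<and> osc W F}"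
  then obtain \<kappa> j F where H: "H = (\<lambda>e \<theta> P. (\<kappa> * damp b P ^ j) *\<^sub>C F e \<theta> P)" and j: "j \<ge> m" and F: "osc W F" by blast
  have G: "oscG W F" by (rule osc_oscG[OF F])
  show "oscG W' H"
    unfolding oscG_def
  proof (intro conjI ballI allI)
    fix e :: real assume e: "e \<in> {0..1}"
    have "continuous_on UNIV (\<lambda>z. (\<kappa> * damp b (snd z) ^ j) *\<^sub>C (case z of (\<theta>, P) \<Rightarrow> F e \<theta> P))"
      using G e unfolding oscG_def by (intro continuous_on_scaleC continuous_intros) blast
    then show "continuous_on UNIV (\<lambda>(\<theta>, P). H e \<theta> P)" by (simp add: H split_beta)
  next
    obtain C where C: "\<And>e \<theta> P. e \<in> {0..1} \<Longrightarrow> norm (F e \<theta> P) \<le> C * (wt \<theta> * W P)" using G unfolding oscG_def by blast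
    have "norm (H e \<theta> P) \<le> (cmod \<kappa> * \<bar>C\<bar>) * (wt \<theta> * W' P)" if e: "e \<in> {0..1}" for e \<theta> P
    proof -
      have "norm (H e \<theta> P) = (cmod \<kappa> * cmod (damp b P) ^ j) * norm (F e \<theta> P)"
        by (simp add: H norm_scaleC norm_mult norm_power)
      also have "\<dots> \<le> (cmod \<kappa> * cmod (damp b P) ^ j) * (\<bar>C\<bar> * (wt \<theta> * W P))"
        using order_trans[OF C[OF e, of \<theta> P] mult_right_mono[OF abs_ge_self]] W[of P]
        by (intro mult_left_mono) auto
      also have "\<dots> = (cmod \<kappa> * \<bar>C\<bar>) * (wt \<theta> * (cmod (damp b P) ^ j * W P))" by simp
      also have "\<dots> \<le> (cmod \<kappa> * \<bar>C\<bar>) * (wt \<theta> * W' P)" by (intro mult_left_mono W' j) auto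
      finally show ?thesis .
    qed
    then show "\<exists>C. \<forall>e\<in>{0..1}. \<forall>\<theta> P. norm (H e \<theta> P) \<le> C * (wt \<theta> * W' P)" by blast
  next
    fix \<theta> P
    show "((\<lambda>e. H e \<theta> P) \<longlongrightarrow> H 0 \<theta> P) (at_right 0)"
      unfolding H using G unfolding oscG_def by (intro scaleC.tendsto tendsto_const) blast
  next
    fix e :: real and \<theta> assume "e \<in> {0<..1}"
    then obtain R where "\<And>P. norm P > R \<Longrightarrow> F e \<theta> P = 0" using G unfolding oscG_def by blast
    then show "\<exists>R. \<forall>P. norm P > R \<longrightarrow> H e \<theta> P = 0" unfolding H by (intro exI[of _ R]) simp
  qed
  assume "b' \<in> Basis"
  then obtain F' where F': "oscD b' F F'" "osc W F'" using osc_oscD[OF F] by blast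
  let ?\<mu> = "\<kappa> * (of_nat j * (- \<i> * of_real (slope b b')))"
  show "\<exists>K. oscD b' H K \<and> addspan {(\<lambda>e \<theta> P. (\<kappa> * damp b P ^ j) *\<^sub>C F e \<theta> P) |\<kappa> j F. j \<ge> m \<and> osc W F} K"
  proof (intro exI conjI)
    show "addspan {(\<lambda>e \<theta> P. (\<kappa> * damp b P ^ j) *\<^sub>C F e \<theta> P) |\<kappa> j F. j \<ge> m \<and> osc W F}
        ((\<lambda>e \<theta> P. (\<kappa> * damp b P ^ j) *\<^sub>C F' e \<theta> P) + (\<lambda>e \<theta> P. (?\<mu> * damp b P ^ Suc j) *\<^sub>C F e \<theta> P))"
    proof (intro addspan_add addspan_base CollectI)
      show "\<exists>\<kappa>' j' G. (\<lambda>e \<theta> P. (\<kappa> * damp b P ^ j) *\<^sub>C F' e \<theta> P) = (\<lambda>e \<theta> P. (\<kappa>' * damp b P ^ j') *\<^sub>C G e \<theta> P) \<and> m \<le> j' \<and> osc W G"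
        using j F'(2) by (intro exI[of _ \<kappa>] exI[of _ j] exI[of _ F'] conjI refl)
      show "\<exists>\<kappa>' j' G. (\<lambda>e \<theta> P. (?\<mu> * damp b P ^ Suc j) *\<^sub>C F e \<theta> P) = (\<lambda>e \<theta> P. (\<kappa>' * damp b P ^ j') *\<^sub>C G e \<theta> P) \<and> m \<le> j' \<and> osc W G"
        using j F by (intro exI[of _ ?\<mu>] exI[of _ "Suc j"] exI[of _ F] conjI refl) simp
    qed
    show "oscD b' H ((\<lambda>e \<theta> P. (\<kappa> * damp b P ^ j) *\<^sub>C F' e \<theta> P) + (\<lambda>e \<theta> P. (?\<mu> * damp b P ^ Suc j) *\<^sub>C F e \<theta> P))"
      unfolding oscD_def
    proof (intro ballI allI)
      fix e :: real and \<theta> assume "e \<in> {0..1}"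
      then have d: "has_dd b' (F e \<theta>) (F' e \<theta>)" using F'(1) unfolding oscD_def by blast
      have "has_dd b' (\<lambda>P. \<kappa> * damp b P ^ j) (\<lambda>P. ?\<mu> * damp b P ^ Suc j)"
        using bounded_linear.has_dd[OF bounded_linear_mult_right[of \<kappa>] has_dd_damp_power[of b' b j]] by (simp only: mult.assoc)
      from scaleC.has_dd[OF this d]
      show "has_dd b' (H e \<theta>) (((\<lambda>e \<theta> P. (\<kappa> * damp b P ^ j) *\<^sub>C F' e \<theta> P) + (\<lambda>e \<theta> P. (?\<mu> * damp b P ^ Suc j) *\<^sub>C F e \<theta> P)) e \<theta>)"
        by (simp only: H plus_fun_def)
    qed
  qed
next
  show "(\<lambda>e \<theta> P. (\<kappa> * damp b P ^ m) *\<^sub>C F e \<theta> P) \<in> {(\<lambda>e \<theta> P. (\<kappa> * damp b P ^ j) *\<^sub>C F e \<theta> P) |\<kappa> j F. j \<ge> m \<and> osc W F}"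
    using F by (intro CollectI exI[of _ \<kappa>] exI[of _ m] exI[of _ F] conjI refl order_refl)
qed

lemma osc_dec:
  assumes F: "oscG W F" and e: "e \<in> {0<..1}"
  shows "dec (F e \<theta>)"
proof -
  obtain R where R: "\<And>P. norm P > R \<Longrightarrow> F e \<theta> P = 0" using assms unfolding oscG_def by metis
  have "continuous_on UNIV (\<lambda>(\<theta>, P). F e \<theta> P)" using assms unfolding oscG_def by simp
  then have "continuous_on UNIV (\<lambda>P. (case (\<theta>, P) of (\<theta>, P) \<Rightarrow> F e \<theta> P))"
    by (rule continuous_on_compose2) (auto intro!: continuous_intros)
  then show ?thesis by (intro dec_compact[of _ R] R) simp_all
qed

lemma dec_phase: "dec f \<Longrightarrow> dec (\<lambda>P. cis (phase P) *\<^sub>C f P)" for f :: "'x \<times> 'x \<Rightarrow> 'a"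
  by (rule dec_cis) (auto intro!: continuous_intros)

lemma dec_damp: "dec f \<Longrightarrow> dec (\<lambda>P. damp b P *\<^sub>C f P)" for f :: "'x \<times> 'x \<Rightarrow> 'a"
  by (rule dec_bounded[of f _ 1])
     (auto simp: norm_scaleC dec_continuous mult_left_le_one_le norm_damp_le_1 intro!: continuous_on_scaleC continuous_intros)

lemma by_parts:
  fixes f f' :: "'x \<times> 'x \<Rightarrow> 'a"
  assumes f: "dec f" and f': "dec f'" and d: "has_dd b f f'" and b: "b \<in> Basis"
  shows "integral UNIV (\<lambda>P. cis (phase P) *\<^sub>C f P)
    = integral UNIV (\<lambda>P. cis (phase P) *\<^sub>C (damp b P *\<^sub>C (f P + (-1) *\<^sub>C f' P)))"
proof -
  let ?e = "\<lambda>P. cis (phase P)"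
  have u: "has_dd b (damp b) (\<lambda>P. 0)" using has_dd_damp[of b b] by (simp add: slope_self[OF b])
  have 1: "has_dd b (\<lambda>P. damp b P *\<^sub>C f P) (\<lambda>P. damp b P *\<^sub>C f' P)" using scaleC.has_dd[OF u d] by simp
  have 2: "has_dd b (\<lambda>P. ?e P *\<^sub>C damp b P *\<^sub>C f P)
     (\<lambda>P. ?e P *\<^sub>C damp b P *\<^sub>C f' P + (\<i> * of_real (slope b P) * ?e P) *\<^sub>C damp b P *\<^sub>C f P)"
    by (rule scaleC.has_dd[OF has_dd_cis[OF has_dd_phase] 1])
  \<comment> \<open>\<open>damp_eq\<close> replaces i times the slope times \<open>damp b P\<close>
    by \<open>1 - damp b P\<close>: the derivative becomes the original integrand minus the damped
    one, so the two have equal integrals.\<close>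
  have eq: "?e P *\<^sub>C damp b P *\<^sub>C f' P + (\<i> * of_real (slope b P) * ?e P) *\<^sub>C damp b P *\<^sub>C f P =
     ?e P *\<^sub>C f P + (- 1) *\<^sub>R (?e P *\<^sub>C (damp b P *\<^sub>C (f P + (-1) *\<^sub>C f' P)))" for P
  proof -
    have "(\<i> * of_real (slope b P) * ?e P) *\<^sub>C damp b P *\<^sub>C f P = (?e P * (\<i> * of_real (slope b P) * damp b P)) *\<^sub>C f P"
      by (simp add: scaleC_scaleC mult_ac)
    also have "\<dots> = ?e P *\<^sub>C f P - ?e P *\<^sub>C damp b P *\<^sub>C f P"
      unfolding damp_eq by (simp add: scaleC_scaleC scaleC.diff_left right_diff_distrib)
    finally show ?thesis by (simp add: scaleC_add_right scaleC_scaleC scaleC.minus_left scaleC_one scaleC.diff_right)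
  qed
  have m: "dec (\<lambda>P. (-1) *\<^sub>C f' P)"
    by (rule dec_bounded[OF f', of _ 1]) (auto simp: norm_scaleC intro!: continuous_on_scaleC dec_continuous[OF f'])
  have d1: "dec (\<lambda>P. ?e P *\<^sub>C damp b P *\<^sub>C f P)" by (intro dec_phase dec_damp f)
  have d2: "dec (\<lambda>P. ?e P *\<^sub>C f P)" by (intro dec_phase f)
  have d3: "dec (\<lambda>P. ?e P *\<^sub>C (damp b P *\<^sub>C (f P + (-1) *\<^sub>C f' P)))" by (intro dec_phase dec_damp dec_add f m)
  have d4: "dec (\<lambda>P. (- 1) *\<^sub>R (?e P *\<^sub>C (damp b P *\<^sub>C (f P + (-1) *\<^sub>C f' P))))"
    by (rule dec_bounded[OF d3, of _ 1]) (auto intro!: continuous_on_minus dec_continuous[OF d3])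
  have "integral UNIV (\<lambda>P. ?e P *\<^sub>C f P + (- 1) *\<^sub>R (?e P *\<^sub>C (damp b P *\<^sub>C (f P + (-1) *\<^sub>C f' P)))) = 0"
    by (rule integral_has_dd_0[OF 2[unfolded eq] d1 dec_add[OF d2 d4]])
  then show ?thesis
    using integral_add[OF dec_integrable[OF d2] dec_integrable[OF d4]] by simp
qed

text \<open>For each letter b the amplitude f is replaced by \<open>damp b\<close> times (f minus
  its b-derivative), without changing the integral for e > 0. The last conclusion records that
  vanishing at e = 0 is preserved, which is what the comparison of different cutoffs rests
  on.\<close>

lemma osc_iterate:
  assumes "bs \<in> lists Basis" "osc W F" "\<And>P. W P \<ge> 0"
  shows "\<exists>H. osc (\<lambda>P. W P * (\<Prod>b\<leftarrow>bs. cmod (damp b P))) H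
    \<and> (\<forall>e\<in>{0<..1}. \<forall>\<theta>. integral UNIV (\<lambda>P. cis (phase P) *\<^sub>C F e \<theta> P) = integral UNIV (\<lambda>P. cis (phase P) *\<^sub>C H e \<theta> P))
    \<and> (\<forall>\<theta>. (\<forall>P. F 0 \<theta> P = 0) \<longrightarrow> (\<forall>P. H 0 \<theta> P = 0))"
  using assms
proof (induction bs arbitrary: W F rule: list.induct)
  case Nil
  then show ?case by (intro exI[of _ F]) auto
next
  case (Cons b bs)
  have b: "b \<in> Basis" and bs: "bs \<in> lists Basis" using Cons.prems(1) by auto
  have F: "osc W F" by (rule Cons.prems)
  obtain G where G: "oscD b F G" "osc W G" using osc_oscD[OF F b] by blast
  have W1: "cmod (damp b P) ^ j * W P \<le> W P" for j P
    using mult_right_mono[OF power_le_one[OF norm_ge_zero norm_damp_le_1] Cons.prems(3)] by simp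
  have W2: "cmod (damp b P) ^ j * W P \<le> W P * cmod (damp b P)" if "j \<ge> 1" for j P
    using mult_right_mono[OF power_decreasing[OF that norm_ge_zero norm_damp_le_1, of b P] Cons.prems(3)[of P]] by (simp add: mult.commute)
  define F1 where "F1 = F + (\<lambda>e \<theta> P. (-1) *\<^sub>C G e \<theta> P)"
  have F1: "osc W F1"
    unfolding F1_def using osc_mult[OF Cons.prems(3) W1 G(2), where m = 0 and \<kappa> = "- 1"] by (intro osc_add F) simp
  define F2 where "F2 = (\<lambda>e \<theta> P. damp b P *\<^sub>C F1 e \<theta> P)"
  have F2: "osc (\<lambda>P. W P * cmod (damp b P)) F2"
    unfolding F2_def using osc_mult[OF Cons.prems(3) W2 F1, where m = 1 and \<kappa> = 1] by simp
  have W3: "W P * cmod (damp b P) \<ge> 0" for P by (intro mult_nonneg_nonneg Cons.prems) simp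
  from Cons.IH[OF bs F2 W3] obtain H where H0: "osc (\<lambda>P. (W P * cmod (damp b P)) * (\<Prod>b\<leftarrow>bs. cmod (damp b P))) H"
    "\<forall>e\<in>{0<..1}. \<forall>\<theta>. integral UNIV (\<lambda>P. cis (phase P) *\<^sub>C F2 e \<theta> P) = integral UNIV (\<lambda>P. cis (phase P) *\<^sub>C H e \<theta> P)"
    "\<forall>\<theta>. (\<forall>P. F2 0 \<theta> P = 0) \<longrightarrow> (\<forall>P. H 0 \<theta> P = 0)"
    by (elim exE conjE)
  note H = H0(1) bspec[OF H0(2), THEN spec] H0(3)[THEN spec, THEN mp]
  show ?case
  proof (intro exI[of _ H] conjI ballI allI impI)
    show "osc (\<lambda>P. W P * (\<Prod>b\<leftarrow>b # bs. cmod (damp b P))) H" using H(1) by (simp add: mult.assoc)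
    fix e :: real and \<theta> assume e: "e \<in> {0<..1}"
    have d: "has_dd b (F e \<theta>) (G e \<theta>)" using G(1) e unfolding oscD_def by (metis atLeastAtMost_iff greaterThanAtMost_iff less_imp_le)
    have "integral UNIV (\<lambda>P. cis (phase P) *\<^sub>C F e \<theta> P) = integral UNIV (\<lambda>P. cis (phase P) *\<^sub>C F2 e \<theta> P)"
      using by_parts[OF osc_dec[OF osc_oscG[OF F] e] osc_dec[OF osc_oscG[OF G(2)] e] d b]
      by (simp add: F2_def F1_def)
    then show "integral UNIV (\<lambda>P. cis (phase P) *\<^sub>C F e \<theta> P) = integral UNIV (\<lambda>P. cis (phase P) *\<^sub>C H e \<theta> P)"
      using H(2)[OF e] by simp
  next
    fix \<theta> P assume 0: "\<forall>P. F 0 \<theta> P = 0"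
    then have "F 0 \<theta> = (\<lambda>P. 0)" by auto
    moreover have "has_dd b (F 0 \<theta>) (G 0 \<theta>)" using G(1) unfolding oscD_def by (meson atLeastAtMost_iff order_refl zero_le_one)
    ultimately have "G 0 \<theta> = (\<lambda>P. 0)" using has_dd_unique[OF _ has_dd_const] by metis
    then have "\<forall>P. F2 0 \<theta> P = 0" using 0 by (simp add: F2_def F1_def)
    then show "H 0 \<theta> P = 0" using H(3) by blast
  qed
qed

lemma osc_limit:
  assumes F: "osc (\<lambda>_. 1) F"
  shows "\<exists>J C. continuous_on UNIV J \<and> (\<forall>\<theta>. norm (J \<theta>) \<le> C * wt \<theta>)
    \<and> (\<forall>\<theta>. ((\<lambda>e. integral UNIV (\<lambda>P. cis (phase P) *\<^sub>C F e \<theta> P)) \<longlongrightarrow> J \<theta>) (at_right 0))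
    \<and> (\<forall>e\<in>{0<..1}. \<forall>\<theta>. norm (integral UNIV (\<lambda>P. cis (phase P) *\<^sub>C F e \<theta> P)) \<le> C * wt \<theta>)
    \<and> (\<forall>\<theta>. (\<forall>P. F 0 \<theta> P = 0) \<longrightarrow> J \<theta> = 0)"
proof -
  \<comment> \<open>One pass through all basis directions gains a factor K / (1 + norm P). As many
    passes as the exponent of \<open>wt\<close> on the product space give the integrable majorant
    \<open>K ^ M * wt P\<close>.\<close>
  define M where "M = 2 * DIM('x \<times> 'x)"
  define bs where "bs = concat (replicate M (basis_list :: ('x \<times> 'x) list))"
  have "set bs \<subseteq> set (basis_list :: ('x \<times> 'x) list)" unfolding bs_def by auto
  then have bs: "bs \<in> lists Basis" unfolding basis_list(2) by (simp add: lists_eq_set)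
  from osc_iterate[OF bs F zero_le_one] obtain H where H: "osc (\<lambda>P. 1 * (\<Prod>b\<leftarrow>bs. cmod (damp b P))) H"
    and int0: "\<forall>e\<in>{0<..1}. \<forall>\<theta>. integral UNIV (\<lambda>P. cis (phase P) *\<^sub>C F e \<theta> P) = integral UNIV (\<lambda>P. cis (phase P) *\<^sub>C H e \<theta> P)"
    and z0: "\<forall>\<theta>. (\<forall>P. F 0 \<theta> P = 0) \<longrightarrow> (\<forall>P. H 0 \<theta> P = 0)"
    by (elim exE conjE)
  note int = bspec[OF int0, THEN spec] and z = z0[rule_format]
  have G: "oscG (\<lambda>P. 1 * (\<Prod>b\<leftarrow>bs. cmod (damp b P))) H" by (rule osc_oscG[OF H])
  obtain K where K: "\<And>P. (\<Prod>b\<in>Basis. cmod (damp b P)) \<le> K / (1 + norm P)" using prod_damp_bound by blast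
  have Wb: "(\<Prod>b\<leftarrow>bs. cmod (damp b P)) \<le> K ^ M * wt P" for P
  proof -
    have "(\<Prod>b\<leftarrow>concat (replicate n (basis_list :: ('x \<times> 'x) list)). cmod (damp b P)) = (\<Prod>b\<in>Basis. cmod (damp b P)) ^ n" for n
      by (induction n) (simp_all add: prod.distinct_set_conv_list[symmetric] basis_list)
    then have "(\<Prod>b\<leftarrow>bs. cmod (damp b P)) = (\<Prod>b\<in>Basis. cmod (damp b P)) ^ M" by (simp add: bs_def)
    also have "\<dots> \<le> (K / (1 + norm P)) ^ M" by (intro power_mono K prod_nonneg) auto
    finally show ?thesis by (simp add: wt_def M_def power_divide)
  qed
  obtain C0 where C0: "\<And>e \<theta> P. e \<in> {0..1} \<Longrightarrow> norm (H e \<theta> P) \<le> C0 * (wt \<theta> * (\<Prod>b\<leftarrow>bs. cmod (damp b P)))"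
    using G unfolding oscG_def mult_1_left by blast
  have pos: "(\<Prod>b\<leftarrow>bs. cmod (damp b P)) \<ge> 0" for P by (intro prod_list_nonneg) auto
  define C where "C = \<bar>C0\<bar> * \<bar>K ^ M\<bar>"
  have Hb: "norm (H e \<theta> P) \<le> (C * wt \<theta>) * wt P" if "e \<in> {0..1}" for e \<theta> P
  proof -
    have "norm (H e \<theta> P) \<le> \<bar>C0\<bar> * (wt \<theta> * (\<Prod>b\<leftarrow>bs. cmod (damp b P)))"
      by (rule order_trans[OF C0[OF that] mult_right_mono]) (auto intro!: mult_nonneg_nonneg pos)
    also have "\<dots> \<le> \<bar>C0\<bar> * (wt \<theta> * (\<bar>K ^ M\<bar> * wt P))"
      by (intro mult_left_mono order_trans[OF Wb mult_right_mono]) auto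
    finally show ?thesis by (simp add: C_def mult_ac)
  qed
  have Cn: "C \<ge> 0" by (simp add: C_def)
  have cont: "continuous_on UNIV (\<lambda>(\<theta>, P). H e \<theta> P)" if "e \<in> {0..1}" for e using G that unfolding oscG_def by blast
  have cont1: "continuous_on UNIV (H e \<theta>)" if "e \<in> {0..1}" for e \<theta>
    by (rule continuous_on_compose2[OF cont[OF that], of UNIV "\<lambda>P. (\<theta>, P)", simplified]) (auto intro!: continuous_intros)
  let ?I = "\<lambda>e \<theta>. integral UNIV (\<lambda>P. cis (phase P) *\<^sub>C H e \<theta> P)"
  define W where "W = integral UNIV (wt :: 'x \<times> 'x \<Rightarrow> real)"
  have Ib: "norm (?I e \<theta>) \<le> (C * W) * wt \<theta>" if e: "e \<in> {0..1}" for e \<theta>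
  proof -
    have d: "dec (H e \<theta>)" by (rule decI[OF cont1[OF e] Hb[OF e]])
    have b: "norm (cis (phase P) *\<^sub>C H e \<theta> P) \<le> (C * wt \<theta>) * wt P" for P
      using Hb[OF e] by (simp add: norm_scaleC)
    have "norm (?I e \<theta>) \<le> (C * wt \<theta>) * W"
      unfolding W_def by (rule norm_integral_le[OF dec_phase[OF d] b])
    then show ?thesis by (simp only: mult_ac)
  qed
  show ?thesis
  proof (intro exI[of _ "?I 0"] exI[of _ "C * W"] conjI allI ballI impI)
    show "continuous_on UNIV (?I 0)"
    proof (rule continuous_on_integral[where C = C])
      have "continuous_on UNIV (\<lambda>z. cis (phase (snd z)) *\<^sub>C (case z of (\<theta>, P) \<Rightarrow> H 0 \<theta> P))"
        by (intro continuous_on_scaleC continuous_on_cis continuous_intros cont) simp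
      then show "continuous_on (UNIV \<times> UNIV) (\<lambda>(\<theta>, P). cis (phase P) *\<^sub>C H 0 \<theta> P)" by (simp add: split_beta)
      show "norm (cis (phase P) *\<^sub>C H 0 \<theta> P) \<le> C * wt P" for \<theta> P
      proof -
        have "(C * wt \<theta>) * wt P \<le> (C * 1) * wt P" by (intro mult_right_mono mult_left_mono wt_le_1 Cn) simp
        then show ?thesis using Hb[of 0 \<theta> P] by (simp add: norm_scaleC)
      qed
    qed
    show "norm (?I 0 \<theta>) \<le> C * W * wt \<theta>" for \<theta> by (rule Ib) simp
    show "norm (integral UNIV (\<lambda>P. cis (phase P) *\<^sub>C F e \<theta> P)) \<le> C * W * wt \<theta>" if "e \<in> {0<..1}" for e \<theta>
      unfolding int[OF that] by (rule Ib) (use that in simp)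
    show "?I 0 \<theta> = 0" if "\<forall>P. F 0 \<theta> P = 0" for \<theta> using z[OF that[rule_format]] by simp
    fix \<theta>
    \<comment> \<open>The estimates hold for e \<le> 1 only; near 0 from the right this restriction
      does not change the filter.\<close>
    have at: "at_right 0 = at 0 within {0<..1::real}"
      by (rule at_within_nhd[of 0 "{-1<..<1}"]) auto
    have "((\<lambda>e. ?I e \<theta>) \<longlongrightarrow> ?I 0 \<theta>) (at 0 within {0<..1})"
    proof (rule tendsto_integral[where C = "C * wt \<theta>"])
      show "continuous_on UNIV (\<lambda>P. cis (phase P) *\<^sub>C H e \<theta> P)" if "e \<in> {0<..1} - {0}" for e
        by (intro continuous_on_scaleC continuous_on_cis continuous_intros cont1) (use that in auto)
      show "continuous_on UNIV (\<lambda>P. cis (phase P) *\<^sub>C H 0 \<theta> P)"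
        by (intro continuous_on_scaleC continuous_on_cis continuous_intros cont1) simp
      show "norm (cis (phase P) *\<^sub>C H e \<theta> P) \<le> C * wt \<theta> * wt P" if "e \<in> {0<..1} - {0}" for e P
        using Hb[of e \<theta> P] that by (simp add: norm_scaleC)
      show "norm (cis (phase P) *\<^sub>C H 0 \<theta> P) \<le> C * wt \<theta> * wt P" for P using Hb[of 0 \<theta> P] by (simp add: norm_scaleC)
      fix P
      have "((\<lambda>e. H e \<theta> P) \<longlongrightarrow> H 0 \<theta> P) (at 0 within {0<..1})" using G unfolding oscG_def at[symmetric] by blast
      then show "((\<lambda>e. cis (phase P) *\<^sub>C H e \<theta> P) \<longlongrightarrow> cis (phase P) *\<^sub>C H 0 \<theta> P) (at 0 within {0<..1})"
        by (intro scaleC.tendsto tendsto_const)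
    qed
    then show "((\<lambda>e. integral UNIV (\<lambda>P. cis (phase P) *\<^sub>C F e \<theta> P)) \<longlongrightarrow> ?I 0 \<theta>) (at_right 0)"
      unfolding at by (rule Lim_transform_eventually)
        (simp add: eventually_at_filter int always_eventually)
  qed
qed

text \<open>The regularized amplitude without the phase. With \<eta> = 0 the cutoff is the one in
  the definition of the Rieffel product; with \<eta> = 1 it is free of \<theta> once P is replaced
  by P - \<theta>.\<close>

definition amp :: "('x \<times> 'x \<Rightarrow> complex) \<Rightarrow> real \<Rightarrow> ('x \<Rightarrow> 'a) \<Rightarrow> ('x \<Rightarrow> 'a) \<Rightarrow> real \<Rightarrow> 'x \<times> 'x \<Rightarrow> 'x \<times> 'x \<Rightarrow> 'a" where
  "amp \<phi> \<eta> F G e \<theta> P = \<phi> (e *\<^sub>R (P + \<eta> *\<^sub>R \<theta>)) *\<^sub>C (\<Theta> (fst P) (F (fst \<theta>)) * \<Theta> (snd P) (G (snd \<theta>)))"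

lemma schw_prod_bound:
  assumes F: "schw F" and G: "schw G"
  shows "\<exists>C\<ge>0. \<forall>\<theta>. norm (F (fst \<theta>)) * norm (G (snd \<theta>)) \<le> C * wt \<theta>"
proof -
  define M where "M = 2 * DIM('x \<times> 'x)"
  obtain K where K: "K \<ge> 0" "\<And>X. (1 + norm X) ^ M * norm (F X) \<le> K" using schw_bound[OF F] by blast
  obtain L where L: "L \<ge> 0" "\<And>X. (1 + norm X) ^ M * norm (G X) \<le> L" using schw_bound[OF G] by blast
  have "norm (F (fst \<theta>)) * norm (G (snd \<theta>)) \<le> (K * L) * wt \<theta>" for \<theta> :: "'x \<times> 'x"
  proof (rule wt_rapid)
    have "norm \<theta> \<le> norm (fst \<theta>) + norm (snd \<theta>)" using norm_Pair_le[of "fst \<theta>" "snd \<theta>"] by simp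
    then have "1 + norm \<theta> \<le> (1 + norm (fst \<theta>)) * (1 + norm (snd \<theta>))"
      using mult_nonneg_nonneg[OF norm_ge_zero[of "fst \<theta>"] norm_ge_zero[of "snd \<theta>"]]
      unfolding distrib_left distrib_right mult_1_left mult_1_right by linarith
    then have "(1 + norm \<theta>) ^ M \<le> (1 + norm (fst \<theta>)) ^ M * (1 + norm (snd \<theta>)) ^ M"
      unfolding power_mult_distrib[symmetric] by (intro power_mono) auto
    then have "(1 + norm \<theta>) ^ M * (norm (F (fst \<theta>)) * norm (G (snd \<theta>)))
        \<le> ((1 + norm (fst \<theta>)) ^ M * (1 + norm (snd \<theta>)) ^ M) * (norm (F (fst \<theta>)) * norm (G (snd \<theta>)))"
      by (intro mult_right_mono) auto
    also have "\<dots> = ((1 + norm (fst \<theta>)) ^ M * norm (F (fst \<theta>))) * ((1 + norm (snd \<theta>)) ^ M * norm (G (snd \<theta>)))" by simp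
    also have "\<dots> \<le> K * L" by (intro mult_mono K L) auto
    finally show "(1 + norm \<theta>) ^ (2 * DIM('x \<times> 'x)) * (norm (F (fst \<theta>)) * norm (G (snd \<theta>))) \<le> K * L"
      by (simp only: M_def)
  qed
  then show ?thesis using K(1) L(1) by (intro exI[of _ "K * L"]) auto
qed

text \<open>A derivative in P falls either on the cutoff, where the chain rule gives a factor e
  \<le> 1, or on one of the two orbits, where it replaces F or G by a derivative along the action.
  The decay in \<theta> comes from F and G in every term.\<close>

lemma osc_amp:
  assumes sm: "smooth \<psi>" and supp: "\<And>P. norm P > R \<Longrightarrow> \<psi> P = 0" and F: "schw F" and G: "schw G"
  shows "osc (\<lambda>_. 1) (amp \<psi> \<eta> F G)"
proof -
  have supp': "norm P > R \<Longrightarrow> partials w \<psi> P = 0" if "w \<in> lists Basis" for w P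
    using that
  proof (induction w arbitrary: P rule: list.induct)
    case (Cons b w)
    then show ?case using has_dd_support[OF smooth_has_dd[OF sm, of w b], of R P] by auto
  qed (simp add: supp)
  have bd: "\<exists>B\<ge>0. \<forall>P. cmod (partials w \<psi> P) \<le> B" if w: "w \<in> lists Basis" for w
  proof -
    have "dec (partials w \<psi>)" by (rule dec_compact[OF smooth_continuous[OF sm w] supp'[OF w]])
    then obtain C where C: "\<And>P. cmod (partials w \<psi> P) \<le> C * wt P" by (auto simp: dec_def)
    have "cmod (partials w \<psi> P) \<le> \<bar>C\<bar>" for P
    proof -
      have "C * wt P \<le> \<bar>C\<bar> * 1" by (intro mult_mono) (auto simp: wt_le_1)
      then show ?thesis using C[of P] by simp
    qed
    then show ?thesis by (intro exI[of _ "\<bar>C\<bar>"]) auto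
  qed
  let ?C = "{(\<lambda>e \<theta> P. e ^ j *\<^sub>R amp (partials w \<psi>) \<eta> F G e \<theta> P) |j w F G. w \<in> lists Basis \<and> schw F \<and> schw G}"
  show ?thesis
  proof (rule osc_coinduct[where C = ?C])
    fix H and b :: "'x \<times> 'x" assume "H \<in> ?C"
    then obtain j w F G where H: "H = (\<lambda>e \<theta> P. e ^ j *\<^sub>R amp (partials w \<psi>) \<eta> F G e \<theta> P)"
      and w: "w \<in> lists Basis" and F: "schw F" and G: "schw G" by blast
    show "oscG (\<lambda>_. 1) H"
      unfolding oscG_def
    proof (intro conjI ballI allI)
      show "continuous_on UNIV (\<lambda>(\<theta>, P). H e \<theta> P)" for e
        unfolding H amp_def split_beta
        by (intro continuous_intros continuous_on_scaleC continuous_on_compose2[OF smooth_continuous[OF sm w]]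
            continuous_on_compose2[OF schw_continuous[OF F]] continuous_on_compose2[OF schw_continuous[OF G]]) auto
    next
      obtain B where B: "B \<ge> 0" "\<And>P. cmod (partials w \<psi> P) \<le> B" using bd[OF w] by blast
      obtain C where C: "C \<ge> 0" "\<And>\<theta>. norm (F (fst \<theta>)) * norm (G (snd \<theta>)) \<le> C * wt \<theta>" using schw_prod_bound[OF F G] by blast
      have "norm (H e \<theta> P) \<le> (B * C) * (wt \<theta> * 1)" if e: "e \<in> {0..1}" for e \<theta> P
      proof -
        have "norm (\<Theta> (fst P) (F (fst \<theta>)) * \<Theta> (snd P) (G (snd \<theta>))) \<le> C * wt \<theta>"
          using order_trans[OF norm_mult_ineq, of "\<Theta> (fst P) (F (fst \<theta>))" "\<Theta> (snd P) (G (snd \<theta>))"] C(2)[of \<theta>] by simp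
        then have "norm (amp (partials w \<psi>) \<eta> F G e \<theta> P) \<le> B * (C * wt \<theta>)"
          unfolding amp_def norm_scaleC by (intro mult_mono B) auto
        moreover have "\<bar>e ^ j\<bar> \<le> 1" using e by (simp add: power_le_one)
        ultimately have "\<bar>e ^ j\<bar> * norm (amp (partials w \<psi>) \<eta> F G e \<theta> P) \<le> 1 * (B * (C * wt \<theta>))"
          by (intro mult_mono) auto
        then show ?thesis by (simp add: H mult.assoc)
      qed
      then show "\<exists>C. \<forall>e\<in>{0..1}. \<forall>\<theta> P. norm (H e \<theta> P) \<le> C * (wt \<theta> * 1)" by blast
    next
      fix \<theta> P
      have "((\<lambda>e. partials w \<psi> (e *\<^sub>R (P + \<eta> *\<^sub>R \<theta>))) \<longlongrightarrow> partials w \<psi> (0 *\<^sub>R (P + \<eta> *\<^sub>R \<theta>))) (at_right 0)"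
        by (rule continuous_on_tendsto_compose[OF smooth_continuous[OF sm w]]) ((intro tendsto_intros | simp)+)
      then show "((\<lambda>e. H e \<theta> P) \<longlongrightarrow> H 0 \<theta> P) (at_right 0)"
        unfolding H amp_def by (intro tendsto_intros scaleC.tendsto)
    next
      fix e :: real and \<theta> assume e: "e \<in> {0<..1}"
      have "H e \<theta> P = 0" if P: "norm P > R / e + norm (\<eta> *\<^sub>R \<theta>)" for P
      proof -
        have "norm (P + \<eta> *\<^sub>R \<theta>) > R / e" using P norm_triangle_ineq4[of "P + \<eta> *\<^sub>R \<theta>" "\<eta> *\<^sub>R \<theta>"] by simp
        then have "norm (e *\<^sub>R (P + \<eta> *\<^sub>R \<theta>)) > R" using e unfolding norm_scaleR by (simp add: pos_divide_less_eq mult.commute)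
        then show ?thesis by (simp add: H amp_def supp'[OF w])
      qed
      then show "\<exists>R. \<forall>P. norm P > R \<longrightarrow> H e \<theta> P = 0" by blast
    qed
    assume b: "b \<in> Basis"
    have inC: "addspan ?C (\<lambda>e \<theta> P. e ^ j *\<^sub>R amp (partials w \<psi>) \<eta> F G e \<theta> P)"
      if "w \<in> lists Basis" "schw F" "schw G" for j w F G
      by (intro addspan_base CollectI exI[of _ j] exI[of _ w] exI[of _ F] exI[of _ G] conjI refl that)
    have bw: "b # w \<in> lists Basis" using b w by simp
    have "\<exists>F' G'. schw F' \<and> schw G' \<and> (\<forall>\<theta>. has_dd b (\<lambda>P. \<Theta> (fst P) (F (fst \<theta>)) * \<Theta> (snd P) (G (snd \<theta>)))
        (\<lambda>P. \<Theta> (fst P) (F' (fst \<theta>)) * \<Theta> (snd P) (G' (snd \<theta>))))"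
    proof -
      from b consider b1 where "b = (b1, 0)" "b1 \<in> Basis" | b2 where "b = (0, b2)" "b2 \<in> Basis"
        by (auto simp: Basis_prod_def)
      then show ?thesis
      proof cases
        case 1
        obtain F' where F': "\<And>X. hasA b1 (F X) (F' X)" "schw F'" using schw_hasA[OF F 1(2)] by blast
        have "has_dd b (\<lambda>P. \<Theta> (fst P) (F (fst \<theta>)) * \<Theta> (snd P) (G (snd \<theta>)))
            (\<lambda>P. \<Theta> (fst P) (F' (fst \<theta>)) * \<Theta> (snd P) (G (snd \<theta>)))" for \<theta>
          unfolding has_dd_def
        proof
          fix P :: "'x \<times> 'x"
          have "((\<lambda>t. \<Theta> (fst P + t *\<^sub>R b1) (F (fst \<theta>))) has_vector_derivative \<Theta> (fst P) (F' (fst \<theta>))) (at 0)"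
            using hasA_dd[OF F'(1)] by (simp add: has_dd_def)
          from bounded_linear.has_vector_derivative[OF bounded_linear_mult_left this, of "\<Theta> (snd P) (G (snd \<theta>))"]
          show "((\<lambda>t. \<Theta> (fst (P + t *\<^sub>R b)) (F (fst \<theta>)) * \<Theta> (snd (P + t *\<^sub>R b)) (G (snd \<theta>))) has_vector_derivative
              \<Theta> (fst P) (F' (fst \<theta>)) * \<Theta> (snd P) (G (snd \<theta>))) (at 0)" by (simp add: 1(1))
        qed
        then show ?thesis using F'(2) G by (intro exI[of _ F'] exI[of _ G]) simp
      next
        case 2
        obtain G' where G': "\<And>X. hasA b2 (G X) (G' X)" "schw G'" using schw_hasA[OF G 2(2)] by blast
        have "has_dd b (\<lambda>P. \<Theta> (fst P) (F (fst \<theta>)) * \<Theta> (snd P) (G (snd \<theta>)))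
            (\<lambda>P. \<Theta> (fst P) (F (fst \<theta>)) * \<Theta> (snd P) (G' (snd \<theta>)))" for \<theta>
          unfolding has_dd_def
        proof
          fix P :: "'x \<times> 'x"
          have "((\<lambda>t. \<Theta> (snd P + t *\<^sub>R b2) (G (snd \<theta>))) has_vector_derivative \<Theta> (snd P) (G' (snd \<theta>))) (at 0)"
            using hasA_dd[OF G'(1)] by (simp add: has_dd_def)
          from bounded_linear.has_vector_derivative[OF bounded_linear_mult_right this, of "\<Theta> (fst P) (F (fst \<theta>))"]
          show "((\<lambda>t. \<Theta> (fst (P + t *\<^sub>R b)) (F (fst \<theta>)) * \<Theta> (snd (P + t *\<^sub>R b)) (G (snd \<theta>))) has_vector_derivative
              \<Theta> (fst P) (F (fst \<theta>)) * \<Theta> (snd P) (G' (snd \<theta>))) (at 0)" by (simp add: 2(1))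
        qed
        then show ?thesis using G'(2) F by (intro exI[of _ F] exI[of _ G']) simp
      qed
    qed
    then obtain F' G' where F': "schw F'" "schw G'"
      and d: "\<And>\<theta>. has_dd b (\<lambda>P. \<Theta> (fst P) (F (fst \<theta>)) * \<Theta> (snd P) (G (snd \<theta>)))
        (\<lambda>P. \<Theta> (fst P) (F' (fst \<theta>)) * \<Theta> (snd P) (G' (snd \<theta>)))" by blast
    let ?K = "(\<lambda>e \<theta> P. e ^ j *\<^sub>R amp (partials w \<psi>) \<eta> F' G' e \<theta> P)
      + (\<lambda>e \<theta> P. e ^ Suc j *\<^sub>R amp (partials (b # w) \<psi>) \<eta> F G e \<theta> P)"
    have "has_dd b (H e \<theta>) (?K e \<theta>)" for e \<theta>
    proof -
      have "has_dd b (\<lambda>P. partials w \<psi> (e *\<^sub>R P + e *\<^sub>R \<eta> *\<^sub>R \<theta>)) (\<lambda>P. e *\<^sub>R partials (b # w) \<psi> (e *\<^sub>R P + e *\<^sub>R \<eta> *\<^sub>R \<theta>))"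
        by (rule has_dd_affine[OF smooth_has_dd[OF sm w b]])
      from bounded_linear.has_dd[OF bounded_linear_scaleR_right scaleC.has_dd[OF this d], of "e ^ j" \<theta>]
      show ?thesis
        by (simp add: H amp_def plus_fun_def scaleR_add_right scaleC.scaleR_left mult.commute del: partials_Cons)
    qed
    then show "\<exists>K. oscD b H K \<and> addspan ?C K"
      by (intro exI[of _ ?K] conjI addspan_add inC w bw F' F G) (simp add: oscD_def)
  next
    show "amp \<psi> \<eta> F G \<in> ?C"
      by (intro CollectI exI[of _ 0] exI[of _ "[]"] exI[of _ F] exI[of _ G]) (simp add: F G fun_eq_iff)
  qed
qed

text \<open>The limit depends neither on the cutoff nor on the shift \<open>\<eta>\<close>, because the difference of two such
  amplitudes vanishes at \<open>e = 0\<close>.\<close>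

theorem oscillatory_limit:
  assumes F: "schw F" and G: "schw G"
  shows "\<exists>J. dec J \<and> (\<forall>\<psi> \<eta>. smooth \<psi> \<longrightarrow> (\<exists>R. \<forall>P. norm P > R \<longrightarrow> \<psi> P = 0) \<longrightarrow> \<psi> 0 = 1 \<longrightarrow>
    (\<forall>\<theta>. ((\<lambda>e. integral UNIV (\<lambda>P. cis (phase P) *\<^sub>C amp \<psi> \<eta> F G e \<theta> P)) \<longlongrightarrow> J \<theta>) (at_right 0))
    \<and> (\<exists>C. \<forall>e\<in>{0<..1}. \<forall>\<theta>. norm (integral UNIV (\<lambda>P. cis (phase P) *\<^sub>C amp \<psi> \<eta> F G e \<theta> P)) \<le> C * wt \<theta>))"
proof -
  let ?I = "\<lambda>\<psi> \<eta> F e \<theta>. integral UNIV (\<lambda>P. cis (phase P) *\<^sub>C amp \<psi> \<eta> F G e \<theta> P)"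
  have F': "schw (\<lambda>X. (-1) *\<^sub>R F X)" by (rule schw_scaleR[OF F])
  have os: "osc (\<lambda>_. 1) (amp cbump 0 F G)"
    by (rule osc_amp[OF smf_smooth[OF smf_bump] _ F G, where R = 2]) (simp add: bump_0)
  have os': "osc (\<lambda>_. 1) (amp cbump 0 (\<lambda>X. (-1) *\<^sub>R F X) G)"
    by (rule osc_amp[OF smf_smooth[OF smf_bump] _ F' G, where R = 2]) (simp add: bump_0)
  obtain J C where J: "continuous_on UNIV J" "\<And>\<theta>. norm (J \<theta>) \<le> C * wt \<theta>"
    "\<And>\<theta>. ((\<lambda>e. ?I cbump 0 F e \<theta>) \<longlongrightarrow> J \<theta>) (at_right 0)"
    using osc_limit[OF os] by blast
  show ?thesis
  proof (intro exI[of _ J] conjI allI impI)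
    show "dec J" by (rule decI[OF J(1,2)])
    fix \<psi> :: "'x \<times> 'x \<Rightarrow> complex" and \<eta> assume sm: "smooth \<psi>" and "\<exists>R. \<forall>P. norm P > R \<longrightarrow> \<psi> P = 0" and 1: "\<psi> 0 = 1"
    then obtain R where R: "\<And>P. norm P > R \<Longrightarrow> \<psi> P = 0" by blast
    have op: "osc (\<lambda>_. 1) (amp \<psi> \<eta> F G)" by (rule osc_amp[OF sm R F G])
    obtain J' C' where J': "\<And>\<theta>. ((\<lambda>e. ?I \<psi> \<eta> F e \<theta>) \<longlongrightarrow> J' \<theta>) (at_right 0)"
      "\<And>e \<theta>. e \<in> {0<..1} \<Longrightarrow> norm (?I \<psi> \<eta> F e \<theta>) \<le> C' * wt \<theta>"
      using osc_limit[OF op] by blast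
    then show "\<exists>C. \<forall>e\<in>{0<..1}. \<forall>\<theta>. norm (?I \<psi> \<eta> F e \<theta>) \<le> C * wt \<theta>" by blast
    let ?D = "amp \<psi> \<eta> F G + amp cbump 0 (\<lambda>X. (-1) *\<^sub>R F X) G"
    have z: "?D 0 \<theta> P = 0" for \<theta> P
      by (simp add: amp_def 1 bump_1 scaleC_one act_scaleR linear_neg[OF bounded_linear.linear[OF bounded_linear_act]])
    obtain JD where JD: "\<And>\<theta>. ((\<lambda>e. integral UNIV (\<lambda>P. cis (phase P) *\<^sub>C ?D e \<theta> P)) \<longlongrightarrow> JD \<theta>) (at_right 0)"
      "\<And>\<theta>. JD \<theta> = 0"
      using osc_limit[OF osc_add[OF op os']] z by blast
    fix \<theta>
    have D: "integral UNIV (\<lambda>P. cis (phase P) *\<^sub>C ?D e \<theta> P) = ?I \<psi> \<eta> F e \<theta> - ?I cbump 0 F e \<theta>"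
      if e: "e \<in> {0<..1}" for e
    proof -
      have "cis (phase P) *\<^sub>C ?D e \<theta> P = cis (phase P) *\<^sub>C amp \<psi> \<eta> F G e \<theta> P - cis (phase P) *\<^sub>C amp cbump 0 F G e \<theta> P" for P
        by (simp add: amp_def scaleC_add_right act_scaleR scaleC.minus_right scaleC.diff_right linear_neg[OF bounded_linear.linear[OF bounded_linear_act]])
      then show ?thesis
        using integral_diff[OF dec_integrable[OF dec_phase[OF osc_dec[OF osc_oscG[OF op] e]]]
          dec_integrable[OF dec_phase[OF osc_dec[OF osc_oscG[OF os] e]]]] by simp
    qed
    have at: "at_right 0 = at 0 within {0<..1::real}"
      by (rule at_within_nhd[of 0 "{-1<..<1}"]) auto
    have "((\<lambda>e. ?I \<psi> \<eta> F e \<theta> - ?I cbump 0 F e \<theta>) \<longlongrightarrow> 0) (at_right 0)"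
      using JD(1)[of \<theta>] unfolding JD(2) at
      by (rule Lim_transform_eventually) (simp only: eventually_at_filter, intro always_eventually allI impI D)
    from tendsto_add[OF this J(3)[of \<theta>]]
    show "((\<lambda>e. ?I \<psi> \<eta> F e \<theta>) \<longlongrightarrow> J \<theta>) (at_right 0)" by simp
  qed
qed

end

section \<open>The Rieffel product\<close>

lemma cutoffD:
  assumes "cutoff \<psi>"
  shows "smooth \<psi>" "\<exists>R. \<forall>P. norm P > R \<longrightarrow> \<psi> P = 0" "\<psi> 0 = 1"
proof -
  show "smooth \<psi>" using assms by (simp add: cutoff_def)
  have "bounded {P. \<psi> P \<noteq> 0}"
    using assms unfolding cutoff_def by (blast intro: bounded_subset[OF compact_imp_bounded closure_subset])
  then obtain R where "\<And>P. \<psi> P \<noteq> 0 \<Longrightarrow> norm P \<le> R" by (auto simp: bounded_iff)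
  then show "\<exists>R. \<forall>P. norm P > R \<longrightarrow> \<psi> P = 0" by (metis not_le)
  show "\<psi> 0 = 1" using assms unfolding cutoff_def by (blast dest: eventually_nhds_x_imp_x)
qed

text \<open>Uniqueness of the value requires that some cutoff exists; the bump function is
  one.\<close>

lemma osc_integral_eq:
  assumes "has_osc_integral c f l" shows "osc_integral c f = l"
  unfolding osc_integral_def
proof (rule the_equality[where P = "has_osc_integral c f", OF assms])
  fix l' assume "has_osc_integral c f l'"
  note lim = assms[unfolded has_osc_integral_def, rule_format, OF cutoff_bump]
    and lim' = \<open>has_osc_integral c f l'\<close>[unfolded has_osc_integral_def, rule_format, OF cutoff_bump]
  show "l' = l" by (rule tendsto_unique[OF trivial_limit_at_right_real lim' lim])
qed

lemma tendsto_cutoff_integral: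
  fixes g :: "'x::euclidean_space \<times> 'x \<Rightarrow> 'a::cstar_algebra"
  assumes \<psi>: "cutoff \<psi>" and g: "dec g"
  shows "((\<lambda>e. integral UNIV (\<lambda>P. \<psi> (e *\<^sub>R P) *\<^sub>C g P)) \<longlongrightarrow> integral UNIV g) (at_right 0)"
proof -
  obtain R where R: "\<And>P. norm P > R \<Longrightarrow> \<psi> P = 0" using cutoffD(2)[OF \<psi>] by blast
  have c\<psi>: "continuous_on UNIV \<psi>" using smooth_continuous[OF cutoffD(1)[OF \<psi>], of "[]"] by simp
  have "dec \<psi>" by (rule dec_compact[OF c\<psi> R])
  then obtain B0 where B0: "\<And>P. cmod (\<psi> P) \<le> B0 * wt P" by (auto simp: dec_def)
  have B: "cmod (\<psi> P) \<le> \<bar>B0\<bar>" for P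
  proof -
    have "B0 * wt P \<le> \<bar>B0\<bar> * 1" by (intro mult_mono) (auto simp: wt_le_1)
    then show ?thesis using B0[of P] by simp
  qed
  obtain C where C: "\<And>P. norm (g P) \<le> C * wt P" using g by (auto simp: dec_def)
  show ?thesis
  proof (rule tendsto_integral[where C = "(\<bar>B0\<bar> + 1) * C"])
    show "continuous_on UNIV (\<lambda>P. \<psi> (e *\<^sub>R P) *\<^sub>C g P)" for e
      by (intro continuous_on_scaleC dec_continuous[OF g] continuous_on_compose2[OF c\<psi>] continuous_intros) auto
    have Cn: "0 \<le> C * wt P" for P :: "'x \<times> 'x" by (rule order_trans[OF norm_ge_zero C])
    show "norm (\<psi> (e *\<^sub>R P) *\<^sub>C g P) \<le> (\<bar>B0\<bar> + 1) * C * wt P" for e P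
    proof -
      have "cmod (\<psi> (e *\<^sub>R P)) \<le> \<bar>B0\<bar> + 1" using B[of "e *\<^sub>R P"] by linarith
      then have "cmod (\<psi> (e *\<^sub>R P)) * norm (g P) \<le> (\<bar>B0\<bar> + 1) * (C * wt P)" by (rule mult_mono[OF _ C]) auto
      then show ?thesis by (simp add: norm_scaleC mult.assoc)
    qed
    show "norm (g P) \<le> (\<bar>B0\<bar> + 1) * C * wt P" for P
      using C[of P] mult_right_mono[of 1 "\<bar>B0\<bar> + 1" "C * wt P"] Cn[of P] by (simp add: mult.assoc)
    fix P
    have "((\<lambda>e. \<psi> (e *\<^sub>R P)) \<longlongrightarrow> \<psi> (0 *\<^sub>R P)) (at_right 0)"
      by (rule continuous_on_tendsto_compose[OF c\<psi>]) ((intro tendsto_intros | simp)+)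
    then have "((\<lambda>e. \<psi> (e *\<^sub>R P)) \<longlongrightarrow> 1) (at_right 0)" by (simp add: cutoffD(3)[OF \<psi>])
    from scaleC.tendsto[OF this tendsto_const, of "g P"]
    show "((\<lambda>e. \<psi> (e *\<^sub>R P) *\<^sub>C g P) \<longlongrightarrow> g P) (at_right 0)" by (simp add: scaleC_one)
  qed (rule dec_continuous[OF g])
qed

lemma has_osc_integral_dec:
  fixes g :: "'x::euclidean_space \<times> 'x \<Rightarrow> 'a::cstar_algebra"
  assumes "dec g" shows "has_osc_integral c g (c\<^sup>2 *\<^sub>R integral UNIV g)"
  unfolding has_osc_integral_def dint2_def
proof (intro allI impI)
  fix \<psi> :: "'x \<times> 'x \<Rightarrow> complex" assume "cutoff \<psi>"
  have "(\<lambda>(Y, Z). \<psi> (e *\<^sub>R Y, e *\<^sub>R Z) *\<^sub>C g (Y, Z)) = (\<lambda>P. \<psi> (e *\<^sub>R P) *\<^sub>C g P)" for e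
    by (auto simp: fun_eq_iff)
  then show "((\<lambda>e. c\<^sup>2 *\<^sub>R integral UNIV (\<lambda>(Y, Z). \<psi> (e *\<^sub>R Y, e *\<^sub>R Z) *\<^sub>C g (Y, Z))) \<longlongrightarrow> c\<^sup>2 *\<^sub>R integral UNIV g) (at_right 0)"
    using tendsto_scaleR[OF tendsto_const tendsto_cutoff_integral[OF \<open>cutoff \<psi>\<close> assms]] by simp
qed

lemma wt_scale: assumes "\<bar>s\<bar> \<ge> 1" shows "wt (s *\<^sub>R X) \<le> wt (X :: 'y::euclidean_space)"
proof -
  have "1 * norm X \<le> \<bar>s\<bar> * norm X" using assms by (intro mult_right_mono) auto
  then have "(1 + norm X) ^ (2 * DIM('y)) \<le> (1 + norm (s *\<^sub>R X)) ^ (2 * DIM('y))" by (intro power_mono) auto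
  then show ?thesis unfolding wt_def by (intro divide_left_mono mult_pos_pos zero_less_power add_pos_nonneg) auto
qed

lemma dec_nonneg_const: "(\<And>Y::'y::euclidean_space. norm (f Y) \<le> C * wt Y) \<Longrightarrow> C \<ge> 0"
  using order_trans[OF norm_ge_zero, of "f 0" "C * wt (0::'y)"] mult_neg_pos[of C "wt (0::'y)"] by (force simp: not_le)

section \<open>Comparison of the two products\<close>

context fourier
begin

lemma rieffel_limit:
  assumes F: "schw F" and G: "schw G"
    and J: "\<And>\<psi>. cutoff \<psi> \<Longrightarrow> ((\<lambda>e. integral UNIV (\<lambda>P. cis (phase P) *\<^sub>C amp \<psi> 0 F G e \<theta> P)) \<longlongrightarrow> J) (at_right 0)"
  shows "rieffel_prod \<omega> c \<Theta> (F (fst \<theta>)) (G (snd \<theta>)) = 2 ^ DIM('x) *\<^sub>R (c\<^sup>2 *\<^sub>R J)"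
proof -
  have "has_osc_integral c (\<lambda>(Y, Z). cis (2 * \<omega> Y Z) *\<^sub>C (\<Theta> Y (F (fst \<theta>)) * \<Theta> Z (G (snd \<theta>)))) (c\<^sup>2 *\<^sub>R J)"
    unfolding has_osc_integral_def dint2_def
  proof (intro allI impI)
    fix \<psi> :: "'x \<times> 'x \<Rightarrow> complex" assume \<psi>: "cutoff \<psi>"
    have "(\<lambda>(Y, Z). \<psi> (e *\<^sub>R Y, e *\<^sub>R Z) *\<^sub>C (case (Y, Z) of (Y, Z) \<Rightarrow> cis (2 * \<omega> Y Z) *\<^sub>C (\<Theta> Y (F (fst \<theta>)) * \<Theta> Z (G (snd \<theta>)))))
        = (\<lambda>P. cis (phase P) *\<^sub>C amp \<psi> 0 F G e \<theta> P)" for e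
      by (auto simp: fun_eq_iff amp_def phase_def scaleC_scaleC mult.commute)
    then show "((\<lambda>e. c\<^sup>2 *\<^sub>R integral UNIV (\<lambda>(Y, Z). \<psi> (e *\<^sub>R Y, e *\<^sub>R Z) *\<^sub>C
        (case (Y, Z) of (Y, Z) \<Rightarrow> cis (2 * \<omega> Y Z) *\<^sub>C (\<Theta> Y (F (fst \<theta>)) * \<Theta> Z (G (snd \<theta>)))))) \<longlongrightarrow> c\<^sup>2 *\<^sub>R J) (at_right 0)"
      using tendsto_scaleR[OF tendsto_const J[OF \<psi>]] by simp
  qed
  then show ?thesis unfolding rieffel_prod_def by (simp only: osc_integral_eq)
qed

text \<open>The integrand of the double integral for \<open>M_inv\<close> of a twisted convolution
  at X, as a function of P = (V, T): the outer variable is W = 2T - 2V and the inner one is Y =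
  2T.\<close>

definition prodint :: "'x \<Rightarrow> ('x \<Rightarrow> 'a) \<Rightarrow> ('x \<Rightarrow> 'a) \<Rightarrow> 'x \<times> 'x \<Rightarrow> 'a" where
  "prodint X G H P = cis (- \<omega> X (2 *\<^sub>R snd P - 2 *\<^sub>R fst P)) *\<^sub>C \<Theta> (- X) (tw G H (2 *\<^sub>R snd P - 2 *\<^sub>R fst P) (2 *\<^sub>R snd P))"

text \<open>With W = 2T - 2V and Y = 2T the halved arguments become (Y - W)/2 = V and Y/2 = T, and W
  - Y = -2V. The phase splits into 2[V, T] and one factor for each of G and H, the form in which
  \<open>M_map_integrals\<close> produces them.\<close>

lemma prodint_eq: "prodint X G H (V, T) =
    cis (2 * \<omega> V T) *\<^sub>C ((cis (- 2 * \<omega> X T) *\<^sub>C \<Theta> (V - X) (G (2 *\<^sub>R T)))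
      * (cis (- 2 * \<omega> V X) *\<^sub>C \<Theta> (T - X) (H ((- 2) *\<^sub>R V))))"
proof -
  have 1: "- \<omega> X (2 *\<^sub>R T - 2 *\<^sub>R V) + - (1 / 2) * \<omega> (2 *\<^sub>R T - 2 *\<^sub>R V) (2 *\<^sub>R T)
      = 2 * \<omega> V T + (- 2 * \<omega> X T + - 2 * \<omega> V X)"
    by (simp add: \<omega>.diff_right \<omega>.diff_left \<omega>.scaleR_right \<omega>.scaleR_left form_antisym[of X V])
  have 2: "(1 / 2) *\<^sub>R (2 *\<^sub>R T - (2 *\<^sub>R T - 2 *\<^sub>R V)) = V" "(1 / 2) *\<^sub>R 2 *\<^sub>R T = T"
    "2 *\<^sub>R T - 2 *\<^sub>R V - 2 *\<^sub>R T = (- 2) *\<^sub>R V" by simp_all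
  have "prodint X G H (V, T) = (cis (- \<omega> X (2 *\<^sub>R T - 2 *\<^sub>R V)) * cis (- (1 / 2) * \<omega> (2 *\<^sub>R T - 2 *\<^sub>R V) (2 *\<^sub>R T))) *\<^sub>C
      (\<Theta> (- X) (\<Theta> V (G (2 *\<^sub>R T))) * \<Theta> (- X) (\<Theta> T (H ((- 2) *\<^sub>R V))))"
    unfolding prodint_def tw_def fst_conv snd_conv 2 act_scaleC act_mult scaleC_scaleC ..
  also have "\<dots> = cis (2 * \<omega> V T + (- 2 * \<omega> X T + - 2 * \<omega> V X)) *\<^sub>C
      (\<Theta> (V - X) (G (2 *\<^sub>R T)) * \<Theta> (T - X) (H ((- 2) *\<^sub>R V)))"
    unfolding cis_mult 1 act_act by simp
  finally show ?thesis
    by (simp only: cis_mult[symmetric] mult_scaleC_left mult_scaleC_right scaleC_scaleC mult.assoc mult.left_commute mult.commute)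
qed

lemma norm_prodint: "norm (prodint X G H P) \<le> norm (H ((- 2) *\<^sub>R fst P)) * norm (G (2 *\<^sub>R snd P))"
proof -
  have "norm (prodint X G H (fst P, snd P)) \<le> norm (\<Theta> (fst P - X) (G (2 *\<^sub>R snd P))) * norm (\<Theta> (snd P - X) (H ((- 2) *\<^sub>R fst P)))"
    unfolding prodint_eq mult_scaleC_left mult_scaleC_right norm_scaleC
    by (simp add: norm_mult_ineq[of "\<Theta> (fst P - X) (G (2 *\<^sub>R snd P))" "\<Theta> (snd P - X) (H ((- 2) *\<^sub>R fst P))", simplified])
  then show ?thesis by (simp add: mult.commute)
qed

lemma continuous_on_prodint:
  assumes "schw G" "schw H" shows "continuous_on UNIV (prodint X G H)"
proof -
  have "continuous_on UNIV (\<lambda>P. case (2 *\<^sub>R snd P - 2 *\<^sub>R fst P, 2 *\<^sub>R snd P) of (W, Y) \<Rightarrow> tw G H W Y)"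
    by (rule continuous_on_compose2[OF continuous_on_tw[OF assms]]) (auto intro!: continuous_intros)
  then show ?thesis
    unfolding prodint_def[abs_def]
    by (intro continuous_on_scaleC continuous_on_cis continuous_intros) simp_all
qed

lemma dec_prodint:
  assumes "schw G" "schw H" shows "dec (prodint X G H)"
proof -
  obtain C where C: "C \<ge> 0" "\<And>\<theta>. norm (H (fst \<theta>)) * norm (G (snd \<theta>)) \<le> C * wt \<theta>"
    using schw_prod_bound[OF assms(2,1)] by blast
  have "norm (prodint X G H P) \<le> C * wt P" for P
  proof -
    have "wt ((- 2) *\<^sub>R fst P, 2 *\<^sub>R snd P) = wt (2 *\<^sub>R P)"
      unfolding wt_def by (simp add: norm_Pair norm_prod_def)
    also have "\<dots> \<le> wt P" by (rule wt_scale) simp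
    finally have "C * wt ((- 2) *\<^sub>R fst P, 2 *\<^sub>R snd P) \<le> C * wt P" by (rule mult_left_mono[OF _ C(1)])
    then show ?thesis using C(2)[of "((- 2) *\<^sub>R fst P, 2 *\<^sub>R snd P)"] norm_prodint[of X G H P] by simp
  qed
  then show ?thesis by (rule decI[OF continuous_on_prodint[OF assms]])
qed

text \<open>The variables are changed one at a time, V at fixed T and then T, with scale factors -2
  and 2; each contributes one factor \<open>2 ^ DIM('x)\<close>. The two factors \<open>c\<close>
  are those of \<open>M_inv\<close> and of the twisted convolution.\<close>

lemma integral_prodint:
  assumes G: "schw G" and H: "schw H"
  shows "M_inv \<omega> c \<Theta> (diamond_prod \<omega> c \<Theta> G H) X = (c\<^sup>2 * (2 ^ DIM('x) * 2 ^ DIM('x))) *\<^sub>R integral UNIV (prodint X G H)"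
proof -
  define q where "q = (\<lambda>W Y. cis (- \<omega> X W) *\<^sub>C \<Theta> (- X) (tw G H W Y))"
  have qP: "prodint X G H (V, T) = q (2 *\<^sub>R T - 2 *\<^sub>R V) (2 *\<^sub>R T)" for V T
    by (simp add: prodint_def q_def)
  have qc: "continuous_on UNIV (\<lambda>(W, Y). q W Y)"
  proof -
    have "continuous_on UNIV (\<lambda>z. cis (- \<omega> X (fst z)) *\<^sub>C \<Theta> (- X) (case z of (W, Y) \<Rightarrow> tw G H W Y))"
      by (intro continuous_on_scaleC continuous_on_cis continuous_intros continuous_on_tw G H)
    then show ?thesis by (simp add: q_def split_beta)
  qed
  obtain K where K: "K \<ge> 0" "\<And>W Y. (1 + norm W) ^ (2 * DIM('x)) * norm (tw G H W Y) \<le> K * wt Y"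
    using tw_bound[OF G H] by blast
  have qb: "norm (q W Y) \<le> K * (wt W * wt Y)" for W Y
    using wt_rapid[OF K(2)[of W Y]] by (simp add: q_def norm_scaleC mult_ac)
  have qc': "continuous_on UNIV (\<lambda>z. q (snd z) (fst z))"
    using continuous_on_compose2[OF qc continuous_on_swap, of UNIV] by (simp add: prod.swap_def split_beta)
  have qb': "norm (q W Y) \<le> K * (wt Y * wt W)" for W Y
    using qb by (simp only: mult.commute)
  \<comment> \<open>W is integrated first because the substitution in V moves W while Y = 2T stays
    fixed.\<close>
  define h where "h = (\<lambda>Y. integral UNIV (\<lambda>W. q W Y))"
  have dh: "dec h"
    using fubini_dec[OF qc', of K] qb' by (simp add: h_def)
  have dq: "dec (\<lambda>W. q W Y)" for Y
    using fubini_inner_dec[OF qc', of K Y] qb' by simp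
  have M: "M_inv \<omega> c \<Theta> (diamond_prod \<omega> c \<Theta> G H) X = c\<^sup>2 *\<^sub>R integral UNIV (\<lambda>W. integral UNIV (q W))"
  proof -
    have "cis (- \<omega> X W) *\<^sub>C \<Theta> (- X) (dint c (tw G H W)) = c *\<^sub>R integral UNIV (q W)" for W
    proof -
      have "bounded_linear (\<lambda>f. cis (- \<omega> X W) *\<^sub>C \<Theta> (- X) f)"
        by (rule bounded_linear_compose[OF scaleC.bounded_linear_right bounded_linear_act])
      from dint_bounded_linear[OF this dec_integrable[OF tw_dec[OF G H]], of c W]
      show ?thesis unfolding q_def dint_def by simp
    qed
    then show ?thesis by (simp add: M_inv_def diamond_tw dint_def power2_eq_square)
  qed
  obtain CG where CG: "CG \<ge> 0" "\<And>Y. norm (G Y) \<le> CG * wt Y" using schw_wt_bound[OF G, of 0] by auto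
  obtain CH where CH: "CH \<ge> 0" "\<And>Y. norm (H Y) \<le> CH * wt Y" using schw_wt_bound[OF H, of 0] by auto
  have pb: "norm (prodint X G H (V, T)) \<le> (CH * CG) * (wt V * wt T)" for V T
  proof -
    have "norm (H ((- 2) *\<^sub>R V)) \<le> CH * wt V"
      by (rule order_trans[OF CH(2) mult_left_mono[OF wt_scale CH(1)]]) simp
    moreover have "norm (G (2 *\<^sub>R T)) \<le> CG * wt T"
      by (rule order_trans[OF CG(2) mult_left_mono[OF wt_scale CG(1)]]) simp
    ultimately have "norm (H ((- 2) *\<^sub>R V)) * norm (G (2 *\<^sub>R T)) \<le> (CH * wt V) * (CG * wt T)"
      by (intro mult_mono) (auto intro!: mult_nonneg_nonneg CH)
    then show ?thesis using norm_prodint[of X G H "(V, T)"] by (simp add: mult_ac)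
  qed
  have "integral UNIV (prodint X G H) = integral UNIV (\<lambda>V. integral UNIV (\<lambda>T. prodint X G H (V, T)))"
    by (rule fubini[OF continuous_on_prodint[OF G H] pb])
  also have "\<dots> = integral UNIV (\<lambda>T. integral UNIV (\<lambda>V. prodint X G H (V, T)))"
    by (rule fubini_swap[OF _ pb]) (use continuous_on_prodint[OF G H] in simp)
  also have "(\<lambda>T. integral UNIV (\<lambda>V. prodint X G H (V, T))) = (\<lambda>T. (1 / 2 ^ DIM('x)) *\<^sub>R h (2 *\<^sub>R T))"
  proof
    fix T
    have "integral UNIV (\<lambda>V. q ((- 2) *\<^sub>R V + 2 *\<^sub>R T) (2 *\<^sub>R T)) = (1 / 2 ^ DIM('x)) *\<^sub>R h (2 *\<^sub>R T)"
      using integral_unique[OF integral_affine[OF dec_integrable[OF dq[of "2 *\<^sub>R T"]], of "- 2" "2 *\<^sub>R T"]] by (simp add: h_def)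
    then show "integral UNIV (\<lambda>V. prodint X G H (V, T)) = (1 / 2 ^ DIM('x)) *\<^sub>R h (2 *\<^sub>R T)"
      by (simp add: qP)
  qed
  also have "integral UNIV \<dots> = (1 / (2 ^ DIM('x) * 2 ^ DIM('x))) *\<^sub>R integral UNIV h"
    using integral_unique[OF integral_affine[OF dec_integrable[OF dh], of 2 0]] by simp
  also have "integral UNIV h = integral UNIV (\<lambda>W. integral UNIV (q W))"
    unfolding h_def by (rule fubini_swap[OF qc qb, symmetric])
  finally have "integral UNIV (\<lambda>W. integral UNIV (q W)) = (2 ^ DIM('x) * 2 ^ DIM('x)) *\<^sub>R integral UNIV (prodint X G H)"
    by simp
  then show ?thesis by (simp add: M)
qed

text \<open>The reflection A \<mapsto> X - A frees the argument of F. What remains is the transform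
  of \<open>\<Theta> A (F A)\<close> at 2T, up to a phase and the automorphism
  \<open>\<Theta> (V - X)\<close>, neither of which depends on A.\<close>

lemma M_map_integrals:
  assumes F: "schw F"
  shows "c *\<^sub>R integral UNIV (\<lambda>A. cis (- 2 * \<omega> A T) *\<^sub>C \<Theta> (V - A) (F (X - A)))
      = cis (- 2 * \<omega> X T) *\<^sub>C \<Theta> (V - X) (M_map \<omega> c \<Theta> F (2 *\<^sub>R T))"
proof -
  have d: "dec (\<lambda>Y. \<Theta> (1 *\<^sub>R Y) (F Y))" by (rule schw_dec[OF schw_act[OF F]])
  let ?k = "\<lambda>A. cis (- 2 * \<omega> (X - A) T) *\<^sub>C \<Theta> (V - X + A) (F A)"
  have k: "?k A = cis (- 2 * \<omega> X T) *\<^sub>C \<Theta> (V - X) (cis (- \<omega> (2 *\<^sub>R T) A) *\<^sub>C \<Theta> (1 *\<^sub>R A) (F A))" for A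
  proof -
    have "- 2 * \<omega> (X - A) T = - 2 * \<omega> X T + - \<omega> (2 *\<^sub>R T) A"
      by (simp add: \<omega>.diff_left \<omega>.scaleR_left form_antisym[of T A])
    then show ?thesis
      by (simp only: cis_mult[symmetric] act_scaleC scaleC_scaleC act_act scaleR_one)
  qed
  have bl: "bounded_linear (\<lambda>f. cis (- 2 * \<omega> X T) *\<^sub>C \<Theta> (V - X) f)"
    by (rule bounded_linear_compose[OF scaleC.bounded_linear_right bounded_linear_act])
  have dk: "dec ?k"
    unfolding k
    by (rule dec_bounded[OF dec_FT[OF d, of "2 *\<^sub>R T"], of _ 1])
       (rule bounded_linear.continuous_on[OF bl dec_continuous[OF dec_FT[OF d]]], auto simp: norm_scaleC)
  have "integral UNIV (\<lambda>A. ?k (X - A)) = integral UNIV ?k"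
    by (rule integral_reflect[OF dec_integrable[OF dk]])
  moreover have "?k (X - A) = cis (- 2 * \<omega> A T) *\<^sub>C \<Theta> (V - A) (F (X - A))" for A by simp
  ultimately have "integral UNIV (\<lambda>A. cis (- 2 * \<omega> A T) *\<^sub>C \<Theta> (V - A) (F (X - A))) = integral UNIV ?k" by simp
  also have "c *\<^sub>R \<dots> = cis (- 2 * \<omega> X T) *\<^sub>C \<Theta> (V - X) (M_map \<omega> c \<Theta> F (2 *\<^sub>R T))"
    unfolding k M_map_FT FT_def
    using dint_bounded_linear[OF bl dec_integrable[OF dec_FT[OF d, of "2 *\<^sub>R T"]], of c] by (simp only: dint_def)
  finally show ?thesis .
qed

lemma square_formula:
  assumes F1: "schw F1" and F2: "schw F2" and c: "c \<noteq> 0"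
  shows "square_prod \<omega> c \<Theta> F1 F2 X = M_inv \<omega> c \<Theta> (diamond_prod \<omega> c \<Theta> (M_map \<omega> c \<Theta> F1) (M_map \<omega> c \<Theta> F2)) X"
proof -
  \<comment> \<open>Recentering at X turns F1(X - A) and F2(X - B) into Schwartz functions of A and
    B, so that \<open>oscillatory_limit\<close> applies with \<theta> = (A, B).\<close>
  define F where "F = (\<lambda>A. F1 ((- 1) *\<^sub>R A + X))"
  define G where "G = (\<lambda>B. F2 ((- 1) *\<^sub>R B + X))"
  have F: "schw F" and G: "schw G" unfolding F_def G_def by (intro schw_affine F1 F2; simp)+
  have Fe: "F A = F1 (X - A)" and Ge: "G A = F2 (X - A)" for A by (simp_all add: F_def G_def)
  define G1 where "G1 = M_map \<omega> c \<Theta> F1"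
  define G2 where "G2 = M_map \<omega> c \<Theta> F2"
  have G1: "schw G1" and G2: "schw G2" unfolding G1_def G2_def by (intro schw_M_map F1 F2)+
  from oscillatory_limit[OF F G] obtain J where dJ: "dec J"
    and J: "\<forall>\<psi> \<eta>. smooth \<psi> \<longrightarrow> (\<exists>R. \<forall>P. norm P > R \<longrightarrow> \<psi> P = 0) \<longrightarrow> \<psi> 0 = 1 \<longrightarrow>
      (\<forall>\<theta>. ((\<lambda>e. integral UNIV (\<lambda>P. cis (phase P) *\<^sub>C amp \<psi> \<eta> F G e \<theta> P)) \<longlongrightarrow> J \<theta>) (at_right 0))
      \<and> (\<exists>C. \<forall>e\<in>{0<..1}. \<forall>\<theta>. norm (integral UNIV (\<lambda>P. cis (phase P) *\<^sub>C amp \<psi> \<eta> F G e \<theta> P)) \<le> C * wt \<theta>)"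
    by (elim exE conjE)
  note J = J[rule_format, OF cutoffD(1) _ cutoffD(3)]
  have Jl: "((\<lambda>e. integral UNIV (\<lambda>P. cis (phase P) *\<^sub>C amp \<psi> \<eta> F G e \<theta> P)) \<longlongrightarrow> J \<theta>) (at_right 0)"
    if "cutoff \<psi>" for \<psi> \<eta> \<theta> using J[OF that _ that] cutoffD(2)[OF that] by blast
  have Jb: "\<exists>C. \<forall>e\<in>{0<..1}. \<forall>\<theta>. norm (integral UNIV (\<lambda>P. cis (phase P) *\<^sub>C amp \<psi> \<eta> F G e \<theta> P)) \<le> C * wt \<theta>"
    if "cutoff \<psi>" for \<psi> \<eta> using J[OF that _ that] cutoffD(2)[OF that] by blast
  let ?d = "2 ^ DIM('x) :: real"
  have R: "rieffel_prod \<omega> c \<Theta> (F1 (X - A)) (F2 (X - B)) = (?d * c\<^sup>2) *\<^sub>R J (A, B)" for A B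
    using rieffel_limit[where \<theta> = "(A, B)", OF F G Jl] by (simp add: Fe Ge)
  let ?j = "\<lambda>\<theta>. cis (- phase \<theta>) *\<^sub>C J \<theta>"
  have dj: "dec ?j" by (rule dec_cis[OF dJ]) (intro continuous_intros)
  have djs: "dec (\<lambda>\<theta>. (?d * c\<^sup>2) *\<^sub>R ?j \<theta>)"
    by (rule dec_bounded[OF dj, of _ "\<bar>?d * c\<^sup>2\<bar>"]) (auto intro!: continuous_intros dec_continuous[OF dj])
  have "(\<lambda>(A, B). cis (- 2 * \<omega> A B) *\<^sub>C rieffel_prod \<omega> c \<Theta> (F1 (X - A)) (F2 (X - B))) = (\<lambda>\<theta>. (?d * c\<^sup>2) *\<^sub>R ?j \<theta>)"
    by (auto simp: fun_eq_iff R phase_def scaleC_scaleR)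
  then have sq: "square_prod \<omega> c \<Theta> F1 F2 X = ?d *\<^sub>R c\<^sup>2 *\<^sub>R (?d * c\<^sup>2) *\<^sub>R integral UNIV ?j"
    unfolding square_prod_def using osc_integral_eq[OF has_osc_integral_dec[OF djs, of c]] by simp
  have "(c\<^sup>2) *\<^sub>R integral UNIV ?j = integral UNIV (prodint X G1 G2)"
  proof -
    have at: "at_right 0 = at 0 within {0<..1::real}"
      by (rule at_within_nhd[of 0 "{-1<..<1}"]) auto
    let ?I = "\<lambda>e \<theta>. integral UNIV (\<lambda>P. cis (phase P) *\<^sub>C amp cbump 1 F G e \<theta> P)"
    \<comment> \<open>\<open>a\<close> collects what depends on A and \<open>b\<close> what depends
      on B; for fixed P the integral over \<theta> is then a product of two integrals.\<close>
    define a where "a = (\<lambda>P A. cis (- 2 * \<omega> A (snd P)) *\<^sub>C \<Theta> (fst P - A) (F A))"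
    define b where "b = (\<lambda>P B. cis (- 2 * \<omega> (fst P) B) *\<^sub>C \<Theta> (snd P - B) (G B))"
    define v where "v = (\<lambda>\<theta> P. cis (phase P) *\<^sub>C (a P (fst \<theta>) * b P (snd \<theta>)))"
    have nv: "norm (v \<theta> P) \<le> norm (F (fst \<theta>)) * norm (G (snd \<theta>))" for \<theta> P
      unfolding v_def norm_scaleC
      by (rule order_trans[OF _ norm_mult_ineq[of "a P (fst \<theta>)" "b P (snd \<theta>)", THEN order_trans]])
         (auto simp: a_def b_def norm_scaleC)
    obtain CFG where CFG: "CFG \<ge> 0" "\<And>\<theta>. norm (F (fst \<theta>)) * norm (G (snd \<theta>)) \<le> CFG * wt \<theta>"
      using schw_prod_bound[OF F G] by blast
    have cv: "continuous_on UNIV (\<lambda>z. v (fst z) (snd z))"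
      unfolding v_def a_def b_def
      by (intro continuous_on_scaleC continuous_on_cis continuous_intros
          continuous_on_compose2[OF schw_continuous[OF F]] continuous_on_compose2[OF schw_continuous[OF G]]) auto
    have vint: "c\<^sup>2 *\<^sub>R integral UNIV (\<lambda>\<theta>. v \<theta> P) = prodint X G1 G2 P" for P
    proof -
      have da: "dec (a P)"
        unfolding a_def
        by (rule dec_bounded[OF schw_dec[OF F], of _ 1])
           (auto simp: norm_scaleC intro!: continuous_on_scaleC continuous_on_cis continuous_intros dec_continuous[OF schw_dec[OF F]])
      have db: "dec (b P)"
        unfolding b_def
        by (rule dec_bounded[OF schw_dec[OF G], of _ 1])
           (auto simp: norm_scaleC intro!: continuous_on_scaleC continuous_on_cis continuous_intros dec_continuous[OF schw_dec[OF G]])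
      obtain Ca where Ca: "\<And>A. norm (a P A) \<le> Ca * wt A" using da by (auto simp: dec_def)
      obtain Cb where Cb: "\<And>A. norm (b P A) \<le> Cb * wt A" using db by (auto simp: dec_def)
      have abc: "continuous_on UNIV (\<lambda>\<theta>. a P (fst \<theta>) * b P (snd \<theta>))"
        by (intro continuous_intros continuous_on_compose2[OF dec_continuous[OF da]] continuous_on_compose2[OF dec_continuous[OF db]]) auto
      have abb: "norm (a P (fst (A, B)) * b P (snd (A, B))) \<le> Ca * Cb * (wt A * wt B)" for A B
      proof -
        have "norm (a P A) * norm (b P B) \<le> (Ca * wt A) * (Cb * wt B)"
          by (intro mult_mono Ca Cb order_trans[OF norm_ge_zero Ca]) auto
        then show ?thesis using norm_mult_ineq[of "a P A" "b P B"] by (simp add: mult_ac)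
      qed
      have "integral UNIV (\<lambda>\<theta>. a P (fst \<theta>) * b P (snd \<theta>)) = integral UNIV (\<lambda>A. integral UNIV (\<lambda>B. a P A * b P B))"
        using fubini[OF abc abb] by simp
      also have "(\<lambda>A. integral UNIV (\<lambda>B. a P A * b P B)) = (\<lambda>A. a P A * integral UNIV (b P))"
        using integral_linear[OF dec_integrable[OF db] bounded_linear_mult_right] by (simp add: o_def)
      also have "integral UNIV \<dots> = integral UNIV (a P) * integral UNIV (b P)"
        using integral_linear[OF dec_integrable[OF da] bounded_linear_mult_left] by (simp add: o_def)
      finally have i: "integral UNIV (\<lambda>\<theta>. a P (fst \<theta>) * b P (snd \<theta>)) = integral UNIV (a P) * integral UNIV (b P)" .
      have ii: "(\<lambda>\<theta>. a P (fst \<theta>) * b P (snd \<theta>)) integrable_on UNIV"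
        by (rule fubini_integrable[OF abc abb])
      have ca: "c *\<^sub>R integral UNIV (a P) = cis (- 2 * \<omega> X (snd P)) *\<^sub>C \<Theta> (fst P - X) (G1 (2 *\<^sub>R snd P))"
        unfolding a_def Fe G1_def by (rule M_map_integrals[OF F1])
      have cb: "c *\<^sub>R integral UNIV (b P) = cis (- 2 * \<omega> (fst P) X) *\<^sub>C \<Theta> (snd P - X) (G2 ((- 2) *\<^sub>R fst P))"
      proof -
        \<comment> \<open>B is the second argument of the form here. Exchanging the arguments puts a
          minus sign on \<open>fst P\<close>, which is why the image of F2 is evaluated at
          -2Y.\<close>
        have e: "- 2 * \<omega> (fst P) B = - 2 * \<omega> B (- fst P)" for B
          by (simp only: \<omega>.minus_right form_antisym[of B "fst P"] minus_minus)
        have e2: "2 *\<^sub>R (- fst P) = (- 2) *\<^sub>R fst P" by simp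
        show ?thesis
          unfolding b_def Ge G2_def
          using M_map_integrals[OF F2, of "- fst P" "snd P" X, unfolded e[symmetric] e2] .
      qed
      have "integral UNIV (\<lambda>\<theta>. v \<theta> P) = cis (phase P) *\<^sub>C (integral UNIV (a P) * integral UNIV (b P))"
        unfolding v_def i[symmetric]
        using integral_linear[OF ii scaleC.bounded_linear_right, of "cis (phase P)"] by (simp add: o_def)
      then have "c\<^sup>2 *\<^sub>R integral UNIV (\<lambda>\<theta>. v \<theta> P) = cis (phase P) *\<^sub>C ((c *\<^sub>R integral UNIV (a P)) * (c *\<^sub>R integral UNIV (b P)))"
        by (simp add: power2_eq_square scaleC_scaleR)
      also have "\<dots> = prodint X G1 G2 (fst P, snd P)" unfolding ca cb prodint_eq phase_def ..
      finally show ?thesis by simp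
    qed
    \<comment> \<open>At fixed e the cutoff makes Fubini available, so the two orders of integration
      can be compared; continuity in \<theta> is recorded for the dominated convergence that
      follows.\<close>
    have main: "c\<^sup>2 *\<^sub>R integral UNIV (\<lambda>\<theta>. cis (- phase \<theta>) *\<^sub>C ?I e \<theta>) = integral UNIV (\<lambda>P. cbump (e *\<^sub>R P) *\<^sub>C prodint X G1 G2 P)
        \<and> continuous_on UNIV (?I e)"
      if e: "e \<in> {0<..1}" for e
    proof -
      have "e \<noteq> 0" using e by auto
      from dec_bump_scaled[OF this, where 'y = "'x \<times> 'x"] obtain Ce where "\<forall>P. norm (bump (e *\<^sub>R P)) \<le> Ce * wt (P :: 'x \<times> 'x)"
        unfolding dec_def by (elim conjE exE)
      note Ce = this[rule_format]
      have Ce0: "Ce \<ge> 0" using Ce by (rule dec_nonneg_const)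
      define u where "u = (\<lambda>\<theta> P. cbump (e *\<^sub>R P) *\<^sub>C v \<theta> P)"
      have uc: "continuous_on UNIV (\<lambda>(\<theta>, P). u \<theta> P)"
        unfolding u_def split_beta by (intro continuous_on_scaleC continuous_intros cv)
      have ub: "norm (u \<theta> P) \<le> (Ce * CFG) * (wt \<theta> * wt P)" for \<theta> P
      proof -
        have "\<bar>bump (e *\<^sub>R P)\<bar> * norm (v \<theta> P) \<le> (Ce * wt P) * (CFG * wt \<theta>)"
          using Ce[of P] order_trans[OF nv CFG(2)] by (intro mult_mono) (auto intro!: mult_nonneg_nonneg Ce0)
        then show ?thesis by (simp add: u_def norm_scaleC mult_ac)
      qed
      have uI: "cis (- phase \<theta>) *\<^sub>C ?I e \<theta> = integral UNIV (u \<theta>)" for \<theta>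
      proof -
        have osc': "osc (\<lambda>_. 1) (amp cbump 1 F G)"
          by (rule osc_amp[OF smf_smooth[OF smf_bump] _ F G, where R = 2]) (simp add: bump_0)
        have dd: "dec (\<lambda>P. cis (phase P) *\<^sub>C amp cbump 1 F G e \<theta> P)"
          by (rule dec_phase[OF osc_dec[OF osc_oscG[OF osc'] e]])
        \<comment> \<open>The shift by \<open>\<theta>\<close> cancels \<open>phase \<theta>\<close> and leaves a phase that is additive in the components of \<open>\<theta>\<close>.\<close>
        have "?I e \<theta> = integral UNIV (\<lambda>P. cis (phase (P + - \<theta>)) *\<^sub>C amp cbump 1 F G e \<theta> (P + - \<theta>))"
          by (rule integral_shift[OF dec_integrable[OF dd], symmetric])
        moreover have "dec (\<lambda>P. cis (phase (P + - \<theta>)) *\<^sub>C amp cbump 1 F G e \<theta> (P + - \<theta>))"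
        proof -
          obtain Cd where Cd: "\<And>P. norm (cis (phase P) *\<^sub>C amp cbump 1 F G e \<theta> P) \<le> Cd * wt P" using dd by (auto simp: dec_def)
          show ?thesis
          proof (rule decI)
            show "continuous_on UNIV (\<lambda>P. cis (phase (P + - \<theta>)) *\<^sub>C amp cbump 1 F G e \<theta> (P + - \<theta>))"
              by (rule continuous_on_compose2[OF dec_continuous[OF dd]]) (auto intro!: continuous_intros)
            show "norm (cis (phase (P + - \<theta>)) *\<^sub>C amp cbump 1 F G e \<theta> (P + - \<theta>))
                \<le> (Cd * (1 + norm (- \<theta>)) ^ (2 * DIM('x \<times> 'x))) * wt P" for P
              using order_trans[OF Cd mult_left_mono[OF wt_shift dec_nonneg_const[OF Cd]], of P "- \<theta>"] by (simp only: mult.assoc)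
          qed
        qed
        from integral_linear[OF dec_integrable[OF this] scaleC.bounded_linear_right, of "cis (- phase \<theta>)"]
        have "cis (- phase \<theta>) *\<^sub>C integral UNIV (\<lambda>P. cis (phase (P + - \<theta>)) *\<^sub>C amp cbump 1 F G e \<theta> (P + - \<theta>))
            = integral UNIV (\<lambda>P. cis (- phase \<theta>) *\<^sub>C cis (phase (P + - \<theta>)) *\<^sub>C amp cbump 1 F G e \<theta> (P + - \<theta>))"
          by (simp only: o_def)
        moreover have "cis (- phase \<theta>) *\<^sub>C cis (phase (P + - \<theta>)) *\<^sub>C amp cbump 1 F G e \<theta> (P + - \<theta>) = u \<theta> P" for P
        proof -
          have "- phase \<theta> + phase (P + - \<theta>) = phase P + (- 2 * \<omega> (fst \<theta>) (snd P) + - 2 * \<omega> (fst P) (snd \<theta>))"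
            by (simp add: phase_def \<omega>.diff_left \<omega>.diff_right algebra_simps)
          then have ph: "cis (- phase \<theta>) * cis (phase (P + - \<theta>)) = cis (phase P) * (cis (- 2 * \<omega> (fst \<theta>) (snd P)) * cis (- 2 * \<omega> (fst P) (snd \<theta>)))"
            by (simp only: cis_mult)
          show ?thesis
            unfolding scaleC_scaleC[of "cis (- phase \<theta>)"] ph u_def v_def a_def b_def amp_def
            by (simp add: mult_scaleC_left mult_scaleC_right scaleC_scaleC mult_ac)
        qed
        ultimately show ?thesis by simp
      qed
      have "continuous_on UNIV (\<lambda>\<theta>. integral UNIV (u \<theta>))"
        using dec_continuous[OF fubini_dec[OF uc, of "Ce * CFG"]] ub by simp
      moreover have "?I e \<theta> = cis (phase \<theta>) *\<^sub>C integral UNIV (u \<theta>)" for \<theta>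
        unfolding uI[symmetric] by (simp add: scaleC_scaleC cis_mult scaleC_one)
      ultimately have "continuous_on UNIV (?I e)"
        by (simp only:) (intro continuous_on_scaleC continuous_on_cis continuous_intros)
      moreover have "c\<^sup>2 *\<^sub>R integral UNIV (\<lambda>\<theta>. cis (- phase \<theta>) *\<^sub>C ?I e \<theta>) = integral UNIV (\<lambda>P. cbump (e *\<^sub>R P) *\<^sub>C prodint X G1 G2 P)"
      proof -
        have vd: "dec (\<lambda>\<theta>. v \<theta> P)" for P
        proof (rule decI[of _ CFG])
          show "continuous_on UNIV (\<lambda>\<theta>. v \<theta> P)"
            using continuous_on_compose2[OF cv, of UNIV "\<lambda>\<theta>. (\<theta>, P)"] by (simp add: continuous_on_Pair)
        qed (rule order_trans[OF nv CFG(2)])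
        have "integral UNIV (\<lambda>\<theta>. integral UNIV (u \<theta>)) = integral UNIV (\<lambda>P. integral UNIV (\<lambda>\<theta>. u \<theta> P))"
          by (rule fubini_swap[OF uc ub])
        also have "(\<lambda>P. integral UNIV (\<lambda>\<theta>. u \<theta> P)) = (\<lambda>P. cbump (e *\<^sub>R P) *\<^sub>C integral UNIV (\<lambda>\<theta>. v \<theta> P))"
          using integral_linear[OF dec_integrable[OF vd] scaleC.bounded_linear_right] by (simp add: o_def u_def)
        finally have "c\<^sup>2 *\<^sub>R integral UNIV (\<lambda>\<theta>. integral UNIV (u \<theta>))
            = integral UNIV (\<lambda>P. c\<^sup>2 *\<^sub>R (cbump (e *\<^sub>R P) *\<^sub>C integral UNIV (\<lambda>\<theta>. v \<theta> P)))" by simp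
        then show ?thesis unfolding uI scaleC_scaleR[symmetric] vint .
      qed
      ultimately show ?thesis by blast
    qed
    obtain CI where CI: "\<And>e \<theta>. e \<in> {0<..1} \<Longrightarrow> norm (?I e \<theta>) \<le> CI * wt \<theta>"
      using Jb[OF cutoff_bump, of 1] by blast
    obtain CJ where CJ: "\<And>\<theta>. norm (J \<theta>) \<le> CJ * wt \<theta>" using dJ by (auto simp: dec_def)
    \<comment> \<open>The two sides of \<open>main\<close> are followed as e tends to 0. On this one
      the bound \<open>CI\<close>, uniform in e, permits the limit under the integral, and the
      shifted cutoff leads to the same \<open>J\<close>; on the other the cutoff tends to 1 against
      an integrable function.\<close>
    have "((\<lambda>e. integral UNIV (\<lambda>\<theta>. cis (- phase \<theta>) *\<^sub>C ?I e \<theta>)) \<longlongrightarrow> integral UNIV ?j) (at 0 within {0<..1})"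
    proof (rule tendsto_integral[where C = "max CI CJ"])
      show "continuous_on UNIV (\<lambda>\<theta>. cis (- phase \<theta>) *\<^sub>C ?I e \<theta>)" if "e \<in> {0<..1} - {0}" for e
        using main[of e] that by (intro continuous_on_scaleC continuous_on_cis continuous_intros) auto
      show "norm (cis (- phase \<theta>) *\<^sub>C ?I e \<theta>) \<le> max CI CJ * wt \<theta>" if "e \<in> {0<..1} - {0}" for e \<theta>
        using order_trans[OF CI mult_right_mono[OF max.cobounded1]] that by (simp add: norm_scaleC)
      show "norm (?j \<theta>) \<le> max CI CJ * wt \<theta>" for \<theta>
        using order_trans[OF CJ mult_right_mono[OF max.cobounded2]] by (simp add: norm_scaleC)
      show "((\<lambda>e. cis (- phase \<theta>) *\<^sub>C ?I e \<theta>) \<longlongrightarrow> ?j \<theta>) (at 0 within {0<..1})" for \<theta>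
        using Jl[OF cutoff_bump, of 1 \<theta>] unfolding at by (intro scaleC.tendsto tendsto_const)
    qed (rule dec_continuous[OF dj])
    then have "((\<lambda>e. c\<^sup>2 *\<^sub>R integral UNIV (\<lambda>\<theta>. cis (- phase \<theta>) *\<^sub>C ?I e \<theta>)) \<longlongrightarrow> c\<^sup>2 *\<^sub>R integral UNIV ?j) (at_right 0)"
      unfolding at by (intro tendsto_scaleR tendsto_const)
    moreover have "\<forall>\<^sub>F e in at_right 0. c\<^sup>2 *\<^sub>R integral UNIV (\<lambda>\<theta>. cis (- phase \<theta>) *\<^sub>C ?I e \<theta>)
        = integral UNIV (\<lambda>P. cbump (e *\<^sub>R P) *\<^sub>C prodint X G1 G2 P)"
      unfolding at eventually_at_filter using main by (intro always_eventually) blast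
    ultimately have "((\<lambda>e. integral UNIV (\<lambda>P. cbump (e *\<^sub>R P) *\<^sub>C prodint X G1 G2 P)) \<longlongrightarrow> c\<^sup>2 *\<^sub>R integral UNIV ?j) (at_right 0)"
      by (rule Lim_transform_eventually)
    moreover have "((\<lambda>e. integral UNIV (\<lambda>P. cbump (e *\<^sub>R P) *\<^sub>C prodint X G1 G2 P)) \<longlongrightarrow> integral UNIV (prodint X G1 G2)) (at_right 0)"
      by (rule tendsto_cutoff_integral[OF cutoff_bump dec_prodint[OF G1 G2]])
    ultimately show ?thesis using tendsto_unique trivial_limit_at_right_real by blast
  qed
  note e = this
  \<comment> \<open>Each of the two oscillatory integrals contributes \<open>c\<^sup>2\<close> and
    one power of 2. One factor \<open>c\<^sup>2\<close> is used up by \<open>e\<close>; the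
    remaining constant is that of \<open>integral_prodint\<close>.\<close>
  have "square_prod \<omega> c \<Theta> F1 F2 X = (c\<^sup>2 * (?d * ?d)) *\<^sub>R integral UNIV (prodint X G1 G2)"
    unfolding sq e[symmetric] scaleR_scaleR by (rule arg_cong2[of _ _ _ _ scaleR]) (simp_all only: mult_ac)
  then show ?thesis using integral_prodint[OF G1 G2, of X] by (simp add: G1_def G2_def)
qed

end

section \<open>The Schwartz topology\<close>

context caction
begin

lemma partials_zero: "w \<in> lists Basis \<Longrightarrow> partials w (\<lambda>_::'x. 0 :: 'a) = (\<lambda>_. 0)"
  by (rule smoothI(2)[of "\<lambda>w X. 0"]) (simp_all add: has_dd_def)

lemma partials_add:
  assumes "F \<in> S" "G \<in> S" "w \<in> lists Basis"
  shows "partials w (\<lambda>X. F X + G X) = (\<lambda>X. partials w F X + partials w G X)"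
proof (rule smoothI(2)[of "\<lambda>w X. partials w F X + partials w G X"])
  note F = schwartz_smooth[OF assms(1)] and G = schwartz_smooth[OF assms(2)]
  show "continuous_on UNIV (\<lambda>X. partials w F X + partials w G X)" if "w \<in> lists Basis" for w
    by (intro continuous_on_add smooth_continuous F G that)
  show "has_dd b (\<lambda>X. partials w F X + partials w G X) (\<lambda>X. partials (b # w) F X + partials (b # w) G X)"
    if "w \<in> lists Basis" "b \<in> Basis" for w b
    by (intro has_dd_add smooth_has_dd F G that)
qed (simp_all add: assms(3))

lemma smooth_seminorm_triangle:
  assumes "f \<in> smooth_vectors \<Theta>" "g \<in> smooth_vectors \<Theta>"
  shows "smooth_seminorm \<Theta> k (f + g) \<le> smooth_seminorm \<Theta> k f + smooth_seminorm \<Theta> k g"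
  unfolding smooth_seminorm_delta sum.distrib[symmetric] distrib_left[symmetric]
  by (intro sum_mono mult_left_mono)
     (use delta_lincomb[OF assms mword_lists, where r = 1] in \<open>auto intro: norm_triangle_ineq prod_nonneg\<close>)

lemma schwartz_seminorm_triangle:
  assumes F: "F \<in> S" and G: "G \<in> S"
  shows "schwartz_seminorm \<Theta> i (\<lambda>X. F X + G X) \<le> schwartz_seminorm \<Theta> i F + schwartz_seminorm \<Theta> i G"
proof -
  have "schwartz_weight \<Theta> i (\<lambda>X. F X + G X) X \<le> schwartz_weight \<Theta> i F X + schwartz_weight \<Theta> i G X" for X
  proof (cases i)
    case (fields k N \<beta>)
    have "smooth_seminorm \<Theta> k (mpartial \<beta> (\<lambda>X. F X + G X) X)
        \<le> smooth_seminorm \<Theta> k (mpartial \<beta> F X) + smooth_seminorm \<Theta> k (mpartial \<beta> G X)"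
      unfolding mpartial_mword partials_add[OF F G mword_lists]
      by (intro smooth_seminorm_triangle schwartz_partials(1) F G mword_lists)
    then have "(1 + norm X) ^ N * smooth_seminorm \<Theta> k (mpartial \<beta> (\<lambda>X. F X + G X) X)
        \<le> (1 + norm X) ^ N * (smooth_seminorm \<Theta> k (mpartial \<beta> F X) + smooth_seminorm \<Theta> k (mpartial \<beta> G X))"
      by (rule mult_left_mono) simp
    then show ?thesis by (simp add: schwartz_weight_def fields distrib_left)
  qed
  then have "schwartz_weight \<Theta> i (\<lambda>X. F X + G X) X \<le> schwartz_seminorm \<Theta> i F + schwartz_seminorm \<Theta> i G" for X
    using schwartz_weight_le[OF F, of i X] schwartz_weight_le[OF G, of i X] by (meson add_mono order_trans)
  then show ?thesis unfolding schwartz_seminorm_def[of \<Theta> i "\<lambda>X. F X + G X"] by (intro cSUP_least) simp_all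
qed

lemma schwartz_seminorm_zero: "schwartz_seminorm \<Theta> i (\<lambda>_. 0) = 0"
proof (cases i)
  case (fields k N \<beta>)
  have "delta w 0 = 0" if "w \<in> lists Basis" for w
    using partials_zero[OF that] by (simp add: delta_def)
  then have "smooth_seminorm \<Theta> k 0 = 0"
    by (simp add: smooth_seminorm_delta mword_lists)
  then show ?thesis
    by (simp add: fields schwartz_seminorm_def schwartz_weight_def mpartial_mword partials_zero mword_lists)
qed

text \<open>Written with the scalar -1, the form in which differences occur in
  \<open>fa_topology\<close>.\<close>

definition fdiff :: "('x \<Rightarrow> 'a) \<Rightarrow> ('x \<Rightarrow> 'a) \<Rightarrow> 'x \<Rightarrow> 'a" where
  "fdiff F G X = F X + (- 1) *\<^sub>C G X"

lemma fdiff_minus: "fdiff F G = (\<lambda>X. F X - G X)"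
proof -
  have "(- 1) *\<^sub>C f = - f" for f :: 'a using scaleR_scaleC[of "- 1" f] by simp
  then show ?thesis by (simp add: fdiff_def fun_eq_iff)
qed

lemma fdiff_schwartz:
  assumes "F \<in> S" "G \<in> S" shows "fdiff F G \<in> S"
  using schw_add[of F "\<lambda>X. (- 1) *\<^sub>C G X"] schw_scaleC[of G "- 1"] assms
  unfolding schw_iff fdiff_def[abs_def] by blast

text \<open>Both algebras have the same carrier, linear structure and seminorms, hence this one
  topology.\<close>

definition schwartz_topology :: "('x \<Rightarrow> 'a) topology" where
  "schwartz_topology = topology_generated_by
     {{y \<in> S. schwartz_seminorm \<Theta> i (fdiff y x) < e} | i x e. x \<in> S \<and> 0 < e}"

lemma fa_topology_schwartz:
  assumes "fa_carrier A = S" "fa_add A = (\<lambda>F G X. F X + G X)" "fa_scale A = (\<lambda>a F X. a *\<^sub>C F X)"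
    "fa_seminorm A = schwartz_seminorm \<Theta>"
  shows "fa_topology A = schwartz_topology"
  unfolding fa_topology_def schwartz_topology_def assms fdiff_def[abs_def] ..

lemma openin_ball: "x \<in> S \<Longrightarrow> 0 < e \<Longrightarrow> openin schwartz_topology {y \<in> S. schwartz_seminorm \<Theta> i (fdiff y x) < e}"
  unfolding schwartz_topology_def by (rule topology_generated_by_Basis) blast

lemma mem_ball: "x \<in> S \<Longrightarrow> 0 < e \<Longrightarrow> x \<in> {y \<in> S. schwartz_seminorm \<Theta> i (fdiff y x) < e}"
  by (simp add: fdiff_minus schwartz_seminorm_zero)

lemma topspace_schwartz: "topspace schwartz_topology = S"
proof
  show "topspace schwartz_topology \<subseteq> S" unfolding schwartz_topology_def topology_generated_by_topspace by blast
  show "S \<subseteq> topspace schwartz_topology"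
  proof
    fix x assume x: "x \<in> S"
    from openin_subset[OF openin_ball[OF x zero_less_one]] mem_ball[OF x zero_less_one]
    show "x \<in> topspace schwartz_topology" by blast
  qed
qed

text \<open>For an additive map it suffices that each seminorm of the image is bounded by finitely
  many seminorms of the argument. The bound is read off from the family \<open>D\<close>, which
  agrees with \<Phi> on the Schwartz space.\<close>

lemma continuous_map_schwartz:
  assumes lin: "\<And>F G. F \<in> S \<Longrightarrow> G \<in> S \<Longrightarrow> \<Phi> (fdiff F G) = fdiff (\<Phi> F) (\<Phi> G)"
    and D: "sch seminorm_cone S D" and eq: "\<And>F. F \<in> S \<Longrightarrow> D F = \<Phi> F"
  shows "continuous_map schwartz_topology schwartz_topology \<Phi>"
proof -
  have maps: "\<Phi> F \<in> S" if "F \<in> S" for F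
    using sch_schwartz(1)[OF cone_seminorm D that] eq[OF that] by simp
  have opn: "openin schwartz_topology (\<Phi> -` {y \<in> S. schwartz_seminorm \<Theta> i (fdiff y x) < e} \<inter> S)"
    if x: "x \<in> S" for i x e
  proof (subst openin_subopen, intro ballI)
    fix z assume "z \<in> \<Phi> -` {y \<in> S. schwartz_seminorm \<Theta> i (fdiff y x) < e} \<inter> S"
    then have z: "z \<in> S" and ze: "schwartz_seminorm \<Theta> i (fdiff (\<Phi> z) x) < e" by auto
    obtain p where "p \<in> seminorm_cone" and p: "\<And>F. F \<in> S \<Longrightarrow> schwartz_seminorm \<Theta> i (D F) \<le> p F"
      using sch_schwartz(2)[OF cone_seminorm D, of i] by blast
    then obtain J C where J: "finite J" "C \<ge> 0" "\<And>F. F \<in> S \<Longrightarrow> p F \<le> C * (\<Sum>j\<in>J. schwartz_seminorm \<Theta> j F)"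
      unfolding seminorm_cone_def by blast
    \<comment> \<open>The room left between z and the boundary of the ball, divided so that the sum
      over \<open>J\<close> of bounds \<open>d\<close>, multiplied by \<open>C\<close>, stays
      strictly below it; the summand 1 keeps the denominator positive.\<close>
    define d where "d = (e - schwartz_seminorm \<Theta> i (fdiff (\<Phi> z) x)) / (C * card J + 1)"
    have pos: "C * card J + 1 > 0" using J(2) by (intro add_nonneg_pos mult_nonneg_nonneg) auto
    have d: "d > 0" using ze pos by (simp add: d_def)
    define U where "U = S \<inter> (\<Inter>j\<in>J. {y \<in> S. schwartz_seminorm \<Theta> j (fdiff y z) < d})"
    have "openin schwartz_topology U"
    proof (cases "J = {}")
      case True
      then show ?thesis using openin_topspace[of schwartz_topology] by (simp add: U_def topspace_schwartz)
    next
      case False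
      then show ?thesis unfolding U_def using openin_topspace[of schwartz_topology, unfolded topspace_schwartz]
        by (intro openin_Int openin_INT2 J(1) openin_ball z d)
    qed
    moreover have "z \<in> U" unfolding U_def using mem_ball[OF z d] z by blast
    moreover have "U \<subseteq> \<Phi> -` {y \<in> S. schwartz_seminorm \<Theta> i (fdiff y x) < e} \<inter> S"
    proof
      fix y assume "y \<in> U"
      then have y: "y \<in> S" and yd: "\<And>j. j \<in> J \<Longrightarrow> schwartz_seminorm \<Theta> j (fdiff y z) < d" unfolding U_def by auto
      have yz: "fdiff y z \<in> S" by (rule fdiff_schwartz[OF y z])
      have "fdiff (\<Phi> y) x = (\<lambda>X. fdiff (\<Phi> y) (\<Phi> z) X + fdiff (\<Phi> z) x X)" by (simp add: fdiff_minus)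
      then have "schwartz_seminorm \<Theta> i (fdiff (\<Phi> y) x)
          \<le> schwartz_seminorm \<Theta> i (\<Phi> (fdiff y z)) + schwartz_seminorm \<Theta> i (fdiff (\<Phi> z) x)"
        using schwartz_seminorm_triangle[OF fdiff_schwartz fdiff_schwartz, OF maps maps maps x, OF y z z, of i] lin[OF y z] by simp
      moreover have "schwartz_seminorm \<Theta> i (\<Phi> (fdiff y z)) \<le> C * (\<Sum>j\<in>J. schwartz_seminorm \<Theta> j (fdiff y z))"
        using order_trans[OF p[OF yz] J(3)[OF yz]] eq[OF yz] by simp
      moreover have "\<dots> \<le> C * (\<Sum>j\<in>J. d)" by (intro mult_left_mono sum_mono J(2) less_imp_le yd)
      moreover have "C * (\<Sum>j\<in>J. d) < (C * card J + 1) * d" using d by (simp add: algebra_simps)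
      moreover have "(C * card J + 1) * d = e - schwartz_seminorm \<Theta> i (fdiff (\<Phi> z) x)" using pos by (simp add: d_def)
      ultimately show "y \<in> \<Phi> -` {y \<in> S. schwartz_seminorm \<Theta> i (fdiff y x) < e} \<inter> S"
        using y maps[OF y] by simp
    qed
    ultimately show "\<exists>T. openin schwartz_topology T \<and> z \<in> T \<and> T \<subseteq> \<Phi> -` {y \<in> S. schwartz_seminorm \<Theta> i (fdiff y x) < e} \<inter> S"
      by blast
  qed
  let ?B = "{{y \<in> S. schwartz_seminorm \<Theta> i (fdiff y x) < e} | i x e. x \<in> S \<and> 0 < e}"
  have B: "topology_generated_by ?B = schwartz_topology" by (simp only: schwartz_topology_def)
  have "\<Union> ?B = S" using topspace_schwartz unfolding schwartz_topology_def topology_generated_by_topspace .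
  then have "continuous_map schwartz_topology (topology_generated_by ?B) \<Phi>"
    unfolding continuous_on_generated_topo_iff topspace_schwartz
  proof (intro conjI allI impI)
    show "\<Phi> ` S \<subseteq> \<Union> ?B" if "\<Union> ?B = S" using maps unfolding that by blast
  qed (use opn in blast)
  then show ?thesis unfolding B .
qed

end

section \<open>The isomorphism\<close>

context fourier
begin

lemma FT_add: "dec f \<Longrightarrow> dec g \<Longrightarrow> FT \<omega> c (\<lambda>Y. f Y + g Y) X = FT \<omega> c f X + FT \<omega> c g X" for f :: "'x \<Rightarrow> 'a"
  by (simp add: FT_def scaleC_add_right dint_add dec_FT)

lemma FT_scaleC:
  fixes f :: "'x \<Rightarrow> 'a"
  assumes "dec f" shows "FT \<omega> c (\<lambda>Y. a *\<^sub>C f Y) X = a *\<^sub>C FT \<omega> c f X"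
  using dint_bounded_linear[OF scaleC.bounded_linear_right dec_integrable[OF dec_FT[OF assms]], of a]
  by (simp add: FT_def scaleC_scaleC mult.commute)

lemma
  assumes F: "schw F" and G: "schw G"
  shows M_map_add: "M_map \<omega> c \<Theta> (\<lambda>X. F X + G X) = (\<lambda>X. M_map \<omega> c \<Theta> F X + M_map \<omega> c \<Theta> G X)"
    and M_inv_add: "M_inv \<omega> c \<Theta> (\<lambda>X. F X + G X) = (\<lambda>X. M_inv \<omega> c \<Theta> F X + M_inv \<omega> c \<Theta> G X)"
  using FT_add[OF schw_dec[OF schw_act[OF F, of 1]] schw_dec[OF schw_act[OF G, of 1]]]
    FT_add[OF schw_dec[OF F] schw_dec[OF G]] schw_dec[OF schw_add[OF F G]] schw_dec[OF F] schw_dec[OF G]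
  by (simp_all add: M_map_FT M_inv_FT fun_eq_iff act_add)

lemma
  assumes F: "schw F"
  shows M_map_scaleC: "M_map \<omega> c \<Theta> (\<lambda>X. a *\<^sub>C F X) = (\<lambda>X. a *\<^sub>C M_map \<omega> c \<Theta> F X)"
    and M_inv_scaleC: "M_inv \<omega> c \<Theta> (\<lambda>X. a *\<^sub>C F X) = (\<lambda>X. a *\<^sub>C M_inv \<omega> c \<Theta> F X)"
  using FT_scaleC[OF schw_dec[OF schw_act[OF F, of 1]]] FT_scaleC[OF schw_dec[OF F]]
    schw_dec[OF schw_scaleC[OF F]] schw_dec[OF F]
  by (simp_all add: M_map_FT M_inv_FT fun_eq_iff act_scaleC)

text \<open>The star commutes with the action and conjugates the phase, which amounts to replacing X
  by -X; this is the reflection in \<open>diamond_star\<close>.\<close>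

lemma M_map_star:
  assumes "schw F" shows "M_map \<omega> c \<Theta> (square_star F) = diamond_star (M_map \<omega> c \<Theta> F)"
proof
  fix X
  have "dec (\<lambda>Y. cis (- \<omega> (- X) Y) *\<^sub>C \<Theta> Y (F Y))"
    using dec_FT[OF schw_dec[OF schw_act[OF assms, of 1]], of "- X"] by simp
  from dint_bounded_linear[OF bounded_linear_star dec_integrable[OF this], of c]
  show "M_map \<omega> c \<Theta> (square_star F) X = diamond_star (M_map \<omega> c \<Theta> F) X"
    by (simp add: M_map_def diamond_star_def square_star_def[abs_def] star_scaleC cis_cnj act_star \<omega>.minus_left)
qed

lemma M_map_continuous: "continuous_map schwartz_topology schwartz_topology (M_map \<omega> c \<Theta>)"
  by (rule continuous_map_schwartz[OF _ M_map_sch[OF cone_seminorm sch_seminorm_cone] refl])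
     (simp add: fdiff_def[abs_def] M_map_add M_map_scaleC schw_scaleC flip: schw_iff)

lemma M_inv_continuous: "continuous_map schwartz_topology schwartz_topology (M_inv \<omega> c \<Theta>)"
proof -
  obtain D where D: "sch seminorm_cone S D" "\<And>F. F \<in> S \<Longrightarrow> D F = M_inv \<omega> c \<Theta> F"
    using M_inv_sch[OF cone_seminorm sch_seminorm_cone] by blast
  show ?thesis
    by (rule continuous_map_schwartz[OF _ D])
       (simp add: fdiff_def[abs_def] M_inv_add M_inv_scaleC schw_scaleC flip: schw_iff)
qed

end

context normalized
begin

theorem isomorphism:
  "frechet_star_isomorphism (square_algebra \<omega> c \<Theta>) (diamond_algebra \<omega> c \<Theta>) (M_map \<omega> c \<Theta>) (M_inv \<omega> c \<Theta>)"
proof -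
  have top: "fa_topology (square_algebra \<omega> c \<Theta>) = schwartz_topology"
    "fa_topology (diamond_algebra \<omega> c \<Theta>) = schwartz_topology"
    by (rule fa_topology_schwartz; simp add: square_algebra_def diamond_algebra_def)+
  \<comment> \<open>This identity serves twice: it shows that the Schwartz space is closed under the
    square product, and applying \<open>M_map\<close> to it gives multiplicativity.\<close>
  have sq: "square_prod \<omega> c \<Theta> F G = M_inv \<omega> c \<Theta> (diamond_prod \<omega> c \<Theta> (M_map \<omega> c \<Theta> F) (M_map \<omega> c \<Theta> G))"
    if "schw F" "schw G" for F G
    using square_formula[OF that] c_pos by (simp add: fun_eq_iff)
  have closed: "schw (square_star F)" "schw (diamond_star F)" if "schw F" for F
    using schw_star[OF that] schw_affine[OF _ schw_star[OF that], of "- 1" 0]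
    by (simp_all add: square_star_def[abs_def] diamond_star_def[abs_def])
  have "fa_closed (square_algebra \<omega> c \<Theta>)" "fa_closed (diamond_algebra \<omega> c \<Theta>)"
    by (simp_all add: fa_closed_def square_algebra_def diamond_algebra_def sq closed
        schw_add schw_scaleC schw_M_inv schw_M_map schw_diamond flip: schw_iff)
  moreover have "homeomorphic_maps schwartz_topology schwartz_topology (M_map \<omega> c \<Theta>) (M_inv \<omega> c \<Theta>)"
    unfolding homeomorphic_maps_def topspace_schwartz
    using M_map_continuous M_inv_continuous M_M_inv M_inv_M by (simp flip: schw_iff)
  ultimately show ?thesis
    unfolding frechet_star_isomorphism_def top
    by (simp add: square_algebra_def diamond_algebra_def M_map_add M_map_scaleC M_map_star sq
        M_M_inv schw_diamond schw_M_map flip: schw_iff)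
qed

end

theorem proposition4p2:
  fixes n :: nat
    and \<omega> :: "'x::euclidean_space \<Rightarrow> 'x \<Rightarrow> real"
    and c :: real
    and \<Theta> :: "'x \<Rightarrow> 'a::cstar_algebra \<Rightarrow> 'a"
  assumes "DIM('x) = 2 * n"
    and "symplectic_form \<omega>"
    and "fourier_normalized \<omega> c"
    and "strongly_continuous_action \<Theta>"
  shows "frechet_star_isomorphism (square_algebra \<omega> c \<Theta>) (diamond_algebra \<omega> c \<Theta>)
           (M_map \<omega> c \<Theta>) (M_inv \<omega> c \<Theta>)"
proof -
  interpret normalized \<Theta> \<omega> c
    using assms by unfold_locales
  show ?thesis by (rule isomorphism)
qed


end
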